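(* Let $H=(V,E)$ be a weighted hypergraph with $m$ hyperedges, $n$ vertices and total size $p=\sum_{e\in E}|e|$, and let $R\subseteq V$ with $k=|R|$. The minimum isolating cuts over $R$ can be computed with high probability in time $$\tilde{O}\Big(T_{ec}(p,m+n)+\max_{n_1,\dots,n_k,p_1,\dots,p_k}\Big\{\sum_{i=1}^k T_{ec}(p_i,m+n_i): n_1+\cdots+n_k\le n,\ p_1+\cdots+p_k\le 2p\Big\}\Big).$$
   Context: For $S\subseteq V$, $\delta(S)$ is the set of hyperedges meeting both $S$ and $V\setminus S$, and $w(\delta(S))$ is its total weight. The minimum isolating cuts over $R$ consist of, for each $r\in R$, a set $Y_r\subseteq V$ with $Y_r\cap R=\{r\}$ minimizing $w(\delta(Y_r))$. $T_{ec}(m,n)$ denotes the running time for computing a minimum $(s,t)$-cut in an edge-weighted directed graph with $m$ edges and $n$ vertices. $\tilde O$ hides polylogarithmic factors. *)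

theory Defs
  imports "HOL-Probability.SPMF" "HOL-Library.Log_Nat"
begin

section \<open>Hypergraphs and isolating cuts\<close>

text \<open>
  The vertex set is \<open>{..<hn H}\<close>; hyperedges are indexed by \<open>{..<hm H}\<close>, so parallel hyperedges are
  allowed. Values of \<open>hedge\<close> and \<open>hweight\<close> outside the index range are irrelevant.
\<close>

record hypergraph =
  hn :: nat
  hm :: nat
  hedge :: "nat \<Rightarrow> nat set"
  hweight :: "nat \<Rightarrow> real"

definition hverts :: "hypergraph \<Rightarrow> nat set" where
  "hverts H = {..<hn H}"

definition wf_hypergraph :: "hypergraph \<Rightarrow> bool" where
  "wf_hypergraph H \<longleftrightarrow> (\<forall>j<hm H. hedge H j \<subseteq> hverts H \<and> 0 \<le> hweight H j)"

definition hsize :: "hypergraph \<Rightarrow> nat" where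
  "hsize H = (\<Sum>j<hm H. card (hedge H j))"

definition hcut :: "hypergraph \<Rightarrow> nat set \<Rightarrow> nat set" where
  "hcut H S = {j. j < hm H \<and> hedge H j \<inter> S \<noteq> {} \<and> hedge H j \<inter> (hverts H - S) \<noteq> {}}"

definition hcut_weight :: "hypergraph \<Rightarrow> nat set \<Rightarrow> real" where
  "hcut_weight H S = (\<Sum>j\<in>hcut H S. hweight H j)"

definition isolating_set :: "hypergraph \<Rightarrow> nat set \<Rightarrow> nat \<Rightarrow> nat set \<Rightarrow> bool" where
  "isolating_set H R r Y \<longleftrightarrow> Y \<subseteq> hverts H \<and> Y \<inter> R = {r}"

definition min_isolating_cut :: "hypergraph \<Rightarrow> nat set \<Rightarrow> nat \<Rightarrow> nat set \<Rightarrow> bool" where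
  "min_isolating_cut H R r Y \<longleftrightarrow> isolating_set H R r Y \<and>
     (\<forall>Y'. isolating_set H R r Y' \<longrightarrow> hcut_weight H Y \<le> hcut_weight H Y')"


section \<open>Directed graphs and minimum (s,t)-cuts\<close>

record digraph =
  dn :: nat
  dm :: nat
  dtail :: "nat \<Rightarrow> nat"
  dhead :: "nat \<Rightarrow> nat"
  dweight :: "nat \<Rightarrow> real"

definition wf_digraph :: "digraph \<Rightarrow> bool" where
  "wf_digraph G \<longleftrightarrow>
     (\<forall>a<dm G. dtail G a < dn G \<and> dhead G a < dn G \<and> dtail G a \<noteq> dhead G a \<and> 0 \<le> dweight G a) \<and>
     inj_on (\<lambda>a. (dtail G a, dhead G a)) {..<dm G}"

definition dcut_weight :: "digraph \<Rightarrow> nat set \<Rightarrow> real" where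
  "dcut_weight G S = (\<Sum>a | a < dm G \<and> dtail G a \<in> S \<and> dhead G a \<notin> S. dweight G a)"

definition st_set :: "digraph \<Rightarrow> nat \<Rightarrow> nat \<Rightarrow> nat set \<Rightarrow> bool" where
  "st_set G s t S \<longleftrightarrow> S \<subseteq> {..<dn G} \<and> s \<in> S \<and> t \<notin> S"

definition min_st_cut :: "digraph \<Rightarrow> nat \<Rightarrow> nat \<Rightarrow> nat set \<Rightarrow> bool" where
  "min_st_cut G s t S \<longleftrightarrow> st_set G s t S \<and>
     (\<forall>S'. st_set G s t S' \<longrightarrow> dcut_weight G S \<le> dcut_weight G S')"


section \<open>Model of computation\<close>

text \<open>
  Randomized random access machine, presented as a structured programming language. The memory
  consists of named arrays of natural numbers (also used for addresses and, at index 0, as scalar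
  variables) and named arrays of reals (for weights). Natural numbers are charged logarithmic cost:
  every evaluated subexpression pays for the bit length of its value, so large integers give no free
  parallelism. Reals are charged unit cost, but only allow field operations and comparisons: there is
  no rounding, and only naturals can be converted to reals. A program mentions finitely many arrays,
  each of which is unbounded.
\<close>

record mem =
  imem :: "string \<Rightarrow> nat \<Rightarrow> nat"
  rmem :: "string \<Rightarrow> nat \<Rightarrow> real"

datatype iexp =
    IConst nat
  | IRead string iexp
  | IAdd iexp iexp
  | ISub iexp iexp
  | IMul iexp iexp
  | IDiv iexp iexp

datatype rexp =
    ROf iexp
  | RRead string iexp
  | RAdd rexp rexp
  | RSub rexp rexp
  | RMul rexp rexp
  | RDiv rexp rexp

datatype bexp =
    ILess iexp iexp
  | RLess rexp rexp
  | BNot bexp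
  | BAnd bexp bexp

text \<open>
  \<open>Flip x i\<close> stores a fair random bit. \<open>Call xs c\<close> runs \<open>c\<close> as a subroutine which shares exactly the
  arrays named in \<open>xs\<close> with the caller (by reference); all other arrays seen by \<open>c\<close> are local to
  it, initially zero, and discarded on return. There is no recursion.
\<close>

datatype com =
    Skip
  | IAssign string iexp iexp
  | RAssign string iexp rexp
  | Flip string iexp
  | Seq com com
  | Cond bexp com com
  | While bexp com
  | Call "string list" com

primrec ival :: "mem \<Rightarrow> iexp \<Rightarrow> nat" where
  "ival \<mu> (IConst k) = k"
| "ival \<mu> (IRead x e) = imem \<mu> x (ival \<mu> e)"
| "ival \<mu> (IAdd e f) = ival \<mu> e + ival \<mu> f"
| "ival \<mu> (ISub e f) = ival \<mu> e - ival \<mu> f"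
| "ival \<mu> (IMul e f) = ival \<mu> e * ival \<mu> f"
| "ival \<mu> (IDiv e f) = ival \<mu> e div ival \<mu> f"

primrec rval :: "mem \<Rightarrow> rexp \<Rightarrow> real" where
  "rval \<mu> (ROf e) = real (ival \<mu> e)"
| "rval \<mu> (RRead x e) = rmem \<mu> x (ival \<mu> e)"
| "rval \<mu> (RAdd e f) = rval \<mu> e + rval \<mu> f"
| "rval \<mu> (RSub e f) = rval \<mu> e - rval \<mu> f"
| "rval \<mu> (RMul e f) = rval \<mu> e * rval \<mu> f"
| "rval \<mu> (RDiv e f) = rval \<mu> e / rval \<mu> f"

primrec bval :: "mem \<Rightarrow> bexp \<Rightarrow> bool" where
  "bval \<mu> (ILess e f) \<longleftrightarrow> ival \<mu> e < ival \<mu> f"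
| "bval \<mu> (RLess e f) \<longleftrightarrow> rval \<mu> e < rval \<mu> f"
| "bval \<mu> (BNot b) \<longleftrightarrow> \<not> bval \<mu> b"
| "bval \<mu> (BAnd b c) \<longleftrightarrow> bval \<mu> b \<and> bval \<mu> c"

text \<open>\<open>floorlog 2 k\<close> is the length of the binary representation of \<open>k\<close>.\<close>

primrec icost :: "mem \<Rightarrow> iexp \<Rightarrow> nat" where
  "icost \<mu> (IConst k) = 1 + floorlog 2 k"
| "icost \<mu> (IRead x e) = icost \<mu> e + 1 + floorlog 2 (ival \<mu> (IRead x e))"
| "icost \<mu> (IAdd e f) = icost \<mu> e + icost \<mu> f + 1 + floorlog 2 (ival \<mu> (IAdd e f))"
| "icost \<mu> (ISub e f) = icost \<mu> e + icost \<mu> f + 1 + floorlog 2 (ival \<mu> (ISub e f))"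
| "icost \<mu> (IMul e f) = icost \<mu> e + icost \<mu> f + 1 + floorlog 2 (ival \<mu> (IMul e f))"
| "icost \<mu> (IDiv e f) = icost \<mu> e + icost \<mu> f + 1 + floorlog 2 (ival \<mu> (IDiv e f))"

primrec rcost :: "mem \<Rightarrow> rexp \<Rightarrow> nat" where
  "rcost \<mu> (ROf e) = icost \<mu> e + 1"
| "rcost \<mu> (RRead x e) = icost \<mu> e + 1"
| "rcost \<mu> (RAdd e f) = rcost \<mu> e + rcost \<mu> f + 1"
| "rcost \<mu> (RSub e f) = rcost \<mu> e + rcost \<mu> f + 1"
| "rcost \<mu> (RMul e f) = rcost \<mu> e + rcost \<mu> f + 1"
| "rcost \<mu> (RDiv e f) = rcost \<mu> e + rcost \<mu> f + 1"

primrec bcost :: "mem \<Rightarrow> bexp \<Rightarrow> nat" where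
  "bcost \<mu> (ILess e f) = icost \<mu> e + icost \<mu> f + 1"
| "bcost \<mu> (RLess e f) = rcost \<mu> e + rcost \<mu> f + 1"
| "bcost \<mu> (BNot b) = bcost \<mu> b + 1"
| "bcost \<mu> (BAnd b c) = bcost \<mu> b + bcost \<mu> c + 1"

definition istore :: "string \<Rightarrow> nat \<Rightarrow> nat \<Rightarrow> mem \<Rightarrow> mem" where
  "istore x i v \<mu> = \<mu>\<lparr>imem := (imem \<mu>)(x := (imem \<mu> x)(i := v))\<rparr>"

definition rstore :: "string \<Rightarrow> nat \<Rightarrow> real \<Rightarrow> mem \<Rightarrow> mem" where
  "rstore x i v \<mu> = \<mu>\<lparr>rmem := (rmem \<mu>)(x := (rmem \<mu> x)(i := v))\<rparr>"

text \<open>The memory that agrees with \<open>\<mu>\<close> on the arrays \<open>xs\<close> and with \<open>\<nu>\<close> elsewhere.\<close>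

definition overlay :: "string list \<Rightarrow> mem \<Rightarrow> mem \<Rightarrow> mem" where
  "overlay xs \<mu> \<nu> =
     \<lparr>imem = (\<lambda>x. if x \<in> set xs then imem \<mu> x else imem \<nu> x),
      rmem = (\<lambda>x. if x \<in> set xs then rmem \<mu> x else rmem \<nu> x)\<rparr>"

definition zero_mem :: mem where
  "zero_mem = \<lparr>imem = (\<lambda>_ _. 0), rmem = (\<lambda>_ _. 0)\<rparr>"

text \<open>
  The semantics of a program maps a memory and a running clock to a subprobability distribution on
  final memories and clock values; the missing mass is the probability of divergence.
\<close>

partial_function (spmf) while_spmf :: "('s \<Rightarrow> bool) \<Rightarrow> ('s \<Rightarrow> 's spmf) \<Rightarrow> 's \<Rightarrow> 's spmf" where
  "while_spmf b f x = (if b x then bind_spmf (f x) (while_spmf b f) else return_spmf x)"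

primrec exec :: "com \<Rightarrow> mem \<times> nat \<Rightarrow> (mem \<times> nat) spmf" where
  "exec Skip = (\<lambda>(\<mu>, \<tau>). return_spmf (\<mu>, \<tau> + 1))"
| "exec (IAssign x e f) =
     (\<lambda>(\<mu>, \<tau>). return_spmf (istore x (ival \<mu> e) (ival \<mu> f) \<mu>, \<tau> + icost \<mu> e + icost \<mu> f + 1))"
| "exec (RAssign x e f) =
     (\<lambda>(\<mu>, \<tau>). return_spmf (rstore x (ival \<mu> e) (rval \<mu> f) \<mu>, \<tau> + icost \<mu> e + rcost \<mu> f + 1))"
| "exec (Flip x e) =
     (\<lambda>(\<mu>, \<tau>). map_spmf (\<lambda>b. (istore x (ival \<mu> e) (of_bool b) \<mu>, \<tau> + icost \<mu> e + 1)) coin_spmf)"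
| "exec (Seq c d) = (\<lambda>z. bind_spmf (exec c z) (exec d))"
| "exec (Cond b c d) =
     (\<lambda>(\<mu>, \<tau>). (if bval \<mu> b then exec c else exec d) (\<mu>, \<tau> + bcost \<mu> b + 1))"
| "exec (While b c) = (\<lambda>z.
     map_spmf (\<lambda>(\<mu>, \<tau>). (\<mu>, \<tau> + bcost \<mu> b + 1))
       (while_spmf (\<lambda>(\<mu>, \<tau>). bval \<mu> b) (\<lambda>(\<mu>, \<tau>). exec c (\<mu>, \<tau> + bcost \<mu> b + 1)) z))"
| "exec (Call xs c) =
     (\<lambda>(\<mu>, \<tau>). map_spmf (\<lambda>(\<nu>, \<tau>'). (overlay xs \<nu> \<mu>, \<tau>'))
       (exec c (overlay xs \<mu> zero_mem, \<tau> + length xs + 1)))"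


section \<open>Randomized solvability with high probability\<close>

text \<open>
  \<open>soft_solvable_whp inp out N f\<close>: the problem with input relation \<open>inp\<close> (instance, initial
  memory) and output relation \<open>out\<close> (instance, final memory) can be solved with high probability
  in time \<open>O~(f)\<close>, where \<open>N\<close> is the size of an instance. For every exponent \<open>c\<close> there is one
  program for all instances that always halts within \<open>K * log(N)^d * f\<close> steps and fails with
  probability at most \<open>N^(-c)\<close>.
  The shift by 2 only avoids vanishing logarithms on instances of size at most 1.
\<close>

definition soft_solvable_whp ::
  "('i \<Rightarrow> mem \<Rightarrow> bool) \<Rightarrow> ('i \<Rightarrow> mem \<Rightarrow> bool) \<Rightarrow> ('i \<Rightarrow> nat) \<Rightarrow> ('i \<Rightarrow> nat) \<Rightarrow> bool" where
  "soft_solvable_whp inp out N f \<longleftrightarrow>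
     (\<forall>c::nat. \<exists>(P::com) (K::real) (d::nat). \<forall>I \<mu>. inp I \<mu> \<longrightarrow>
        lossless_spmf (exec P (\<mu>, 0)) \<and>
        (\<forall>(\<nu>, \<tau>) \<in> set_spmf (exec P (\<mu>, 0)).
           real \<tau> \<le> K * ln (real (N I) + 2) ^ d * real (f I)) \<and>
        measure (measure_spmf (exec P (\<mu>, 0))) {(\<nu>, \<tau>). out I \<nu>} \<ge> 1 - 1 / real (N I) ^ c)"


section \<open>Input and output formats\<close>

definition array :: "nat \<Rightarrow> (nat \<Rightarrow> 'a) \<Rightarrow> nat \<Rightarrow> 'a::zero" where
  "array l f = (\<lambda>i. if i < l then f i else 0)"

definition scalar :: "nat \<Rightarrow> nat \<Rightarrow> nat" where
  "scalar a = array 1 (\<lambda>_. a)"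

definition stcut_input :: "digraph \<times> nat \<times> nat \<Rightarrow> mem \<Rightarrow> bool" where
  "stcut_input = (\<lambda>(G, s, t) \<mu>.
     wf_digraph G \<and> s < dn G \<and> t < dn G \<and> s \<noteq> t \<and>
     \<mu> = \<lparr>imem = (\<lambda>_ _. 0)
             (''n'' := scalar (dn G), ''m'' := scalar (dm G), ''s'' := scalar s, ''t'' := scalar t,
              ''tail'' := array (dm G) (dtail G), ''head'' := array (dm G) (dhead G)),
           rmem = (\<lambda>_ _. 0)(''w'' := array (dm G) (dweight G))\<rparr>)"

definition stcut_output :: "digraph \<times> nat \<times> nat \<Rightarrow> mem \<Rightarrow> bool" where
  "stcut_output = (\<lambda>(G, s, t) \<mu>. min_st_cut G s t {v. v < dn G \<and> imem \<mu> ''cut'' v \<noteq> 0})"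

text \<open>
  A hypergraph is given by its incidence lists: the vertices of hyperedge \<open>j\<close> are stored, without
  repetition and in arbitrary order, in \<open>''inc''\<close> at the positions \<open>i\<close> with
  \<open>off[j] \<le> i < off[j + 1]\<close>. The terminals are likewise listed in arbitrary order.
\<close>

definition isocut_input :: "hypergraph \<times> nat set \<Rightarrow> mem \<Rightarrow> bool" where
  "isocut_input = (\<lambda>(H, R) \<mu>.
     wf_hypergraph H \<and> R \<subseteq> hverts H \<and>
     (\<exists>(es :: nat list list) (rs :: nat list).
        length es = hm H \<and> (\<forall>j<hm H. distinct (es ! j) \<and> set (es ! j) = hedge H j) \<and>
        distinct rs \<and> set rs = R \<and>
        \<mu> = \<lparr>imem = (\<lambda>_ _. 0)
                (''n'' := scalar (hn H), ''m'' := scalar (hm H), ''k'' := scalar (card R),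
                 ''off'' := array (hm H + 1) (\<lambda>j. \<Sum>i<j. length (es ! i)),
                 ''inc'' := array (hsize H) (\<lambda>i. concat es ! i),
                 ''term'' := array (card R) (\<lambda>i. rs ! i)),
              rmem = (\<lambda>_ _. 0)(''w'' := array (hm H) (hweight H))\<rparr>))"

text \<open>
  The sets \<open>Y r\<close> are output as explicit lists of vertices, namely as segments of one array
  (for arbitrary disjoint \<open>Y r\<close>, the total output length is at most \<open>n\<close>).
\<close>

definition isocut_output :: "hypergraph \<times> nat set \<Rightarrow> mem \<Rightarrow> bool" where
  "isocut_output = (\<lambda>(H, R) \<mu>. \<forall>r\<in>R. min_isolating_cut H R r
     (imem \<mu> ''verts'' ` {imem \<mu> ''start'' r ..< imem \<mu> ''stop'' r}))"


section \<open>Running times\<close>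

text \<open>
  The usual conventions for a running time as a function of the numbers of edges and vertices: it is
  monotone, at least linear (the input has to be read), and grows at most polynomially, in the form
  that constant factors in the arguments only cost a constant factor.
\<close>

definition regular_time :: "(nat \<Rightarrow> nat \<Rightarrow> nat) \<Rightarrow> bool" where
  "regular_time T \<longleftrightarrow>
     (\<forall>m m' n n'. m \<le> m' \<longrightarrow> n \<le> n' \<longrightarrow> T m n \<le> T m' n') \<and>
     (\<forall>m n. 0 < T m n \<and> m + n \<le> T m n) \<and>
     (\<exists>C. \<forall>m n. T (2 * m) (2 * n) \<le> C * T m n)"

text \<open>
  \<open>T\<close> is (up to polylogarithmic factors) a running time for computing a minimum (s,t)-cut in an
  edge-weighted directed graph with \<open>m\<close> edges and \<open>n\<close> vertices.
\<close>

definition stcut_time :: "(nat \<Rightarrow> nat \<Rightarrow> nat) \<Rightarrow> bool" where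
  "stcut_time T \<longleftrightarrow> regular_time T \<and>
     soft_solvable_whp stcut_input stcut_output
       (\<lambda>(G, s, t). dm G + dn G) (\<lambda>(G, s, t). T (dm G) (dn G))"

end

theory Submission
  imports Defs
begin

text \<open>
  Number the terminals by \<open>0, \<dots>, k - 1\<close>. For each of the \<open>O(log k)\<close> bits, compute a minimum cut that
  separates the terminals with this bit from those without it, and label every vertex with the bits
  of the sides on which it lies. By submodularity, some minimum isolating cut of the terminal \<open>r\<close> is
  contained in the set \<open>U\<^sub>r\<close> of the vertices with the same label as \<open>r\<close>. It is found as a minimum cut
  after contraction of the vertices outside \<open>U\<^sub>r\<close>. The sets \<open>U\<^sub>r\<close> are disjoint, and each incidence of
  a hyperedge belongs to at most one of them, so that the sizes of these instances add up to at most
  \<open>n\<close> and \<open>p\<close>.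

  Hypergraph cuts are reduced to cuts in digraphs: a hyperedge becomes an arc of the same weight
  between two new vertices, and its incidences become arcs that are too heavy to be cut. The weight
  \<open>1 + (\<Sum>j. w j)\<close> suffices for this. The subroutine for minimum cuts succeeds with probability at least
  \<open>1/2\<close>. Every instance is solved \<open>log B\<close> times for \<open>B = (N + 1) ^ (c + 2)\<close>, keeping the lightest cut;
  it then fails with probability at most \<open>1 / B\<close>, and there are at most \<open>2 k\<close> instances.
\<close>

text \<open>The subroutine is an unknown program, specified only for clock 0 and for a memory that
  is zero outside its input; afterwards its arrays may hold anything. Therefore it runs behind a
  \<open>Call\<close>, whose unshared arrays are fresh, its input is tracked exactly, zeros
  included, and the time to read its output is charged to its own running time. Everything else
  keeps the stored numbers below a polynomial bound M, so that an operation costs O(log M).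

  One routine, \<open>part\<close>, serves both phases. It solves one contracted instance per label
  class. For a bit, all labels are 0, the terminals with this bit are sources and the others sinks;
  for the isolating cuts, the labels are those found, the terminals are sources, and the outside of
  each class is the sink. A contraction is only a flag on hyperedges, so an instance never touches
  the vertices outside its class. Every network keeps node numbers for all m hyperedges, which
  explains the term \<open>m + n_i\<close>.

  Failure is accounted for by one device: a potential that dominates the conditional failure
  probability and does not grow in expectation.\<close>

lemma exec_While:
  "exec (While b c) (\<mu>, \<tau>) = (if bval \<mu> b then bind_spmf (exec c (\<mu>, \<tau> + bcost \<mu> b + 1)) (exec (While b c))
     else return_spmf (\<mu>, \<tau> + bcost \<mu> b + 1))"
  by (subst exec.simps, subst while_spmf.simps) (auto simp: map_spmf_bind_spmf o_def)

text \<open>The inclusion is an admissible property, so induction over the approximations of the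
  fixed point reduces it to single executions of the body.\<close>

lemma while_spmf_support:
  assumes refl: "\<And>x. R x x" and trans: "\<And>x y z. R x y \<Longrightarrow> R y z \<Longrightarrow> R x z"
    and step: "\<And>x y. b x \<Longrightarrow> y \<in> set_spmf (f x) \<Longrightarrow> R x y"
  shows "set_spmf (while_spmf b f x) \<subseteq> {y. R x y}"
proof -
  have "\<forall>x. set_spmf (while_spmf b f x) \<subseteq> {y. R x y}"
  proof (induction rule: while_spmf.fixp_induct[where P="\<lambda>F. \<forall>x. set_spmf (F b f x) \<subseteq> {y. R x y}"])
    case 1
    show ?case unfolding curry_def by (intro cont_intro)
  next
    case 2
    show ?case by simp
  next
    case (3 g)
    have "R x z" if "b x" "y \<in> set_spmf (f x)" "z \<in> set_spmf (g b f y)" for x y z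
      using 3 that step trans by blast
    then show ?case using refl by (auto simp: set_bind_spmf)
  qed
  then show ?thesis by blast
qed

lemma while_spmf_map_le:
  assumes "\<And>x. b' (h x) = b x" and "\<And>x. f' (h x) = map_spmf h (f x)"
  shows "ord_spmf (=) (map_spmf h (while_spmf b f x)) (while_spmf b' f' (h x))"
proof -
  have "\<forall>x. ord_spmf (=) (map_spmf h (while_spmf b f x)) (while_spmf b' f' (h x))"
  proof (induction rule: while_spmf.fixp_induct[where P="\<lambda>F. \<forall>x. ord_spmf (=) (map_spmf h (F b f x)) (while_spmf b' f' (h x))"])
    case 1
    show ?case unfolding curry_def by (intro cont_intro)
  next
    case 2
    show ?case by simp
  next
    case (3 g)
    show ?case
    proof
      fix x
      show "ord_spmf (=) (map_spmf h (if b x then f x \<bind> g b f else return_spmf x)) (while_spmf b' f' (h x))"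
        using 3 by (subst while_spmf.simps) (auto simp: assms map_spmf_bind_spmf bind_map_spmf o_def intro!: ord_spmf_bind_reflI)
    qed
  qed
  then show ?thesis by blast
qed

lemma while_spmf_map_ge:
  assumes "\<And>x. b' (h x) = b x" and "\<And>x. f' (h x) = map_spmf h (f x)"
  shows "ord_spmf (=) (while_spmf b' f' (h x)) (map_spmf h (while_spmf b f x))"
proof -
  have "\<forall>x. ord_spmf (=) (while_spmf b' f' (h x)) (map_spmf h (while_spmf b f x))"
  proof (induction rule: while_spmf.fixp_induct[where P="\<lambda>F. \<forall>x. ord_spmf (=) (F b' f' (h x)) (map_spmf h (while_spmf b f x))"])
    case 1
    show ?case unfolding curry_def by (intro cont_intro)
  next
    case 2
    show ?case by simp
  next
    case (3 g)
    show ?case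
    proof
      fix x
      show "ord_spmf (=) (if b' (h x) then f' (h x) \<bind> g b' f' else return_spmf (h x)) (map_spmf h (while_spmf b f x))"
        using 3 by (subst while_spmf.simps) (auto simp: assms map_spmf_bind_spmf bind_map_spmf o_def intro!: ord_spmf_bind_reflI)
    qed
  qed
  then show ?thesis by blast
qed

text \<open>Fixed-point induction unfolds only one of the two loops. The equation therefore comes
  from two inequalities in the order of subprobabilities and antisymmetry.\<close>

lemma while_spmf_map:
  assumes "\<And>x. b' (h x) = b x" and "\<And>x. f' (h x) = map_spmf h (f x)"
  shows "while_spmf b' f' (h x) = map_spmf h (while_spmf b f x)"
  by (rule spmf.leq_antisym) (intro while_spmf_map_ge while_spmf_map_le assms)+

definition delay :: "nat \<Rightarrow> mem \<times> nat \<Rightarrow> mem \<times> nat" where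
  "delay \<delta> z = (fst z, snd z + \<delta>)"

lemma delay_Pair: "delay \<delta> (\<mu>, \<tau>) = (\<mu>, \<tau> + \<delta>)"
  by (simp add: delay_def)

text \<open>No program reads the clock, so a shift of its start shifts its end. This transfers the
  hypothesis on the subroutine, which speaks about clock 0 only, to calls at any time.\<close>

lemma exec_delay: "exec c (delay \<delta> z) = map_spmf (delay \<delta>) (exec c z)"
proof (induction c arbitrary: z)
  case (Seq c d)
  show ?case by (simp add: Seq.IH map_spmf_bind_spmf bind_map_spmf o_def)
next
  case (Cond b c d)
  obtain \<mu> \<tau> where z: "z = (\<mu>, \<tau>)" by fastforce
  have eq: "delay \<delta> (\<mu>, \<tau> + bcost \<mu> b + 1) = (\<mu>, \<tau> + \<delta> + bcost \<mu> b + 1)"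
    by (simp add: delay_Pair)
  show ?case
    using Cond.IH[of "(\<mu>, \<tau> + bcost \<mu> b + 1)"] unfolding eq z delay_Pair
    by (simp add: add.commute add.left_commute)
next
  case (While b c)
  have "while_spmf (\<lambda>(\<mu>, \<tau>). bval \<mu> b) (\<lambda>(\<mu>, \<tau>). exec c (\<mu>, \<tau> + bcost \<mu> b + 1)) (delay \<delta> z) =
    map_spmf (delay \<delta>) (while_spmf (\<lambda>(\<mu>, \<tau>). bval \<mu> b) (\<lambda>(\<mu>, \<tau>). exec c (\<mu>, \<tau> + bcost \<mu> b + 1)) z)"
  proof (rule while_spmf_map)
    fix x :: "mem \<times> nat"
    obtain \<mu> \<tau> where x: "x = (\<mu>, \<tau>)" by fastforce
    have eq: "delay \<delta> (\<mu>, \<tau> + bcost \<mu> b + 1) = (\<mu>, \<tau> + \<delta> + bcost \<mu> b + 1)"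
      by (simp add: delay_Pair)
    show "(case delay \<delta> x of (\<mu>, \<tau>) \<Rightarrow> exec c (\<mu>, \<tau> + bcost \<mu> b + 1)) =
        map_spmf (delay \<delta>) (case x of (\<mu>, \<tau>) \<Rightarrow> exec c (\<mu>, \<tau> + bcost \<mu> b + 1))"
      using While.IH[of "(\<mu>, \<tau> + bcost \<mu> b + 1)"] unfolding eq x delay_Pair
        by (simp add: add.commute add.left_commute)
  qed (simp add: delay_def split_beta)
  then show ?case
    by (simp only: exec.simps spmf.map_comp) (rule map_spmf_cong, auto simp: delay_Pair)
next
  case (Call xs c)
  obtain \<mu> \<tau> where z: "z = (\<mu>, \<tau>)" by fastforce
  have eq: "delay \<delta> (overlay xs \<mu> zero_mem, \<tau> + length xs + 1) = (overlay xs \<mu> zero_mem, \<tau> + \<delta> + length xs + 1)"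
    by (simp add: delay_Pair)
  have IH: "exec c (overlay xs \<mu> zero_mem, \<tau> + \<delta> + length xs + 1) =
      map_spmf (delay \<delta>) (exec c (overlay xs \<mu> zero_mem, \<tau> + length xs + 1))"
    using Call.IH[of "(overlay xs \<mu> zero_mem, \<tau> + length xs + 1)"] unfolding eq .
  show ?case unfolding z delay_Pair
    by (simp only: exec.simps prod.case IH spmf.map_comp) (rule map_spmf_cong, auto simp: delay_Pair)
next
  case (Flip x e)
  obtain \<mu> \<tau> where z: "z = (\<mu>, \<tau>)" by fastforce
  show ?case unfolding z delay_Pair
    by (simp only: exec.simps spmf.map_comp prod.case) (rule map_spmf_cong, auto simp: delay_Pair)
next
  case Skip
  show ?case by (cases z) (simp add: delay_Pair)
next
  case (IAssign x e f)
  show ?case by (cases z) (simp add: delay_Pair)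
next
  case (RAssign x e f)
  show ?case by (cases z) (simp add: delay_Pair)
qed

lemma imem_istore [simp]: "imem (istore x i v \<mu>) y = (if y = x then (imem \<mu> x)(i := v) else imem \<mu> y)"
  by (simp add: istore_def)

lemma rmem_istore [simp]: "rmem (istore x i v \<mu>) = rmem \<mu>"
  by (simp add: istore_def)

lemma imem_rstore [simp]: "imem (rstore x i v \<mu>) = imem \<mu>"
  by (simp add: rstore_def)

lemma rmem_rstore [simp]: "rmem (rstore x i v \<mu>) y = (if y = x then (rmem \<mu> x)(i := v) else rmem \<mu> y)"
  by (simp add: rstore_def)

lemma imem_overlay [simp]: "imem (overlay xs \<mu> \<nu>) x = (if x \<in> set xs then imem \<mu> x else imem \<nu> x)"
  by (simp add: overlay_def)

lemma rmem_overlay [simp]: "rmem (overlay xs \<mu> \<nu>) x = (if x \<in> set xs then rmem \<mu> x else rmem \<nu> x)"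
  by (simp add: overlay_def)

lemma imem_zero_mem [simp]: "imem zero_mem x i = 0"
  by (simp add: zero_mem_def)

lemma rmem_zero_mem [simp]: "rmem zero_mem x i = 0"
  by (simp add: zero_mem_def)

text \<open>Syntactic bound on the arrays that can change, so that frame conditions are computed by
  simplification. Through a \<open>Call\<close>, only shared arrays can change.\<close>

primrec wr :: "com \<Rightarrow> string set" where
  "wr Skip = {}"
| "wr (IAssign x e f) = {x}"
| "wr (RAssign x e f) = {x}"
| "wr (Flip x e) = {x}"
| "wr (Seq c d) = wr c \<union> wr d"
| "wr (Cond b c d) = wr c \<union> wr d"
| "wr (While b c) = wr c"
| "wr (Call xs c) = set xs \<inter> wr c"

definition agree :: "string set \<Rightarrow> mem \<Rightarrow> mem \<Rightarrow> bool" where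
  "agree W \<mu> \<nu> \<longleftrightarrow> (\<forall>x. x \<notin> W \<longrightarrow> imem \<nu> x = imem \<mu> x \<and> rmem \<nu> x = rmem \<mu> x)"

lemma agree_refl [simp]: "agree W \<mu> \<mu>"
  by (simp add: agree_def)

lemma agree_trans: "agree V \<mu> \<nu> \<Longrightarrow> agree W \<nu> \<kappa> \<Longrightarrow> agree (V \<union> W) \<mu> \<kappa>"
  by (simp add: agree_def)

lemma agree_mono: "agree V \<mu> \<nu> \<Longrightarrow> V \<subseteq> W \<Longrightarrow> agree W \<mu> \<nu>"
  by (auto simp: agree_def)

lemma agreeD: "agree W \<mu> \<nu> \<Longrightarrow> x \<notin> W \<Longrightarrow> imem \<nu> x = imem \<mu> x" "agree W \<mu> \<nu> \<Longrightarrow> x \<notin> W \<Longrightarrow> rmem \<nu> x = rmem \<mu> x"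
  by (auto simp: agree_def)

definition cell_bits :: "string \<Rightarrow> nat set \<Rightarrow> mem \<Rightarrow> nat" where
  "cell_bits x X \<mu> = (\<Sum>i\<in>X. floorlog 2 (imem \<mu> x i))"

text \<open>Storing a number costs its length, so the clock bounds the growth of the contents of the memory.\<close>

definition grows :: "mem \<times> nat \<Rightarrow> mem \<times> nat \<Rightarrow> bool" where
  "grows z z' \<longleftrightarrow> snd z \<le> snd z' \<and>
     (\<forall>x X. finite X \<longrightarrow> cell_bits x X (fst z') + snd z \<le> cell_bits x X (fst z) + snd z')"

lemma growsD: "grows z z' \<Longrightarrow> finite X \<Longrightarrow> cell_bits x X (fst z') + snd z \<le> cell_bits x X (fst z) + snd z'"
  by (simp add: grows_def)

lemma grows_trans:
  assumes "grows x y" "grows y z"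
  shows "grows x z"
proof -
  have "cell_bits v X (fst z) + snd x \<le> cell_bits v X (fst x) + snd z" if "finite X" for v X
    using growsD[OF assms(1) that, of v] growsD[OF assms(2) that, of v] by linarith
  then show ?thesis using assms by (simp add: grows_def)
qed

lemma grows_refl_le: "\<tau> \<le> \<tau>' \<Longrightarrow> grows (\<mu>, \<tau>) (\<mu>, \<tau>')"
  by (simp add: grows_def)

lemma cell_bits_istore_le: "finite X \<Longrightarrow> cell_bits x X (istore y i v \<mu>) \<le> cell_bits x X \<mu> + floorlog 2 v"
proof -
  assume X: "finite X"
  have "cell_bits x X (istore y i v \<mu>) \<le> (\<Sum>j\<in>X. floorlog 2 (imem \<mu> x j) + (if j = i then floorlog 2 v else 0))"
    unfolding cell_bits_def by (intro sum_mono) auto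
  also have "\<dots> \<le> cell_bits x X \<mu> + floorlog 2 v"
    using X by (simp add: sum.distrib cell_bits_def)
  finally show ?thesis .
qed

lemma floorlog_le_icost: "floorlog 2 (ival \<mu> e) \<le> icost \<mu> e"
  by (cases e) auto

text \<open>Two invariants that pass through loops by transitivity: the frame, and the fact that the
  total bit length of any finite set of cells grows no faster than the clock. A stored number is
  paid for by \<open>floorlog_le_icost\<close>, and a \<open>Call\<close> restores all unshared
  cells.\<close>

lemma exec_support:
  assumes "(\<nu>, \<tau>') \<in> set_spmf (exec c (\<mu>, \<tau>))"
  shows "agree (wr c) \<mu> \<nu>" and "grows (\<mu>, \<tau>) (\<nu>, \<tau>')"
proof -
  have "\<forall>z' \<in> set_spmf (exec c z). agree (wr c) (fst z) (fst z') \<and> grows z z'" for z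
  proof (induction c arbitrary: z)
    case Skip
    then show ?case by (cases z) (simp add: grows_def)
  next
    case (IAssign x e f)
    have *: "cell_bits y X (istore x (ival \<mu> e) (ival \<mu> f) \<mu>) \<le> cell_bits y X \<mu> + icost \<mu> f" if "finite X" for y X \<mu>
      by (rule order_trans[OF cell_bits_istore_le[OF that]]) (simp add: floorlog_le_icost)
    show ?case
      by (cases z) (auto simp: agree_def grows_def intro: order_trans[OF *])
  next
    case (RAssign x e f)
    show ?case by (cases z) (auto simp: agree_def grows_def cell_bits_def)
  next
    case (Flip x e)
    have *: "cell_bits y X (istore x (ival \<mu> e) (of_bool b) \<mu>) \<le> cell_bits y X \<mu> + 1" if "finite X" for y X \<mu> b
      by (rule order_trans[OF cell_bits_istore_le[OF that]]) (simp add: floorlog_def of_bool_def)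
    show ?case
    proof
      fix z' assume "z' \<in> set_spmf (exec (Flip x e) z)"
      then obtain b where z': "z' = (istore x (ival (fst z) e) (of_bool b) (fst z), snd z + icost (fst z) e + 1)"
        by (cases z) auto
      have "cell_bits y X (fst z') + snd z \<le> cell_bits y X (fst z) + snd z'" if "finite X" for y X
        using *[OF that, of y "fst z" b] unfolding z' fst_conv snd_conv by linarith
      moreover have "snd z \<le> snd z'" "agree (wr (Flip x e)) (fst z) (fst z')"
        by (auto simp: z' agree_def)
      ultimately show "agree (wr (Flip x e)) (fst z) (fst z') \<and> grows z z'"
        by (simp add: grows_def)
    qed
  next
    case (Seq c d)
    show ?case
    proof
      fix z' assume "z' \<in> set_spmf (exec (Seq c d) z)"
      then obtain y where y: "y \<in> set_spmf (exec c z)" "z' \<in> set_spmf (exec d y)"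
        by (auto simp: set_bind_spmf)
      then have "agree (wr c) (fst z) (fst y)" "grows z y" "agree (wr d) (fst y) (fst z')" "grows y z'"
        using Seq.IH by blast+
      then show "agree (wr (Seq c d)) (fst z) (fst z') \<and> grows z z'"
        unfolding wr.simps by (blast intro: agree_trans grows_trans)
    qed
  next
    case (Cond b c d)
    obtain \<mu> \<tau> where z: "z = (\<mu>, \<tau>)" by fastforce
    have *: "grows (\<mu>, \<tau>) (\<mu>, \<tau> + bcost \<mu> b + 1)" by (simp add: grows_refl_le)
    show ?case
    proof
      fix z' assume z': "z' \<in> set_spmf (exec (Cond b c d) z)"
      let ?e = "if bval \<mu> b then c else d"
      have "z' \<in> set_spmf (exec ?e (\<mu>, \<tau> + bcost \<mu> b + 1))" using z' by (simp add: z split: if_splits)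
      then have "agree (wr ?e) \<mu> (fst z')" "grows (\<mu>, \<tau> + bcost \<mu> b + 1) z'"
        using Cond.IH(1)[of "(\<mu>, \<tau> + bcost \<mu> b + 1)"] Cond.IH(2)[of "(\<mu>, \<tau> + bcost \<mu> b + 1)"]
        by (cases "bval \<mu> b"; simp)+
      then show "agree (wr (Cond b c d)) (fst z) (fst z') \<and> grows z z'"
        using grows_trans[OF *] agree_mono[of "wr ?e" _ _ "wr c \<union> wr d"] unfolding z by (auto split: if_splits)
    qed
  next
    case (While b c)
    let ?R = "\<lambda>z z'. agree (wr c) (fst z) (fst z') \<and> grows z z'"
    let ?w = "while_spmf (\<lambda>(\<mu>, \<tau>). bval \<mu> b) (\<lambda>(\<mu>, \<tau>). exec c (\<mu>, \<tau> + bcost \<mu> b + 1))"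
    have sup: "set_spmf (?w z) \<subseteq> {z'. ?R z z'}"
    proof (rule while_spmf_support)
      show "?R x x" for x by (simp add: grows_def)
      show "?R x z" if "?R x y" "?R y z" for x y z
        using agree_trans[of "wr c" "fst x" "fst y" "wr c" "fst z"] grows_trans[of x y z] that by simp
      show "?R x y" if "y \<in> set_spmf (case x of (\<mu>, \<tau>) \<Rightarrow> exec c (\<mu>, \<tau> + bcost \<mu> b + 1))" for x y
      proof -
        obtain \<mu> \<tau> where x: "x = (\<mu>, \<tau>)" by fastforce
        have *: "grows (\<mu>, \<tau>) (\<mu>, \<tau> + bcost \<mu> b + 1)" by (simp add: grows_refl_le)
        show ?thesis
          using bspec[OF While.IH[of "(\<mu>, \<tau> + bcost \<mu> b + 1)"]] that grows_trans[OF *, of y] unfolding x by simp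
      qed
    qed
    show ?case
    proof
      fix z' assume "z' \<in> set_spmf (exec (While b c) z)"
      then obtain \<mu> \<tau> where y: "(\<mu>, \<tau>) \<in> set_spmf (?w z)" and z': "z' = (\<mu>, \<tau> + bcost \<mu> b + 1)"
        by auto
      have "?R z (\<mu>, \<tau>)" using sup y by blast
      moreover have "grows (\<mu>, \<tau>) z'" unfolding z' by (simp add: grows_refl_le)
      ultimately show "agree (wr (While b c)) (fst z) (fst z') \<and> grows z z'"
        using grows_trans[of z "(\<mu>, \<tau>)" z'] by (simp add: z')
    qed
  next
    case (Call xs c)
    obtain \<mu> \<tau> where z: "z = (\<mu>, \<tau>)" by fastforce
    show ?case
    proof
      fix z' assume "z' \<in> set_spmf (exec (Call xs c) z)"
      then obtain \<nu> \<tau>' where y: "(\<nu>, \<tau>') \<in> set_spmf (exec c (overlay xs \<mu> zero_mem, \<tau> + length xs + 1))"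
        and z': "z' = (overlay xs \<nu> \<mu>, \<tau>')"
        by (auto simp: z)
      have ag: "agree (wr c) (overlay xs \<mu> zero_mem) \<nu>"
        using Call.IH y by fastforce
      have g: "grows (overlay xs \<mu> zero_mem, \<tau> + length xs + 1) (\<nu>, \<tau>')"
        using Call.IH y by blast
      have "cell_bits x X (overlay xs \<nu> \<mu>) + \<tau> \<le> cell_bits x X \<mu> + \<tau>'" if "finite X" for x X
      proof (cases "x \<in> set xs")
        case True
        then have "cell_bits x X (overlay xs \<nu> \<mu>) = cell_bits x X \<nu>"
          "cell_bits x X (overlay xs \<mu> zero_mem) = cell_bits x X \<mu>"
          by (simp_all add: cell_bits_def)
        moreover have "cell_bits x X \<nu> + (\<tau> + length xs + 1) \<le> cell_bits x X (overlay xs \<mu> zero_mem) + \<tau>'"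
          using g that unfolding grows_def by (metis fst_conv snd_conv)
        ultimately show ?thesis by linarith
      next
        case False
        then show ?thesis using g by (simp add: cell_bits_def grows_def)
      qed
      moreover have "\<tau> \<le> \<tau>'" using g by (simp add: grows_def)
      ultimately show "agree (wr (Call xs c)) (fst z) (fst z') \<and> grows z z'"
        using ag unfolding z z' by (simp add: agree_def grows_def)
    qed
  qed
  from this[of "(\<mu>, \<tau>)"] assms show "agree (wr c) \<mu> \<nu>" "grows (\<mu>, \<tau>) (\<nu>, \<tau>')" by auto
qed

section \<open>A quantitative Hoare logic\<close>

text \<open>
  \<open>ok c \<mu> t Q \<phi> a\<close>: started in \<open>\<mu>\<close>, the program \<open>c\<close> certainly halts within time \<open>t\<close> in a state with
  \<open>Q\<close>, and the expected value of \<open>\<phi>\<close> is at most \<open>a\<close> afterwards. Failure probabilities are handled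
  by taking for \<open>\<phi>\<close> an upper bound on the conditional probability of failure.
\<close>

definition ok :: "com \<Rightarrow> mem \<Rightarrow> nat \<Rightarrow> (mem \<Rightarrow> bool) \<Rightarrow> (mem \<Rightarrow> ennreal) \<Rightarrow> ennreal \<Rightarrow> bool" where
  "ok c \<mu> t Q \<phi> a \<longleftrightarrow> (\<forall>\<tau>. lossless_spmf (exec c (\<mu>, \<tau>)) \<and>
     (\<forall>z \<in> set_spmf (exec c (\<mu>, \<tau>)). snd z \<le> \<tau> + t \<and> Q (fst z)) \<and>
     (\<integral>\<^sup>+ z. \<phi> (fst z) \<partial>measure_spmf (exec c (\<mu>, \<tau>))) \<le> a)"

abbreviation run :: "com \<Rightarrow> mem \<Rightarrow> nat \<Rightarrow> (mem \<Rightarrow> bool) \<Rightarrow> bool" where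
  "run c \<mu> t Q \<equiv> ok c \<mu> t Q (\<lambda>_. 0) 0"

lemma nn_integral_spmf_mono:
  "(\<And>z. z \<in> set_spmf p \<Longrightarrow> f z \<le> g z) \<Longrightarrow> (\<integral>\<^sup>+ z. f z \<partial>measure_spmf p) \<le> (\<integral>\<^sup>+ z. g z \<partial>measure_spmf p)"
  by (intro nn_integral_mono_AE) simp

lemma nn_integral_spmf_bind:
  "(\<integral>\<^sup>+ z. f z \<partial>measure_spmf (bind_spmf p k)) = (\<integral>\<^sup>+ y. (\<integral>\<^sup>+ z. f z \<partial>measure_spmf (k y)) \<partial>measure_spmf p)"
  by (subst measure_spmf_bind, subst nn_integral_bind[where B="count_space UNIV"]) (auto simp: space_subprob_algebra)

lemma nn_integral_spmf_le_const:
  "(\<And>z. z \<in> set_spmf p \<Longrightarrow> f z \<le> a) \<Longrightarrow> (\<integral>\<^sup>+ z. f z \<partial>measure_spmf p) \<le> a"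
proof -
  assume "\<And>z. z \<in> set_spmf p \<Longrightarrow> f z \<le> a"
  then have "(\<integral>\<^sup>+ z. f z \<partial>measure_spmf p) \<le> (\<integral>\<^sup>+ z. a \<partial>measure_spmf p)"
    by (intro nn_integral_spmf_mono)
  also have "\<dots> \<le> a * 1"
    by (simp del: mult_1_right) (intro mult_left_mono measure_spmf.emeasure_space_le_1, simp)
  finally show ?thesis by simp
qed

text \<open>A pointwise bound over all outcomes bounds the expectation. Parts without a risk of
  failure are verified with \<open>run\<close> and joined to potentials by this rule.\<close>

lemma ok_run: "run c \<mu> t (\<lambda>\<nu>. Q \<nu> \<and> \<phi> \<nu> \<le> a) \<Longrightarrow> ok c \<mu> t Q \<phi> a"
  unfolding ok_def by (auto intro!: nn_integral_spmf_le_const)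

lemma ok_frame: "ok c \<mu> t Q \<phi> a \<Longrightarrow> ok c \<mu> t (\<lambda>\<nu>. Q \<nu> \<and> agree (wr c) \<mu> \<nu>) \<phi> a"
  unfolding ok_def using exec_support(1) by fastforce

lemma ok_mono:
  assumes "ok c \<mu> t Q \<phi> a" "t \<le> t'" "\<And>\<nu>. Q \<nu> \<Longrightarrow> agree (wr c) \<mu> \<nu> \<Longrightarrow> Q' \<nu> \<and> \<phi>' \<nu> \<le> \<phi> \<nu>" "a \<le> a'"
  shows "ok c \<mu> t' Q' \<phi>' a'"
  unfolding ok_def
proof (intro allI conjI ballI)
  fix \<tau>
  have c: "lossless_spmf (exec c (\<mu>, \<tau>))" "(\<integral>\<^sup>+ z. \<phi> (fst z) \<partial>measure_spmf (exec c (\<mu>, \<tau>))) \<le> a"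
    "\<And>z. z \<in> set_spmf (exec c (\<mu>, \<tau>)) \<Longrightarrow> snd z \<le> \<tau> + t \<and> Q (fst z) \<and> agree (wr c) \<mu> (fst z)"
    using ok_frame[OF assms(1)] unfolding ok_def by blast+
  show "lossless_spmf (exec c (\<mu>, \<tau>))" by (rule c(1))
  show "snd z \<le> \<tau> + t'" "Q' (fst z)" if z: "z \<in> set_spmf (exec c (\<mu>, \<tau>))" for z
    using c(3)[OF z] assms(2,3) by fastforce+
  show "(\<integral>\<^sup>+ z. \<phi>' (fst z) \<partial>measure_spmf (exec c (\<mu>, \<tau>))) \<le> a'"
    by (rule order_trans[OF nn_integral_spmf_mono order_trans[OF c(2) assms(4)]]) (use c(3) assms(3) in blast)
qed

lemma run_mono:
  assumes "run c \<mu> t Q" "t \<le> t'" "\<And>\<nu>. Q \<nu> \<Longrightarrow> agree (wr c) \<mu> \<nu> \<Longrightarrow> Q' \<nu>"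
  shows "run c \<mu> t' Q'"
  using assms by (intro ok_mono[OF assms(1)]) auto

text \<open>Tower rule: \<open>\<psi> \<nu>\<close> bounds the expectation of \<open>\<phi>\<close>
  after \<open>d\<close> given the intermediate memory \<open>\<nu>\<close>, so the expectation of
  \<open>\<psi>\<close> bounds that of \<open>\<phi>\<close>. The frame of \<open>c\<close> is
  available at the intermediate memory for free.\<close>

lemma ok_Seq:
  assumes c: "ok c \<mu> t1 R \<psi> a" and d: "\<And>\<nu>. R \<nu> \<Longrightarrow> agree (wr c) \<mu> \<nu> \<Longrightarrow> ok d \<nu> t2 Q \<phi> (\<psi> \<nu>)"
    and t: "t1 + t2 \<le> t"
  shows "ok (Seq c d) \<mu> t Q \<phi> a"
  unfolding ok_def
proof (intro allI conjI ballI)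
  fix \<tau>
  have c': "lossless_spmf (exec c (\<mu>, \<tau>))" "(\<integral>\<^sup>+ z. \<psi> (fst z) \<partial>measure_spmf (exec c (\<mu>, \<tau>))) \<le> a"
    "\<And>z. z \<in> set_spmf (exec c (\<mu>, \<tau>)) \<Longrightarrow> snd z \<le> \<tau> + t1 \<and> R (fst z) \<and> agree (wr c) \<mu> (fst z)"
    using ok_frame[OF c] unfolding ok_def by blast+
  have d': "lossless_spmf (exec d z)" "(\<integral>\<^sup>+ z'. \<phi> (fst z') \<partial>measure_spmf (exec d z)) \<le> \<psi> (fst z)"
    "\<And>z'. z' \<in> set_spmf (exec d z) \<Longrightarrow> snd z' \<le> snd z + t2 \<and> Q (fst z')"
    if "z \<in> set_spmf (exec c (\<mu>, \<tau>))" for z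
  proof -
    have "ok d (fst z) t2 Q \<phi> (\<psi> (fst z))" using c'(3)[OF that] d by blast
    then show "lossless_spmf (exec d z)" "(\<integral>\<^sup>+ z'. \<phi> (fst z') \<partial>measure_spmf (exec d z)) \<le> \<psi> (fst z)"
      "\<And>z'. z' \<in> set_spmf (exec d z) \<Longrightarrow> snd z' \<le> snd z + t2 \<and> Q (fst z')"
      unfolding ok_def by (metis prod.collapse)+
  qed
  show "lossless_spmf (exec (Seq c d) (\<mu>, \<tau>))" using c'(1) d'(1) by simp
  show "snd z \<le> \<tau> + t" "Q (fst z)" if z: "z \<in> set_spmf (exec (Seq c d) (\<mu>, \<tau>))" for z
  proof -
    from z obtain y where y: "y \<in> set_spmf (exec c (\<mu>, \<tau>))" "z \<in> set_spmf (exec d y)"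
      by (auto simp: set_bind_spmf)
    show "snd z \<le> \<tau> + t" "Q (fst z)" using c'(3)[OF y(1)] d'(3)[OF y] t by linarith+
  qed
  show "(\<integral>\<^sup>+ z. \<phi> (fst z) \<partial>measure_spmf (exec (Seq c d) (\<mu>, \<tau>))) \<le> a"
    by (simp add: nn_integral_spmf_bind) (rule order_trans[OF nn_integral_spmf_mono c'(2)], rule d'(2))
qed

lemma ok_Seq_run:
  assumes "run c \<mu> t1 R" and "\<And>\<nu>. R \<nu> \<Longrightarrow> agree (wr c) \<mu> \<nu> \<Longrightarrow> ok d \<nu> t2 Q \<phi> a" and "t1 + t2 \<le> t"
  shows "ok (Seq c d) \<mu> t Q \<phi> a"
  by (rule ok_Seq[OF ok_run[where \<phi>="\<lambda>_. a" and a=a and Q=R] _ assms(3)]) (use assms in auto)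

lemma ok_delay:
  assumes "ok c \<mu> t' Q \<phi> a" "\<And>\<tau>. exec d (\<mu>, \<tau>) = exec c (\<mu>, \<tau> + s)" "t' + s \<le> t"
  shows "ok d \<mu> t Q \<phi> a"
  unfolding ok_def
proof
  fix \<tau>
  show "lossless_spmf (exec d (\<mu>, \<tau>)) \<and> (\<forall>z \<in> set_spmf (exec d (\<mu>, \<tau>)). snd z \<le> \<tau> + t \<and> Q (fst z)) \<and>
     (\<integral>\<^sup>+ z. \<phi> (fst z) \<partial>measure_spmf (exec d (\<mu>, \<tau>))) \<le> a"
    using assms(1)[unfolded ok_def, rule_format, of "\<tau> + s"] assms(3) unfolding assms(2) by fastforce
qed

lemma ok_Cond:
  assumes "bval \<mu> b \<Longrightarrow> ok c \<mu> t' Q \<phi> a" "\<not> bval \<mu> b \<Longrightarrow> ok d \<mu> t' Q \<phi> a" "t' + bcost \<mu> b + 1 \<le> t"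
  shows "ok (Cond b c d) \<mu> t Q \<phi> a"
proof (rule ok_delay)
  show "ok (if bval \<mu> b then c else d) \<mu> t' Q \<phi> a" using assms by simp
  show "exec (Cond b c d) (\<mu>, \<tau>) = exec (if bval \<mu> b then c else d) (\<mu>, \<tau> + (bcost \<mu> b + 1))" for \<tau>
    by (simp add: add.assoc)
qed (use assms in simp)

lemma ok_Call:
  assumes "ok c (overlay xs \<mu> zero_mem) t' (\<lambda>\<nu>. Q (overlay xs \<nu> \<mu>)) (\<lambda>\<nu>. \<phi> (overlay xs \<nu> \<mu>)) a"
    and "t' + length xs + 1 \<le> t"
  shows "ok (Call xs c) \<mu> t Q \<phi> a"
  unfolding ok_def
proof
  fix \<tau>
  show "lossless_spmf (exec (Call xs c) (\<mu>, \<tau>)) \<and>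
     (\<forall>z \<in> set_spmf (exec (Call xs c) (\<mu>, \<tau>)). snd z \<le> \<tau> + t \<and> Q (fst z)) \<and>
     (\<integral>\<^sup>+ z. \<phi> (fst z) \<partial>measure_spmf (exec (Call xs c) (\<mu>, \<tau>))) \<le> a"
    using assms(1)[unfolded ok_def, rule_format, of "\<tau> + length xs + 1"] assms(2)
    by (fastforce simp: o_def split_beta)
qed

lemma ok_While_exit:
  assumes "\<not> bval \<mu> b" "Q \<mu>" "\<phi> \<mu> \<le> a" "bcost \<mu> b + 1 \<le> t"
  shows "ok (While b c) \<mu> t Q \<phi> a"
  unfolding ok_def exec_While using assms by (auto intro!: nn_integral_spmf_le_const)

text \<open>One unrolling; the rules for counting and doubling loops iterate it by induction on the
  remaining rounds.\<close>

lemma ok_While_step: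
  assumes b: "bval \<mu> b" and s: "ok (Seq c (While b c)) \<mu> t' Q \<phi> a" and t: "t' + bcost \<mu> b + 1 \<le> t"
  shows "ok (While b c) \<mu> t Q \<phi> a"
proof (rule ok_delay[OF s])
  show "exec (While b c) (\<mu>, \<tau>) = exec (Seq c (While b c)) (\<mu>, \<tau> + (bcost \<mu> b + 1))" for \<tau>
    using b by (simp only: exec_While if_True exec.simps(5) add.assoc)
qed (use t in simp)

section \<open>Logarithmic costs while all stored numbers are bounded\<close>

definition wlen :: "nat \<Rightarrow> nat" where
  "wlen M = floorlog 2 M + 1"

definition bnd :: "nat \<Rightarrow> mem \<Rightarrow> bool" where
  "bnd M \<mu> \<longleftrightarrow> (\<forall>x i. imem \<mu> x i \<le> M)"

lemma wlen_pos: "0 < wlen M" "Suc 0 \<le> wlen M"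
  by (simp_all add: wlen_def)

lemma Suc_le_wlen: "a \<le> b \<Longrightarrow> Suc a \<le> wlen M + b"
  by (simp add: wlen_def)

lemma floorlog_less_wlen: "v \<le> M \<Longrightarrow> floorlog 2 v < wlen M"
  using floorlog_mono[of v M 2] by (simp add: wlen_def)

lemma bnd_istore: "bnd M \<mu> \<Longrightarrow> v \<le> M \<Longrightarrow> bnd M (istore x i v \<mu>)"
  by (simp add: bnd_def)

lemma bnd_rstore: "bnd M \<mu> \<Longrightarrow> bnd M (rstore x i v \<mu>)"
  by (simp add: bnd_def)

lemma bnd_overlay: "bnd M \<mu> \<Longrightarrow> bnd M \<nu> \<Longrightarrow> bnd M (overlay xs \<mu> \<nu>)"
  by (simp add: bnd_def)

lemma bnd_zero_mem [simp]: "bnd M zero_mem"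
  by (simp add: bnd_def)

lemma floorlog_add_le: "floorlog 2 (a + b) \<le> floorlog 2 a + floorlog 2 b + 1"
proof (cases "a = 0 \<or> b = 0")
  case True
  then show ?thesis by auto
next
  case False
  have "a < 2 ^ floorlog 2 a" "b < 2 ^ floorlog 2 b" using False floorlog_bounds by auto
  moreover have "(2::nat) ^ floorlog 2 a \<le> 2 ^ (floorlog 2 a + floorlog 2 b)"
    "(2::nat) ^ floorlog 2 b \<le> 2 ^ (floorlog 2 a + floorlog 2 b)"
    by (intro power_increasing; simp)+
  ultimately have "a + b < 2 ^ (floorlog 2 a + floorlog 2 b) + 2 ^ (floorlog 2 a + floorlog 2 b)" by linarith
  then show ?thesis by (intro floorlog_leI) auto
qed

lemma floorlog_mult_le: "floorlog 2 (a * b) \<le> floorlog 2 a + floorlog 2 b"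
proof (cases "a = 0 \<or> b = 0")
  case False
  have "a < 2 ^ floorlog 2 a" "b < 2 ^ floorlog 2 b" using False floorlog_bounds by auto
  then have "a * b < 2 ^ (floorlog 2 a + floorlog 2 b)"
    unfolding power_add by (rule mult_strict_mono) auto
  then show ?thesis by (intro floorlog_leI) auto
qed (auto simp: floorlog_def)

text \<open>Bit length of a value in units of \<open>wlen M\<close>, read off from the syntax: a
  stored number counts as one unit, and truncated subtraction and division cannot exceed their first
  argument. Hence any fixed expression costs a constant number of units.\<close>

primrec ibits :: "iexp \<Rightarrow> nat" where
  "ibits (IConst k) = floorlog 2 k"
| "ibits (IRead x e) = 1"
| "ibits (IAdd e f) = ibits e + ibits f + 1"
| "ibits (ISub e f) = ibits e"
| "ibits (IMul e f) = ibits e + ibits f"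
| "ibits (IDiv e f) = ibits e"

primrec icst :: "iexp \<Rightarrow> nat" where
  "icst (IConst k) = 1 + floorlog 2 k"
| "icst (IRead x e) = icst e + 2"
| "icst (IAdd e f) = icst e + icst f + 1 + ibits (IAdd e f)"
| "icst (ISub e f) = icst e + icst f + 1 + ibits (ISub e f)"
| "icst (IMul e f) = icst e + icst f + 1 + ibits (IMul e f)"
| "icst (IDiv e f) = icst e + icst f + 1 + ibits (IDiv e f)"

primrec rcst :: "rexp \<Rightarrow> nat" where
  "rcst (ROf e) = icst e + 1"
| "rcst (RRead x e) = icst e + 1"
| "rcst (RAdd e f) = rcst e + rcst f + 1"
| "rcst (RSub e f) = rcst e + rcst f + 1"
| "rcst (RMul e f) = rcst e + rcst f + 1"
| "rcst (RDiv e f) = rcst e + rcst f + 1"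

primrec bcst :: "bexp \<Rightarrow> nat" where
  "bcst (ILess e f) = icst e + icst f + 1"
| "bcst (RLess e f) = rcst e + rcst f + 1"
| "bcst (BNot b) = bcst b + 1"
| "bcst (BAnd b c) = bcst b + bcst c + 1"

text \<open>The cost of executing each part of a program once, per unit \<open>wlen M\<close>, while no stored number exceeds \<open>M\<close>.\<close>

primrec cst :: "com \<Rightarrow> nat" where
  "cst Skip = 1"
| "cst (IAssign x e f) = icst e + icst f + 1"
| "cst (RAssign x e f) = icst e + rcst f + 1"
| "cst (Flip x e) = icst e + 1"
| "cst (Seq c d) = cst c + cst d"
| "cst (Cond b c d) = bcst b + 1 + cst c + cst d"
| "cst (While b c) = bcst b + 1 + cst c"
| "cst (Call xs c) = length xs + 1 + cst c"

lemma cst_pos: "0 < cst c"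
  by (induction c) auto

lemma floorlog_ival_le: "bnd M \<mu> \<Longrightarrow> floorlog 2 (ival \<mu> e) \<le> ibits e * wlen M"
proof (induction e)
  case (IConst k)
  have "floorlog 2 k * 1 \<le> floorlog 2 k * wlen M" by (intro mult_left_mono) (auto simp: wlen_pos)
  then show ?case by simp
next
  case (IRead x e)
  then have "imem \<mu> x (ival \<mu> e) \<le> M" by (simp add: bnd_def)
  from floorlog_less_wlen[OF this] show ?case by simp
next
  case (IAdd e f)
  have "floorlog 2 (ival \<mu> (IAdd e f)) \<le> floorlog 2 (ival \<mu> e) + floorlog 2 (ival \<mu> f) + 1"
    by (simp add: floorlog_add_le[simplified])
  also have "\<dots> \<le> ibits e * wlen M + ibits f * wlen M + wlen M"
    using IAdd by (intro add_mono) (auto simp: wlen_pos)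
  finally show ?case by (simp add: algebra_simps)
next
  case (ISub e f)
  have "floorlog 2 (ival \<mu> e - ival \<mu> f) \<le> floorlog 2 (ival \<mu> e)" by (intro floorlog_mono) auto
  with ISub show ?case by simp
next
  case (IMul e f)
  have "floorlog 2 (ival \<mu> (IMul e f)) \<le> floorlog 2 (ival \<mu> e) + floorlog 2 (ival \<mu> f)"
    by (simp add: floorlog_mult_le)
  then show ?case using IMul by (simp add: algebra_simps)
next
  case (IDiv e f)
  have "floorlog 2 (ival \<mu> e div ival \<mu> f) \<le> floorlog 2 (ival \<mu> e)" by (intro floorlog_mono) auto
  with IDiv show ?case by simp
qed

lemma icost_le: "bnd M \<mu> \<Longrightarrow> icost \<mu> e \<le> icst e * wlen M"
proof (induction e)
  case (IConst k)
  have "(1 + floorlog 2 k) * 1 \<le> (1 + floorlog 2 k) * wlen M" by (intro mult_left_mono) (auto simp: wlen_pos)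
  then show ?case by simp
next
  case (IRead x e)
  have "icost \<mu> (IRead x e) \<le> icst e * wlen M + wlen M + 1 * wlen M"
    using IRead floorlog_ival_le[OF IRead.prems, of "IRead x e"] wlen_pos(2)[of M] unfolding icost.simps ibits.simps by linarith
  then show ?case by (simp add: algebra_simps)
next
  case (IAdd e f)
  have "icost \<mu> (IAdd e f) \<le> icst e * wlen M + icst f * wlen M + wlen M + ibits (IAdd e f) * wlen M"
    using IAdd floorlog_ival_le[OF IAdd.prems, of "IAdd e f"] wlen_pos(2)[of M] unfolding icost.simps by linarith
  then show ?case by (simp add: algebra_simps)
next
  case (ISub e f)
  have "icost \<mu> (ISub e f) \<le> icst e * wlen M + icst f * wlen M + wlen M + ibits (ISub e f) * wlen M"
    using ISub floorlog_ival_le[OF ISub.prems, of "ISub e f"] wlen_pos(2)[of M] unfolding icost.simps by linarith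
  then show ?case by (simp add: algebra_simps)
next
  case (IMul e f)
  have "icost \<mu> (IMul e f) \<le> icst e * wlen M + icst f * wlen M + wlen M + ibits (IMul e f) * wlen M"
    using IMul floorlog_ival_le[OF IMul.prems, of "IMul e f"] wlen_pos(2)[of M] unfolding icost.simps by linarith
  then show ?case by (simp add: algebra_simps)
next
  case (IDiv e f)
  have "icost \<mu> (IDiv e f) \<le> icst e * wlen M + icst f * wlen M + wlen M + ibits (IDiv e f) * wlen M"
    using IDiv floorlog_ival_le[OF IDiv.prems, of "IDiv e f"] wlen_pos(2)[of M] unfolding icost.simps by linarith
  then show ?case by (simp add: algebra_simps)
qed

lemma rcost_le: "bnd M \<mu> \<Longrightarrow> rcost \<mu> e \<le> rcst e * wlen M"
proof (induction e)
  case (ROf e)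
  then show ?case using icost_le[of M \<mu> e] by (simp add: algebra_simps Suc_le_wlen)
next
  case (RRead x e)
  then show ?case using icost_le[of M \<mu> e] by (simp add: algebra_simps Suc_le_wlen)
next
  case (RAdd e f)
  then show ?case by (simp add: algebra_simps Suc_le_wlen)
next
  case (RSub e f)
  then show ?case by (simp add: algebra_simps Suc_le_wlen)
next
  case (RMul e f)
  then show ?case by (simp add: algebra_simps Suc_le_wlen)
next
  case (RDiv e f)
  then show ?case by (simp add: algebra_simps Suc_le_wlen)
qed

lemma bcost_le: "bnd M \<mu> \<Longrightarrow> bcost \<mu> e \<le> bcst e * wlen M"
proof (induction e)
  case (ILess e f)
  then show ?case using icost_le[of M \<mu> e] icost_le[of M \<mu> f] by (simp add: algebra_simps Suc_le_wlen)
next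
  case (RLess e f)
  then show ?case using rcost_le[of M \<mu> e] rcost_le[of M \<mu> f] by (simp add: algebra_simps Suc_le_wlen)
next
  case (BNot e)
  then show ?case by (simp add: algebra_simps Suc_le_wlen)
next
  case (BAnd e f)
  then show ?case by (simp add: algebra_simps Suc_le_wlen)
qed

primrec simple :: "com \<Rightarrow> bool" where
  "simple Skip \<longleftrightarrow> True"
| "simple (IAssign x e f) \<longleftrightarrow> True"
| "simple (RAssign x e f) \<longleftrightarrow> True"
| "simple (Flip x e) \<longleftrightarrow> False"
| "simple (Seq c d) \<longleftrightarrow> simple c \<and> simple d"
| "simple (Cond b c d) \<longleftrightarrow> simple c \<and> simple d"
| "simple (While b c) \<longleftrightarrow> False"
| "simple (Call xs c) \<longleftrightarrow> False"

text \<open>Meaningful for \<open>simple\<close> programs; the values for coins, loops and calls are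
  placeholders.\<close>

primrec sem :: "com \<Rightarrow> mem \<Rightarrow> mem" where
  "sem Skip \<mu> = \<mu>"
| "sem (IAssign x e f) \<mu> = istore x (ival \<mu> e) (ival \<mu> f) \<mu>"
| "sem (RAssign x e f) \<mu> = rstore x (ival \<mu> e) (rval \<mu> f) \<mu>"
| "sem (Flip x e) \<mu> = \<mu>"
| "sem (Seq c d) \<mu> = sem d (sem c \<mu>)"
| "sem (Cond b c d) \<mu> = (if bval \<mu> b then sem c \<mu> else sem d \<mu>)"
| "sem (While b c) \<mu> = \<mu>"
| "sem (Call xs c) \<mu> = \<mu>"

primrec safe :: "nat \<Rightarrow> com \<Rightarrow> mem \<Rightarrow> bool" where
  "safe M Skip \<mu> \<longleftrightarrow> True"
| "safe M (IAssign x e f) \<mu> \<longleftrightarrow> ival \<mu> f \<le> M"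
| "safe M (RAssign x e f) \<mu> \<longleftrightarrow> True"
| "safe M (Flip x e) \<mu> \<longleftrightarrow> True"
| "safe M (Seq c d) \<mu> \<longleftrightarrow> safe M c \<mu> \<and> safe M d (sem c \<mu>)"
| "safe M (Cond b c d) \<mu> \<longleftrightarrow> (if bval \<mu> b then safe M c \<mu> else safe M d \<mu>)"
| "safe M (While b c) \<mu> \<longleftrightarrow> True"
| "safe M (Call xs c) \<mu> \<longleftrightarrow> True"

text \<open>Straight-line code takes a constant number of units of \<open>wlen M\<close> as long as
  no store exceeds M, which is \<open>safe\<close>. Both branches of a conditional are charged, so
  that \<open>cst\<close> does not depend on the memory.\<close>

lemma run_simple:
  "simple c \<Longrightarrow> bnd M \<mu> \<Longrightarrow> safe M c \<mu> \<Longrightarrow> run c \<mu> (cst c * wlen M) (\<lambda>\<nu>. \<nu> = sem c \<mu> \<and> bnd M \<nu>)"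
proof (induction c arbitrary: \<mu>)
  case Skip
  then show ?case unfolding ok_def by (auto simp: Suc_le_wlen wlen_pos)
next
  case (IAssign x e f)
  then show ?case using icost_le[of M \<mu> e] icost_le[of M \<mu> f] wlen_pos(2)[of M]
    unfolding ok_def by (auto simp: bnd_istore algebra_simps Suc_le_wlen)
next
  case (RAssign x e f)
  then show ?case using icost_le[of M \<mu> e] rcost_le[of M \<mu> f] wlen_pos(2)[of M]
    unfolding ok_def by (auto simp: bnd_rstore algebra_simps Suc_le_wlen)
next
  case (Seq c d)
  have "run c \<mu> (cst c * wlen M) (\<lambda>\<nu>. \<nu> = sem c \<mu> \<and> bnd M \<nu>)" using Seq by simp
  then show ?case
    by (rule ok_Seq_run[where ?t2.0="cst d * wlen M"]) (use Seq in \<open>auto simp: algebra_simps\<close>)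
next
  case (Cond b c d)
  have *: "cst c * wlen M \<le> (cst c + cst d) * wlen M" "cst d * wlen M \<le> (cst c + cst d) * wlen M"
    by (simp_all add: algebra_simps)
  show ?case
  proof (rule ok_Cond[where t'="(cst c + cst d) * wlen M"])
    show "run c \<mu> ((cst c + cst d) * wlen M) (\<lambda>\<nu>. \<nu> = sem (Cond b c d) \<mu> \<and> bnd M \<nu>)" if "bval \<mu> b"
      by (rule run_mono[OF Cond.IH(1) *(1)]) (use Cond.prems that in auto)
    show "run d \<mu> ((cst c + cst d) * wlen M) (\<lambda>\<nu>. \<nu> = sem (Cond b c d) \<mu> \<and> bnd M \<nu>)" if "\<not> bval \<mu> b"
      by (rule run_mono[OF Cond.IH(2) *(2)]) (use Cond.prems that in auto)
    show "(cst c + cst d) * wlen M + bcost \<mu> b + 1 \<le> cst (Cond b c d) * wlen M"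
      using bcost_le[OF Cond.prems(2), of b] by (simp add: algebra_simps Suc_le_wlen)
  qed
qed auto

section \<open>Counting loops\<close>

definition Up :: "string \<Rightarrow> iexp \<Rightarrow> com \<Rightarrow> com" where
  "Up x e c = While (ILess (IRead x (IConst 0)) e) (Seq c (IAssign x (IConst 0) (IAdd (IRead x (IConst 0)) (IConst 1))))"

definition For :: "string \<Rightarrow> iexp \<Rightarrow> com \<Rightarrow> com" where
  "For x e c = Seq (IAssign x (IConst 0) (IConst 0)) (Up x e c)"

definition upcst :: "string \<Rightarrow> iexp \<Rightarrow> nat" where
  "upcst x e = cst (Up x e Skip)"

lemma cst_Up: "cst (Up x e c) + 1 = upcst x e + cst c"
  by (simp add: Up_def upcst_def)

lemma wr_For [simp]: "wr (Up x e c) = insert x (wr c)" "wr (For x e c) = insert x (wr c)"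
  by (auto simp: Up_def For_def)

text \<open>The loop starts from whatever value the counter has, so that successive loops can
  advance one pointer. Downward induction on the start value unrolls it: the potentials
  \<open>\<Phi> i\<close> telescope, the times \<open>t i\<close> add up, and each test of the guard
  together with the increment costs \<open>upcst\<close> units. The \<open>+ 1\<close> is the final
  failing test.\<close>

lemma ok_Up:
  assumes "lo \<le> n" "n \<le> M" "I lo \<mu>" "imem \<mu> x 0 = lo" "bnd M \<mu>"
    and e: "\<And>i \<nu>. lo \<le> i \<Longrightarrow> i \<le> n \<Longrightarrow> I i \<nu> \<Longrightarrow> imem \<nu> x 0 = i \<Longrightarrow> ival \<nu> e = n"
    and c: "\<And>i \<nu>. lo \<le> i \<Longrightarrow> i < n \<Longrightarrow> I i \<nu> \<Longrightarrow> bnd M \<nu> \<Longrightarrow> imem \<nu> x 0 = i \<Longrightarrow>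
      ok c \<nu> (t i) (\<lambda>\<nu>'. I (Suc i) (istore x 0 (Suc i) \<nu>') \<and> bnd M \<nu>' \<and> imem \<nu>' x 0 = i)
        (\<lambda>\<nu>'. \<Phi> (Suc i) (istore x 0 (Suc i) \<nu>')) (\<Phi> i \<nu>)"
    and t: "(\<Sum>i=lo..<n. t i) + upcst x e * (n - lo + 1) * wlen M \<le> T"
  shows "ok (Up x e c) \<mu> T (\<lambda>\<nu>. I n \<nu> \<and> bnd M \<nu> \<and> imem \<nu> x 0 = n) (\<Phi> n) (\<Phi> lo \<mu>)"
proof -
  let ?g = "ILess (IRead x (IConst 0)) e" and ?inc = "IAssign x (IConst 0) (IAdd (IRead x (IConst 0)) (IConst 1))"
  have cs: "upcst x e = bcst ?g + 1 + 1 + cst ?inc"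
    by (simp add: upcst_def Up_def)
  have "ok (Up x e c) \<mu> ((\<Sum>i=lo..<n. t i) + upcst x e * (n - lo + 1) * wlen M)
     (\<lambda>\<nu>. I n \<nu> \<and> bnd M \<nu> \<and> imem \<nu> x 0 = n) (\<Phi> n) (\<Phi> lo \<mu>)"
    using assms(1,3,4,5) e c
  proof (induction lo arbitrary: \<mu> rule: inc_induct)
    case base
    have "bcost \<mu> ?g + 1 \<le> (bcst ?g + 1) * wlen M"
      using bcost_le[OF base(3), of ?g] wlen_pos(2)[of M] unfolding add_mult_distrib by linarith
    also have "\<dots> \<le> upcst x e * wlen M" unfolding cs by (intro mult_right_mono) auto
    finally show ?case using base(1-3) base(4)[OF _ _ base(1,2)] unfolding Up_def by (intro ok_While_exit) auto
  next
    case (step i)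
    have e_i: "ival \<mu> e = n" using step.prems(4)[OF order_refl _ step.prems(1,2)] step.hyps by simp
    let ?R = "\<lambda>\<nu>. I (Suc i) \<nu> \<and> bnd M \<nu> \<and> imem \<nu> x 0 = Suc i"
    have body: "ok (Seq c ?inc) \<mu> (t i + cst ?inc * wlen M) ?R (\<Phi> (Suc i)) (\<Phi> i \<mu>)"
    proof (rule ok_Seq)
      show "ok c \<mu> (t i) (\<lambda>\<nu>'. I (Suc i) (istore x 0 (Suc i) \<nu>') \<and> bnd M \<nu>' \<and> imem \<nu>' x 0 = i)
        (\<lambda>\<nu>'. \<Phi> (Suc i) (istore x 0 (Suc i) \<nu>')) (\<Phi> i \<mu>)"
        using step.prems(5)[OF order_refl step.hyps(2) step.prems(1,3,2)] .
      fix \<nu> assume \<nu>: "I (Suc i) (istore x 0 (Suc i) \<nu>) \<and> bnd M \<nu> \<and> imem \<nu> x 0 = i"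
      have "run ?inc \<nu> (cst ?inc * wlen M) (\<lambda>\<nu>'. \<nu>' = sem ?inc \<nu> \<and> bnd M \<nu>')"
        using \<nu> step.hyps assms(2) by (intro run_simple) auto
      then have "run ?inc \<nu> (cst ?inc * wlen M) (\<lambda>\<nu>'. ?R \<nu>' \<and> \<Phi> (Suc i) \<nu>' \<le> \<Phi> (Suc i) (istore x 0 (Suc i) \<nu>))"
        by (rule run_mono) (use \<nu> in auto)
      then show "ok ?inc \<nu> (cst ?inc * wlen M) ?R (\<Phi> (Suc i)) (\<Phi> (Suc i) (istore x 0 (Suc i) \<nu>))"
        by (rule ok_run)
    qed simp
    have "ok (Seq (Seq c ?inc) (Up x e c)) \<mu> (t i + cst ?inc * wlen M +
        ((\<Sum>j=Suc i..<n. t j) + upcst x e * (n - Suc i + 1) * wlen M))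
      (\<lambda>\<nu>. I n \<nu> \<and> bnd M \<nu> \<and> imem \<nu> x 0 = n) (\<Phi> n) (\<Phi> i \<mu>)"
    proof (rule ok_Seq[OF body])
      fix \<nu> assume \<nu>: "?R \<nu>"
      show "ok (Up x e c) \<nu> ((\<Sum>j=Suc i..<n. t j) + upcst x e * (n - Suc i + 1) * wlen M)
         (\<lambda>\<nu>. I n \<nu> \<and> bnd M \<nu> \<and> imem \<nu> x 0 = n) (\<Phi> n) (\<Phi> (Suc i) \<nu>)"
      proof (rule step.IH)
        show "ival \<nu>' e = n" if "Suc i \<le> j" "j \<le> n" "I j \<nu>'" "imem \<nu>' x 0 = j" for j \<nu>'
          using that by (intro step.prems(4)) simp_all
        show "ok c \<nu>' (t j) (\<lambda>\<nu>'. I (Suc j) (istore x 0 (Suc j) \<nu>') \<and> bnd M \<nu>' \<and> imem \<nu>' x 0 = j)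
           (\<lambda>\<nu>'. \<Phi> (Suc j) (istore x 0 (Suc j) \<nu>')) (\<Phi> j \<nu>')"
          if "Suc i \<le> j" "j < n" "I j \<nu>'" "bnd M \<nu>'" "imem \<nu>' x 0 = j" for j \<nu>'
          by (rule step.prems(5)) (use that in simp_all)
      qed (use \<nu> in simp_all)
    qed simp
    then have "ok (While ?g (Seq c ?inc)) \<mu> (t i + cst ?inc * wlen M +
        ((\<Sum>j=Suc i..<n. t j) + upcst x e * (n - Suc i + 1) * wlen M) + bcost \<mu> ?g + 1)
      (\<lambda>\<nu>. I n \<nu> \<and> bnd M \<nu> \<and> imem \<nu> x 0 = n) (\<Phi> n) (\<Phi> i \<mu>)"
      unfolding Up_def by (rule ok_While_step[rotated]) (use step.prems(2) step.hyps e_i in auto)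
    then show ?case unfolding Up_def
    proof (rule ok_mono)
      have "bcost \<mu> ?g + 1 + cst ?inc * wlen M \<le> (bcst ?g + 1 + cst ?inc) * wlen M"
        using bcost_le[OF step.prems(3), of ?g] wlen_pos(2)[of M] unfolding add_mult_distrib by linarith
      also have "\<dots> \<le> upcst x e * wlen M" unfolding cs by (intro mult_right_mono) auto
      finally have *: "bcost \<mu> ?g + 1 + cst ?inc * wlen M \<le> upcst x e * wlen M" .
      have sum_eq: "(\<Sum>j=i..<n. t j) = t i + (\<Sum>j=Suc i..<n. t j)"
        using step.hyps by (simp add: sum.atLeast_Suc_lessThan)
      have mult_eq: "upcst x e * (n - i + 1) * wlen M = upcst x e * wlen M + upcst x e * (n - Suc i + 1) * wlen M"
      proof -
        have "n - i + 1 = Suc (n - Suc i + 1)" using step.hyps by simp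
        then show ?thesis by (simp add: algebra_simps)
      qed
      have gen: "a + c + (s + r) + b + 1 \<le> (a + s) + (w + r)" if "b + 1 + c \<le> w" for a b c s r w :: nat
        using that by linarith
      show "t i + cst ?inc * wlen M + ((\<Sum>j=Suc i..<n. t j) + upcst x e * (n - Suc i + 1) * wlen M)
          + bcost \<mu> ?g + 1 \<le> (\<Sum>j=i..<n. t j) + upcst x e * (n - i + 1) * wlen M"
        unfolding sum_eq mult_eq using * by (rule gen)
    qed auto
  qed
  then show ?thesis by (rule ok_mono) (use t in auto)
qed

lemma ok_For:
  assumes "n \<le> M" "bnd M \<mu>" "I 0 (istore x 0 0 \<mu>)"
    and e: "\<And>i \<nu>. i \<le> n \<Longrightarrow> I i \<nu> \<Longrightarrow> imem \<nu> x 0 = i \<Longrightarrow> ival \<nu> e = n"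
    and c: "\<And>i \<nu>. i < n \<Longrightarrow> I i \<nu> \<Longrightarrow> bnd M \<nu> \<Longrightarrow> imem \<nu> x 0 = i \<Longrightarrow>
      ok c \<nu> (t i) (\<lambda>\<nu>'. I (Suc i) (istore x 0 (Suc i) \<nu>') \<and> bnd M \<nu>' \<and> imem \<nu>' x 0 = i)
        (\<lambda>\<nu>'. \<Phi> (Suc i) (istore x 0 (Suc i) \<nu>')) (\<Phi> i \<nu>)"
    and \<Phi>: "\<Phi> 0 (istore x 0 0 \<mu>) \<le> a"
    and t: "(\<Sum>i<n. t i) + upcst x e * (n + 1) * wlen M + 3 * wlen M \<le> T"
  shows "ok (For x e c) \<mu> T (\<lambda>\<nu>. I n \<nu> \<and> bnd M \<nu> \<and> imem \<nu> x 0 = n) (\<Phi> n) a"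
  unfolding For_def
proof (rule ok_Seq_run)
  show "run (IAssign x (IConst 0) (IConst 0)) \<mu> (cst (IAssign x (IConst 0) (IConst 0)) * wlen M)
    (\<lambda>\<nu>. \<nu> = sem (IAssign x (IConst 0) (IConst 0)) \<mu> \<and> bnd M \<nu>)"
    using assms(2) by (intro run_simple) auto
  fix \<nu> assume "\<nu> = sem (IAssign x (IConst 0) (IConst 0)) \<mu> \<and> bnd M \<nu>"
  then have \<nu>: "\<nu> = istore x 0 0 \<mu>" "bnd M \<nu>" by auto
  have "ok (Up x e c) \<nu> ((\<Sum>i=0..<n. t i) + upcst x e * (n - 0 + 1) * wlen M)
     (\<lambda>\<nu>. I n \<nu> \<and> bnd M \<nu> \<and> imem \<nu> x 0 = n) (\<Phi> n) (\<Phi> 0 \<nu>)"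
  proof (rule ok_Up[OF _ assms(1)])
    show "ok c \<nu>' (t j) (\<lambda>\<nu>'. I (Suc j) (istore x 0 (Suc j) \<nu>') \<and> bnd M \<nu>' \<and> imem \<nu>' x 0 = j)
        (\<lambda>\<nu>'. \<Phi> (Suc j) (istore x 0 (Suc j) \<nu>')) (\<Phi> j \<nu>')"
      if "j < n" "I j \<nu>'" "bnd M \<nu>'" "imem \<nu>' x 0 = j" for j \<nu>'
      by (rule c) (use that in simp_all)
    show "ival \<nu>' e = n" if "j \<le> n" "I j \<nu>'" "imem \<nu>' x 0 = j" for j \<nu>'
      by (rule e) (use that in simp_all)
  qed (use \<nu> assms(3) in simp_all)
  then show "ok (Up x e c) \<nu> ((\<Sum>i=0..<n. t i) + upcst x e * (n - 0 + 1) * wlen M)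
     (\<lambda>\<nu>. I n \<nu> \<and> bnd M \<nu> \<and> imem \<nu> x 0 = n) (\<Phi> n) a"
    by (rule ok_mono) (use \<nu> \<Phi> in auto)
next
  show "cst (IAssign x (IConst 0) (IConst 0)) * wlen M + ((\<Sum>i=0..<n. t i) + upcst x e * (n - 0 + 1) * wlen M) \<le> T"
    using t by (simp add: algebra_simps atLeast0LessThan floorlog_def)
qed

lemma cst_For: "cst (For x e c) + 1 = upcst x e + 3 + cst c"
  using cst_Up[of x e c] by (simp add: For_def floorlog_def)

text \<open>For straight-line bodies, the frame against the initial memory is carried along
  automatically, so that an invariant speaks only about the arrays written by the body.\<close>

lemma run_For_simple:
  assumes "simple c" "x \<notin> wr c" "n \<le> M" "bnd M \<mu>"
    and init: "I 0 (istore x 0 0 \<mu>)"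
    and e: "\<And>i \<nu>. i \<le> n \<Longrightarrow> I i \<nu> \<Longrightarrow> agree (insert x (wr c)) \<mu> \<nu> \<Longrightarrow> imem \<nu> x 0 = i \<Longrightarrow> ival \<nu> e = n"
    and step: "\<And>i \<nu>. i < n \<Longrightarrow> I i \<nu> \<Longrightarrow> agree (insert x (wr c)) \<mu> \<nu> \<Longrightarrow> imem \<nu> x 0 = i \<Longrightarrow> bnd M \<nu> \<Longrightarrow>
      safe M c \<nu> \<and> I (Suc i) (istore x 0 (Suc i) (sem c \<nu>))"
    and t: "cst (For x e c) * ((n + 1) * wlen M) \<le> T"
  shows "run (For x e c) \<mu> T (\<lambda>\<nu>. I n \<nu> \<and> bnd M \<nu>)"
proof -
  have "run (For x e c) \<mu> T (\<lambda>\<nu>. (I n \<nu> \<and> agree (insert x (wr c)) \<mu> \<nu>) \<and> bnd M \<nu> \<and> imem \<nu> x 0 = n)"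
  proof (rule ok_For[where t="\<lambda>_. cst c * wlen M" and \<Phi>="\<lambda>_ _. 0" and I="\<lambda>i \<nu>. I i \<nu> \<and> agree (insert x (wr c)) \<mu> \<nu>", OF assms(3,4)])
    show "I 0 (istore x 0 0 \<mu>) \<and> agree (insert x (wr c)) \<mu> (istore x 0 0 \<mu>)"
      using init by (simp add: agree_def)
    show "ival \<nu> e = n" if "i \<le> n" "I i \<nu> \<and> agree (insert x (wr c)) \<mu> \<nu>" "imem \<nu> x 0 = i" for i \<nu>
      using e that by blast
    show "run c \<nu> (cst c * wlen M)
            (\<lambda>\<nu>'. (I (Suc i) (istore x 0 (Suc i) \<nu>') \<and> agree (insert x (wr c)) \<mu> (istore x 0 (Suc i) \<nu>')) \<and>
                  bnd M \<nu>' \<and> imem \<nu>' x 0 = i)"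
      if *: "i < n" "I i \<nu> \<and> agree (insert x (wr c)) \<mu> \<nu>" "bnd M \<nu>" "imem \<nu> x 0 = i" for i \<nu>
    proof (rule run_mono[OF run_simple])
      fix \<nu>' assume \<nu>': "\<nu>' = sem c \<nu> \<and> bnd M \<nu>'" "agree (wr c) \<nu> \<nu>'"
      have "imem \<nu>' x 0 = i" using \<nu>'(2) assms(2) * by (simp add: agree_def)
      moreover have "agree (insert x (wr c)) \<mu> (istore x 0 (Suc i) \<nu>')"
        using \<nu>'(2) * by (auto simp: agree_def)
      ultimately show "(I (Suc i) (istore x 0 (Suc i) \<nu>') \<and> agree (insert x (wr c)) \<mu> (istore x 0 (Suc i) \<nu>')) \<and>
                  bnd M \<nu>' \<and> imem \<nu>' x 0 = i"
        using step * \<nu>' by blast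
    qed (use assms(1) *(3) step[OF *(1) _ _ *(4,3)] *(2) in auto)
    have "cst c \<ge> 1" "cst (For x e c) = upcst x e + 2 + cst c" using cst_pos[of c] cst_For[of x e c] by simp_all
    then have "n * cst c + upcst x e * (n + 1) + 3 \<le> cst (For x e c) * (n + 1)"
      by (simp add: algebra_simps)
    from mult_right_mono[OF this, of "wlen M"]
    show "(\<Sum>i<n. cst c * wlen M) + upcst x e * (n + 1) * wlen M + 3 * wlen M \<le> T"
      using t by (simp add: algebra_simps)
  qed auto
  then show ?thesis by (rule run_mono) auto
qed

section \<open>The flow network of a contracted hypergraph\<close>

text \<open>
  The network has source \<open>0\<close>, sink \<open>1\<close>, the vertices \<open>2 + 2 j\<close> and \<open>3 + 2 j\<close> for hyperedge \<open>j\<close>, and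
  \<open>2 + 2 m + l\<close> for the local vertex \<open>l\<close>. The incidences \<open>(E a, V a)\<close> are numbered by \<open>a\<close>. The flags
  \<open>fs j\<close> and \<open>ft j\<close> tell that hyperedge \<open>j\<close> also contains the contracted source and sink, respectively.
  Arcs that do not belong to an incidence are created with the first incidence of a hyperedge, so that
  their number is bounded by the number of incidences.
\<close>

primrec arcs :: "(nat \<Rightarrow> nat) \<Rightarrow> (nat \<Rightarrow> nat) \<Rightarrow> nat \<Rightarrow> (nat \<Rightarrow> nat) \<Rightarrow> (nat \<Rightarrow> nat) \<Rightarrow> (nat \<Rightarrow> real) \<Rightarrow> real \<Rightarrow> nat
    \<Rightarrow> (nat \<times> nat \<times> real) list" where
  "arcs E V m fs ft hw W 0 = []"
| "arcs E V m fs ft hw W (Suc a) = arcs E V m fs ft hw W a @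
    (if \<exists>b<a. E b = E a then [] else
      [(2 + 2 * E a, 3 + 2 * E a, hw (E a)), (0, 2 + 2 * E a, W * real (fs (E a))), (3 + 2 * E a, 1, W * real (ft (E a)))]) @
    [(2 + 2 * m + V a, 2 + 2 * E a, W), (3 + 2 * E a, 2 + 2 * m + V a, W)]"

definition network :: "(nat \<Rightarrow> nat) \<Rightarrow> (nat \<Rightarrow> nat) \<Rightarrow> nat \<Rightarrow> nat \<Rightarrow> (nat \<Rightarrow> nat) \<Rightarrow> (nat \<Rightarrow> nat) \<Rightarrow> (nat \<Rightarrow> real) \<Rightarrow> real \<Rightarrow> nat
    \<Rightarrow> digraph" where
  "network E V m l fs ft hw W p = (let as = arcs E V m fs ft hw W p in
     \<lparr>dn = 2 + 2 * m + l, dm = length as, dtail = (\<lambda>i. fst (as ! i)), dhead = (\<lambda>i. fst (snd (as ! i))),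
      dweight = (\<lambda>i. snd (snd (as ! i)))\<rparr>)"

text \<open>The 5: two arcs for each incidence, and three more if it is the first of its
  hyperedge.\<close>

lemma length_arcs: "length (arcs E V m fs ft hw W p) \<le> 5 * p"
  by (induction p) auto

text \<open>Regroups the arcs, whose order is dictated by the program, into three per hyperedge with
  an incidence and two per incidence.\<close>

lemma sum_list_arcs:
  fixes f :: "nat \<times> nat \<times> real \<Rightarrow> real"
  shows "sum_list (map f (arcs E V m fs ft hw W p)) =
    (\<Sum>j\<in>E ` {..<p}. f (2 + 2 * j, 3 + 2 * j, hw j) + f (0, 2 + 2 * j, W * real (fs j)) + f (3 + 2 * j, 1, W * real (ft j))) +
    (\<Sum>b<p. f (2 + 2 * m + V b, 2 + 2 * E b, W) + f (3 + 2 * E b, 2 + 2 * m + V b, W))"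
proof (induction p)
  case (Suc p)
  show ?case
  proof (cases "\<exists>b<p. E b = E p")
    case True
    then have "E p \<in> E ` {..<p}" by (metis imageI lessThan_iff)
    then have "E ` {..<Suc p} = E ` {..<p}" by (simp add: lessThan_Suc insert_absorb)
    then show ?thesis using Suc True by simp
  next
    case False
    then have "E ` {..<Suc p} = insert (E p) (E ` {..<p})" "E p \<notin> E ` {..<p}" by (auto simp: lessThan_Suc)
    then show ?thesis using Suc unfolding arcs.simps if_not_P[OF False] by simp
  qed
qed simp

lemma dcut_weight_network:
  "dcut_weight (network E V m l fs ft hw W p) S =
    (\<Sum>j\<in>E ` {..<p}. (if 2 + 2 * j \<in> S \<and> 3 + 2 * j \<notin> S then hw j else 0) +
       (if 0 \<in> S \<and> 2 + 2 * j \<notin> S then W * real (fs j) else 0) + (if 3 + 2 * j \<in> S \<and> 1 \<notin> S then W * real (ft j) else 0)) +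
    (\<Sum>b<p. (if 2 + 2 * m + V b \<in> S \<and> 2 + 2 * E b \<notin> S then W else 0) +
       (if 3 + 2 * E b \<in> S \<and> 2 + 2 * m + V b \<notin> S then W else 0))"
proof -
  let ?as = "arcs E V m fs ft hw W p" and ?f = "\<lambda>(x, y, r). if x \<in> S \<and> y \<notin> S then r else (0::real)"
  have "dcut_weight (network E V m l fs ft hw W p) S = (\<Sum>a | a < length ?as \<and> fst (?as ! a) \<in> S \<and> fst (snd (?as ! a)) \<notin> S. snd (snd (?as ! a)))"
    by (simp add: dcut_weight_def network_def Let_def)
  also have "\<dots> = (\<Sum>a<length ?as. ?f (?as ! a))"
    by (rule sum.mono_neutral_cong_left) (auto simp: split_beta)
  also have "\<dots> = sum_list (map ?f ?as)"
    by (simp add: sum_list_sum_nth atLeast0LessThan)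
  finally show ?thesis unfolding sum_list_arcs by simp
qed

lemma set_arcs:
  assumes "z \<in> set (arcs E V m fs ft hw W p)"
  shows "\<exists>b<p. (fst z, fst (snd z)) \<in> {(2 + 2 * E b, 3 + 2 * E b), (0, 2 + 2 * E b), (3 + 2 * E b, 1),
    (2 + 2 * m + V b, 2 + 2 * E b), (3 + 2 * E b, 2 + 2 * m + V b)}"
  using assms
proof (induction p)
  case (Suc p)
  then consider "z \<in> set (arcs E V m fs ft hw W p)" |
    "(fst z, fst (snd z)) \<in> {(2 + 2 * E p, 3 + 2 * E p), (0, 2 + 2 * E p), (3 + 2 * E p, 1),
      (2 + 2 * m + V p, 2 + 2 * E p), (3 + 2 * E p, 2 + 2 * m + V p)}"
    by (auto split: if_splits)
  then show ?case
    by cases (use Suc.IH less_SucI lessI in blast)+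
qed simp

locale incidences =
  fixes E V :: "nat \<Rightarrow> nat" and m l p :: nat and fs ft :: "nat \<Rightarrow> nat" and hw :: "nat \<Rightarrow> real" and W :: real
  assumes E_less: "\<And>a. a < p \<Longrightarrow> E a < m" and V_less: "\<And>a. a < p \<Longrightarrow> V a < l"
    and inj: "inj_on (\<lambda>a. (E a, V a)) {..<p}"
    and fs: "\<And>j. fs j \<le> 1" and ft: "\<And>j. ft j \<le> 1" and hw: "\<And>j. j < m \<Longrightarrow> 0 \<le> hw j" and W: "0 \<le> W"
begin

abbreviation "net \<equiv> network E V m l fs ft hw W p"

text \<open>\<open>wf_digraph\<close> forbids parallel arcs. In-nodes are even, out-nodes are odd,
  and both lie between the source and sink and the local vertices, which start at
  \<open>2 + 2 * m\<close>; so arcs of different kinds differ. Arcs of one kind differ because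
  incidences are distinct and the arcs of a hyperedge are created once.\<close>

lemma distinct_arcs: "q \<le> p \<Longrightarrow> distinct (map (\<lambda>z. (fst z, fst (snd z))) (arcs E V m fs ft hw W q))"
proof (induction q)
  case (Suc q)
  have q: "E q < m" "\<And>b. b < q \<Longrightarrow> E b < m" using Suc.prems E_less by auto
  have ne: "\<not> (E b = E q \<and> V b = V q)" if "b < q" for b
    using inj_onD[OF inj, of b q] that Suc.prems by auto
  let ?S = "(\<lambda>z. (fst z, fst (snd z))) ` set (arcs E V m fs ft hw W q)"
  have S: "\<exists>b<q. y \<in> {(2 + 2 * E b, 3 + 2 * E b), (0, 2 + 2 * E b), (3 + 2 * E b, 1),
      (2 + 2 * m + V b, 2 + 2 * E b), (3 + 2 * E b, 2 + 2 * m + V b)}" if "y \<in> ?S" for y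
    using that set_arcs[of _ E V m fs ft hw W q] by blast
  have B1: "(2 + 2 * m + V q, 2 + 2 * E q) \<notin> ?S"
  proof
    assume "(2 + 2 * m + V q, 2 + 2 * E q) \<in> ?S"
    from S[OF this] obtain b where b: "b < q" "(2 + 2 * m + V q, 2 + 2 * E q) \<in> {(2 + 2 * E b, 3 + 2 * E b), (0, 2 + 2 * E b),
      (3 + 2 * E b, 1), (2 + 2 * m + V b, 2 + 2 * E b), (3 + 2 * E b, 2 + 2 * m + V b)}" by blast
    show False using b(2) q(2)[OF b(1)] q(1) ne[OF b(1)] by (simp; presburger?)
  qed
  have B2: "(3 + 2 * E q, 2 + 2 * m + V q) \<notin> ?S"
  proof
    assume "(3 + 2 * E q, 2 + 2 * m + V q) \<in> ?S"
    from S[OF this] obtain b where b: "b < q" "(3 + 2 * E q, 2 + 2 * m + V q) \<in> {(2 + 2 * E b, 3 + 2 * E b), (0, 2 + 2 * E b),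
      (3 + 2 * E b, 1), (2 + 2 * m + V b, 2 + 2 * E b), (3 + 2 * E b, 2 + 2 * m + V b)}" by blast
    show False using b(2) q(2)[OF b(1)] q(1) ne[OF b(1)] by (simp; presburger?)
  qed
  have A: "(2 + 2 * E q, 3 + 2 * E q) \<notin> ?S \<and> (0, 2 + 2 * E q) \<notin> ?S \<and> (3 + 2 * E q, 1) \<notin> ?S" if new: "\<not> (\<exists>b<q. E b = E q)"
  proof (rule ccontr)
    assume "\<not> ?thesis"
    then obtain y where y: "y \<in> ?S" "y \<in> {(2 + 2 * E q, 3 + 2 * E q), (0, 2 + 2 * E q), (3 + 2 * E q, 1)}" by blast
    from S[OF y(1)] obtain b where b: "b < q" "y \<in> {(2 + 2 * E b, 3 + 2 * E b), (0, 2 + 2 * E b),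
      (3 + 2 * E b, 1), (2 + 2 * m + V b, 2 + 2 * E b), (3 + 2 * E b, 2 + 2 * m + V b)}" by blast
    have "E b \<noteq> E q" using b(1) new by blast
    then show False using b(2) y(2) q(2)[OF b(1)] q(1) by (elim insertE emptyE; simp; presburger?)
  qed
  have AB: "2 + 2 * E q \<noteq> 2 + 2 * m + V q" "2 + 2 * m + V q \<noteq> 3 + 2 * E q" using q by simp_all
  show ?case
  proof (cases "\<exists>b<q. E b = E q")
    case True
    show ?thesis using Suc B1 B2 AB unfolding arcs.simps if_P[OF True] map_append distinct_append set_append set_map
      by simp
  next
    case False
    show ?thesis using Suc A[OF False] B1 B2 AB unfolding arcs.simps if_not_P[OF False] map_append distinct_append set_append set_map
      by (simp; presburger?)
  qed
qed simp

lemma arcs_wf: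
  assumes "(x, y, r) \<in> set (arcs E V m fs ft hw W q)" "q \<le> p"
  shows "x < 2 + 2 * m + l \<and> y < 2 + 2 * m + l \<and> x \<noteq> y \<and> 0 \<le> r"
  using assms
proof (induction q)
  case (Suc q)
  have "E q < m" "V q < l" using Suc.prems E_less V_less by auto
  then show ?case using Suc hw W by (auto split: if_splits)
qed simp

lemma wf_network: "wf_digraph net"
proof -
  let ?as = "arcs E V m fs ft hw W p"
  have "dtail net a < dn net \<and> dhead net a < dn net \<and> dtail net a \<noteq> dhead net a \<and> 0 \<le> dweight net a" if "a < dm net" for a
  proof -
    have "?as ! a \<in> set ?as" using that by (simp add: network_def Let_def)
    then show ?thesis using arcs_wf[of "fst (?as ! a)" "fst (snd (?as ! a))" "snd (snd (?as ! a))" p]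
      by (simp add: network_def Let_def)
  qed
  moreover have "inj_on (\<lambda>a. (dtail net a, dhead net a)) {..<dm net}"
  proof -
    have "inj_on ((!) (map (\<lambda>z. (fst z, fst (snd z))) ?as)) {..<length ?as}"
      using distinct_arcs[of p] by (intro inj_on_nth) auto
    then show ?thesis
      by (simp add: network_def Let_def inj_on_def split_beta)
  qed
  ultimately show ?thesis by (simp add: wf_digraph_def)
qed

text \<open>Cut function of the contracted hypergraph: the flags act as a source and a sink vertex
  that belong to the flagged hyperedges.\<close>

definition obj :: "nat set \<Rightarrow> real" where
  "obj Y = (\<Sum>j | j \<in> E ` {..<p} \<and> (fs j = 1 \<or> (\<exists>b<p. E b = j \<and> V b \<in> Y)) \<and> (ft j = 1 \<or> (\<exists>b<p. E b = j \<and> V b \<notin> Y)). hw j)"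

text \<open>The in-node of a hyperedge joins the source side if the hyperedge touches it, and the
  out-node does so if the hyperedge does not touch the sink side. Then no arc of weight W is cut,
  and the arc from in-node to out-node is cut exactly for the hyperedges counted by
  \<open>obj\<close>.\<close>

lemma network_cut_of_set:
  obtains S where "st_set net 0 1 S" "dcut_weight net S = obj Y"
proof -
  let ?A = "\<lambda>j. fs j = 1 \<or> (\<exists>b<p. E b = j \<and> V b \<in> Y)" and ?B = "\<lambda>j. ft j = 1 \<or> (\<exists>b<p. E b = j \<and> V b \<notin> Y)"
  define S where "S = {x. x = 0 \<or> (\<exists>v. x = 2 + 2 * m + v \<and> v < l \<and> v \<in> Y) \<or> (\<exists>j. x = 2 + 2 * j \<and> j < m \<and> ?A j) \<or>
    (\<exists>j. x = 3 + 2 * j \<and> j < m \<and> \<not> ?B j)}"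
  have i: "2 + 2 * j \<in> S \<longleftrightarrow> ?A j" if "j < m" for j
  proof -
    have "2 + 2 * j \<noteq> 3 + 2 * j'" for j' by presburger
    with that show ?thesis unfolding S_def by auto
  qed
  have o: "3 + 2 * j \<in> S \<longleftrightarrow> \<not> ?B j" if "j < m" for j
  proof -
    have "3 + 2 * j \<noteq> 2 + 2 * j'" for j' by presburger
    with that show ?thesis unfolding S_def by auto
  qed
  have v: "2 + 2 * m + v \<in> S \<longleftrightarrow> v \<in> Y" if "v < l" for v
    using that unfolding S_def by auto
  have z: "0 \<in> S" "1 \<notin> S" by (simp_all add: S_def)
  have fs0: "fs j = 1 \<or> fs j = 0" and ft0: "ft j = 1 \<or> ft j = 0" for j using fs[of j] ft[of j] by auto
  have "S \<subseteq> {..<2 + 2 * m + l}" by (auto simp: S_def)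
  with z have st: "st_set net 0 1 S" by (auto simp: st_set_def network_def Let_def)
  have "(\<Sum>b<p. (if 2 + 2 * m + V b \<in> S \<and> 2 + 2 * E b \<notin> S then W else 0) +
       (if 3 + 2 * E b \<in> S \<and> 2 + 2 * m + V b \<notin> S then W else 0)) = 0"
  proof (intro sum.neutral ballI)
    fix b assume "b \<in> {..<p}"
    then have b: "b < p" by simp
    have "2 + 2 * m + V b \<in> S \<Longrightarrow> 2 + 2 * E b \<in> S" "3 + 2 * E b \<in> S \<Longrightarrow> 2 + 2 * m + V b \<in> S"
      unfolding i[OF E_less[OF b]] o[OF E_less[OF b]] v[OF V_less[OF b]] using b by blast+
    then show "(if 2 + 2 * m + V b \<in> S \<and> 2 + 2 * E b \<notin> S then W else 0) +
       (if 3 + 2 * E b \<in> S \<and> 2 + 2 * m + V b \<notin> S then W else 0) = 0" by argo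
  qed
  moreover have "(\<Sum>j\<in>E ` {..<p}. (if 2 + 2 * j \<in> S \<and> 3 + 2 * j \<notin> S then hw j else 0) +
       (if 0 \<in> S \<and> 2 + 2 * j \<notin> S then W * real (fs j) else 0) + (if 3 + 2 * j \<in> S \<and> 1 \<notin> S then W * real (ft j) else 0))
      = (\<Sum>j\<in>E ` {..<p}. if ?A j \<and> ?B j then hw j else 0)"
  proof (intro sum.cong refl)
    fix j assume "j \<in> E ` {..<p}"
    then have "j < m" using E_less by auto
    have gen: "(if P \<and> \<not> \<not> Q then h else 0) + (if z \<and> \<not> P then W * f else 0) + (if \<not> Q \<and> y then W * g else 0)
      = (if P \<and> Q then h else 0)" if "P \<or> f = 0" "Q \<or> g = 0" for P Q z y and h f g :: real
      using that by auto
    have a1': "?A j \<or> real (fs j) = 0" using fs0[of j] by auto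
    have a2': "?B j \<or> real (ft j) = 0" using ft0[of j] by auto
    show "(if 2 + 2 * j \<in> S \<and> 3 + 2 * j \<notin> S then hw j else 0) +
       (if 0 \<in> S \<and> 2 + 2 * j \<notin> S then W * real (fs j) else 0) + (if 3 + 2 * j \<in> S \<and> 1 \<notin> S then W * real (ft j) else 0)
       = (if ?A j \<and> ?B j then hw j else 0)"
      unfolding i[OF \<open>j < m\<close>] o[OF \<open>j < m\<close>] by (rule gen[OF a1' a2'])
  qed
  moreover have "obj Y = (\<Sum>j\<in>E ` {..<p}. if ?A j \<and> ?B j then hw j else 0)"
    unfolding obj_def by (rule sum.mono_neutral_cong_left) auto
  ultimately have "dcut_weight net S = obj Y" unfolding dcut_weight_network by simp
  with st show ?thesis by (rule that)
qed

text \<open>A cut lighter than W contains no arc of weight W. This forces the in-node of every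
  hyperedge that touches the source side into S and the out-node of every hyperedge that touches the
  sink side out of S, so each hyperedge counted by \<open>obj\<close> pays with its own arc.\<close>

lemma obj_le_network_cut:
  assumes S: "st_set net 0 1 S" and less: "dcut_weight net S < W"
  shows "obj {v. 2 + 2 * m + v \<in> S} \<le> dcut_weight net S"
proof -
  define h where "h j = (if 2 + 2 * j \<in> S \<and> 3 + 2 * j \<notin> S then hw j else 0) +
       (if 0 \<in> S \<and> 2 + 2 * j \<notin> S then W * real (fs j) else 0) + (if 3 + 2 * j \<in> S \<and> 1 \<notin> S then W * real (ft j) else 0)" for j
  define g where "g b = (if 2 + 2 * m + V b \<in> S \<and> 2 + 2 * E b \<notin> S then W else 0) +
       (if 3 + 2 * E b \<in> S \<and> 2 + 2 * m + V b \<notin> S then W else 0)" for b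
  let ?Y = "{v. 2 + 2 * m + v \<in> S}"
  have eq: "dcut_weight net S = (\<Sum>j\<in>E ` {..<p}. h j) + (\<Sum>b<p. g b)" unfolding h_def g_def by (rule dcut_weight_network)
  have s: "0 \<in> S" "1 \<notin> S" using S by (auto simp: st_set_def)
  have E: "j < m" if "j \<in> E ` {..<p}" for j using that E_less by auto
  have h0: "0 \<le> h j" if "j \<in> E ` {..<p}" for j
    unfolding h_def using hw[OF E[OF that]] W by (intro add_nonneg_nonneg) auto
  have g0: "0 \<le> g b" for b unfolding g_def using W by auto
  have hW: "h j < W" if "j \<in> E ` {..<p}" for j
  proof -
    have "h j \<le> (\<Sum>j\<in>E ` {..<p}. h j)" by (rule member_le_sum[OF that]) (use h0 in blast, simp)
    moreover have "0 \<le> (\<Sum>b<p. g b)" by (rule sum_nonneg) (rule g0)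
    ultimately show ?thesis using less eq by linarith
  qed
  have gW: "g b < W" if "b < p" for b
  proof -
    have "g b \<le> (\<Sum>b<p. g b)" by (rule member_le_sum) (use that g0 in auto)
    moreover have "0 \<le> (\<Sum>j\<in>E ` {..<p}. h j)" by (rule sum_nonneg) (rule h0)
    ultimately show ?thesis using less eq by linarith
  qed
  have inS: "2 + 2 * j \<in> S" if j: "j \<in> E ` {..<p}" "fs j = 1 \<or> (\<exists>b<p. E b = j \<and> V b \<in> ?Y)" for j
  proof (rule ccontr)
    assume n: "2 + 2 * j \<notin> S"
    show False using j(2)
    proof
      assume "fs j = 1"
      then have "h j = W + (if 3 + 2 * j \<in> S \<and> 1 \<notin> S then W * real (ft j) else 0)" using n s by (simp add: h_def)
      moreover have "0 \<le> W * real (ft j)" using W by simp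
      ultimately show False using hW[OF j(1)] by (simp split: if_splits)
    next
      assume "\<exists>b<p. E b = j \<and> V b \<in> ?Y"
      then obtain b where "b < p" "E b = j" "2 + 2 * m + V b \<in> S" by auto
      then show False using gW[of b] n by (simp add: g_def)
    qed
  qed
  have outS: "3 + 2 * j \<notin> S" if j: "j \<in> E ` {..<p}" "ft j = 1 \<or> (\<exists>b<p. E b = j \<and> V b \<notin> ?Y)" for j
  proof
    assume n: "3 + 2 * j \<in> S"
    show False using j(2)
    proof
      assume "ft j = 1"
      then have "h j = (if 2 + 2 * j \<notin> S then W * real (fs j) else 0) + W" using n s by (simp add: h_def)
      moreover have "0 \<le> W * real (fs j)" using W by simp
      ultimately show False using hW[OF j(1)] by (simp split: if_splits)
    next
      assume "\<exists>b<p. E b = j \<and> V b \<notin> ?Y"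
      then obtain b where "b < p" "E b = j" "2 + 2 * m + V b \<notin> S" by auto
      then show False using gW[of b] n W by (simp add: g_def split: if_splits)
    qed
  qed
  let ?J = "{j. j \<in> E ` {..<p} \<and> (fs j = 1 \<or> (\<exists>b<p. E b = j \<and> V b \<in> ?Y)) \<and> (ft j = 1 \<or> (\<exists>b<p. E b = j \<and> V b \<notin> ?Y))}"
  have "hw j = h j" if "j \<in> ?J" for j
    using inS[of j] outS[of j] that by (simp add: h_def)
  then have "obj ?Y = sum h ?J"
    unfolding obj_def by (intro sum.cong) auto
  also have "\<dots> \<le> (\<Sum>j\<in>E ` {..<p}. h j)"
    by (rule sum_mono2) (use h0 in auto)
  also have "\<dots> \<le> dcut_weight net S"
    unfolding eq using sum_nonneg[of "{..<p}" g] g0 by simp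
  finally show ?thesis .
qed

text \<open>The minimum cut weighs at most as much as the cut built from Y, hence at most the total
  weight of the hyperedges, hence less than W. Only this makes \<open>obj_le_network_cut\<close>
  applicable to it.\<close>

lemma min_st_cut_network:
  assumes S: "min_st_cut net 0 1 S" and less: "(\<Sum>j<m. hw j) < W"
  shows "obj {v. 2 + 2 * m + v \<in> S} \<le> obj Y"
proof -
  obtain S' where S': "st_set net 0 1 S'" "dcut_weight net S' = obj Y" by (rule network_cut_of_set)
  have "obj Y \<le> (\<Sum>j<m. hw j)" unfolding obj_def
  proof (rule sum_mono2)
    show "{j \<in> E ` {..<p}. (fs j = 1 \<or> (\<exists>b<p. E b = j \<and> V b \<in> Y)) \<and> (ft j = 1 \<or> (\<exists>b<p. E b = j \<and> V b \<notin> Y))} \<subseteq> {..<m}"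
      using E_less by fastforce
  qed (use hw in auto)
  moreover have *: "dcut_weight net S \<le> obj Y" using S S'(1) unfolding min_st_cut_def S'(2)[symmetric] by blast
  ultimately have "dcut_weight net S < W" using less by linarith
  with S have "obj {v. 2 + 2 * m + v \<in> S} \<le> dcut_weight net S"
    by (intro obj_le_network_cut) (auto simp: min_st_cut_def)
  with * show ?thesis by linarith
qed

end

section \<open>Uncrossing\<close>

lemma hcut_weight_eq: "hcut_weight H S = (\<Sum>j<hm H. if j \<in> hcut H S then hweight H j else 0)"
  unfolding hcut_weight_def by (rule sum.mono_neutral_cong_left) (auto simp: hcut_def)

lemma hcut_weight_compl: "wf_hypergraph H \<Longrightarrow> S \<subseteq> hverts H \<Longrightarrow> hcut_weight H (hverts H - S) = hcut_weight H S"
proof -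
  assume H: "wf_hypergraph H" and S: "S \<subseteq> hverts H"
  have "hedge H j \<subseteq> hverts H" if "j < hm H" for j using that H by (simp add: wf_hypergraph_def)
  then have "hcut H (hverts H - S) = hcut H S" unfolding hcut_def using S by blast
  then show ?thesis by (simp add: hcut_weight_def)
qed

text \<open>Holds hyperedge by hyperedge: one that is cut by the intersection or the union is cut by
  X or Y, and one that is cut by both of the former is cut by both of the latter.\<close>

lemma hcut_weight_submodular:
  assumes "wf_hypergraph H" "X \<subseteq> hverts H" "Y \<subseteq> hverts H"
  shows "hcut_weight H (X \<inter> Y) + hcut_weight H (X \<union> Y) \<le> hcut_weight H X + hcut_weight H Y"
  unfolding hcut_weight_eq sum.distrib[symmetric]
proof (rule sum_mono)
  fix j assume j: "j \<in> {..<hm H}"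
  have 0: "0 \<le> hweight H j" using assms(1) j by (simp add: wf_hypergraph_def)
  have 1: "j \<in> hcut H (X \<inter> Y) \<or> j \<in> hcut H (X \<union> Y) \<Longrightarrow> j \<in> hcut H X \<or> j \<in> hcut H Y"
    unfolding hcut_def using assms(2,3) by blast
  have 2: "j \<in> hcut H (X \<inter> Y) \<Longrightarrow> j \<in> hcut H (X \<union> Y) \<Longrightarrow> j \<in> hcut H X \<and> j \<in> hcut H Y"
    unfolding hcut_def using assms(2,3) by blast
  show "(if j \<in> hcut H (X \<inter> Y) then hweight H j else 0) + (if j \<in> hcut H (X \<union> Y) then hweight H j else 0)
    \<le> (if j \<in> hcut H X then hweight H j else 0) + (if j \<in> hcut H Y then hweight H j else 0)"
  proof -
    have "(if a then h else 0) + (if b then h else 0) \<le> (if c then h else 0) + (if d then h else 0)"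
      if "0 \<le> h" "a \<or> b \<Longrightarrow> c \<or> d" "a \<Longrightarrow> b \<Longrightarrow> c \<and> d" for a b c d and h :: real
      using that by (cases a; cases b; cases c; cases d; simp)
    from this[OF 0 1 2] show ?thesis .
  qed
qed

text \<open>Minimum cut for a bipartition of the terminals; the bipartition is given implicitly, as
  the trace of C on R.\<close>

definition min_separating :: "hypergraph \<Rightarrow> nat set \<Rightarrow> nat set \<Rightarrow> bool" where
  "min_separating H R C \<longleftrightarrow> C \<subseteq> hverts H \<and>
     (\<forall>C'. C' \<subseteq> hverts H \<longrightarrow> C' \<inter> R = C \<inter> R \<longrightarrow> hcut_weight H C \<le> hcut_weight H C')"

lemma min_separating_compl:
  assumes "wf_hypergraph H" "R \<subseteq> hverts H" "min_separating H R C"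
  shows "min_separating H R (hverts H - C)"
  unfolding min_separating_def
proof (intro conjI allI impI)
  fix C' assume C': "C' \<subseteq> hverts H" "C' \<inter> R = (hverts H - C) \<inter> R"
  then have "(hverts H - C') \<inter> R = C \<inter> R" using assms(2) by auto
  then have "hcut_weight H C \<le> hcut_weight H (hverts H - C')"
    using assms(3) C' unfolding min_separating_def by (meson Diff_subset)
  then show "hcut_weight H (hverts H - C) \<le> hcut_weight H C'"
    using assms C' by (simp add: hcut_weight_compl min_separating_def)
qed auto

text \<open>Since \<open>r \<in> C\<close>, adding Y to C leaves the trace on R unchanged, so
  \<open>Y \<union> C\<close> weighs at least as much as C. By submodularity,
  \<open>Y \<inter> C\<close> then weighs at most as much as Y.\<close>

lemma min_isolating_cut_Int:
  assumes H: "wf_hypergraph H" and Y: "min_isolating_cut H R r Y" and C: "min_separating H R C" "r \<in> C"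
  shows "min_isolating_cut H R r (Y \<inter> C)"
proof -
  have Y': "Y \<subseteq> hverts H" "Y \<inter> R = {r}" and C': "C \<subseteq> hverts H"
    using Y C by (auto simp: min_isolating_cut_def isolating_set_def min_separating_def)
  have "(Y \<union> C) \<inter> R = Y \<inter> R \<union> C \<inter> R" by (rule Int_Un_distrib2)
  also have "\<dots> = C \<inter> R" unfolding Y'(2) using C(2) Y'(2) by auto
  finally have "(Y \<union> C) \<inter> R = C \<inter> R" .
  moreover have "Y \<union> C \<subseteq> hverts H" using Y'(1) C' by simp
  ultimately have "hcut_weight H C \<le> hcut_weight H (Y \<union> C)"
    using C(1) by (simp add: min_separating_def)
  then have le: "hcut_weight H (Y \<inter> C) \<le> hcut_weight H Y"
    using hcut_weight_submodular[OF H Y'(1) C'] by linarith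
  have "Y \<inter> C \<inter> R = Y \<inter> R \<inter> C" by blast
  also have "\<dots> = {r}" unfolding Y'(2) using C(2) by simp
  finally have "isolating_set H R r (Y \<inter> C)" using Y'(1) by (simp add: isolating_set_def le_infI1)
  moreover have "hcut_weight H (Y \<inter> C) \<le> hcut_weight H Y'" if "isolating_set H R r Y'" for Y'
  proof -
    have "hcut_weight H Y \<le> hcut_weight H Y'" using Y that by (simp add: min_isolating_cut_def)
    with le show ?thesis by linarith
  qed
  ultimately show ?thesis unfolding min_isolating_cut_def by blast
qed

lemma min_isolating_cut_exists: "R \<subseteq> hverts H \<Longrightarrow> r \<in> R \<Longrightarrow> \<exists>Y. min_isolating_cut H R r Y"
proof -
  assume R: "R \<subseteq> hverts H" "r \<in> R"
  let ?F = "{Y. isolating_set H R r Y}"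
  have "finite ?F" by (rule finite_subset[of _ "Pow (hverts H)"]) (auto simp: isolating_set_def hverts_def)
  moreover have "{r} \<in> ?F" using R by (auto simp: isolating_set_def)
  ultimately have "arg_min_on (hcut_weight H) ?F \<in> ?F" "\<And>Y. Y \<in> ?F \<Longrightarrow> hcut_weight H (arg_min_on (hcut_weight H) ?F) \<le> hcut_weight H Y"
    using arg_min_if_finite(1)[of ?F "hcut_weight H"] arg_min_least[of ?F _ "hcut_weight H"] by blast+
  then show ?thesis unfolding min_isolating_cut_def by blast
qed

text \<open>Any minimum isolating cut is intersected in turn with the side of each bipartition that
  contains r, which is a complement where r lies outside \<open>C b\<close>. Intersections never
  undo an earlier step.\<close>

lemma min_isolating_cut_in_sides:
  fixes L :: nat
  assumes H: "wf_hypergraph H" and R: "R \<subseteq> hverts H" "r \<in> R"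
    and C: "\<And>b. b < L \<Longrightarrow> min_separating H R (C b)"
  shows "\<exists>Y. min_isolating_cut H R r Y \<and> (\<forall>v\<in>Y. \<forall>b<L. v \<in> C b \<longleftrightarrow> r \<in> C b)"
  using C
proof (induction L)
  case 0
  then show ?case using min_isolating_cut_exists[OF R] by auto
next
  case (Suc L)
  then obtain Y where Y: "min_isolating_cut H R r Y" "\<forall>v\<in>Y. \<forall>b<L. v \<in> C b \<longleftrightarrow> r \<in> C b" by auto
  define D where "D = (if r \<in> C L then C L else hverts H - C L)"
  have "min_separating H R D" using Suc.prems[of L] min_separating_compl[OF H R(1)] by (simp add: D_def)
  moreover have "r \<in> D" using R by (auto simp: D_def)
  ultimately have "min_isolating_cut H R r (Y \<inter> D)" using min_isolating_cut_Int[OF H Y(1)] by blast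
  moreover have "\<forall>v\<in>Y \<inter> D. \<forall>b<Suc L. v \<in> C b \<longleftrightarrow> r \<in> C b"
    using Y(2) by (auto simp: less_Suc_eq D_def split: if_splits)
  ultimately show ?case by blast
qed

section \<open>Contracted cut functions\<close>

text \<open>
  The cut function in which everything outside \<open>U\<close> is contracted into the sink together with \<open>B\<close>, and
  \<open>A\<close> is contracted into the source.
\<close>

definition contracted_cut :: "hypergraph \<Rightarrow> nat set \<Rightarrow> nat set \<Rightarrow> nat set \<Rightarrow> nat set \<Rightarrow> real" where
  "contracted_cut H U A B Y = (\<Sum>j | j < hm H \<and> hedge H j \<inter> U \<noteq> {} \<and> (hedge H j \<inter> A \<noteq> {} \<or> hedge H j \<inter> U \<inter> Y \<noteq> {}) \<and>
     (\<not> hedge H j \<subseteq> U \<or> hedge H j \<inter> B \<noteq> {} \<or> hedge H j \<inter> U - Y \<noteq> {}). hweight H j)"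

text \<open>Vertices of A and B are not merged with the source and sink of the network; only the
  hyperedges through them are flagged. An optimum Y may therefore miss A or meet B. Correcting it to
  \<open>(Y \<union> A) - B\<close> cuts only hyperedges that the flags have already
  charged.\<close>

lemma hcut_weight_le_contracted_cut:
  assumes "wf_hypergraph H" "U \<subseteq> hverts H" "A \<subseteq> U" "B \<subseteq> U" "A \<inter> B = {}" "Y \<subseteq> U"
  shows "hcut_weight H ((Y \<union> A) - B) \<le> contracted_cut H U A B Y"
  unfolding hcut_weight_def contracted_cut_def
proof (rule sum_mono2)
  show "0 \<le> hweight H j" if "j \<in> {j. j < hm H \<and> hedge H j \<inter> U \<noteq> {} \<and> (hedge H j \<inter> A \<noteq> {} \<or> hedge H j \<inter> U \<inter> Y \<noteq> {}) \<and>
     (\<not> hedge H j \<subseteq> U \<or> hedge H j \<inter> B \<noteq> {} \<or> hedge H j \<inter> U - Y \<noteq> {})} - hcut H ((Y \<union> A) - B)" for j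
    using that assms(1) by (auto simp: wf_hypergraph_def)
qed (use assms in \<open>auto simp: hcut_def\<close>)

text \<open>The competitors respect A and B, and for these the flags charge nothing beyond the true
  weight.\<close>

lemma contracted_cut_eq:
  assumes "wf_hypergraph H" "U \<subseteq> hverts H" "A \<subseteq> Y" "Y \<subseteq> U - B" "B \<subseteq> U"
  shows "contracted_cut H U A B Y = hcut_weight H Y"
proof -
  have e: "hedge H j \<subseteq> hverts H" if "j < hm H" for j using that assms(1) by (simp add: wf_hypergraph_def)
  show ?thesis unfolding hcut_weight_def contracted_cut_def hcut_def
    by (rule sum.cong[OF _ refl]) (use assms(2-) e in blast)
qed

section \<open>Rules for straight-line code and for a common time scale\<close>

definition exs :: "nat \<Rightarrow> com \<Rightarrow> mem \<Rightarrow> (mem \<Rightarrow> bool) \<Rightarrow> bool" where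
  "exs M c \<mu> P \<longleftrightarrow> safe M c \<mu> \<and> P (sem c \<mu>)"

text \<open>Weakest preconditions by rewriting: the bound on stored numbers and the postcondition
  are pushed through the code together.\<close>

lemma exs_simps:
  "exs M Skip \<mu> P \<longleftrightarrow> P \<mu>"
  "exs M (IAssign x e f) \<mu> P \<longleftrightarrow> ival \<mu> f \<le> M \<and> P (istore x (ival \<mu> e) (ival \<mu> f) \<mu>)"
  "exs M (RAssign x e g) \<mu> P \<longleftrightarrow> P (rstore x (ival \<mu> e) (rval \<mu> g) \<mu>)"
  "exs M (Seq c d) \<mu> P \<longleftrightarrow> exs M c \<mu> (\<lambda>\<nu>. exs M d \<nu> P)"
  "exs M (Cond b c d) \<mu> P \<longleftrightarrow> (if bval \<mu> b then exs M c \<mu> P else exs M d \<mu> P)"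
  by (auto simp: exs_def)

lemma exs_mono: "exs M c \<mu> P \<Longrightarrow> (\<And>\<nu>. P \<nu> \<Longrightarrow> Q \<nu>) \<Longrightarrow> exs M c \<mu> Q"
  by (auto simp: exs_def)

primrec ird :: "iexp \<Rightarrow> string set" where
  "ird (IConst k) = {}"
| "ird (IRead x e) = insert x (ird e)"
| "ird (IAdd e f) = ird e \<union> ird f"
| "ird (ISub e f) = ird e \<union> ird f"
| "ird (IMul e f) = ird e \<union> ird f"
| "ird (IDiv e f) = ird e \<union> ird f"

primrec rrd :: "rexp \<Rightarrow> string set" where
  "rrd (ROf e) = ird e"
| "rrd (RRead x e) = insert x (ird e)"
| "rrd (RAdd e f) = rrd e \<union> rrd f"
| "rrd (RSub e f) = rrd e \<union> rrd f"
| "rrd (RMul e f) = rrd e \<union> rrd f"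
| "rrd (RDiv e f) = rrd e \<union> rrd f"

lemma ival_cong: "agree W \<mu> \<nu> \<Longrightarrow> ird e \<inter> W = {} \<Longrightarrow> ival \<nu> e = ival \<mu> e"
  by (induction e) (auto simp: agree_def Int_Un_distrib2)

lemma rval_cong: "agree W \<mu> \<nu> \<Longrightarrow> rrd e \<inter> W = {} \<Longrightarrow> rval \<nu> e = rval \<mu> e"
proof (induction e)
  case (RRead x e)
  then have "ival \<nu> e = ival \<mu> e" by (intro ival_cong) auto
  with RRead show ?case by (auto simp: agree_def)
qed (auto intro: ival_cong simp: Int_Un_distrib2)

text \<open>Time bounds have the form \<open>cst c * s\<close> with a scale s shared by all parts of
  a program. As \<open>cst\<close> is additive, composition needs no arithmetic, and s only has to
  dominate the most expensive part.\<close>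

lemma run_Seq_cst:
  assumes "run c \<mu> (cst c * s) R" and "\<And>\<nu>. R \<nu> \<Longrightarrow> agree (wr c) \<mu> \<nu> \<Longrightarrow> ok d \<nu> (cst d * s) Q \<phi> a"
  shows "ok (Seq c d) \<mu> (cst (Seq c d) * s) Q \<phi> a"
  by (rule ok_Seq_run[OF assms]) (simp_all add: algebra_simps)

lemma ok_Seq_cst:
  assumes "ok c \<mu> (cst c * s) R \<psi> a" and "\<And>\<nu>. R \<nu> \<Longrightarrow> agree (wr c) \<mu> \<nu> \<Longrightarrow> ok d \<nu> (cst d * s) Q \<phi> (\<psi> \<nu>)"
  shows "ok (Seq c d) \<mu> (cst (Seq c d) * s) Q \<phi> a"
  by (rule ok_Seq[OF assms]) (simp_all add: algebra_simps)

lemma run_simple_cst: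
  assumes "simple c" "bnd M \<mu>" "wlen M \<le> s" "exs M c \<mu> P"
  shows "run c \<mu> (cst c * s) (\<lambda>\<nu>. P \<nu> \<and> bnd M \<nu>)"
  by (rule run_mono[OF run_simple[OF assms(1,2)]]) (use assms in \<open>auto simp: exs_def\<close>)

lemma ok_Call_cst:
  assumes "ok c (overlay xs \<mu> zero_mem) (cst c * s) (\<lambda>\<nu>. Q (overlay xs \<nu> \<mu>)) (\<lambda>\<nu>. \<phi> (overlay xs \<nu> \<mu>)) a"
    and "1 \<le> s"
  shows "ok (Call xs c) \<mu> (cst (Call xs c) * s) Q \<phi> a"
proof (rule ok_Call[OF assms(1)])
  have "(length xs + 1) * 1 \<le> (length xs + 1) * s" using assms(2) by (intro mult_left_mono) auto
  then show "cst c * s + length xs + 1 \<le> cst (Call xs c) * s" by (simp add: algebra_simps)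
qed

lemma run_Cond_cst:
  assumes "bval \<mu> b \<Longrightarrow> run c \<mu> (cst c * s) Q" "\<not> bval \<mu> b \<Longrightarrow> run d \<mu> (cst d * s) Q"
    and s: "bnd M \<mu>" "wlen M \<le> s"
  shows "run (Cond b c d) \<mu> (cst (Cond b c d) * s) Q"
proof (rule ok_Cond[where t'="(cst c + cst d) * s"])
  have "bcost \<mu> b + 1 \<le> (bcst b + 1) * wlen M" using bcost_le[OF s(1), of b] by (simp add: Suc_le_wlen)
  also have "\<dots> \<le> (bcst b + 1) * s" using s(2) by (intro mult_left_mono) auto
  finally show "(cst c + cst d) * s + bcost \<mu> b + 1 \<le> cst (Cond b c d) * s" by (simp add: algebra_simps)
qed (auto intro!: run_mono[OF assms(1)] run_mono[OF assms(2)] mult_right_mono)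

lemma run_For_simple_cst:
  assumes "simple c" "x \<notin> wr c" "n \<le> M" "bnd M \<mu>"
    and init: "I 0 (istore x 0 0 \<mu>)"
    and e: "\<And>i \<nu>. i \<le> n \<Longrightarrow> I i \<nu> \<Longrightarrow> agree (insert x (wr c)) \<mu> \<nu> \<Longrightarrow> imem \<nu> x 0 = i \<Longrightarrow> ival \<nu> e = n"
    and step: "\<And>i \<nu>. i < n \<Longrightarrow> I i \<nu> \<Longrightarrow> agree (insert x (wr c)) \<mu> \<nu> \<Longrightarrow> imem \<nu> x 0 = i \<Longrightarrow> bnd M \<nu> \<Longrightarrow>
      exs M c \<nu> (\<lambda>\<nu>'. I (Suc i) (istore x 0 (Suc i) \<nu>'))"
    and t: "(n + 1) * wlen M \<le> s"
  shows "run (For x e c) \<mu> (cst (For x e c) * s) (\<lambda>\<nu>. I n \<nu> \<and> bnd M \<nu>)"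
  by (rule run_For_simple[OF assms(1-4), where I=I])
    (use init e step mult_left_mono[OF t] in \<open>auto simp: exs_def\<close>)

section \<open>Doubling loops\<close>

definition Dbl :: "string \<Rightarrow> iexp \<Rightarrow> com \<Rightarrow> com" where
  "Dbl y e c = While (ILess (IRead y (IConst 0)) e) (Seq c (IAssign y (IConst 0) (IMul (IConst 2) (IRead y (IConst 0)))))"

lemma wr_Dbl [simp]: "wr (Dbl y e c) = insert y (wr c)"
  by (auto simp: Dbl_def)

text \<open>Induction on a number k of doublings that suffices. The loop may stop earlier, so
  \<open>fin\<close> has to cover every j at which it can stop.\<close>

lemma ok_Dbl_aux:
  fixes t :: nat
  assumes M: "2 * B \<le> M"
    and e: "\<And>j \<nu>. I j \<nu> \<Longrightarrow> imem \<nu> y 0 = 2 ^ j \<Longrightarrow> ival \<nu> e = B"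
    and c: "\<And>j \<nu>. 2 ^ j < B \<Longrightarrow> I j \<nu> \<Longrightarrow> bnd M \<nu> \<Longrightarrow> imem \<nu> y 0 = 2 ^ j \<Longrightarrow>
      ok c \<nu> t (\<lambda>\<nu>'. I (Suc j) (istore y 0 (2 ^ Suc j) \<nu>') \<and> bnd M \<nu>' \<and> imem \<nu>' y 0 = 2 ^ j)
        (\<lambda>\<nu>'. \<Phi> (Suc j) (istore y 0 (2 ^ Suc j) \<nu>')) (\<Phi> j \<nu>)"
    and fin: "\<And>j \<nu>. B \<le> 2 ^ j \<Longrightarrow> I j \<nu> \<Longrightarrow> bnd M \<nu> \<Longrightarrow> imem \<nu> y 0 = 2 ^ j \<Longrightarrow> Q \<nu> \<and> \<phi> \<nu> \<le> \<Phi> j \<nu>"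
  shows "I j \<mu> \<Longrightarrow> bnd M \<mu> \<Longrightarrow> imem \<mu> y 0 = 2 ^ j \<Longrightarrow> B \<le> 2 ^ j * 2 ^ k \<Longrightarrow>
    ok (Dbl y e c) \<mu> (k * (t + cst (Dbl y e Skip) * wlen M) + cst (Dbl y e Skip) * wlen M) Q \<phi> (\<Phi> j \<mu>)"
proof (induction k arbitrary: j \<mu>)
  case 0
  let ?g = "ILess (IRead y (IConst 0)) e"
  have "bcost \<mu> ?g + 1 \<le> (bcst ?g + 1) * wlen M" using bcost_le[OF 0(2), of ?g] by (simp add: Suc_le_wlen)
  also have "\<dots> \<le> cst (Dbl y e Skip) * wlen M" by (intro mult_right_mono) (auto simp: Dbl_def)
  finally show ?case unfolding Dbl_def using 0 e[of j \<mu>] fin[of j \<mu>] by (intro ok_While_exit) auto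
next
  case (Suc k)
  let ?g = "ILess (IRead y (IConst 0)) e" and ?d = "IAssign y (IConst 0) (IMul (IConst 2) (IRead y (IConst 0)))"
  let ?D = "cst (Dbl y e Skip) * wlen M"
  have g: "bcost \<mu> ?g + 1 \<le> (bcst ?g + 1) * wlen M" using bcost_le[OF Suc.prems(2), of ?g] by (simp add: Suc_le_wlen)
  have D: "(bcst ?g + 1) * wlen M + cst ?d * wlen M \<le> ?D"
    unfolding Dbl_def by (simp add: algebra_simps)
  show ?case
  proof (cases "2 ^ j < B")
    case False
    then show ?thesis unfolding Dbl_def using Suc.prems e[of j \<mu>] fin[of j \<mu>] g D
      by (intro ok_While_exit) (auto simp: Dbl_def)
  next
    case True
    let ?R = "\<lambda>\<nu>. I (Suc j) \<nu> \<and> bnd M \<nu> \<and> imem \<nu> y 0 = 2 ^ Suc j"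
    have body: "ok (Seq c ?d) \<mu> (t + cst ?d * wlen M) ?R (\<Phi> (Suc j)) (\<Phi> j \<mu>)"
    proof (rule ok_Seq[OF c[OF True Suc.prems(1-3)]])
      fix \<nu> assume \<nu>: "I (Suc j) (istore y 0 (2 ^ Suc j) \<nu>) \<and> bnd M \<nu> \<and> imem \<nu> y 0 = 2 ^ j"
      have "run ?d \<nu> (cst ?d * wlen M) (\<lambda>\<nu>'. \<nu>' = sem ?d \<nu> \<and> bnd M \<nu>')"
        using \<nu> True M by (intro run_simple) auto
      then have "run ?d \<nu> (cst ?d * wlen M) (\<lambda>\<nu>'. ?R \<nu>' \<and> \<Phi> (Suc j) \<nu>' \<le> \<Phi> (Suc j) (istore y 0 (2 ^ Suc j) \<nu>))"
        by (rule run_mono) (use \<nu> in auto)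
      then show "ok ?d \<nu> (cst ?d * wlen M) ?R (\<Phi> (Suc j)) (\<Phi> (Suc j) (istore y 0 (2 ^ Suc j) \<nu>))"
        by (rule ok_run)
    qed simp
    have "ok (Seq (Seq c ?d) (Dbl y e c)) \<mu> (t + cst ?d * wlen M + (k * (t + ?D) + ?D)) Q \<phi> (\<Phi> j \<mu>)"
    proof (rule ok_Seq[OF body])
      fix \<nu> assume "?R \<nu>"
      then show "ok (Dbl y e c) \<nu> (k * (t + ?D) + ?D) Q \<phi> (\<Phi> (Suc j) \<nu>)"
        using Suc.prems(4) by (intro Suc.IH) (auto simp: algebra_simps)
    qed simp
    then have "ok (Dbl y e c) \<mu> (t + cst ?d * wlen M + (k * (t + ?D) + ?D) + bcost \<mu> ?g + 1) Q \<phi> (\<Phi> j \<mu>)"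
      unfolding Dbl_def by (rule ok_While_step[rotated]) (use Suc.prems True e[of j \<mu>] in auto)
    then show ?thesis
    proof (rule ok_mono)
      have gen: "a + c + r + b + 1 \<le> (a + x) + r" if "b + 1 \<le> w" "w + c \<le> x" for a b c r w x :: nat
        using that by linarith
      show "t + cst ?d * wlen M + (k * (t + ?D) + ?D) + bcost \<mu> ?g + 1 \<le> Suc k * (t + ?D) + ?D"
        unfolding mult_Suc add.assoc[of "t + ?D"] using g D by (rule gen)
    qed auto
  qed
qed

text \<open>\<open>B < 2 ^ wlen M\<close> bounds the number of rounds by \<open>wlen M\<close>. The
  counter overshoots, and its last value may be almost \<open>2 * B\<close>, whence the bound on
  M.\<close>

lemma ok_Dbl:
  fixes t :: nat
  assumes M: "2 * B \<le> M" "1 \<le> M" and \<mu>: "bnd M \<mu>" "I 0 \<mu>" "imem \<mu> y 0 = 1"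
    and e: "\<And>j \<nu>. I j \<nu> \<Longrightarrow> imem \<nu> y 0 = 2 ^ j \<Longrightarrow> ival \<nu> e = B"
    and c: "\<And>j \<nu>. 2 ^ j < B \<Longrightarrow> I j \<nu> \<Longrightarrow> bnd M \<nu> \<Longrightarrow> imem \<nu> y 0 = 2 ^ j \<Longrightarrow>
      ok c \<nu> t (\<lambda>\<nu>'. I (Suc j) (istore y 0 (2 ^ Suc j) \<nu>') \<and> bnd M \<nu>' \<and> imem \<nu>' y 0 = 2 ^ j)
        (\<lambda>\<nu>'. \<Phi> (Suc j) (istore y 0 (2 ^ Suc j) \<nu>')) (\<Phi> j \<nu>)"
    and fin: "\<And>j \<nu>. B \<le> 2 ^ j \<Longrightarrow> I j \<nu> \<Longrightarrow> bnd M \<nu> \<Longrightarrow> imem \<nu> y 0 = 2 ^ j \<Longrightarrow> Q \<nu> \<and> \<phi> \<nu> \<le> \<Phi> j \<nu>"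
    and t: "t \<le> cst c * s" "wlen M \<le> s"
  shows "ok (Dbl y e c) \<mu> (cst (Dbl y e c) * (2 * (wlen M + 1) * s)) Q \<phi> (\<Phi> 0 \<mu>)"
proof -
  have "B \<le> M" using M(1) by linarith
  then have "floorlog 2 B \<le> wlen M" using floorlog_less_wlen[of B M] by simp
  then have "B < 2 ^ wlen M" by (rule floorlog_leD) simp
  then have k: "B \<le> 2 ^ 0 * 2 ^ wlen M" by simp
  have y: "imem \<mu> y 0 = 2 ^ 0" using \<mu>(3) by simp
  have "ok (Dbl y e c) \<mu> (wlen M * (t + cst (Dbl y e Skip) * wlen M) + cst (Dbl y e Skip) * wlen M) Q \<phi> (\<Phi> 0 \<mu>)"
    by (rule ok_Dbl_aux[where I=I and \<Phi>=\<Phi> and j=0, OF M(1) e c fin \<mu>(2,1) y k])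
  then show ?thesis
  proof (rule ok_mono)
    have "cst (Dbl y e c) + 1 = cst (Dbl y e Skip) + cst c" "cst c \<ge> 1" "cst (Dbl y e Skip) \<ge> 1"
      using cst_pos[of c] by (simp_all add: Dbl_def)
    then have D: "cst c + cst (Dbl y e Skip) \<le> cst (Dbl y e c) * 2" by simp
    have 1: "t + cst (Dbl y e Skip) * wlen M \<le> cst c * s + cst (Dbl y e Skip) * s"
      by (rule add_mono[OF t(1) mult_left_mono[OF t(2)]]) simp
    have 2: "cst (Dbl y e Skip) * wlen M \<le> cst c * s + cst (Dbl y e Skip) * s"
      by (rule trans_le_add2[OF mult_left_mono[OF t(2)]]) simp
    have "wlen M * (t + cst (Dbl y e Skip) * wlen M) + cst (Dbl y e Skip) * wlen M
       \<le> wlen M * (cst c * s + cst (Dbl y e Skip) * s) + (cst c * s + cst (Dbl y e Skip) * s)"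
      by (rule add_mono[OF mult_left_mono[OF 1] 2]) simp
    also have "\<dots> = (cst c + cst (Dbl y e Skip)) * ((wlen M + 1) * s)" by (simp add: algebra_simps)
    also have "\<dots> \<le> cst (Dbl y e c) * 2 * ((wlen M + 1) * s)" using D by (rule mult_right_mono) simp
    also have "\<dots> = cst (Dbl y e c) * (2 * (wlen M + 1) * s)" by (simp add: mult.assoc)
    finally show "wlen M * (t + cst (Dbl y e Skip) * wlen M) + cst (Dbl y e Skip) * wlen M \<le>
      cst (Dbl y e c) * (2 * (wlen M + 1) * s)" .
  qed auto
qed

section \<open>The program\<close>

abbreviation rd :: "string \<Rightarrow> iexp" where
  "rd x \<equiv> IRead x (IConst 0)"

abbreviation wt :: "string \<Rightarrow> iexp \<Rightarrow> com" where
  "wt x \<equiv> IAssign x (IConst 0)"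

definition arc_com :: "iexp \<Rightarrow> iexp \<Rightarrow> rexp \<Rightarrow> com" where
  "arc_com e f g = Seq (IAssign ''tail'' (rd ''m'') e) (Seq (IAssign ''head'' (rd ''m'') f)
     (Seq (RAssign ''w'' (rd ''m'') g) (wt ''m'' (IAdd (rd ''m'') (IConst 1)))))"

text \<open>Incidence number a of instance i: its bucket in \<open>''IL''\<close> starts at
  \<open>i * hp\<close>.\<close>

definition inc_at :: "iexp" where
  "inc_at = IRead ''IL'' (IAdd (IMul (rd ''i'') (rd ''hp'')) (rd ''a''))"

definition in_node :: iexp where
  "in_node = IAdd (IConst 2) (IMul (IConst 2) (rd ''e''))"

definition out_node :: iexp where
  "out_node = IAdd (IConst 3) (IMul (IConst 2) (rd ''e''))"

definition vert_node :: iexp where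
  "vert_node = IAdd (IAdd (IConst 2) (IMul (IConst 2) (rd ''hm''))) (rd ''v'')"

definition build_hyper :: com where
  "build_hyper = Seq (IAssign ''seen'' (rd ''e'') (IConst 1))
     (Seq (arc_com in_node out_node (RRead ''hw'' (rd ''e'')))
     (Seq (arc_com (IConst 0) in_node (RMul (RRead ''W'' (IConst 0)) (ROf (IRead ''fs'' (rd ''e'')))))
       (arc_com out_node (IConst 1) (RMul (RRead ''W'' (IConst 0)) (ROf (IRead ''ft'' (rd ''e'')))))))"

definition build_step :: com where
  "build_step = Seq (wt ''e'' (IRead ''eo'' inc_at)) (Seq (wt ''v'' (IRead ''pos'' (IRead ''inc'' inc_at)))
     (Seq (Cond (ILess (IConst 0) (IRead ''seen'' (rd ''e''))) Skip build_hyper)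
     (Seq (arc_com vert_node in_node (RRead ''W'' (IConst 0))) (arc_com out_node vert_node (RRead ''W'' (IConst 0))))))"

definition num_nodes :: iexp where
  "num_nodes = IAdd (IAdd (IConst 2) (IMul (IConst 2) (rd ''hm''))) (IRead ''vc'' (rd ''i''))"

definition build :: com where
  "build = Seq (Seq (wt ''n'' num_nodes) (wt ''t'' (IConst 1))) (For ''a'' (IRead ''ic'' (rd ''i'')) build_step)"

text \<open>The abstract instance denoted by a memory. The functions from \<open>mE\<close> to
  \<open>minc\<close> turn the addressing used by the program into the parameters of
  \<open>incidences\<close>, so that its results apply to the network being built.\<close>

definition mE :: "mem \<Rightarrow> nat \<Rightarrow> nat" where
  "mE \<mu> a = imem \<mu> ''eo'' (imem \<mu> ''IL'' (imem \<mu> ''i'' 0 * imem \<mu> ''hp'' 0 + a))"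

definition mV :: "mem \<Rightarrow> nat \<Rightarrow> nat" where
  "mV \<mu> a = imem \<mu> ''pos'' (imem \<mu> ''inc'' (imem \<mu> ''IL'' (imem \<mu> ''i'' 0 * imem \<mu> ''hp'' 0 + a)))"

definition mp :: "mem \<Rightarrow> nat" where
  "mp \<mu> = imem \<mu> ''ic'' (imem \<mu> ''i'' 0)"

definition ml :: "mem \<Rightarrow> nat" where
  "ml \<mu> = imem \<mu> ''vc'' (imem \<mu> ''i'' 0)"

definition marcs :: "mem \<Rightarrow> nat \<Rightarrow> (nat \<times> nat \<times> real) list" where
  "marcs \<mu> = arcs (mE \<mu>) (mV \<mu>) (imem \<mu> ''hm'' 0) (imem \<mu> ''fs'') (imem \<mu> ''ft'') (rmem \<mu> ''hw'') (rmem \<mu> ''W'' 0)"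

definition mnet :: "mem \<Rightarrow> digraph" where
  "mnet \<mu> = network (mE \<mu>) (mV \<mu>) (imem \<mu> ''hm'' 0) (ml \<mu>) (imem \<mu> ''fs'') (imem \<mu> ''ft'') (rmem \<mu> ''hw'') (rmem \<mu> ''W'' 0) (mp \<mu>)"

definition minc :: "mem \<Rightarrow> bool" where
  "minc \<mu> \<longleftrightarrow> incidences (mE \<mu>) (mV \<mu>) (imem \<mu> ''hm'' 0) (ml \<mu>) (mp \<mu>) (imem \<mu> ''fs'') (imem \<mu> ''ft'') (rmem \<mu> ''hw'') (rmem \<mu> ''W'' 0)"

text \<open>The arrays on which the denoted instance depends, as \<open>minst_cong\<close> shows;
  sharing them with a \<open>Call\<close> hands over the instance.\<close>

definition inst_names :: "string list" where
  "inst_names = [''hm'', ''hp'', ''inc'', ''eo'', ''hw'', ''W'', ''fs'', ''ft'', ''pos'', ''vc'', ''IL'', ''ic'', ''i'']"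

lemma minst_cong:
  assumes "agree (- set inst_names) \<mu> \<nu>"
  shows "mE \<nu> = mE \<mu>" "mV \<nu> = mV \<mu>" "mp \<nu> = mp \<mu>" "ml \<nu> = ml \<mu>" "marcs \<nu> = marcs \<mu>" "mnet \<nu> = mnet \<mu>"
    "minc \<nu> = minc \<mu>" "imem \<nu> ''hm'' 0 = imem \<mu> ''hm'' 0"
proof -
  have [simp]: "imem \<nu> x = imem \<mu> x" "rmem \<nu> x = rmem \<mu> x" if "x \<in> set inst_names" for x
    using assms that by (auto simp: agree_def)
  show 1: "mE \<nu> = mE \<mu>" "mV \<nu> = mV \<mu>" "mp \<nu> = mp \<mu>" "ml \<nu> = ml \<mu>" "imem \<nu> ''hm'' 0 = imem \<mu> ''hm'' 0"
    by (simp_all add: mE_def mV_def mp_def ml_def fun_eq_iff inst_names_def)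
  show "marcs \<nu> = marcs \<mu>" "mnet \<nu> = mnet \<mu>" "minc \<nu> = minc \<mu>"
    by (simp_all add: marcs_def mnet_def minc_def 1) (simp_all add: inst_names_def)
qed

text \<open>A list followed by zeros. \<open>stcut_input\<close> fixes every cell of every array, so
  equalities between whole arrays are maintained while arcs are appended.\<close>

definition arr :: "('b \<Rightarrow> 'a::zero) \<Rightarrow> 'b list \<Rightarrow> nat \<Rightarrow> 'a" where
  "arr f xs = array (length xs) (\<lambda>i. f (xs ! i))"

lemma arr_Nil: "arr f [] = (\<lambda>_. 0)"
  by (simp add: arr_def array_def)

lemma arr_snoc: "(arr f xs)(length xs := f x) = arr f (xs @ [x])"
  by (auto simp: arr_def array_def fun_eq_iff nth_append)

lemma scalar_upd: "(scalar a)(0 := b) = scalar b"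
  by (auto simp: scalar_def array_def)

lemma scalar_0 [simp]: "scalar a 0 = a" "scalar 0 = (\<lambda>_. 0)"
  by (auto simp: scalar_def array_def)

definition has_arcs :: "(nat \<times> nat \<times> real) list \<Rightarrow> mem \<Rightarrow> bool" where
  "has_arcs as \<mu> \<longleftrightarrow> imem \<mu> ''tail'' = arr fst as \<and> imem \<mu> ''head'' = arr (fst \<circ> snd) as \<and>
     rmem \<mu> ''w'' = arr (snd \<circ> snd) as \<and> imem \<mu> ''m'' = scalar (length as)"

lemma exs_arc:
  assumes h: "has_arcs as \<mu>" and e: "ird e \<union> ird f \<union> rrd g \<subseteq> - {''tail'', ''head'', ''w'', ''m''}"
    and M: "ival \<mu> e \<le> M" "ival \<mu> f \<le> M" "length as < M"
    and P: "\<And>\<nu>. has_arcs (as @ [(ival \<mu> e, ival \<mu> f, rval \<mu> g)]) \<nu> \<Longrightarrow> agree {''tail'', ''head'', ''w'', ''m''} \<mu> \<nu> \<Longrightarrow> P \<nu>"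
  shows "exs M (arc_com e f g) \<mu> P"
proof -
  let ?\<mu>1 = "istore ''tail'' (length as) (ival \<mu> e) \<mu>"
  let ?\<mu>2 = "istore ''head'' (length as) (ival \<mu> f) ?\<mu>1"
  have f: "ival ?\<mu>1 f = ival \<mu> f" by (rule ival_cong[where W="{''tail''}"]) (use e in \<open>auto simp: agree_def\<close>)
  have g: "rval ?\<mu>2 g = rval \<mu> g" by (rule rval_cong[where W="{''tail'', ''head''}"]) (use e in \<open>auto simp: agree_def\<close>)
  have m: "imem \<mu> ''m'' 0 = length as" using h by (simp add: has_arcs_def)
  show ?thesis unfolding arc_com_def exs_simps
    using h M f g m
    by (auto intro!: P simp: has_arcs_def agree_def arr_snoc scalar_upd
          arr_snoc[of "fst" as "(ival \<mu> e, ival \<mu> f, rval \<mu> g)", simplified]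
          arr_snoc[of "fst \<circ> snd" as "(ival \<mu> e, ival \<mu> f, rval \<mu> g)", simplified]
          arr_snoc[of "snd \<circ> snd" as "(ival \<mu> e, ival \<mu> f, rval \<mu> g)", simplified])
qed

lemma wr_build_step: "wr build_step = {''e'', ''v'', ''seen'', ''tail'', ''head'', ''w'', ''m''}"
  by (auto simp: build_step_def build_hyper_def arc_com_def)

lemma simple_build_step: "simple build_step"
  by (simp add: build_step_def build_hyper_def arc_com_def)

lemma length_arcs_mono: "a \<le> b \<Longrightarrow> length (arcs E V m fs ft hw W a) \<le> length (arcs E V m fs ft hw W b)"
  by (induction b rule: dec_induct) auto

text \<open>A round appends what \<open>arcs\<close> appends for incidence a. A lookup in
  \<open>''seen''\<close> replaces the search for an earlier incidence of the same
  hyperedge.\<close>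

lemma exs_build_step:
  assumes inst: "minc \<mu>" "a < mp \<mu>" and M: "2 + 2 * imem \<mu> ''hm'' 0 + ml \<mu> \<le> M" "5 * mp \<mu> \<le> M" "2 \<le> M" "bnd M \<mu>"
    and h: "has_arcs (marcs \<mu> a) \<mu>" and seen: "\<And>j. imem \<mu> ''seen'' j = of_bool (\<exists>b<a. mE \<mu> b = j)"
    and a: "imem \<mu> ''a'' 0 = a"
  shows "exs M build_step \<mu> (\<lambda>\<nu>. has_arcs (marcs \<mu> (Suc a)) \<nu> \<and> (\<forall>j. imem \<nu> ''seen'' j = of_bool (\<exists>b<Suc a. mE \<mu> b = j)))"
proof -
  interpret incidences "mE \<mu>" "mV \<mu>" "imem \<mu> ''hm'' 0" "ml \<mu>" "mp \<mu>" "imem \<mu> ''fs''" "imem \<mu> ''ft''" "rmem \<mu> ''hw''" "rmem \<mu> ''W'' 0"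
    using inst(1) by (simp add: minc_def)
  let ?as = "marcs \<mu> a" and ?e = "mE \<mu> a" and ?v = "mV \<mu> a"
  have e: "?e < imem \<mu> ''hm'' 0" and v: "?v < ml \<mu>" using E_less V_less inst by auto
  have len: "length (marcs \<mu> (Suc a)) \<le> M"
    using length_arcs_mono[of "Suc a" "mp \<mu>"] length_arcs inst(2) M(2) unfolding marcs_def by (meson Suc_leI order_trans)
  define \<mu>1 where "\<mu>1 = istore ''v'' 0 ?v (istore ''e'' 0 ?e \<mu>)"
  have ag1: "agree {''e'', ''v''} \<mu> \<mu>1" by (simp add: \<mu>1_def agree_def)
  have ev1: "imem \<mu>1 ''e'' 0 = ?e" "imem \<mu>1 ''v'' 0 = ?v" by (simp_all add: \<mu>1_def)
  have h1: "has_arcs ?as \<mu>1" using h by (simp add: has_arcs_def \<mu>1_def)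
  have seen1: "imem \<mu>1 ''seen'' = imem \<mu> ''seen''" by (simp add: \<mu>1_def)
  let ?hyp = "if \<exists>b<a. mE \<mu> b = ?e then [] else [(2 + 2 * ?e, 3 + 2 * ?e, rmem \<mu> ''hw'' ?e),
    (0, 2 + 2 * ?e, rmem \<mu> ''W'' 0 * real (imem \<mu> ''fs'' ?e)), (3 + 2 * ?e, 1, rmem \<mu> ''W'' 0 * real (imem \<mu> ''ft'' ?e))]"
  let ?inc = "[(2 + 2 * imem \<mu> ''hm'' 0 + ?v, 2 + 2 * ?e, rmem \<mu> ''W'' 0), (3 + 2 * ?e, 2 + 2 * imem \<mu> ''hm'' 0 + ?v, rmem \<mu> ''W'' 0)]"
  have as: "marcs \<mu> (Suc a) = ?as @ ?hyp @ ?inc" by (simp add: marcs_def)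
  have len': "length ?as + length ?hyp + 2 \<le> M" using len unfolding as by simp
  let ?Q = "\<lambda>\<nu>. has_arcs (?as @ ?hyp) \<nu> \<and> agree {''tail'', ''head'', ''w'', ''m'', ''seen''} \<mu>1 \<nu> \<and>
    (\<forall>j. imem \<nu> ''seen'' j = of_bool (\<exists>b<Suc a. mE \<mu> b = j))"
  have hyper: "exs M (Cond (ILess (IConst 0) (IRead ''seen'' (rd ''e''))) Skip build_hyper) \<mu>1 ?Q"
  proof (cases "\<exists>b<a. mE \<mu> b = ?e")
    case True
    have "(\<exists>b<Suc a. mE \<mu> b = j) \<longleftrightarrow> (\<exists>b<a. mE \<mu> b = j)" for j
      using True unfolding less_Suc_eq by blast
    with True show ?thesis using h1 seen by (simp add: exs_simps ev1 seen1)
  next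
    case False
    let ?\<mu>2 = "istore ''seen'' ?e 1 \<mu>1"
    have ag2: "agree {''e'', ''v'', ''seen''} \<mu> ?\<mu>2" using ag1 by (simp add: agree_def)
    have ev2: "imem ?\<mu>2 ''e'' 0 = ?e" "imem ?\<mu>2 ''v'' 0 = ?v" using ev1 by simp_all
    have h2: "has_arcs ?as ?\<mu>2" using h1 by (simp add: has_arcs_def)
    have seen2: "imem ?\<mu>2 ''seen'' j = of_bool (\<exists>b<Suc a. mE \<mu> b = j)" for j
      using seen[of j] by (auto simp: seen1 less_Suc_eq)
    have l: "length ?as + 5 \<le> M" using len' False by simp
    have "exs M (Seq (arc_com in_node out_node (RRead ''hw'' (rd ''e'')))
     (Seq (arc_com (IConst 0) in_node (RMul (RRead ''W'' (IConst 0)) (ROf (IRead ''fs'' (rd ''e'')))))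
       (arc_com out_node (IConst 1) (RMul (RRead ''W'' (IConst 0)) (ROf (IRead ''ft'' (rd ''e''))))))) ?\<mu>2 ?Q"
      unfolding exs_simps
    proof (rule exs_arc[OF h2])
      fix \<mu>3 assume h3: "has_arcs (?as @ [(ival ?\<mu>2 in_node, ival ?\<mu>2 out_node, rval ?\<mu>2 (RRead ''hw'' (rd ''e'')))]) \<mu>3"
        and ag3: "agree {''tail'', ''head'', ''w'', ''m''} ?\<mu>2 \<mu>3"
      note s3 = agreeD[OF ag3] agreeD[OF ag1]
      show "exs M (arc_com (IConst 0) in_node (RMul (RRead ''W'' (IConst 0)) (ROf (IRead ''fs'' (rd ''e''))))) \<mu>3
         (\<lambda>\<nu>. exs M (arc_com out_node (IConst 1) (RMul (RRead ''W'' (IConst 0)) (ROf (IRead ''ft'' (rd ''e''))))) \<nu> ?Q)"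
      proof (rule exs_arc[OF h3])
        fix \<mu>4 assume h4: "has_arcs ((?as @ [(ival ?\<mu>2 in_node, ival ?\<mu>2 out_node, rval ?\<mu>2 (RRead ''hw'' (rd ''e'')))]) @
            [(ival \<mu>3 (IConst 0), ival \<mu>3 in_node, rval \<mu>3 (RMul (RRead ''W'' (IConst 0)) (ROf (IRead ''fs'' (rd ''e'')))))]) \<mu>4"
          and ag4: "agree {''tail'', ''head'', ''w'', ''m''} \<mu>3 \<mu>4"
        note s4 = s3 agreeD[OF ag4]
        show "exs M (arc_com out_node (IConst 1) (RMul (RRead ''W'' (IConst 0)) (ROf (IRead ''ft'' (rd ''e''))))) \<mu>4 ?Q"
        proof (rule exs_arc[OF h4])
          fix \<mu>5 assume h5: "has_arcs (((?as @ [(ival ?\<mu>2 in_node, ival ?\<mu>2 out_node, rval ?\<mu>2 (RRead ''hw'' (rd ''e'')))]) @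
            [(ival \<mu>3 (IConst 0), ival \<mu>3 in_node, rval \<mu>3 (RMul (RRead ''W'' (IConst 0)) (ROf (IRead ''fs'' (rd ''e'')))))]) @
            [(ival \<mu>4 out_node, ival \<mu>4 (IConst 1), rval \<mu>4 (RMul (RRead ''W'' (IConst 0)) (ROf (IRead ''ft'' (rd ''e'')))))]) \<mu>5"
          and ag5: "agree {''tail'', ''head'', ''w'', ''m''} \<mu>4 \<mu>5"
          have "has_arcs (?as @ ?hyp) \<mu>5" using h5 ev1 unfolding if_not_P[OF False]
            by (simp add: s4 in_node_def out_node_def)
          moreover have "agree {''tail'', ''head'', ''w'', ''m'', ''seen''} \<mu>1 \<mu>5"
            using ag3 ag4 ag5 by (simp add: agree_def)
          moreover have "imem \<mu>5 ''seen'' = imem ?\<mu>2 ''seen''" by (simp add: agreeD[OF ag5] s4)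
          ultimately show "?Q \<mu>5" using seen2 by simp
        qed (use e M l ev1 in \<open>simp_all add: s4 out_node_def in_node_def\<close>)
      qed (use e M l ev1 in \<open>simp_all add: s3 in_node_def\<close>)
    qed (use e M l ev1 in \<open>simp_all add: in_node_def out_node_def\<close>)
    then have "exs M build_hyper \<mu>1 ?Q" unfolding build_hyper_def using ev1 M by (simp add: exs_simps)
    moreover have "imem \<mu>1 ''seen'' ?e = 0" using False by (simp add: seen1 seen)
    ultimately show ?thesis by (simp add: exs_simps ev1)
  qed
  have hyper': "exs M (Cond (ILess (IConst 0) (IRead ''seen'' (rd ''e''))) Skip build_hyper) \<mu>1
    (\<lambda>\<nu>. exs M (Seq (arc_com vert_node in_node (RRead ''W'' (IConst 0))) (arc_com out_node vert_node (RRead ''W'' (IConst 0)))) \<nu>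
      (\<lambda>\<nu>. has_arcs (marcs \<mu> (Suc a)) \<nu> \<and> (\<forall>j. imem \<nu> ''seen'' j = of_bool (\<exists>b<Suc a. mE \<mu> b = j))))"
  proof (rule exs_mono[OF hyper])
    fix \<mu>2 assume Q: "?Q \<mu>2"
    then have h2: "has_arcs (?as @ ?hyp) \<mu>2" and ag2: "agree {''tail'', ''head'', ''w'', ''m'', ''seen''} \<mu>1 \<mu>2" by blast+
    note s2 = agreeD[OF ag1] agreeD[OF ag2]
    show "exs M (Seq (arc_com vert_node in_node (RRead ''W'' (IConst 0))) (arc_com out_node vert_node (RRead ''W'' (IConst 0)))) \<mu>2
      (\<lambda>\<nu>. has_arcs (marcs \<mu> (Suc a)) \<nu> \<and> (\<forall>j. imem \<nu> ''seen'' j = of_bool (\<exists>b<Suc a. mE \<mu> b = j)))"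
      unfolding exs_simps
    proof (rule exs_arc[OF h2])
      fix \<mu>3 assume h3: "has_arcs ((?as @ ?hyp) @ [(ival \<mu>2 vert_node, ival \<mu>2 in_node, rval \<mu>2 (RRead ''W'' (IConst 0)))]) \<mu>3"
        and ag3: "agree {''tail'', ''head'', ''w'', ''m''} \<mu>2 \<mu>3"
      note s3 = s2 agreeD[OF ag3]
      show "exs M (arc_com out_node vert_node (RRead ''W'' (IConst 0))) \<mu>3
        (\<lambda>\<nu>. has_arcs (marcs \<mu> (Suc a)) \<nu> \<and> (\<forall>j. imem \<nu> ''seen'' j = of_bool (\<exists>b<Suc a. mE \<mu> b = j)))"
      proof (rule exs_arc[OF h3])
        fix \<mu>4 assume h4: "has_arcs (((?as @ ?hyp) @ [(ival \<mu>2 vert_node, ival \<mu>2 in_node, rval \<mu>2 (RRead ''W'' (IConst 0)))]) @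
            [(ival \<mu>3 out_node, ival \<mu>3 vert_node, rval \<mu>3 (RRead ''W'' (IConst 0)))]) \<mu>4"
          and ag4: "agree {''tail'', ''head'', ''w'', ''m''} \<mu>3 \<mu>4"
        have "[(ival \<mu>2 vert_node, ival \<mu>2 in_node, rval \<mu>2 (RRead ''W'' (IConst 0)))] @
            [(ival \<mu>3 out_node, ival \<mu>3 vert_node, rval \<mu>3 (RRead ''W'' (IConst 0)))] = ?inc"
          using ev1 by (simp add: s3 in_node_def out_node_def vert_node_def)
        then have "has_arcs (marcs \<mu> (Suc a)) \<mu>4" using h4 unfolding as by (metis append.assoc)
        moreover have "imem \<mu>4 ''seen'' = imem \<mu>2 ''seen''" by (simp add: agreeD[OF ag4] agreeD[OF ag3])
        ultimately show "has_arcs (marcs \<mu> (Suc a)) \<mu>4 \<and> (\<forall>j. imem \<mu>4 ''seen'' j = of_bool (\<exists>b<Suc a. mE \<mu> b = j))"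
          using Q by simp
      qed (use e v M len' ev1 in \<open>simp_all add: s3 in_node_def out_node_def vert_node_def\<close>)
    qed (use e v M len' ev1 in \<open>simp_all add: s2 in_node_def out_node_def vert_node_def\<close>)
  qed
  have "ival \<mu> (IRead ''eo'' inc_at) = ?e" "ival (istore ''e'' 0 ?e \<mu>) (IRead ''pos'' (IRead ''inc'' inc_at)) = ?v"
    using a by (simp_all add: inc_at_def mE_def mV_def)
  then show ?thesis unfolding build_step_def exs_simps(4)[of M "wt ''e'' (IRead ''eo'' inc_at)"]
      exs_simps(4)[of M "wt ''v'' (IRead ''pos'' (IRead ''inc'' inc_at))"] exs_simps(2)
    using hyper' e v M unfolding \<mu>1_def by (simp del: ival.simps(2) add: exs_simps(4))
qed

definition has_net :: "digraph \<Rightarrow> mem \<Rightarrow> bool" where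
  "has_net G \<mu> \<longleftrightarrow> imem \<mu> ''n'' = scalar (dn G) \<and> imem \<mu> ''m'' = scalar (dm G) \<and> imem \<mu> ''s'' = scalar 0 \<and> imem \<mu> ''t'' = scalar 1 \<and>
     imem \<mu> ''tail'' = array (dm G) (dtail G) \<and> imem \<mu> ''head'' = array (dm G) (dhead G) \<and> rmem \<mu> ''w'' = array (dm G) (dweight G)"

definition net_names :: "string list" where
  "net_names = [''n'', ''m'', ''s'', ''t'', ''tail'', ''head'', ''w'', ''cut'']"

text \<open>The number of rounds is the number of incidences of the instance, whatever m is.
  \<open>''s''\<close> is never written: the source has number 0, and a fresh array is already
  \<open>scalar 0\<close>.\<close>

lemma run_build:
  assumes inst: "minc \<mu>" and M: "2 + 2 * imem \<mu> ''hm'' 0 + ml \<mu> \<le> M" "5 * mp \<mu> \<le> M" "2 \<le> M" "bnd M \<mu>"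
    and z: "\<And>x. x \<in> set net_names \<union> {''seen''} \<Longrightarrow> imem \<mu> x = (\<lambda>_. 0) \<and> rmem \<mu> x = (\<lambda>_. 0)"
    and s: "(mp \<mu> + 1) * wlen M \<le> s"
  shows "run build \<mu> (cst build * s) (\<lambda>\<nu>. has_net (mnet \<mu>) \<nu> \<and> bnd M \<nu>)"
  unfolding build_def
proof (rule run_Seq_cst)
  have s': "wlen M \<le> s" using s by simp
  let ?P = "\<lambda>\<nu>. imem \<nu> ''n'' = scalar (2 + 2 * imem \<mu> ''hm'' 0 + ml \<mu>) \<and> imem \<nu> ''t'' = scalar 1"
  show "run (Seq (wt ''n'' num_nodes) (wt ''t'' (IConst 1))) \<mu> (cst (Seq (wt ''n'' num_nodes) (wt ''t'' (IConst 1))) * s) (\<lambda>\<nu>. ?P \<nu> \<and> bnd M \<nu>)"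
  proof (rule run_simple_cst[OF _ M(4) s'])
    show "exs M (Seq (wt ''n'' num_nodes) (wt ''t'' (IConst 1))) \<mu> ?P"
      using z[of "''n''"] z[of "''t''"] M scalar_upd[of 0] by (simp add: exs_simps net_names_def num_nodes_def ml_def)
  qed simp
  fix \<nu> assume \<nu>: "?P \<nu> \<and> bnd M \<nu>" and "agree (wr (Seq (wt ''n'' num_nodes) (wt ''t'' (IConst 1)))) \<mu> \<nu>"
  then have ag: "agree {''n'', ''t''} \<mu> \<nu>" by (simp add: insert_commute)
  have "agree (- set inst_names) \<mu> \<nu>" by (rule agree_mono[OF ag]) (simp add: inst_names_def)
  note eq = minst_cong[OF this]
  let ?I = "\<lambda>a \<kappa>. has_arcs (marcs \<mu> a) \<kappa> \<and> (\<forall>j. imem \<kappa> ''seen'' j = of_bool (\<exists>b<a. mE \<mu> b = j))"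
  have "run (For ''a'' (IRead ''ic'' (rd ''i'')) build_step) \<nu> (cst (For ''a'' (IRead ''ic'' (rd ''i'')) build_step) * s)
     (\<lambda>\<kappa>. ?I (mp \<mu>) \<kappa> \<and> bnd M \<kappa>)"
  proof (rule run_For_simple_cst[where I="?I"])
    show "?I 0 (istore ''a'' 0 0 \<nu>)"
      using z by (simp add: has_arcs_def marcs_def arr_Nil agreeD[OF ag] net_names_def)
    show "bnd M \<nu>" using \<nu> by simp
    show "mp \<mu> \<le> M" using M by simp
    fix a \<kappa> assume I: "?I a \<kappa>" and ag2: "agree (insert ''a'' (wr build_step)) \<nu> \<kappa>" and a: "imem \<kappa> ''a'' 0 = a"
    have "agree (- set inst_names) \<nu> \<kappa>" by (rule agree_mono[OF ag2]) (simp add: inst_names_def wr_build_step)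
    note eq2 = minst_cong[OF this, unfolded eq]
    show "ival \<kappa> (IRead ''ic'' (rd ''i'')) = mp \<mu>" using eq2(3) by (simp add: mp_def)
    assume "a < mp \<mu>" "bnd M \<kappa>"
    show "exs M build_step \<kappa> (\<lambda>\<nu>'. ?I (Suc a) (istore ''a'' 0 (Suc a) \<nu>'))"
      by (rule exs_mono[OF exs_build_step[of \<kappa> a M]])
        (use \<open>a < mp \<mu>\<close> \<open>bnd M \<kappa>\<close> I a inst M in \<open>simp_all add: eq2 has_arcs_def\<close>)
  qed (use s in \<open>simp_all add: wr_build_step simple_build_step\<close>)
  then show "run (For ''a'' (IRead ''ic'' (rd ''i'')) build_step) \<nu> (cst (For ''a'' (IRead ''ic'' (rd ''i'')) build_step) * s)
     (\<lambda>\<kappa>. has_net (mnet \<mu>) \<kappa> \<and> bnd M \<kappa>)"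
  proof (rule run_mono)
    fix \<kappa> assume k: "?I (mp \<mu>) \<kappa> \<and> bnd M \<kappa>" and "agree (wr (For ''a'' (IRead ''ic'' (rd ''i'')) build_step)) \<nu> \<kappa>"
    then have ag2: "agree {''a'', ''e'', ''v'', ''seen'', ''tail'', ''head'', ''w'', ''m''} \<nu> \<kappa>"
      by (simp add: wr_build_step)
    have "imem \<kappa> ''s'' = (\<lambda>_. 0)" using z[of "''s''"] by (simp add: agreeD[OF ag2] agreeD[OF ag] net_names_def)
    then show "has_net (mnet \<mu>) \<kappa> \<and> bnd M \<kappa>"
      using k \<nu> by (simp add: has_net_def has_arcs_def mnet_def network_def Let_def agreeD[OF ag2] arr_def marcs_def o_def)
  qed simp
qed

section \<open>Solving one instance\<close>

text \<open>Restates \<open>grows\<close> for \<open>ok\<close>: the bits left in an array are those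
  present before plus at most one per unit of time. This pays for reading the output of the
  subroutine.\<close>

lemma ok_bits:
  assumes "ok c \<mu> t Q \<phi> a" "finite X"
  shows "ok c \<mu> t (\<lambda>\<nu>. Q \<nu> \<and> cell_bits x X \<nu> \<le> cell_bits x X \<mu> + t) \<phi> a"
  unfolding ok_def
proof (intro allI conjI ballI)
  fix \<tau>
  have c: "lossless_spmf (exec c (\<mu>, \<tau>))" "(\<integral>\<^sup>+ z. \<phi> (fst z) \<partial>measure_spmf (exec c (\<mu>, \<tau>))) \<le> a"
    "\<And>z. z \<in> set_spmf (exec c (\<mu>, \<tau>)) \<Longrightarrow> snd z \<le> \<tau> + t \<and> Q (fst z)"
    using assms(1) unfolding ok_def by blast+
  show "lossless_spmf (exec c (\<mu>, \<tau>))" "(\<integral>\<^sup>+ z. \<phi> (fst z) \<partial>measure_spmf (exec c (\<mu>, \<tau>))) \<le> a"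
    by (rule c)+
  show "snd z \<le> \<tau> + t" "Q (fst z)" if z: "z \<in> set_spmf (exec c (\<mu>, \<tau>))" for z
    using c(3)[OF z] by blast+
  show "cell_bits x X (fst z) \<le> cell_bits x X \<mu> + t" if z: "z \<in> set_spmf (exec c (\<mu>, \<tau>))" for z
  proof -
    have "grows (\<mu>, \<tau>) z" using exec_support(2)[of "fst z" "snd z" c \<mu> \<tau>] z by simp
    from growsD[OF this assms(2), of x] c(3)[OF z] show ?thesis by simp
  qed
qed

lemma ok_scale:
  assumes "ok c \<mu> t Q \<phi> a"
  shows "ok c \<mu> t Q (\<lambda>\<nu>. k * \<phi> \<nu>) (k * a)"
  unfolding ok_def
proof (intro allI conjI)
  fix \<tau>
  show "lossless_spmf (exec c (\<mu>, \<tau>))" "\<forall>z\<in>set_spmf (exec c (\<mu>, \<tau>)). snd z \<le> \<tau> + t \<and> Q (fst z)"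
    using assms unfolding ok_def by blast+
  have "(\<integral>\<^sup>+ z. \<phi> (fst z) \<partial>measure_spmf (exec c (\<mu>, \<tau>))) \<le> a" using assms unfolding ok_def by blast
  then have "k * (\<integral>\<^sup>+ z. \<phi> (fst z) \<partial>measure_spmf (exec c (\<mu>, \<tau>))) \<le> k * a" by (rule mult_left_mono) simp
  then show "(\<integral>\<^sup>+ z. k * \<phi> (fst z) \<partial>measure_spmf (exec c (\<mu>, \<tau>))) \<le> k * a"
    by (subst nn_integral_cmult) simp_all
qed

text \<open>\<open>wr\<close> identifies natural and real arrays of the same name. The input of the
  subroutine must also have, say, \<open>rmem\<close> of \<open>''n''\<close> and
  \<open>imem\<close> of \<open>''w''\<close> equal to zero, which requires tracking the two kinds
  separately.\<close>

primrec wri :: "com \<Rightarrow> string set" where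
  "wri Skip = {}"
| "wri (IAssign x e f) = {x}"
| "wri (RAssign x e f) = {}"
| "wri (Flip x e) = {x}"
| "wri (Seq c d) = wri c \<union> wri d"
| "wri (Cond b c d) = wri c \<union> wri d"
| "wri (While b c) = wri c"
| "wri (Call xs c) = set xs \<inter> wri c"

primrec wrr :: "com \<Rightarrow> string set" where
  "wrr Skip = {}"
| "wrr (IAssign x e f) = {}"
| "wrr (RAssign x e f) = {x}"
| "wrr (Flip x e) = {}"
| "wrr (Seq c d) = wrr c \<union> wrr d"
| "wrr (Cond b c d) = wrr c \<union> wrr d"
| "wrr (While b c) = wrr c"
| "wrr (Call xs c) = set xs \<inter> wrr c"

definition agree2 :: "string set \<Rightarrow> string set \<Rightarrow> mem \<Rightarrow> mem \<Rightarrow> bool" where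
  "agree2 I R \<mu> \<nu> \<longleftrightarrow> (\<forall>x. x \<notin> I \<longrightarrow> imem \<nu> x = imem \<mu> x) \<and> (\<forall>x. x \<notin> R \<longrightarrow> rmem \<nu> x = rmem \<mu> x)"

lemma exec_agree2:
  "z' \<in> set_spmf (exec c z) \<Longrightarrow> agree2 (wri c) (wrr c) (fst z) (fst z')"
proof (induction c arbitrary: z z')
  case (Flip x e)
  then show ?case by (cases z) (auto simp: agree2_def)
next
  case (Seq c d)
  then obtain y where y: "y \<in> set_spmf (exec c z)" "z' \<in> set_spmf (exec d y)"
    by (auto simp: set_bind_spmf)
  from Seq.IH(1)[OF y(1)] Seq.IH(2)[OF y(2)] show ?case by (simp add: agree2_def)
next
  case (Cond b c d)
  obtain \<mu> \<tau> where z: "z = (\<mu>, \<tau>)" by fastforce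
  show ?case
    using Cond.IH(1)[of z' "(\<mu>, \<tau> + bcost \<mu> b + 1)"] Cond.IH(2)[of z' "(\<mu>, \<tau> + bcost \<mu> b + 1)"] Cond.prems
    unfolding z by (cases "bval \<mu> b") (simp_all add: agree2_def)
next
  case (While b c)
  let ?R = "\<lambda>z z' :: mem \<times> nat. agree2 (wri c) (wrr c) (fst z) (fst z')"
  let ?w = "while_spmf (\<lambda>(\<mu>, \<tau>). bval \<mu> b) (\<lambda>(\<mu>, \<tau>). exec c (\<mu>, \<tau> + bcost \<mu> b + 1))"
  have sup: "set_spmf (?w z) \<subseteq> {z'. ?R z z'}"
  proof (rule while_spmf_support)
    show "?R x x" for x by (simp add: agree2_def)
    show "?R x z" if "?R x y" "?R y z" for x y z using that by (simp add: agree2_def)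
    show "?R x y" if "y \<in> set_spmf (case x of (\<mu>, \<tau>) \<Rightarrow> exec c (\<mu>, \<tau> + bcost \<mu> b + 1))" for x y
      using While.IH[of y "(fst x, snd x + bcost (fst x) b + 1)"] that by (simp add: split_beta)
  qed
  from While.prems obtain y where "y \<in> set_spmf (?w z)" "fst z' = fst y" by auto
  then have "?R z y" using sup by blast
  with \<open>fst z' = fst y\<close> show ?case by simp
next
  case (Call xs c)
  obtain \<mu> \<tau> where z: "z = (\<mu>, \<tau>)" by fastforce
  from Call.prems obtain y where y: "y \<in> set_spmf (exec c (overlay xs \<mu> zero_mem, \<tau> + length xs + 1))"
    and z': "fst z' = overlay xs (fst y) \<mu>" by (auto simp: z)
  from Call.IH[OF y] show ?case by (simp add: agree2_def z z')
qed (auto simp: agree2_def split_beta)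

lemma ok_agree2:
  "ok c \<mu> t Q \<phi> a \<Longrightarrow> ok c \<mu> t (\<lambda>\<nu>. Q \<nu> \<and> agree2 (wri c) (wrr c) \<mu> \<nu>) \<phi> a"
  unfolding ok_def using exec_agree2 by fastforce

lemma icost_cong: "agree W \<mu> \<nu> \<Longrightarrow> ird e \<inter> W = {} \<Longrightarrow> icost \<nu> e = icost \<mu> e"
proof (induction e)
  case (IRead x e)
  then have "ival \<nu> e = ival \<mu> e" by (intro ival_cong) auto
  with IRead show ?case by (auto simp: agree_def)
next
  case (IAdd e f)
  then show ?case using ival_cong[of W \<mu> \<nu> e] ival_cong[of W \<mu> \<nu> f] by (simp add: Int_Un_distrib2)
next
  case (ISub e f)
  then show ?case using ival_cong[of W \<mu> \<nu> e] ival_cong[of W \<mu> \<nu> f] by (simp add: Int_Un_distrib2)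
next
  case (IMul e f)
  then show ?case using ival_cong[of W \<mu> \<nu> e] ival_cong[of W \<mu> \<nu> f] by (simp add: Int_Un_distrib2)
next
  case (IDiv e f)
  then show ?case using ival_cong[of W \<mu> \<nu> e] ival_cong[of W \<mu> \<nu> f] by (simp add: Int_Un_distrib2)
qed simp

definition norm_step :: com where
  "norm_step = Cond (ILess (IConst 0) (IRead ''cut'' (rd ''x''))) (IAssign ''cand'' (rd ''x'') (IConst 1)) Skip"

text \<open>Units of \<open>wlen M\<close> per round of the copying loop: the guard, the 30 of
  \<open>run_norm_step\<close>, and some slack.\<close>

definition normK :: nat where
  "normK = bcst (ILess (rd ''x'') num_nodes) + 40"

lemma run_norm_step:
  assumes x: "imem \<nu> ''x'' 0 = i" "Suc i \<le> M"
  shows "run (Seq norm_step (IAssign ''x'' (IConst 0) (IAdd (rd ''x'') (IConst 1)))) \<nu> (floorlog 2 (imem \<nu> ''cut'' i) + 30 * wlen M)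
    (\<lambda>\<kappa>. \<kappa> = istore ''x'' 0 (Suc i) (if imem \<nu> ''cut'' i \<noteq> 0 then istore ''cand'' i 1 \<nu> else \<nu>))"
proof -
  have "floorlog 2 i < wlen M" "floorlog 2 (Suc i) < wlen M" using x(2) floorlog_less_wlen[of i M] floorlog_less_wlen[of "Suc i" M] by simp_all
  moreover have "floorlog 2 1 = 1" "floorlog 2 0 = 0" by (simp_all add: floorlog_def)
  ultimately show ?thesis using x
    unfolding ok_def norm_step_def by (auto simp: istore_def)
qed

text \<open>
  The subroutine may leave arbitrarily large numbers in \<open>''cut''\<close>, but the time for reading them is
  bounded by the time that it took to write them.
\<close>

lemma run_norm:
  assumes "lo \<le> n" "n \<le> M" "imem \<nu> ''x'' 0 = lo" "bnd M \<mu>'" "agree (insert ''x'' (insert ''cand'' (set net_names))) \<mu>' \<nu>" "ival \<nu> num_nodes = n"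
  shows "run (Up ''x'' num_nodes norm_step) \<nu> ((\<Sum>v=lo..<n. floorlog 2 (imem \<nu> ''cut'' v)) + normK * wlen M * (n - lo + 1))
    (\<lambda>\<kappa>. \<forall>v. imem \<kappa> ''cand'' v = (if lo \<le> v \<and> v < n \<and> imem \<nu> ''cut'' v \<noteq> 0 then 1 else imem \<nu> ''cand'' v))"
  using assms(1,3,5,6)
proof (induction lo arbitrary: \<nu> rule: inc_induct)
  case base
  let ?g = "ILess (rd ''x'') num_nodes"
  \<comment> \<open>The current memory need not be bounded by M, but \<open>num_nodes\<close> reads
    only arrays on which it agrees with the bounded memory \<open>\<mu>'\<close>.\<close>
  have "icost \<nu> num_nodes = icost \<mu>' num_nodes"
    by (rule icost_cong[OF base(2)]) (simp add: num_nodes_def net_names_def)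
  then have "icost \<nu> num_nodes \<le> icst num_nodes * wlen M" using icost_le[OF assms(4)] by simp
  moreover have "icost \<nu> (rd ''x'') \<le> icst (rd ''x'') * wlen M"
    using floorlog_less_wlen[OF assms(2)] base(1) by (simp add: floorlog_def)
  ultimately have "bcost \<nu> ?g + 1 \<le> normK * wlen M"
    using wlen_pos(2)[of M] by (simp add: normK_def algebra_simps)
  then show ?case unfolding Up_def using base by (intro ok_While_exit) auto
next
  case (step i)
  let ?g = "ILess (rd ''x'') num_nodes"
  have "icost \<nu> num_nodes = icost \<mu>' num_nodes"
    by (rule icost_cong[OF step.prems(2)]) (simp add: num_nodes_def net_names_def)
  then have "icost \<nu> num_nodes \<le> icst num_nodes * wlen M" using icost_le[OF assms(4)] by simp
  moreover have "icost \<nu> (rd ''x'') \<le> icst (rd ''x'') * wlen M"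
    using floorlog_less_wlen[of i M] assms(2) step.hyps step.prems(1) by (simp add: floorlog_def)
  ultimately have g: "bcost \<nu> ?g + 1 + 30 * wlen M \<le> normK * wlen M"
    using wlen_pos(2)[of M] by (simp add: normK_def algebra_simps)
  let ?\<nu>1 = "istore ''x'' 0 (Suc i) (if imem \<nu> ''cut'' i \<noteq> 0 then istore ''cand'' i 1 \<nu> else \<nu>)"
  have ag: "agree {''x'', ''cand''} \<nu> ?\<nu>1" by (simp add: agree_def)
  have cut: "imem ?\<nu>1 ''cut'' = imem \<nu> ''cut''" by simp
  let ?Q = "\<lambda>\<kappa>. \<forall>v. imem \<kappa> ''cand'' v = (if i \<le> v \<and> v < n \<and> imem \<nu> ''cut'' v \<noteq> 0 then 1 else imem \<nu> ''cand'' v)"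
  have IH: "run (Up ''x'' num_nodes norm_step) ?\<nu>1 ((\<Sum>v=Suc i..<n. floorlog 2 (imem ?\<nu>1 ''cut'' v)) + normK * wlen M * (n - Suc i + 1))
    (\<lambda>\<kappa>. \<forall>v. imem \<kappa> ''cand'' v = (if Suc i \<le> v \<and> v < n \<and> imem ?\<nu>1 ''cut'' v \<noteq> 0 then 1 else imem ?\<nu>1 ''cand'' v))"
  proof (rule step.IH)
    show "agree (insert ''x'' (insert ''cand'' (set net_names))) \<mu>' ?\<nu>1"
      using step.prems(2) by (simp add: agree_def)
    show "ival ?\<nu>1 num_nodes = n"
      using ival_cong[OF ag, of num_nodes] step.prems(3) by (simp add: num_nodes_def)
  qed simp
  have "run (Seq (Seq norm_step (IAssign ''x'' (IConst 0) (IAdd (rd ''x'') (IConst 1)))) (Up ''x'' num_nodes norm_step)) \<nu>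
     (floorlog 2 (imem \<nu> ''cut'' i) + 30 * wlen M + ((\<Sum>v=Suc i..<n. floorlog 2 (imem \<nu> ''cut'' v)) + normK * wlen M * (n - Suc i + 1))) ?Q"
  proof (rule ok_Seq_run[OF run_norm_step[OF step.prems(1)]])
    show "Suc i \<le> M" using step.hyps assms(2) by simp
    fix \<kappa> assume "\<kappa> = ?\<nu>1"
    then show "run (Up ''x'' num_nodes norm_step) \<kappa> ((\<Sum>v=Suc i..<n. floorlog 2 (imem \<nu> ''cut'' v)) + normK * wlen M * (n - Suc i + 1)) ?Q"
      using IH unfolding cut
    proof (elim ssubst, elim run_mono)
      fix \<kappa>' assume a: "\<forall>v. imem \<kappa>' ''cand'' v = (if Suc i \<le> v \<and> v < n \<and> imem \<nu> ''cut'' v \<noteq> 0 then 1 else imem ?\<nu>1 ''cand'' v)"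
      have "Suc i \<le> v \<or> v = i \<or> v < i" for v by linarith
      then show "?Q \<kappa>'" using a step.hyps by (auto simp: Suc_le_eq)
    qed simp_all
  qed simp
  then have "run (Up ''x'' num_nodes norm_step) \<nu>
     (floorlog 2 (imem \<nu> ''cut'' i) + 30 * wlen M + ((\<Sum>v=Suc i..<n. floorlog 2 (imem \<nu> ''cut'' v)) + normK * wlen M * (n - Suc i + 1))
       + bcost \<nu> ?g + 1) ?Q"
    unfolding Up_def by (rule ok_While_step[rotated]) (use step.prems step.hyps in auto)
  then show ?case
  proof (rule run_mono)
    have sum_eq: "(\<Sum>v=i..<n. floorlog 2 (imem \<nu> ''cut'' v)) = floorlog 2 (imem \<nu> ''cut'' i) + (\<Sum>v=Suc i..<n. floorlog 2 (imem \<nu> ''cut'' v))"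
      using step.hyps by (simp add: sum.atLeast_Suc_lessThan)
    have "n - i + 1 = Suc (n - Suc i + 1)" using step.hyps by simp
    then have mult_eq: "normK * wlen M * (n - i + 1) = normK * wlen M + normK * wlen M * (n - Suc i + 1)" by simp
    have gen: "a + w + (s + r) + b + 1 \<le> a + s + (k + r)" if "b + 1 + w \<le> k" for a b k r s w :: nat
      using that by linarith
    show "floorlog 2 (imem \<nu> ''cut'' i) + 30 * wlen M + ((\<Sum>v=Suc i..<n. floorlog 2 (imem \<nu> ''cut'' v)) + normK * wlen M * (n - Suc i + 1))
       + bcost \<nu> ?g + 1 \<le> (\<Sum>v=i..<n. floorlog 2 (imem \<nu> ''cut'' v)) + normK * wlen M * (n - i + 1)"
      unfolding sum_eq mult_eq using g by (rule gen)
  qed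
qed

definition sample :: "com \<Rightarrow> com" where
  "sample P = Seq build (Seq (Call net_names P) (Seq (wt ''x'' (IConst 0)) (Up ''x'' num_nodes norm_step)))"

definition cut_of :: "digraph \<Rightarrow> (nat \<Rightarrow> nat) \<Rightarrow> nat set" where
  "cut_of G c = {v. v < dn G \<and> c v \<noteq> 0}"

text \<open>All that is used of the subroutine: time \<open>tp\<close> and failure probability at
  most 1/2, from any starting clock by the definition of \<open>ok\<close>.\<close>

definition solver :: "com \<Rightarrow> (nat \<Rightarrow> nat \<Rightarrow> nat) \<Rightarrow> bool" where
  "solver P tp \<longleftrightarrow> (\<forall>G s t \<mu>. stcut_input (G, s, t) \<mu> \<longrightarrow>
     ok P \<mu> (tp (dm G) (dn G)) (\<lambda>_. True) (\<lambda>\<nu>. of_bool (\<not> stcut_output (G, s, t) \<nu>)) (ennreal (1/2)))"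

lemma dn_mnet: "dn (mnet \<mu>) = 2 + 2 * imem \<mu> ''hm'' 0 + ml \<mu>"
  by (simp add: mnet_def network_def Let_def)

lemma dm_mnet: "dm (mnet \<mu>) = length (marcs \<mu> (mp \<mu>))" "dm (mnet \<mu>) \<le> 5 * mp \<mu>"
  by (simp_all add: mnet_def network_def Let_def marcs_def length_arcs)

lemma wf_mnet: "minc \<mu> \<Longrightarrow> wf_digraph (mnet \<mu>)"
  unfolding minc_def mnet_def by (rule incidences.wf_network)

text \<open>Only the shared arrays have to be inspected; all others are zero in the callee by the
  semantics of \<open>Call\<close>.\<close>

lemma has_net_input:
  assumes "has_net (mnet \<mu>) \<nu>" "minc \<mu>" and z: "imem \<nu> ''cut'' = (\<lambda>_. 0)" "rmem \<nu> ''cut'' = (\<lambda>_. 0)"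
    and z': "\<And>x. x \<in> set net_names \<Longrightarrow> x \<noteq> ''w'' \<Longrightarrow> rmem \<nu> x = (\<lambda>_. 0)" "imem \<nu> ''w'' = (\<lambda>_. 0)"
  shows "stcut_input (mnet \<mu>, 0, 1) (overlay net_names \<nu> zero_mem)"
proof -
  have 1: "overlay net_names \<nu> zero_mem = \<lparr>imem = (\<lambda>_ _. 0)
             (''n'' := scalar (dn (mnet \<mu>)), ''m'' := scalar (dm (mnet \<mu>)), ''s'' := scalar 0, ''t'' := scalar 1,
              ''tail'' := array (dm (mnet \<mu>)) (dtail (mnet \<mu>)), ''head'' := array (dm (mnet \<mu>)) (dhead (mnet \<mu>))),
           rmem = (\<lambda>_ _. 0)(''w'' := array (dm (mnet \<mu>)) (dweight (mnet \<mu>)))\<rparr>"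
    unfolding overlay_def
  proof (rule arg_cong2[where f="\<lambda>i r. \<lparr>imem = i, rmem = r\<rparr>"])
    show "(\<lambda>x. if x \<in> set net_names then imem \<nu> x else imem zero_mem x) = (\<lambda>_ _. 0)
             (''n'' := scalar (dn (mnet \<mu>)), ''m'' := scalar (dm (mnet \<mu>)), ''s'' := scalar 0, ''t'' := scalar 1,
              ''tail'' := array (dm (mnet \<mu>)) (dtail (mnet \<mu>)), ''head'' := array (dm (mnet \<mu>)) (dhead (mnet \<mu>)))"
      using assms(1) z(1) z'(2) unfolding has_net_def by (intro ext) (simp add: net_names_def)
    show "(\<lambda>x. if x \<in> set net_names then rmem \<nu> x else rmem zero_mem x) = (\<lambda>_ _. 0)(''w'' := array (dm (mnet \<mu>)) (dweight (mnet \<mu>)))"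
      using assms(1) z(2) z'(1) unfolding has_net_def by (intro ext) (auto simp: net_names_def)
  qed
  show ?thesis unfolding stcut_input_def 1 using wf_mnet[OF assms(2)] by (simp add: dn_mnet)
qed

lemma wr_build: "wr build = {''n'', ''t'', ''a'', ''e'', ''v'', ''seen'', ''tail'', ''head'', ''w'', ''m''}"
  by (auto simp: build_def wr_build_step)

definition fresh :: "string set \<Rightarrow> mem \<Rightarrow> bool" where
  "fresh X \<mu> \<longleftrightarrow> (\<forall>x\<in>X. imem \<mu> x = (\<lambda>_. 0) \<and> rmem \<mu> x = (\<lambda>_. 0))"

definition fits :: "nat \<Rightarrow> mem \<Rightarrow> bool" where
  "fits M \<mu> \<longleftrightarrow> minc \<mu> \<and> 2 + 2 * imem \<mu> ''hm'' 0 + ml \<mu> \<le> M \<and> 5 * mp \<mu> \<le> M \<and> bnd M \<mu>"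

text \<open>Replacing the output by zeros and ones does not change the set that it denotes, so only
  the subroutine can fail. The \<open>2 * tp\<close> pays once for the call and once for the bits of
  its output.\<close>

lemma ok_sample:
  assumes P: "solver P tp" and \<mu>: "fits M \<mu>" and f: "fresh (set net_names \<union> {''seen'', ''cand''}) \<mu>"
    and s: "(mp \<mu> + 1) * wlen M \<le> s" "2 * tp (dm (mnet \<mu>)) (dn (mnet \<mu>)) + normK * wlen M * (dn (mnet \<mu>) + 1) \<le> s"
  shows "ok (sample P) \<mu> (cst (sample P) * s) (\<lambda>\<nu>. \<forall>v. imem \<nu> ''cand'' v \<le> 1)
    (\<lambda>\<nu>. of_bool (\<not> min_st_cut (mnet \<mu>) 0 1 (cut_of (mnet \<mu>) (imem \<nu> ''cand'')))) (ennreal (1/2))"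
  unfolding sample_def
proof (rule run_Seq_cst)
  let ?G = "mnet \<mu>"
  let ?tp = "tp (dm ?G) (dn ?G)"
  have M: "minc \<mu>" "2 + 2 * imem \<mu> ''hm'' 0 + ml \<mu> \<le> M" "5 * mp \<mu> \<le> M" "2 \<le> M" "bnd M \<mu>" "dn ?G \<le> M"
    using \<mu> by (auto simp: fits_def dn_mnet)
  have s1: "1 \<le> s" "wlen M \<le> s" using s(1) wlen_pos(2)[of M] by simp_all
  show "run build \<mu> (cst build * s) (\<lambda>\<nu>. (has_net ?G \<nu> \<and> bnd M \<nu>) \<and> agree2 (wri build) (wrr build) \<mu> \<nu>)"
    by (rule ok_agree2, rule run_build) (use M s f in \<open>auto simp: fresh_def\<close>)
  fix \<nu> assume \<nu>: "(has_net ?G \<nu> \<and> bnd M \<nu>) \<and> agree2 (wri build) (wrr build) \<mu> \<nu>" and "agree (wr build) \<mu> \<nu>"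
  then have ag: "agree {''n'', ''t'', ''a'', ''e'', ''v'', ''seen'', ''tail'', ''head'', ''w'', ''m''} \<mu> \<nu>"
    by (simp add: wr_build)
  note eq = agreeD[OF ag]
  have w: "wrr build = {''w''}" "''w'' \<notin> wri build"
    by (simp_all add: build_def For_def Up_def build_step_def build_hyper_def arc_com_def)
  have rm: "rmem \<nu> x = (\<lambda>_. 0)" if "x \<in> set net_names" "x \<noteq> ''w''" for x
    using \<nu> w(1) that f by (simp add: agree2_def fresh_def)
  have im: "imem \<nu> ''w'' = (\<lambda>_. 0)" "imem \<nu> ''cut'' = (\<lambda>_. 0)" "imem \<nu> ''cand'' = (\<lambda>_. 0)"
    using \<nu> w(2) f by (simp_all add: agree2_def fresh_def net_names_def eq)
  have inp: "stcut_input (?G, 0, 1) (overlay net_names \<nu> zero_mem)"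
    by (rule has_net_input) (use \<nu> M rm im in \<open>auto simp: net_names_def\<close>)
  have "ok P (overlay net_names \<nu> zero_mem) ?tp (\<lambda>_. True) (\<lambda>\<nu>. of_bool (\<not> stcut_output (?G, 0, 1) \<nu>)) (ennreal (1/2))"
    using P inp unfolding solver_def by blast
  \<comment> \<open>\<open>''cut''\<close> is zero before the call, so all of its bits are due to
    the running time of the subroutine.\<close>
  from ok_bits[OF this, of "{..<dn ?G}" "''cut''"]
  have "ok P (overlay net_names \<nu> zero_mem) ?tp
    (\<lambda>\<kappa>. (\<Sum>v<dn ?G. floorlog 2 (imem (overlay net_names \<kappa> \<nu>) ''cut'' v)) \<le> ?tp)
    (\<lambda>\<kappa>. of_bool (\<not> min_st_cut ?G 0 1 (cut_of ?G (imem (overlay net_names \<kappa> \<nu>) ''cut'')))) (ennreal (1/2))"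
    by (rule ok_mono) (use im(2) in \<open>auto simp: cell_bits_def floorlog_def stcut_output_def cut_of_def net_names_def\<close>)
  then have call: "ok (Call net_names P) \<nu> (?tp + length net_names + 1)
    (\<lambda>\<kappa>. (\<Sum>v<dn ?G. floorlog 2 (imem \<kappa> ''cut'' v)) \<le> ?tp)
    (\<lambda>\<kappa>. of_bool (\<not> min_st_cut ?G 0 1 (cut_of ?G (imem \<kappa> ''cut'')))) (ennreal (1/2))"
    by (rule ok_Call) simp
  let ?C = "Seq (wt ''x'' (IConst 0)) (Up ''x'' num_nodes norm_step)"
  show "ok (Seq (Call net_names P) ?C) \<nu> (cst (Seq (Call net_names P) ?C) * s)
     (\<lambda>\<nu>. \<forall>v. imem \<nu> ''cand'' v \<le> 1)
     (\<lambda>\<nu>. of_bool (\<not> min_st_cut ?G 0 1 (cut_of ?G (imem \<nu> ''cand'')))) (ennreal (1/2))"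
  proof (rule ok_Seq[OF call])
    fix \<kappa> assume bits: "(\<Sum>v<dn ?G. floorlog 2 (imem \<kappa> ''cut'' v)) \<le> ?tp" and "agree (wr (Call net_names P)) \<nu> \<kappa>"
    then have ag2: "agree (set net_names) \<nu> \<kappa>" by (auto intro: agree_mono)
    have num: "ival \<kappa>' num_nodes = dn ?G" if "agree (insert ''x'' (insert ''cand'' (set net_names))) \<nu> \<kappa>'" for \<kappa>'
      using agreeD[OF that] by (simp add: num_nodes_def net_names_def eq dn_mnet ml_def)
    let ?\<kappa> = "istore ''x'' 0 0 \<kappa>"
    have ag3: "agree (insert ''x'' (insert ''cand'' (set net_names))) \<nu> ?\<kappa>"
      using ag2 by (simp add: agree_def)
    have "run (Up ''x'' num_nodes norm_step) ?\<kappa> ((\<Sum>v=0..<dn ?G. floorlog 2 (imem ?\<kappa> ''cut'' v)) + normK * wlen M * (dn ?G - 0 + 1))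
      (\<lambda>\<kappa>'. \<forall>v. imem \<kappa>' ''cand'' v = (if 0 \<le> v \<and> v < dn ?G \<and> imem ?\<kappa> ''cut'' v \<noteq> 0 then 1 else imem ?\<kappa> ''cand'' v))"
      by (rule run_norm[OF _ M(6) _ _ ag3 num[OF ag3]]) (use \<nu> in auto)
    then have up: "run (Up ''x'' num_nodes norm_step) ?\<kappa> (?tp + normK * wlen M * (dn ?G + 1))
      (\<lambda>\<kappa>'. \<forall>v. imem \<kappa>' ''cand'' v = (if v < dn ?G \<and> imem \<kappa> ''cut'' v \<noteq> 0 then 1 else 0))"
    proof (rule run_mono)
      show "(\<Sum>v=0..<dn ?G. floorlog 2 (imem ?\<kappa> ''cut'' v)) + normK * wlen M * (dn ?G - 0 + 1) \<le> ?tp + normK * wlen M * (dn ?G + 1)"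
        using bits by (simp add: atLeast0LessThan)
    qed (use im(3) agreeD[OF ag2, of "''cand''"] in \<open>simp add: net_names_def\<close>)
    have "run ?C \<kappa> (3 + (?tp + normK * wlen M * (dn ?G + 1)))
      (\<lambda>\<kappa>'. \<forall>v. imem \<kappa>' ''cand'' v = (if v < dn ?G \<and> imem \<kappa> ''cut'' v \<noteq> 0 then 1 else 0))"
    proof (rule ok_Seq_run[where ?t1.0=3 and R="\<lambda>\<kappa>'. \<kappa>' = ?\<kappa>"])
      show "run (wt ''x'' (IConst 0)) \<kappa> 3 (\<lambda>\<kappa>'. \<kappa>' = ?\<kappa>)"
        unfolding ok_def by (simp add: floorlog_def)
    qed (use up in auto)
    then have "run ?C \<kappa> (3 + (?tp + normK * wlen M * (dn ?G + 1))) (\<lambda>\<kappa>'. (\<forall>v. imem \<kappa>' ''cand'' v \<le> 1) \<and>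
      (of_bool (\<not> min_st_cut ?G 0 1 (cut_of ?G (imem \<kappa>' ''cand''))) :: ennreal) \<le> of_bool (\<not> min_st_cut ?G 0 1 (cut_of ?G (imem \<kappa> ''cut''))))"
    proof (rule run_mono)
      fix \<kappa>' assume c: "\<forall>v. imem \<kappa>' ''cand'' v = (if v < dn ?G \<and> imem \<kappa> ''cut'' v \<noteq> 0 then 1 else 0)"
      then have "cut_of ?G (imem \<kappa>' ''cand'') = cut_of ?G (imem \<kappa> ''cut'')"
        by (auto simp: cut_of_def)
      then show "(\<forall>v. imem \<kappa>' ''cand'' v \<le> 1) \<and>
      (of_bool (\<not> min_st_cut ?G 0 1 (cut_of ?G (imem \<kappa>' ''cand''))) :: ennreal) \<le> of_bool (\<not> min_st_cut ?G 0 1 (cut_of ?G (imem \<kappa> ''cut'')))"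
        using c by simp
    qed simp
    then show "ok ?C \<kappa> (3 + (?tp + normK * wlen M * (dn ?G + 1))) (\<lambda>\<nu>. \<forall>v. imem \<nu> ''cand'' v \<le> 1)
     (\<lambda>\<nu>. of_bool (\<not> min_st_cut ?G 0 1 (cut_of ?G (imem \<nu> ''cand'')))) (of_bool (\<not> min_st_cut ?G 0 1 (cut_of ?G (imem \<kappa> ''cut''))))"
      by (rule ok_run)
  next
    \<comment> \<open>Beyond s there are 8 + 1 steps for the call and 3 for resetting the counter,
      and \<open>s + 12 \<le> 13 * s\<close>.\<close>
    have "13 \<le> cst (Call net_names P) + cst (Seq (wt ''x'' (IConst 0)) (Up ''x'' num_nodes norm_step))"
      using cst_pos[of P] by (simp add: net_names_def)
    then have "13 * s \<le> cst (Seq (Call net_names P) ?C) * s" by (intro mult_right_mono) simp_all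
    moreover have "length net_names = 8" by (simp add: net_names_def)
    ultimately show "?tp + length net_names + 1 + (3 + (?tp + normK * wlen M * (dn ?G + 1))) \<le> cst (Seq (Call net_names P) ?C) * s"
      using s(2) s1(1) by linarith
  qed
qed

lemma scale_mem: "x < dn G \<Longrightarrow> x \<in> cut_of G c \<longleftrightarrow> c x \<noteq> 0"
  by (simp add: cut_of_def)

text \<open>For arrays of zeros and ones, \<open>c u * (1 - c v)\<close> indicates that the arc from
  u to v is cut. \<open>''D''\<close> accumulates the weight of the candidate minus that of the best
  cut so far; only its sign is used.\<close>

definition accum :: com where
  "accum = RAssign ''D'' (IConst 0) (RAdd (RRead ''D'' (IConst 0)) (RMul (RRead ''w'' (rd ''a''))
     (RSub (ROf (IMul (IRead ''cand'' (IRead ''tail'' (rd ''a''))) (ISub (IConst 1) (IRead ''cand'' (IRead ''head'' (rd ''a''))))))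
           (ROf (IMul (IRead ''bc'' (IRead ''tail'' (rd ''a''))) (ISub (IConst 1) (IRead ''bc'' (IRead ''head'' (rd ''a'')))))))))"

definition copy_step :: com where
  "copy_step = IAssign ''bc'' (rd ''x'') (IRead ''cand'' (rd ''x''))"

text \<open>The subroutine may destroy its input, so the network is built again to weigh the candidate cut.\<close>

definition compare :: com where
  "compare = Seq (Seq (IAssign ''cand'' (IConst 0) (IConst 1)) (IAssign ''cand'' (IConst 1) (IConst 0)))
     (Seq build (Seq (For ''a'' (rd ''m'') accum)
       (Cond (RLess (RRead ''D'' (IConst 0)) (ROf (IConst 0))) (For ''x'' num_nodes copy_step) Skip)))"

definition rep :: "com \<Rightarrow> com" where
  "rep P = Seq (Call (''cand'' # inst_names) (sample P)) compare"

definition zo_cut :: "(nat \<Rightarrow> nat) \<Rightarrow> bool" where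
  "zo_cut c \<longleftrightarrow> (\<forall>v. c v \<le> 1) \<and> c 0 = 1 \<and> c 1 = 0"

lemma dcut_weight_cut_of:
  assumes "wf_digraph G" "\<And>v. c v \<le> 1"
  shows "dcut_weight G (cut_of G c) = (\<Sum>a<dm G. dweight G a * real (c (dtail G a) * (1 - c (dhead G a))))"
proof -
  have "dcut_weight G (cut_of G c) = (\<Sum>a<dm G. if dtail G a \<in> cut_of G c \<and> dhead G a \<notin> cut_of G c then dweight G a else 0)"
    unfolding dcut_weight_def by (rule sum.mono_neutral_cong_left) auto
  also have "\<dots> = (\<Sum>a<dm G. dweight G a * real (c (dtail G a) * (1 - c (dhead G a))))"
  proof (rule sum.cong[OF refl])
    fix a assume "a \<in> {..<dm G}"
    then have "dtail G a < dn G" "dhead G a < dn G" using assms(1) by (auto simp: wf_digraph_def)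
    moreover have "c (dtail G a) = 0 \<or> c (dtail G a) = 1" "c (dhead G a) = 0 \<or> c (dhead G a) = 1"
      using assms(2)[of "dtail G a"] assms(2)[of "dhead G a"] by linarith+
    ultimately show "(if dtail G a \<in> cut_of G c \<and> dhead G a \<notin> cut_of G c then dweight G a else 0)
      = dweight G a * real (c (dtail G a) * (1 - c (dhead G a)))"
      by (auto simp: scale_mem)
  qed
  finally show ?thesis .
qed

lemma min_st_cut_le: "min_st_cut G s t S \<Longrightarrow> st_set G s t S' \<Longrightarrow> dcut_weight G S' \<le> dcut_weight G S \<Longrightarrow> min_st_cut G s t S'"
  unfolding min_st_cut_def by (meson order_trans)

lemma st_set_zo_cut: "zo_cut c \<Longrightarrow> 2 \<le> dn G \<Longrightarrow> st_set G 0 1 (cut_of G c)"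
  by (auto simp: st_set_def cut_of_def zo_cut_def)

lemma run_accum:
  assumes net: "has_net G \<mu>" and wf: "wf_digraph G" and c: "\<And>v. imem \<mu> ''cand'' v \<le> 1" "\<And>v. imem \<mu> ''bc'' v \<le> 1"
    and D: "rmem \<mu> ''D'' 0 = 0" and M: "bnd M \<mu>" "dm G \<le> M" and s: "(dm G + 1) * wlen M \<le> s"
  shows "run (For ''a'' (rd ''m'') accum) \<mu> (cst (For ''a'' (rd ''m'') accum) * s)
    (\<lambda>\<nu>. rmem \<nu> ''D'' 0 = dcut_weight G (cut_of G (imem \<mu> ''cand'')) - dcut_weight G (cut_of G (imem \<mu> ''bc'')) \<and> bnd M \<nu>)"
proof -
  let ?f = "\<lambda>b. dweight G b * (real (imem \<mu> ''cand'' (dtail G b) * (1 - imem \<mu> ''cand'' (dhead G b))) -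
    real (imem \<mu> ''bc'' (dtail G b) * (1 - imem \<mu> ''bc'' (dhead G b))))"
  have "run (For ''a'' (rd ''m'') accum) \<mu> (cst (For ''a'' (rd ''m'') accum) * s) (\<lambda>\<nu>. rmem \<nu> ''D'' 0 = (\<Sum>b<dm G. ?f b) \<and> bnd M \<nu>)"
  proof (rule run_For_simple_cst[where I="\<lambda>a \<nu>. rmem \<nu> ''D'' 0 = (\<Sum>b<a. ?f b)"])
    fix a \<nu> assume ag: "agree (insert ''a'' (wr accum)) \<mu> \<nu>"
    then have ag: "agree {''a'', ''D''} \<mu> \<nu>" by (simp add: accum_def insert_commute)
    show "ival \<nu> (rd ''m'') = dm G" using net by (simp add: agreeD[OF ag] has_net_def)
    assume a: "a < dm G" "rmem \<nu> ''D'' 0 = (\<Sum>b<a. ?f b)" "imem \<nu> ''a'' 0 = a"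
    have "imem \<nu> ''tail'' a = dtail G a" "imem \<nu> ''head'' a = dhead G a" "rmem \<nu> ''w'' a = dweight G a"
      using net a(1) by (simp_all add: agreeD[OF ag] has_net_def array_def)
    then show "exs M accum \<nu> (\<lambda>\<nu>'. rmem (istore ''a'' 0 (Suc a) \<nu>') ''D'' 0 = (\<Sum>b<Suc a. ?f b))"
      unfolding accum_def exs_simps using a by (simp add: agreeD[OF ag])
  qed (use M D s in \<open>simp_all add: accum_def\<close>)
  then show ?thesis
    by (rule run_mono) (simp_all add: dcut_weight_cut_of[OF wf c(1)] dcut_weight_cut_of[OF wf c(2)] sum_subtractf right_diff_distrib)
qed

lemma run_copy:
  assumes n: "2 + 2 * imem \<mu> ''hm'' 0 + ml \<mu> = n" and M: "bnd M \<mu>" "n \<le> M" and s: "(n + 1) * wlen M \<le> s"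
  shows "run (For ''x'' num_nodes copy_step) \<mu> (cst (For ''x'' num_nodes copy_step) * s)
    (\<lambda>\<nu>. (\<forall>v. imem \<nu> ''bc'' v = (if v < n then imem \<mu> ''cand'' v else imem \<mu> ''bc'' v)) \<and> bnd M \<nu>)"
proof (rule run_For_simple_cst[where I="\<lambda>i \<nu>. \<forall>v. imem \<nu> ''bc'' v = (if v < i then imem \<mu> ''cand'' v else imem \<mu> ''bc'' v)"])
  fix i \<nu> assume ag: "agree (insert ''x'' (wr copy_step)) \<mu> \<nu>"
  then have ag: "agree {''x'', ''bc''} \<mu> \<nu>" by (simp add: copy_step_def insert_commute)
  show "ival \<nu> num_nodes = n" using n by (simp add: agreeD[OF ag] num_nodes_def ml_def)
  assume a: "\<forall>v. imem \<nu> ''bc'' v = (if v < i then imem \<mu> ''cand'' v else imem \<mu> ''bc'' v)" "imem \<nu> ''x'' 0 = i"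
  have "imem \<mu> ''cand'' i \<le> M" using M(1) by (simp add: bnd_def)
  then show "exs M copy_step \<nu> (\<lambda>\<nu>'. \<forall>v. imem (istore ''x'' 0 (Suc i) \<nu>') ''bc'' v = (if v < Suc i then imem \<mu> ''cand'' v else imem \<mu> ''bc'' v))"
    unfolding copy_step_def exs_simps using a by (simp add: agreeD[OF ag] less_Suc_eq)
qed (use M s in \<open>simp_all add: copy_step_def\<close>)

lemma bnd_le: "bnd M \<mu> \<Longrightarrow> imem \<mu> x i \<le> M"
  by (simp add: bnd_def)

lemma fits_cong: "agree (- set inst_names) \<mu> \<nu> \<Longrightarrow> fits M \<mu> \<Longrightarrow> bnd M \<nu> \<Longrightarrow> fits M \<nu>"
  using minst_cong[of \<mu> \<nu>] by (simp add: fits_def)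

text \<open>Fixing cells 0 and 1 turns any candidate into a cut between source and sink and does not
  change the set of a minimum one. Keeping the lighter of two valid cuts then preserves minimality,
  whichever of them had it.\<close>

lemma run_compare:
  assumes \<mu>: "fits M \<mu>" and f: "fresh (set net_names \<union> {''seen'', ''D''}) \<mu>"
    and c: "\<And>v. imem \<mu> ''cand'' v \<le> 1" and b: "zo_cut (imem \<mu> ''bc'')"
    and s: "(dn (mnet \<mu>) + dm (mnet \<mu>) + mp \<mu> + 1) * wlen M \<le> s"
  shows "run compare \<mu> (cst compare * s) (\<lambda>\<nu>. zo_cut (imem \<nu> ''bc'') \<and>
     (min_st_cut (mnet \<mu>) 0 1 (cut_of (mnet \<mu>) (imem \<mu> ''bc'')) \<or> min_st_cut (mnet \<mu>) 0 1 (cut_of (mnet \<mu>) (imem \<mu> ''cand''))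
        \<longrightarrow> min_st_cut (mnet \<mu>) 0 1 (cut_of (mnet \<mu>) (imem \<nu> ''bc''))))"
  unfolding compare_def
proof (rule run_Seq_cst)
  let ?G = "mnet \<mu>"
  let ?S = "\<lambda>c. cut_of ?G c"
  have M: "minc \<mu>" "2 + 2 * imem \<mu> ''hm'' 0 + ml \<mu> \<le> M" "5 * mp \<mu> \<le> M" "2 \<le> M" "bnd M \<mu>" "dn ?G \<le> M" "dm ?G \<le> M" "2 \<le> dn ?G"
    using \<mu> dm_mnet(2)[of \<mu>] by (auto simp: fits_def dn_mnet)
  have s': "wlen M \<le> s" "(mp \<mu> + 1) * wlen M \<le> s" "(dm ?G + 1) * wlen M \<le> s" "(dn ?G + 1) * wlen M \<le> s"
    using s by (simp_all add: add_mult_distrib)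
  let ?c = "(imem \<mu> ''cand'')(0 := 1, 1 := 0)" and ?b = "imem \<mu> ''bc''"
  have c': "zo_cut ?c" using c by (simp add: zo_cut_def)
  let ?i = "Seq (IAssign ''cand'' (IConst 0) (IConst 1)) (IAssign ''cand'' (IConst 1) (IConst 0))"
  show "run ?i \<mu> (cst ?i * s) (\<lambda>\<nu>. imem \<nu> ''cand'' = ?c \<and> bnd M \<nu>)"
    by (rule run_simple_cst[OF _ M(5) s'(1)]) (use M(4) in \<open>simp_all add: exs_simps\<close>)
  fix \<nu>1 assume \<nu>1: "imem \<nu>1 ''cand'' = ?c \<and> bnd M \<nu>1" and "agree (wr ?i) \<mu> \<nu>1"
  then have ag1: "agree {''cand''} \<mu> \<nu>1" by simp
  have agi1: "agree (- set inst_names) \<mu> \<nu>1" by (rule agree_mono[OF ag1]) (simp add: inst_names_def)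
  note eq1 = minst_cong[OF agi1]
  let ?post = "\<lambda>\<nu>. zo_cut (imem \<nu> ''bc'') \<and> (min_st_cut ?G 0 1 (?S ?b) \<or> min_st_cut ?G 0 1 (?S (imem \<mu> ''cand''))
        \<longrightarrow> min_st_cut ?G 0 1 (?S (imem \<nu> ''bc'')))"
  let ?d = "Cond (RLess (RRead ''D'' (IConst 0)) (ROf (IConst 0))) (For ''x'' num_nodes copy_step) Skip"
  let ?e = "Seq (For ''a'' (rd ''m'') accum) ?d"
  show "run (Seq build ?e) \<nu>1 (cst (Seq build ?e) * s) ?post"
  proof (rule run_Seq_cst)
    show "run build \<nu>1 (cst build * s) (\<lambda>\<nu>. has_net (mnet \<nu>1) \<nu> \<and> bnd M \<nu>)"
      by (rule run_build) (use M s' f \<nu>1 in \<open>auto simp: fresh_def eq1 agreeD[OF ag1] net_names_def\<close>)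
    fix \<nu>2 assume \<nu>2: "has_net (mnet \<nu>1) \<nu>2 \<and> bnd M \<nu>2" and "agree (wr build) \<nu>1 \<nu>2"
    then have ag2: "agree {''n'', ''t'', ''a'', ''e'', ''v'', ''seen'', ''tail'', ''head'', ''w'', ''m''} \<nu>1 \<nu>2"
      by (simp add: wr_build)
    have cb2: "imem \<nu>2 ''cand'' = ?c" "imem \<nu>2 ''bc'' = ?b"
      using \<nu>1 by (simp_all add: agreeD[OF ag2] agreeD[OF ag1])
    have D2: "rmem \<nu>2 ''D'' 0 = 0" using f by (simp add: agreeD[OF ag2] agreeD[OF ag1] fresh_def)
    have "run (For ''a'' (rd ''m'') accum) \<nu>2 (cst (For ''a'' (rd ''m'') accum) * s)
      (\<lambda>\<nu>. rmem \<nu> ''D'' 0 = dcut_weight ?G (?S ?c) - dcut_weight ?G (?S ?b) \<and> bnd M \<nu>)"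
      using run_accum[of ?G \<nu>2 M s] \<nu>2 D2 M s' wf_mnet[OF M(1)] c' b by (simp add: eq1 cb2 zo_cut_def)
    then show "run ?e \<nu>2 (cst ?e * s) ?post"
    proof (rule run_Seq_cst)
      fix \<nu>3 assume \<nu>3: "rmem \<nu>3 ''D'' 0 = dcut_weight ?G (?S ?c) - dcut_weight ?G (?S ?b) \<and> bnd M \<nu>3"
        and "agree (wr (For ''a'' (rd ''m'') accum)) \<nu>2 \<nu>3"
      then have ag3: "agree {''a'', ''D''} \<nu>2 \<nu>3" by (simp add: accum_def)
      have cb3: "imem \<nu>3 ''cand'' = ?c" "imem \<nu>3 ''bc'' = ?b" using cb2 by (simp_all add: agreeD[OF ag3])
      have n3: "2 + 2 * imem \<nu>3 ''hm'' 0 + ml \<nu>3 = dn ?G"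
        by (simp add: agreeD[OF ag3] agreeD[OF ag2] agreeD[OF ag1] dn_mnet ml_def)
      have min_c: "min_st_cut ?G 0 1 (?S (imem \<mu> ''cand'')) \<Longrightarrow> ?S (imem \<mu> ''cand'') = ?S ?c"
        by (auto simp: min_st_cut_def st_set_def cut_of_def)
      show "run ?d \<nu>3 (cst ?d * s) ?post"
      proof (rule run_Cond_cst)
        assume "bval \<nu>3 (RLess (RRead ''D'' (IConst 0)) (ROf (IConst 0)))"
        then have less: "dcut_weight ?G (?S ?c) \<le> dcut_weight ?G (?S ?b)" using \<nu>3 by simp
        show "run (For ''x'' num_nodes copy_step) \<nu>3 (cst (For ''x'' num_nodes copy_step) * s) ?post"
        proof (rule run_mono[OF run_copy[OF n3]])
          fix \<nu> assume "(\<forall>v. imem \<nu> ''bc'' v = (if v < dn ?G then imem \<nu>3 ''cand'' v else imem \<nu>3 ''bc'' v)) \<and> bnd M \<nu>"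
          then have bc: "imem \<nu> ''bc'' v = (if v < dn ?G then ?c v else ?b v)" for v using cb3 by simp
          have zo: "zo_cut (imem \<nu> ''bc'')" using c' b M(8) unfolding zo_cut_def bc by simp
          have "?S (imem \<nu> ''bc'') = ?S ?c" by (auto simp: cut_of_def bc)
          moreover have "min_st_cut ?G 0 1 (?S ?b) \<Longrightarrow> min_st_cut ?G 0 1 (?S ?c)"
            using min_st_cut_le[OF _ st_set_zo_cut[OF c' M(8)] less] .
          ultimately show "?post \<nu>" using zo min_c by auto
        qed (use \<nu>3 M s' in auto)
      next
        assume "\<not> bval \<nu>3 (RLess (RRead ''D'' (IConst 0)) (ROf (IConst 0)))"
        then have le: "dcut_weight ?G (?S ?b) \<le> dcut_weight ?G (?S ?c)" using \<nu>3 by simp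
        have "min_st_cut ?G 0 1 (?S ?c) \<Longrightarrow> min_st_cut ?G 0 1 (?S ?b)"
          using min_st_cut_le[OF _ st_set_zo_cut[OF b M(8)] le] .
        then have "?post \<nu>3" using min_c b cb3 by auto
        have "run Skip \<nu>3 (cst Skip * s) (\<lambda>\<nu>. \<nu> = \<nu>3 \<and> bnd M \<nu>)"
          by (rule run_simple_cst) (use \<nu>3 s' in \<open>simp_all add: exs_simps\<close>)
        then show "run Skip \<nu>3 (cst Skip * s) ?post"
          by (rule run_mono) (use \<open>?post \<nu>3\<close> in auto)
      qed (use \<nu>3 s' in auto)
    qed
  qed
qed

text \<open>The best cut is bad afterwards only if it was bad before and the new sample is bad too.
  The indicators multiply, and the sample contributes an expected factor of at most 1/2 whatever
  happened before.\<close>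

lemma ok_rep:
  assumes P: "solver P tp" and \<mu>: "fits M \<mu>" and f: "fresh (set net_names \<union> {''seen'', ''cand'', ''D''}) \<mu>"
    and b: "zo_cut (imem \<mu> ''bc'')"
    and s: "(dn (mnet \<mu>) + dm (mnet \<mu>) + mp \<mu> + 1) * wlen M + 2 * tp (dm (mnet \<mu>)) (dn (mnet \<mu>)) + normK * wlen M * (dn (mnet \<mu>) + 1) \<le> s"
  shows "ok (rep P) \<mu> (cst (rep P) * s) (\<lambda>\<nu>. zo_cut (imem \<nu> ''bc''))
    (\<lambda>\<nu>. of_bool (\<not> min_st_cut (mnet \<mu>) 0 1 (cut_of (mnet \<mu>) (imem \<nu> ''bc''))))
    (ennreal (1/2) * of_bool (\<not> min_st_cut (mnet \<mu>) 0 1 (cut_of (mnet \<mu>) (imem \<mu> ''bc''))))"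
  unfolding rep_def
proof (rule ok_Seq_cst)
  let ?G = "mnet \<mu>"
  let ?S = "\<lambda>c. cut_of ?G c"
  let ?bad = "\<lambda>c. of_bool (\<not> min_st_cut ?G 0 1 (?S c)) :: ennreal"
  let ?\<nu> = "overlay (''cand'' # inst_names) \<mu> zero_mem"
  have b\<mu>: "bnd M \<mu>" using \<mu> by (simp add: fits_def)
  have ag: "agree (- set inst_names) \<mu> ?\<nu>" by (simp add: agree_def)
  note eq = minst_cong[OF ag]
  have "ok (sample P) ?\<nu> (cst (sample P) * s) (\<lambda>\<nu>. \<forall>v. imem \<nu> ''cand'' v \<le> 1) (\<lambda>\<nu>. ?bad (imem \<nu> ''cand'')) (ennreal (1/2))"
  proof (rule ok_sample[OF P, of M ?\<nu> s, unfolded eq])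
    show "fits M ?\<nu>" by (rule fits_cong[OF ag \<mu>]) (use b\<mu> in \<open>simp add: bnd_overlay\<close>)
    show "fresh (set net_names \<union> {''seen'', ''cand''}) ?\<nu>"
      using f by (auto simp: fresh_def net_names_def inst_names_def fun_eq_iff)
  qed (use s in \<open>auto simp: add_mult_distrib\<close>)
  from ok_scale[OF this, of "?bad (imem \<mu> ''bc'')"]
  have "ok (sample P) ?\<nu> (cst (sample P) * s) (\<lambda>\<nu>. \<forall>v. imem \<nu> ''cand'' v \<le> 1)
    (\<lambda>\<nu>. ?bad (imem \<mu> ''bc'') * ?bad (imem \<nu> ''cand'')) (ennreal (1/2) * ?bad (imem \<mu> ''bc''))"
    by (simp add: mult.commute)
  then show "ok (Call (''cand'' # inst_names) (sample P)) \<mu> (cst (Call (''cand'' # inst_names) (sample P)) * s)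
    (\<lambda>\<nu>. (\<forall>v. imem \<nu> ''cand'' v \<le> 1)) (\<lambda>\<nu>. ?bad (imem \<mu> ''bc'') * ?bad (imem \<nu> ''cand'')) (ennreal (1/2) * ?bad (imem \<mu> ''bc''))"
  proof (intro ok_Call_cst)
    have "1 \<le> wlen M" using wlen_pos(2)[of M] by simp
    also have "\<dots> \<le> s" using s by (simp add: add_mult_distrib)
    finally show "1 \<le> s" .
  qed simp
  fix \<nu> assume \<nu>: "\<forall>v. imem \<nu> ''cand'' v \<le> 1" and "agree (wr (Call (''cand'' # inst_names) (sample P))) \<mu> \<nu>"
  then have ag1: "agree {''cand''} \<mu> \<nu>"
    by (elim agree_mono) (auto simp: sample_def wr_build norm_step_def inst_names_def net_names_def)
  have agi: "agree (- set inst_names) \<mu> \<nu>" by (rule agree_mono[OF ag1]) (simp add: inst_names_def)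
  note eq1 = minst_cong[OF agi]
  have "bnd M \<nu>" unfolding bnd_def
  proof (intro allI)
    fix x i
    have "imem \<nu> ''cand'' i \<le> 1" using \<nu> by blast
    also have "1 \<le> M" using \<mu> by (simp add: fits_def)
    finally show "imem \<nu> x i \<le> M" using b\<mu> agreeD(1)[OF ag1, of x] by (cases "x = ''cand''") (auto simp: bnd_def)
  qed
  have bc: "imem \<nu> ''bc'' = imem \<mu> ''bc''" by (simp add: agreeD[OF ag1])
  have "run compare \<nu> (cst compare * s) (\<lambda>\<kappa>. zo_cut (imem \<kappa> ''bc'') \<and>
     (min_st_cut ?G 0 1 (?S (imem \<nu> ''bc'')) \<or> min_st_cut ?G 0 1 (?S (imem \<nu> ''cand'')) \<longrightarrow> min_st_cut ?G 0 1 (?S (imem \<kappa> ''bc''))))"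
  proof (rule run_compare[of M \<nu> s, unfolded eq1])
    show "fits M \<nu>" by (rule fits_cong[OF agi \<mu> \<open>bnd M \<nu>\<close>])
    show "fresh (set net_names \<union> {''seen'', ''D''}) \<nu>"
      using f by (auto simp: fresh_def net_names_def agreeD[OF ag1])
  qed (use \<nu> b s in \<open>auto simp: bc add_mult_distrib\<close>)
  then have "run compare \<nu> (cst compare * s) (\<lambda>\<kappa>. zo_cut (imem \<kappa> ''bc'') \<and> ?bad (imem \<kappa> ''bc'') \<le> ?bad (imem \<mu> ''bc'') * ?bad (imem \<nu> ''cand''))"
    by (rule run_mono) (auto simp: bc)
  then show "ok compare \<nu> (cst compare * s) (\<lambda>\<nu>. zo_cut (imem \<nu> ''bc'')) (\<lambda>\<nu>. ?bad (imem \<nu> ''bc'')) (?bad (imem \<mu> ''bc'') * ?bad (imem \<nu> ''cand''))"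
    by (rule ok_run)
qed

text \<open>Source flags are recomputed for each instance, because a hyperedge may contain a source
  of one class and none of another. \<open>''fs''\<close> is local to an instance and so starts at
  zero.\<close>

definition fs_step :: com where
  "fs_step = Cond (ILess (IConst 0) (IRead ''src'' (IRead ''inc'' inc_at))) (IAssign ''fs'' (IRead ''eo'' inc_at) (IConst 1)) Skip"

definition extract_step :: com where
  "extract_step = IAssign ''res'' (IRead ''VL'' (IAdd (IMul (rd ''i'') (rd ''hn'')) (rd ''l'')))
     (IRead ''bc'' (IAdd (IAdd (IConst 2) (IMul (IConst 2) (rd ''hm''))) (rd ''l'')))"

definition amplify :: "com \<Rightarrow> com" where
  "amplify P = Dbl ''y'' (rd ''NN'') (Call (''bc'' # inst_names) (rep P))"

definition inst :: "com \<Rightarrow> com" where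
  "inst P = Seq (For ''a'' (IRead ''ic'' (rd ''i'')) fs_step) (Seq (Seq (IAssign ''bc'' (IConst 0) (IConst 1)) (wt ''y'' (IConst 1)))
     (Seq (amplify P) (For ''l'' (IRead ''vc'' (rd ''i'')) extract_step)))"

definition mI :: "mem \<Rightarrow> nat \<Rightarrow> nat" where
  "mI \<mu> a = imem \<mu> ''inc'' (imem \<mu> ''IL'' (imem \<mu> ''i'' 0 * imem \<mu> ''hp'' 0 + a))"

definition mVL :: "mem \<Rightarrow> nat \<Rightarrow> nat" where
  "mVL \<mu> l = imem \<mu> ''VL'' (imem \<mu> ''i'' 0 * imem \<mu> ''hn'' 0 + l)"

definition msrc :: "mem \<Rightarrow> nat \<Rightarrow> nat" where
  "msrc \<mu> j = of_bool (\<exists>a<mp \<mu>. mE \<mu> a = j \<and> imem \<mu> ''src'' (mI \<mu> a) \<noteq> 0)"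

definition mobj :: "mem \<Rightarrow> nat set \<Rightarrow> real" where
  "mobj \<mu> = incidences.obj (mE \<mu>) (mV \<mu>) (mp \<mu>) (msrc \<mu>) (imem \<mu> ''ft'') (rmem \<mu> ''hw'')"

lemma run_fs:
  assumes \<mu>: "fits M \<mu>" and f: "fresh {''fs''} \<mu>" and s: "(mp \<mu> + 1) * wlen M \<le> s"
  shows "run (For ''a'' (IRead ''ic'' (rd ''i'')) fs_step) \<mu> (cst (For ''a'' (IRead ''ic'' (rd ''i'')) fs_step) * s)
    (\<lambda>\<nu>. (\<forall>j. imem \<nu> ''fs'' j = msrc \<mu> j) \<and> bnd M \<nu>)"
  unfolding msrc_def
proof (rule run_For_simple_cst[where I="\<lambda>a \<nu>. \<forall>j. imem \<nu> ''fs'' j = of_bool (\<exists>b<a. mE \<mu> b = j \<and> imem \<mu> ''src'' (mI \<mu> b) \<noteq> 0)"])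
  fix a \<nu> assume ag: "agree (insert ''a'' (wr fs_step)) \<mu> \<nu>"
  then have ag: "agree {''a'', ''fs''} \<mu> \<nu>" by (simp add: fs_step_def insert_commute)
  show "ival \<nu> (IRead ''ic'' (rd ''i'')) = mp \<mu>" by (simp add: agreeD[OF ag] mp_def)
  assume a: "\<forall>j. imem \<nu> ''fs'' j = of_bool (\<exists>b<a. mE \<mu> b = j \<and> imem \<mu> ''src'' (mI \<mu> b) \<noteq> 0)" "imem \<nu> ''a'' 0 = a"
  have e: "ival \<nu> (IRead ''inc'' inc_at) = mI \<mu> a" "ival \<nu> (IRead ''eo'' inc_at) = mE \<mu> a"
    using a(2) by (simp_all add: inc_at_def mI_def mE_def agreeD[OF ag])
  show "exs M fs_step \<nu> (\<lambda>\<nu>'. \<forall>j. imem (istore ''a'' 0 (Suc a) \<nu>') ''fs'' j = of_bool (\<exists>b<Suc a. mE \<mu> b = j \<and> imem \<mu> ''src'' (mI \<mu> b) \<noteq> 0))"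
  proof (cases "imem \<mu> ''src'' (mI \<mu> a) = 0")
    case True
    then have "(\<exists>b<Suc a. mE \<mu> b = j \<and> imem \<mu> ''src'' (mI \<mu> b) \<noteq> 0) \<longleftrightarrow> (\<exists>b<a. mE \<mu> b = j \<and> imem \<mu> ''src'' (mI \<mu> b) \<noteq> 0)" for j
      unfolding less_Suc_eq by blast
    moreover have "\<not> bval \<nu> (ILess (IConst 0) (IRead ''src'' (IRead ''inc'' inc_at)))"
      unfolding bval.simps ival.simps(2)[of \<nu> "''src''"] e using True by (simp add: agreeD[OF ag])
    ultimately show ?thesis unfolding fs_step_def exs_simps using a(1) by simp
  next
    case False
    then have "(\<exists>b<Suc a. mE \<mu> b = j \<and> imem \<mu> ''src'' (mI \<mu> b) \<noteq> 0) \<longleftrightarrow>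
        j = mE \<mu> a \<or> (\<exists>b<a. mE \<mu> b = j \<and> imem \<mu> ''src'' (mI \<mu> b) \<noteq> 0)" for j
      unfolding less_Suc_eq by blast
    moreover have "bval \<nu> (ILess (IConst 0) (IRead ''src'' (IRead ''inc'' inc_at)))"
      unfolding bval.simps ival.simps(2)[of \<nu> "''src''"] e using False by (simp add: agreeD[OF ag])
    ultimately show ?thesis unfolding fs_step_def exs_simps e using a(1) \<mu> by (simp add: fits_def)
  qed
qed (use \<mu> f s in \<open>simp_all add: fs_step_def fits_def fresh_def\<close>)

lemma run_extract:
  assumes M: "bnd M \<mu>" "ml \<mu> \<le> M" and inj: "inj_on (mVL \<mu>) {..<ml \<mu>}" and s: "(ml \<mu> + 1) * wlen M \<le> s"
  shows "run (For ''l'' (IRead ''vc'' (rd ''i'')) extract_step) \<mu> (cst (For ''l'' (IRead ''vc'' (rd ''i'')) extract_step) * s)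
    (\<lambda>\<nu>. ((\<forall>l<ml \<mu>. imem \<nu> ''res'' (mVL \<mu> l) = imem \<mu> ''bc'' (2 + 2 * imem \<mu> ''hm'' 0 + l)) \<and>
      (\<forall>v. v \<notin> mVL \<mu> ` {..<ml \<mu>} \<longrightarrow> imem \<nu> ''res'' v = imem \<mu> ''res'' v)) \<and> bnd M \<nu>)"
proof (rule run_For_simple_cst[where I="\<lambda>i \<nu>. (\<forall>l<i. imem \<nu> ''res'' (mVL \<mu> l) = imem \<mu> ''bc'' (2 + 2 * imem \<mu> ''hm'' 0 + l)) \<and>
      (\<forall>v. v \<notin> mVL \<mu> ` {..<i} \<longrightarrow> imem \<nu> ''res'' v = imem \<mu> ''res'' v)"])
  fix i \<nu> assume ag: "agree (insert ''l'' (wr extract_step)) \<mu> \<nu>"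
  then have ag: "agree {''l'', ''res''} \<mu> \<nu>" by (simp add: extract_step_def insert_commute)
  show "ival \<nu> (IRead ''vc'' (rd ''i'')) = ml \<mu>" by (simp add: agreeD[OF ag] ml_def)
  assume i: "i < ml \<mu>" "imem \<nu> ''l'' 0 = i" and I: "(\<forall>l<i. imem \<nu> ''res'' (mVL \<mu> l) = imem \<mu> ''bc'' (2 + 2 * imem \<mu> ''hm'' 0 + l)) \<and>
      (\<forall>v. v \<notin> mVL \<mu> ` {..<i} \<longrightarrow> imem \<nu> ''res'' v = imem \<mu> ''res'' v)"
  have e: "ival \<nu> (IRead ''VL'' (IAdd (IMul (rd ''i'') (rd ''hn'')) (rd ''l''))) = mVL \<mu> i"
    "ival \<nu> (IRead ''bc'' (IAdd (IAdd (IConst 2) (IMul (IConst 2) (rd ''hm''))) (rd ''l''))) = imem \<mu> ''bc'' (2 + 2 * imem \<mu> ''hm'' 0 + i)"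
    using i(2) by (simp_all add: mVL_def agreeD[OF ag])
  have ne: "mVL \<mu> l \<noteq> mVL \<mu> i" if "l < i" for l
    using inj_onD[OF inj, of l i] that i(1) by auto
  show "exs M extract_step \<nu> (\<lambda>\<nu>'. (\<forall>l<Suc i. imem (istore ''l'' 0 (Suc i) \<nu>') ''res'' (mVL \<mu> l) = imem \<mu> ''bc'' (2 + 2 * imem \<mu> ''hm'' 0 + l)) \<and>
      (\<forall>v. v \<notin> mVL \<mu> ` {..<Suc i} \<longrightarrow> imem (istore ''l'' 0 (Suc i) \<nu>') ''res'' v = imem \<mu> ''res'' v))"
    unfolding extract_step_def exs_simps e using I ne bnd_le[OF M(1)] by (simp add: less_Suc_eq lessThan_Suc)
qed (use M s in \<open>simp_all add: extract_step_def\<close>)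

text \<open>After j rounds the potential is \<open>2 ^ j / NN\<close> if the best cut is bad, and 0
  otherwise. A round halves the expected indicator and doubles the factor, so the potential does not
  grow in expectation. It starts at \<open>1 / NN\<close> or less and dominates the indicator once
  \<open>2 ^ j\<close> has reached \<open>NN\<close>.\<close>

lemma ok_amplify:
  assumes P: "solver P tp" and \<mu>: "fits M \<mu>" "zo_cut (imem \<mu> ''bc'')" "imem \<mu> ''y'' 0 = 1" "2 * imem \<mu> ''NN'' 0 \<le> M" "1 \<le> imem \<mu> ''NN'' 0"
    and s: "(dn (mnet \<mu>) + dm (mnet \<mu>) + mp \<mu> + 1) * wlen M + 2 * tp (dm (mnet \<mu>)) (dn (mnet \<mu>)) + normK * wlen M * (dn (mnet \<mu>) + 1) \<le> s"
  shows "ok (amplify P) \<mu> (cst (amplify P) * (2 * (wlen M + 1) * s)) (\<lambda>\<nu>. zo_cut (imem \<nu> ''bc'') \<and> bnd M \<nu> \<and> agree {''y'', ''bc''} \<mu> \<nu>)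
    (\<lambda>\<nu>. of_bool (\<not> min_st_cut (mnet \<mu>) 0 1 (cut_of (mnet \<mu>) (imem \<nu> ''bc'')))) (ennreal (1 / real (imem \<mu> ''NN'' 0)))"
proof -
  let ?B = "imem \<mu> ''NN'' 0" and ?G = "mnet \<mu>"
  let ?bad = "\<lambda>c. of_bool (\<not> min_st_cut ?G 0 1 (cut_of ?G c)) :: ennreal"
  let ?I = "\<lambda>(j::nat) \<nu>. zo_cut (imem \<nu> ''bc'') \<and> agree {''y'', ''bc''} \<mu> \<nu>"
  let ?\<Phi> = "\<lambda>(j::nat) \<nu>. ennreal (2 ^ j / real ?B) * ?bad (imem \<nu> ''bc'')"
  have M1: "1 \<le> M" using \<mu>(1) by (simp add: fits_def)
  have s1: "wlen M \<le> s" "1 \<le> s" using s wlen_pos(2)[of M] by (simp_all add: add_mult_distrib)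
  have "ok (amplify P) \<mu> (cst (amplify P) * (2 * (wlen M + 1) * s)) (\<lambda>\<nu>. zo_cut (imem \<nu> ''bc'') \<and> bnd M \<nu> \<and> agree {''y'', ''bc''} \<mu> \<nu>)
    (\<lambda>\<nu>. ?bad (imem \<nu> ''bc'')) (?\<Phi> 0 \<mu>)"
    unfolding amplify_def
  proof (rule ok_Dbl[where I="?I" and \<Phi>="?\<Phi>", OF \<mu>(4) M1])
    fix j \<nu> assume b: "2 ^ j < ?B" and I: "?I j \<nu>" and bnd: "bnd M \<nu>" and y: "imem \<nu> ''y'' 0 = 2 ^ j"
    let ?o = "overlay (''bc'' # inst_names) \<nu> zero_mem"
    have agi: "agree (- set inst_names) \<mu> \<nu>" using I by (auto intro: agree_mono simp: inst_names_def)
    have ago: "agree (- set inst_names) \<mu> ?o" using agi by (simp add: agree_def)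
    have fo: "fits M ?o" by (rule fits_cong[OF ago \<mu>(1)]) (use bnd in \<open>simp add: bnd_overlay\<close>)
    have "ok (rep P) ?o (cst (rep P) * s) (\<lambda>\<nu>. zo_cut (imem \<nu> ''bc'')) (\<lambda>\<nu>. ?bad (imem \<nu> ''bc'')) (ennreal (1/2) * ?bad (imem ?o ''bc''))"
    proof (rule ok_rep[OF P fo, unfolded minst_cong[OF ago]])
      show "fresh (set net_names \<union> {''seen'', ''cand'', ''D''}) ?o"
        by (auto simp: fresh_def net_names_def inst_names_def fun_eq_iff)
    qed (use s I in auto)
    then have "ok (Call (''bc'' # inst_names) (rep P)) \<nu> (cst (Call (''bc'' # inst_names) (rep P)) * s) (\<lambda>\<nu>. zo_cut (imem \<nu> ''bc''))
        (\<lambda>\<nu>. ?bad (imem \<nu> ''bc'')) (ennreal (1/2) * ?bad (imem \<nu> ''bc''))"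
      using s1 by (intro ok_Call_cst) simp_all
    from ok_scale[OF this, of "ennreal (2 ^ Suc j / real ?B)"]
    have "ok (Call (''bc'' # inst_names) (rep P)) \<nu> (cst (Call (''bc'' # inst_names) (rep P)) * s) (\<lambda>\<nu>. zo_cut (imem \<nu> ''bc''))
        (?\<Phi> (Suc j)) (ennreal (2 ^ Suc j / real ?B) * (ennreal (1/2) * ?bad (imem \<nu> ''bc'')))" .
    moreover have "ennreal (2 ^ Suc j / real ?B) * (ennreal (1/2) * ?bad (imem \<nu> ''bc'')) = ?\<Phi> j \<nu>"
    proof -
      have "ennreal (2 ^ Suc j / real ?B) * ennreal (1/2) = ennreal (2 ^ Suc j / real ?B * (1/2))"
        by (rule ennreal_mult'[symmetric]) simp
      also have "2 ^ Suc j / real ?B * (1/2) = 2 ^ j / real ?B" by simp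
      finally show ?thesis unfolding mult.assoc[symmetric] by simp
    qed
    ultimately have ok': "ok (Call (''bc'' # inst_names) (rep P)) \<nu> (cst (Call (''bc'' # inst_names) (rep P)) * s) (\<lambda>\<nu>. zo_cut (imem \<nu> ''bc''))
        (?\<Phi> (Suc j)) (?\<Phi> j \<nu>)" by (simp only:)
    show "ok (Call (''bc'' # inst_names) (rep P)) \<nu> (cst (Call (''bc'' # inst_names) (rep P)) * s)
      (\<lambda>\<nu>'. ?I (Suc j) (istore ''y'' 0 (2 ^ Suc j) \<nu>') \<and> bnd M \<nu>' \<and> imem \<nu>' ''y'' 0 = 2 ^ j)
      (\<lambda>\<nu>'. ?\<Phi> (Suc j) (istore ''y'' 0 (2 ^ Suc j) \<nu>')) (?\<Phi> j \<nu>)"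
      using ok'
    proof (rule ok_mono)
      fix \<nu>' assume zo: "zo_cut (imem \<nu>' ''bc'')" and "agree (wr (Call (''bc'' # inst_names) (rep P))) \<nu> \<nu>'"
      then have ag: "agree {''bc''} \<nu> \<nu>'"
        by (elim agree_mono) (auto simp: rep_def compare_def sample_def wr_build accum_def copy_step_def norm_step_def inst_names_def net_names_def)
      have "bnd M \<nu>'" unfolding bnd_def
      proof (intro allI)
        fix x i
        have "imem \<nu>' ''bc'' i \<le> 1" using zo by (simp add: zo_cut_def)
        then show "imem \<nu>' x i \<le> M" using bnd M1 agreeD(1)[OF ag, of x] by (cases "x = ''bc''") (auto simp: bnd_def intro: order_trans)
      qed
      moreover have "agree {''y'', ''bc''} \<mu> (istore ''y'' 0 (2 ^ Suc j) \<nu>')"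
        using ag I by (simp add: agree_def)
      ultimately show "(?I (Suc j) (istore ''y'' 0 (2 ^ Suc j) \<nu>') \<and> bnd M \<nu>' \<and> imem \<nu>' ''y'' 0 = 2 ^ j) \<and>
        ?\<Phi> (Suc j) (istore ''y'' 0 (2 ^ Suc j) \<nu>') \<le> ?\<Phi> (Suc j) \<nu>'"
        using zo y by (simp add: agreeD[OF ag])
    qed simp_all
  next
    fix j :: nat and \<nu> assume b: "?B \<le> 2 ^ j" and I: "?I j \<nu>" and bnd: "bnd M \<nu>"
    have "real ?B \<le> real (2 ^ j)" using b by (simp only: of_nat_le_iff)
    then have "1 \<le> 2 ^ j / real ?B" using \<mu>(5) by simp
    then have "1 * ?bad (imem \<nu> ''bc'') \<le> ?\<Phi> j \<nu>" by (intro mult_right_mono) auto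
    then show "(zo_cut (imem \<nu> ''bc'') \<and> bnd M \<nu> \<and> agree {''y'', ''bc''} \<mu> \<nu>) \<and> ?bad (imem \<nu> ''bc'') \<le> ?\<Phi> j \<nu>"
      using I bnd by simp
  next
    fix j \<nu> assume "?I j \<nu>"
    then show "ival \<nu> (rd ''NN'') = ?B" using agreeD(1)[of "{''y'', ''bc''}" \<mu> \<nu> "''NN''"] by simp
  qed (use \<mu> s1 in \<open>simp_all add: fits_def\<close>)
  then show ?thesis
    by (rule ok_mono) (auto simp: of_bool_def)
qed

text \<open>Cells of \<open>''res''\<close> outside the class are left alone, so that the results of
  all instances accumulate in one array.\<close>

lemma ok_inst:
  assumes P: "solver P tp" and \<mu>: "fits M \<mu>" "2 * imem \<mu> ''NN'' 0 \<le> M" "1 \<le> imem \<mu> ''NN'' 0"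
    and f: "fresh {''fs'', ''bc''} \<mu>"
    and less: "(\<Sum>j<imem \<mu> ''hm'' 0. rmem \<mu> ''hw'' j) < rmem \<mu> ''W'' 0" and inj: "inj_on (mVL \<mu>) {..<ml \<mu>}"
    and tp: "\<And>m' n' m n. m' \<le> m \<Longrightarrow> n' \<le> n \<Longrightarrow> tp m' n' \<le> tp m n"
    and s: "(2 + 2 * imem \<mu> ''hm'' 0 + ml \<mu> + 5 * mp \<mu> + mp \<mu> + 1) * wlen M + 2 * tp (5 * mp \<mu>) (2 + 2 * imem \<mu> ''hm'' 0 + ml \<mu>)
       + normK * wlen M * (2 + 2 * imem \<mu> ''hm'' 0 + ml \<mu> + 1) \<le> s"
  shows "ok (inst P) \<mu> (cst (inst P) * (2 * (wlen M + 1) * s))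
    (\<lambda>\<nu>. (\<forall>l<ml \<mu>. imem \<nu> ''res'' (mVL \<mu> l) \<le> 1) \<and> (\<forall>v. v \<notin> mVL \<mu> ` {..<ml \<mu>} \<longrightarrow> imem \<nu> ''res'' v = imem \<mu> ''res'' v))
    (\<lambda>\<nu>. of_bool (\<not> (\<forall>Y. mobj \<mu> {l. l < ml \<mu> \<and> imem \<nu> ''res'' (mVL \<mu> l) \<noteq> 0} \<le> mobj \<mu> Y))) (ennreal (1 / real (imem \<mu> ''NN'' 0)))"
  unfolding inst_def
proof (rule run_Seq_cst)
  let ?s = "2 * (wlen M + 1) * s"
  have ss: "s \<le> ?s" by simp
  have b\<mu>: "bnd M \<mu>" and i\<mu>: "minc \<mu>" and M: "ml \<mu> \<le> M" "2 \<le> M" using \<mu> by (auto simp: fits_def)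
  have s': "(mp \<mu> + 1) * wlen M \<le> ?s" "(ml \<mu> + 1) * wlen M \<le> ?s" "wlen M \<le> ?s"
    by (rule order_trans[OF _ order_trans[OF s ss]], simp add: add_mult_distrib)+
  let ?fs = "For ''a'' (IRead ''ic'' (rd ''i'')) fs_step"
  show "run ?fs \<mu> (cst ?fs * ?s) (\<lambda>\<nu>. (\<forall>j. imem \<nu> ''fs'' j = msrc \<mu> j) \<and> bnd M \<nu>)"
    by (rule run_fs) (use \<mu> f s' in \<open>auto simp: fresh_def\<close>)
  fix \<nu>1 assume \<nu>1: "(\<forall>j. imem \<nu>1 ''fs'' j = msrc \<mu> j) \<and> bnd M \<nu>1" and "agree (wr ?fs) \<mu> \<nu>1"
  then have ag1: "agree {''a'', ''fs''} \<mu> \<nu>1" by (simp add: fs_step_def)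
  \<comment> \<open>The first best cut is the source alone: any valid cut serves as a start of the
    repetitions.\<close>
  let ?init = "Seq (IAssign ''bc'' (IConst 0) (IConst 1)) (wt ''y'' (IConst 1))"
  let ?ex = "For ''l'' (IRead ''vc'' (rd ''i'')) extract_step"
  let ?Q = "\<lambda>\<nu>. (\<forall>l<ml \<mu>. imem \<nu> ''res'' (mVL \<mu> l) \<le> 1) \<and> (\<forall>v. v \<notin> mVL \<mu> ` {..<ml \<mu>} \<longrightarrow> imem \<nu> ''res'' v = imem \<mu> ''res'' v)"
  let ?\<phi> = "\<lambda>\<nu>. of_bool (\<not> (\<forall>Y. mobj \<mu> {l. l < ml \<mu> \<and> imem \<nu> ''res'' (mVL \<mu> l) \<noteq> 0} \<le> mobj \<mu> Y)) :: ennreal"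
  show "ok (Seq ?init (Seq (amplify P) ?ex)) \<nu>1 (cst (Seq ?init (Seq (amplify P) ?ex)) * ?s) ?Q ?\<phi> (ennreal (1 / real (imem \<mu> ''NN'' 0)))"
  proof (rule run_Seq_cst)
    show "run ?init \<nu>1 (cst ?init * ?s) (\<lambda>\<nu>. (imem \<nu> ''bc'' = (\<lambda>v. of_bool (v = 0)) \<and> imem \<nu> ''y'' 0 = 1) \<and> bnd M \<nu>)"
      by (rule run_simple_cst) (use \<nu>1 s' M f in \<open>auto simp: exs_simps fresh_def fun_eq_iff agreeD[OF ag1]\<close>)
    fix \<nu>2 assume \<nu>2: "(imem \<nu>2 ''bc'' = (\<lambda>v. of_bool (v = 0)) \<and> imem \<nu>2 ''y'' 0 = 1) \<and> bnd M \<nu>2" and "agree (wr ?init) \<nu>1 \<nu>2"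
    then have ag2: "agree {''bc'', ''y''} \<nu>1 \<nu>2" by (simp add: insert_commute)
    note eqs = agreeD[OF ag2] agreeD[OF ag1]
    have m2: "mE \<nu>2 = mE \<mu>" "mV \<nu>2 = mV \<mu>" "mp \<nu>2 = mp \<mu>" "ml \<nu>2 = ml \<mu>" "imem \<nu>2 ''hm'' 0 = imem \<mu> ''hm'' 0"
      "imem \<nu>2 ''ft'' = imem \<mu> ''ft''" "rmem \<nu>2 ''hw'' = rmem \<mu> ''hw''" "rmem \<nu>2 ''W'' 0 = rmem \<mu> ''W'' 0" "mVL \<nu>2 = mVL \<mu>"
      by (simp_all add: fun_eq_iff mE_def mV_def mp_def ml_def mVL_def eqs)
    have fs2: "imem \<nu>2 ''fs'' = msrc \<mu>" using \<nu>1 by (simp add: fun_eq_iff agreeD[OF ag2])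
    have inc2: "minc \<nu>2" using i\<mu> unfolding minc_def m2 fs2 incidences_def by (simp add: msrc_def)
    have f2: "fits M \<nu>2" using \<mu>(1) \<nu>2 inc2 by (simp add: fits_def m2)
    let ?G = "mnet \<nu>2"
    have G: "dn ?G = 2 + 2 * imem \<mu> ''hm'' 0 + ml \<mu>" "dm ?G \<le> 5 * mp \<mu>" using dn_mnet[of \<nu>2] dm_mnet(2)[of \<nu>2] by (simp_all add: m2)
    \<comment> \<open>The exact number of arcs depends on how often hyperedges repeat in the
      instance; monotonicity of \<open>tp\<close> replaces it by 5 per incidence.\<close>
    have "(dn ?G + dm ?G + mp \<nu>2 + 1) * wlen M + 2 * tp (dm ?G) (dn ?G) + normK * wlen M * (dn ?G + 1)
       \<le> (2 + 2 * imem \<mu> ''hm'' 0 + ml \<mu> + 5 * mp \<mu> + mp \<mu> + 1) * wlen M + 2 * tp (5 * mp \<mu>) (2 + 2 * imem \<mu> ''hm'' 0 + ml \<mu>)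
       + normK * wlen M * (2 + 2 * imem \<mu> ''hm'' 0 + ml \<mu> + 1)"
      unfolding G(1) m2 using G(2) tp[OF G(2) order_refl] by (intro add_mono mult_right_mono mult_left_mono) auto
    then have sG: "(dn ?G + dm ?G + mp \<nu>2 + 1) * wlen M + 2 * tp (dm ?G) (dn ?G) + normK * wlen M * (dn ?G + 1) \<le> s"
      using s by (rule order_trans)
    have zo2: "zo_cut (imem \<nu>2 ''bc'')" using \<nu>2 by (simp add: zo_cut_def)
    have NN2: "imem \<nu>2 ''NN'' 0 = imem \<mu> ''NN'' 0" by (simp add: eqs)
    have amp: "ok (amplify P) \<nu>2 (cst (amplify P) * ?s) (\<lambda>\<nu>. zo_cut (imem \<nu> ''bc'') \<and> bnd M \<nu> \<and> agree {''y'', ''bc''} \<nu>2 \<nu>)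
      (\<lambda>\<nu>. of_bool (\<not> min_st_cut ?G 0 1 (cut_of ?G (imem \<nu> ''bc'')))) (ennreal (1 / real (imem \<mu> ''NN'' 0)))"
      by (rule ok_amplify[OF P f2 zo2 _ _ _ sG, unfolded NN2]) (use \<nu>2 \<mu> in auto)
    show "ok (Seq (amplify P) ?ex) \<nu>2 (cst (Seq (amplify P) ?ex) * ?s) ?Q ?\<phi> (ennreal (1 / real (imem \<mu> ''NN'' 0)))"
    proof (rule ok_Seq_cst[OF amp])
      fix \<nu>3 assume \<nu>3: "zo_cut (imem \<nu>3 ''bc'') \<and> bnd M \<nu>3 \<and> agree {''y'', ''bc''} \<nu>2 \<nu>3"
      then have ag3: "agree {''y'', ''bc''} \<nu>2 \<nu>3" by blast
      note eqs3 = agreeD[OF ag3] eqs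
      have m3: "ml \<nu>3 = ml \<mu>" "mVL \<nu>3 = mVL \<mu>" "imem \<nu>3 ''hm'' 0 = imem \<mu> ''hm'' 0" "imem \<nu>3 ''res'' = imem \<mu> ''res''"
        by (simp_all add: fun_eq_iff ml_def mVL_def eqs3)
      have "run ?ex \<nu>3 (cst ?ex * ?s)
        (\<lambda>\<nu>. ((\<forall>l<ml \<mu>. imem \<nu> ''res'' (mVL \<mu> l) = imem \<nu>3 ''bc'' (2 + 2 * imem \<mu> ''hm'' 0 + l)) \<and>
          (\<forall>v. v \<notin> mVL \<mu> ` {..<ml \<mu>} \<longrightarrow> imem \<nu> ''res'' v = imem \<mu> ''res'' v)) \<and> bnd M \<nu>)"
        by (rule run_extract[of M \<nu>3 ?s, unfolded m3]) (use \<nu>3 M inj s' in auto)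
      then have "run ?ex \<nu>3 (cst ?ex * ?s) (\<lambda>\<nu>. ?Q \<nu> \<and> ?\<phi> \<nu> \<le> of_bool (\<not> min_st_cut ?G 0 1 (cut_of ?G (imem \<nu>3 ''bc''))))"
      proof (rule run_mono)
        fix \<nu> assume r: "((\<forall>l<ml \<mu>. imem \<nu> ''res'' (mVL \<mu> l) = imem \<nu>3 ''bc'' (2 + 2 * imem \<mu> ''hm'' 0 + l)) \<and>
          (\<forall>v. v \<notin> mVL \<mu> ` {..<ml \<mu>} \<longrightarrow> imem \<nu> ''res'' v = imem \<mu> ''res'' v)) \<and> bnd M \<nu>"
        have "?Q \<nu>" using r \<nu>3 by (simp add: zo_cut_def)
        moreover have "mobj \<mu> {l. l < ml \<mu> \<and> imem \<nu> ''res'' (mVL \<mu> l) \<noteq> 0} \<le> mobj \<mu> Y"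
          if "min_st_cut ?G 0 1 (cut_of ?G (imem \<nu>3 ''bc''))" for Y
        proof -
          have I: "incidences (mE \<mu>) (mV \<mu>) (imem \<mu> ''hm'' 0) (ml \<mu>) (mp \<mu>) (msrc \<mu>) (imem \<mu> ''ft'') (rmem \<mu> ''hw'') (rmem \<mu> ''W'' 0)"
            using inc2 unfolding minc_def m2 fs2 .
          have net: "?G = network (mE \<mu>) (mV \<mu>) (imem \<mu> ''hm'' 0) (ml \<mu>) (msrc \<mu>) (imem \<mu> ''ft'') (rmem \<mu> ''hw'') (rmem \<mu> ''W'' 0) (mp \<mu>)"
            unfolding mnet_def m2 fs2 ..
          have "{l. l < ml \<mu> \<and> imem \<nu> ''res'' (mVL \<mu> l) \<noteq> 0} = {v. 2 + 2 * imem \<mu> ''hm'' 0 + v \<in> cut_of ?G (imem \<nu>3 ''bc'')}"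
            using r unfolding cut_of_def G(1) by auto
          then show ?thesis unfolding mobj_def
            using incidences.min_st_cut_network[OF I that[unfolded net] less, of Y] unfolding net by simp
        qed
        ultimately show "?Q \<nu> \<and> ?\<phi> \<nu> \<le> of_bool (\<not> min_st_cut ?G 0 1 (cut_of ?G (imem \<nu>3 ''bc'')))" by auto
      qed simp
      then show "ok ?ex \<nu>3 (cst ?ex * ?s) ?Q ?\<phi> (of_bool (\<not> min_st_cut ?G 0 1 (cut_of ?G (imem \<nu>3 ''bc''))))"
        by (rule ok_run)
    qed
  qed
qed

section \<open>Splitting the hypergraph by labels\<close>

definition cnt :: "(nat \<Rightarrow> nat) \<Rightarrow> nat \<Rightarrow> nat \<Rightarrow> nat" where
  "cnt f i n = card {u. u < n \<and> f u = i}"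

text \<open>The local number of u: its position among the indices with the same value of f. It
  identifies each class with an initial segment of the naturals.\<close>

definition rk :: "(nat \<Rightarrow> nat) \<Rightarrow> nat \<Rightarrow> nat" where
  "rk f u = cnt f (f u) u"

lemma cnt_0 [simp]: "cnt f i 0 = 0"
  by (simp add: cnt_def)

lemma cnt_Suc: "cnt f i (Suc n) = (if f n = i then Suc (cnt f i n) else cnt f i n)"
proof -
  have "{u. u < Suc n \<and> f u = i} = (if f n = i then insert n {u. u < n \<and> f u = i} else {u. u < n \<and> f u = i})"
    by (auto simp: less_Suc_eq)
  then show ?thesis by (simp add: cnt_def)
qed

lemma cnt_le: "cnt f i n \<le> n"
  by (induction n) (auto simp: cnt_Suc)

lemma cnt_mono: "m \<le> n \<Longrightarrow> cnt f i m \<le> cnt f i n"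
  by (induction n rule: dec_induct) (auto simp: cnt_Suc)

lemma rk_less: "u < n \<Longrightarrow> rk f u < cnt f (f u) n"
  using cnt_mono[of "Suc u" n f "f u"] by (simp add: rk_def cnt_Suc)

lemma rk_less_bound: "u < n \<Longrightarrow> rk f u < n"
  using rk_less[of u n f] cnt_le[of f "f u" n] by linarith

lemma bij_rk: "bij_betw (rk f) {u. u < n \<and> f u = i} {..<cnt f i n}"
proof -
  have inj: "inj_on (rk f) {u. u < n \<and> f u = i}"
  proof (rule inj_onI)
    fix u v assume *: "u \<in> {u. u < n \<and> f u = i}" "v \<in> {u. u < n \<and> f u = i}" "rk f u = rk f v"
    show "u = v"
    proof (cases u v rule: linorder_cases)
      case less
      then show ?thesis using rk_less[OF less, of f] * by (simp add: rk_def)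
    next
      case greater
      then show ?thesis using rk_less[OF greater, of f] * by (simp add: rk_def)
    qed
  qed
  moreover have "rk f ` {u. u < n \<and> f u = i} \<subseteq> {..<cnt f i n}" using rk_less by auto
  moreover have "card (rk f ` {u. u < n \<and> f u = i}) = card {..<cnt f i n}"
    using card_image[OF inj] by (simp add: cnt_def)
  ultimately have "rk f ` {u. u < n \<and> f u = i} = {..<cnt f i n}" by (intro card_subset_eq) auto
  with inj show ?thesis by (simp add: bij_betw_def)
qed

lemma rk_surj:
  assumes "l < cnt f i n"
  obtains u where "u < n" "f u = i" "rk f u = l"
proof -
  have "l \<in> rk f ` {u. u < n \<and> f u = i}"
    using bij_rk[of f n i] assms by (simp add: bij_betw_def)
  then show ?thesis using that by blast
qed

text \<open>The classes are disjoint. Applied to vertices and to incidences, this yields the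
  constraints on \<open>n_i\<close> and \<open>p_i\<close>.\<close>

lemma sum_cnt: "(\<Sum>i<k. cnt f i n) \<le> n"
proof -
  have "(\<Sum>i<k. cnt f i n) = card (\<Union>i<k. {u. u < n \<and> f u = i})"
    unfolding cnt_def by (rule card_UN_disjoint[symmetric]) auto
  also have "\<dots> \<le> card {..<n}" by (rule card_mono) auto
  finally show ?thesis by simp
qed

lemma mult_add_inj: "a < n \<Longrightarrow> b < n \<Longrightarrow> i * n + a = j * n + b \<longleftrightarrow> i = j \<and> a = (b::nat)"
proof
  assume ab: "a < n" "b < n" and eq: "i * n + a = j * n + b"
  have "(i * n + a) div n = i" "(j * n + b) div n = j" using ab by simp_all
  then have "i = j" unfolding eq by simp
  then show "i = j \<and> a = b" using eq by simp
qed simp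

text \<open>Distribution by key in one pass. Buckets have a fixed stride instead of prefix sums:
  arrays are unbounded, and an access costs only the length of the address, so that gaps are
  free.\<close>

definition bucket :: "string \<Rightarrow> string \<Rightarrow> string \<Rightarrow> string \<Rightarrow> string \<Rightarrow> iexp \<Rightarrow> com" where
  "bucket L C Q N x key = Seq (IAssign L (IAdd (IMul key (rd N)) (IRead C key)) (rd x))
     (Seq (IAssign Q (rd x) (IRead C key)) (IAssign C key (IAdd (IRead C key) (IConst 1))))"

lemma wr_bucket [simp]: "wr (bucket L C Q N x key) = {L, C, Q}" "simple (bucket L C Q N x key)"
  by (auto simp: bucket_def)

text \<open>Addresses in a bucketed array: the bucket with number \<open>i\<close> starts at \<open>i * n\<close>.\<close>

definition bucketed :: "(nat \<Rightarrow> nat) \<Rightarrow> nat \<Rightarrow> (nat \<Rightarrow> nat) \<Rightarrow> (nat \<Rightarrow> nat) \<Rightarrow> (nat \<Rightarrow> nat) \<Rightarrow> nat \<Rightarrow> bool" where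
  "bucketed f n bl bc bp v \<longleftrightarrow> (\<forall>i. bc i = cnt f i v) \<and> (\<forall>u<v. bp u = rk f u \<and> bl (f u * n + rk f u) = u)"

lemma run_bucket:
  assumes d: "distinct [L, C, Q, N, x]" and N: "imem \<mu> N 0 = n" "n \<le> M" "bnd M \<mu>" and C: "imem \<mu> C = (\<lambda>_. 0)"
    and key: "\<And>i \<nu>. i < n \<Longrightarrow> agree {L, C, Q, x} \<mu> \<nu> \<Longrightarrow> imem \<nu> x 0 = i \<Longrightarrow> ival \<nu> key = f i"
    and s: "(n + 1) * wlen M \<le> s"
  shows "run (For x (rd N) (bucket L C Q N x key)) \<mu> (cst (For x (rd N) (bucket L C Q N x key)) * s)
    (\<lambda>\<nu>. bucketed f n (imem \<nu> L) (imem \<nu> C) (imem \<nu> Q) n \<and> bnd M \<nu>)"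
proof (rule run_For_simple_cst[where I="\<lambda>v \<nu>. bucketed f n (imem \<nu> L) (imem \<nu> C) (imem \<nu> Q) v"])
  show "bucketed f n (imem (istore x 0 0 \<mu>) L) (imem (istore x 0 0 \<mu>) C) (imem (istore x 0 0 \<mu>) Q) 0"
    using d C by (simp add: bucketed_def)
  fix v \<nu> assume "agree (insert x (wr (bucket L C Q N x key))) \<mu> \<nu>"
  then have ag: "agree {L, C, Q, x} \<mu> \<nu>" by (simp add: insert_commute)
  have N': "imem \<nu> N = imem \<mu> N" by (rule agreeD(1)[OF ag]) (use d in auto)
  then show e: "ival \<nu> (rd N) = n" using N(1) by simp
  assume v: "v < n" "imem \<nu> x 0 = v" and I: "bucketed f n (imem \<nu> L) (imem \<nu> C) (imem \<nu> Q) v"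
  have ne: "L \<noteq> C" "L \<noteq> Q" "L \<noteq> x" "C \<noteq> L" "C \<noteq> Q" "C \<noteq> x" "Q \<noteq> L" "Q \<noteq> C" "Q \<noteq> x" "x \<noteq> L" "x \<noteq> C" "x \<noteq> Q"
    using d by auto
  have I1: "imem \<nu> C i = cnt f i v" for i using I by (simp add: bucketed_def)
  have I2: "imem \<nu> Q u = rk f u" "imem \<nu> L (f u * n + rk f u) = u" if "u < v" for u
    using I that by (simp_all add: bucketed_def)
  let ?c = "cnt f (f v) v"
  let ?\<nu>1 = "istore L (f v * n + ?c) v \<nu>"
  let ?\<nu>2 = "istore Q v ?c ?\<nu>1"
  let ?\<nu>3 = "istore C (f v) (Suc ?c) ?\<nu>2"
  have k0: "ival \<nu> key = f v" by (rule key[OF v(1) ag v(2)])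
  have k1: "ival ?\<nu>1 key = f v" by (rule key[OF v(1)]) (use ag v(2) ne in \<open>simp_all add: agree_def\<close>)
  have k2: "ival ?\<nu>2 key = f v" by (rule key[OF v(1)]) (use ag v(2) ne in \<open>simp_all add: agree_def\<close>)
  have c: "imem \<nu> C (f v) = ?c" by (rule I1)
  have c1: "imem ?\<nu>1 C (f v) = ?c" "imem ?\<nu>2 C (f v) = ?c" "imem ?\<nu>1 x 0 = v" using c ne v(2) by simp_all
  have cM: "Suc ?c \<le> M" using cnt_le[of f "f v" v] v N by simp
  have x: "exs M (bucket L C Q N x key) \<nu> P \<longleftrightarrow> P ?\<nu>3" for P
    unfolding bucket_def exs_simps ival.simps k0 c
    using k1 k2 c1 cM v N(1,2) N' by simp
  have "bucketed f n (imem ?\<nu>3 L) (imem ?\<nu>3 C) (imem ?\<nu>3 Q) (Suc v)"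
    unfolding bucketed_def
  proof (intro conjI allI impI)
    show "imem ?\<nu>3 C i = cnt f i (Suc v)" for i using ne by (simp add: I1 cnt_Suc)
    fix u assume u: "u < Suc v"
    show "imem ?\<nu>3 Q u = rk f u" using I2(1)[of u] u ne by (cases "u = v") (simp_all add: rk_def)
    show "imem ?\<nu>3 L (f u * n + rk f u) = u"
    proof (cases "u = v")
      case False
      then have "u < v" using u by simp
      \<comment> \<open>The new entry overwrites no old one: ranks stay below the stride, so equal
        addresses would mean equal keys and equal ranks.\<close>
      have "f u * n + rk f u \<noteq> f v * n + rk f v"
      proof
        assume eq: "f u * n + rk f u = f v * n + rk f v"
        have "rk f u < n" "rk f v < n" using rk_less_bound \<open>u < v\<close> v(1) by simp_all
        from mult_add_inj[OF this, of "f u" "f v"] eq have "f u = f v" "rk f u = rk f v" by simp_all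
        then show False using rk_less[OF \<open>u < v\<close>, of f] by (simp add: rk_def)
      qed
      then have "f u * n + rk f u \<noteq> f v * n + ?c" by (simp add: rk_def)
      then show ?thesis using I2(2)[OF \<open>u < v\<close>] ne by simp
    next
      case True
      then show ?thesis using ne by (simp add: rk_def)
    qed
  qed
  then show "exs M (bucket L C Q N x key) \<nu> (\<lambda>\<nu>'. bucketed f n (imem (istore x 0 (Suc v) \<nu>') L) (imem (istore x 0 (Suc v) \<nu>') C) (imem (istore x 0 (Suc v) \<nu>') Q) (Suc v))"
    unfolding x using ne by simp
next
  show "x \<notin> wr (bucket L C Q N x key)" using d by auto
qed (use d N s in simp_all)

definition vlab :: iexp where
  "vlab = IRead ''lab'' (rd ''v'')"

definition qlab :: iexp where
  "qlab = IRead ''lab'' (IRead ''inc'' (rd ''q''))"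

definition qlab0 :: iexp where
  "qlab0 = IRead ''lab'' (IRead ''inc'' (IRead ''off'' (IRead ''eo'' (rd ''q''))))"

text \<open>One sink flag serves all instances: a hyperedge that meets a class lies inside it iff
  its labels are constant, which is tested against its first vertex. Vertices marked as sinks set
  the flag as well.\<close>

definition ft_step :: com where
  "ft_step = Cond (BAnd (BNot (ILess qlab qlab0)) (BAnd (BNot (ILess qlab0 qlab)) (BNot (ILess (IConst 0) (IRead ''snk'' (IRead ''inc'' (rd ''q'')))))))
     Skip (IAssign ''ft'' (IRead ''eo'' (rd ''q'')) (IConst 1))"

definition inst_scope :: "string list" where
  "inst_scope = [''hn'', ''NN'', ''src'', ''VL'', ''res'', ''hm'', ''hp'', ''inc'', ''eo'', ''hw'', ''W'', ''ft'', ''pos'', ''vc'', ''IL'', ''ic'', ''i'']"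

definition prep :: com where
  "prep = Seq (For ''v'' (rd ''hn'') (bucket ''VL'' ''vc'' ''pos'' ''hn'' ''v'' vlab))
     (Seq (For ''q'' (rd ''hp'') (bucket ''IL'' ''ic'' ''iq'' ''hp'' ''q'' qlab)) (For ''q'' (rd ''hp'') ft_step))"

definition part :: "com \<Rightarrow> com" where
  "part P = Seq prep (For ''i'' (rd ''K'') (Call inst_scope (inst P)))"

definition mft :: "mem \<Rightarrow> nat \<Rightarrow> nat \<Rightarrow> nat" where
  "mft \<mu> q j = of_bool (\<exists>b<q. imem \<mu> ''eo'' b = j \<and> (imem \<mu> ''lab'' (imem \<mu> ''inc'' b) \<noteq> imem \<mu> ''lab'' (imem \<mu> ''inc'' (imem \<mu> ''off'' j))
     \<or> imem \<mu> ''snk'' (imem \<mu> ''inc'' b) \<noteq> 0))"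

lemma run_ft:
  assumes M: "bnd M \<mu>" "imem \<mu> ''hp'' 0 = p" "p \<le> M" "1 \<le> M" and f: "fresh {''ft''} \<mu>" and s: "(p + 1) * wlen M \<le> s"
  shows "run (For ''q'' (rd ''hp'') ft_step) \<mu> (cst (For ''q'' (rd ''hp'') ft_step) * s) (\<lambda>\<nu>. (\<forall>j. imem \<nu> ''ft'' j = mft \<mu> p j) \<and> bnd M \<nu>)"
proof (rule run_For_simple_cst[where I="\<lambda>q \<nu>. \<forall>j. imem \<nu> ''ft'' j = mft \<mu> q j"])
  fix q \<nu> assume ag: "agree (insert ''q'' (wr ft_step)) \<mu> \<nu>"
  then have ag: "agree {''q'', ''ft''} \<mu> \<nu>" by (simp add: ft_step_def insert_commute)
  show "ival \<nu> (rd ''hp'') = p" using M(2) by (simp add: agreeD[OF ag])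
  assume I: "\<forall>j. imem \<nu> ''ft'' j = mft \<mu> q j" and q: "imem \<nu> ''q'' 0 = q"
  let ?j = "imem \<mu> ''eo'' q"
  let ?c = "imem \<mu> ''lab'' (imem \<mu> ''inc'' q) \<noteq> imem \<mu> ''lab'' (imem \<mu> ''inc'' (imem \<mu> ''off'' ?j)) \<or> imem \<mu> ''snk'' (imem \<mu> ''inc'' q) \<noteq> 0"
  have b: "bval \<nu> (BAnd (BNot (ILess qlab qlab0)) (BAnd (BNot (ILess qlab0 qlab)) (BNot (ILess (IConst 0) (IRead ''snk'' (IRead ''inc'' (rd ''q''))))))) \<longleftrightarrow> \<not> ?c"
    using q by (auto simp: qlab_def qlab0_def agreeD[OF ag])
  show "exs M ft_step \<nu> (\<lambda>\<nu>'. \<forall>j. imem (istore ''q'' 0 (Suc q) \<nu>') ''ft'' j = mft \<mu> (Suc q) j)"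
  proof (cases ?c)
    case False
    then have nb: "bval \<nu> (BAnd (BNot (ILess qlab qlab0)) (BAnd (BNot (ILess qlab0 qlab)) (BNot (ILess (IConst 0) (IRead ''snk'' (IRead ''inc'' (rd ''q'')))))))"
      using b by blast
    from False have "mft \<mu> (Suc q) j = mft \<mu> q j" for j
      unfolding mft_def less_Suc_eq by (intro arg_cong[where f=of_bool]) blast
    with I show ?thesis unfolding ft_step_def exs_simps if_P[OF nb] by simp
  next
    case True
    then have nb: "\<not> bval \<nu> (BAnd (BNot (ILess qlab qlab0)) (BAnd (BNot (ILess qlab0 qlab)) (BNot (ILess (IConst 0) (IRead ''snk'' (IRead ''inc'' (rd ''q'')))))))"
      using b by blast
    from True have "mft \<mu> (Suc q) j = (if j = ?j then 1 else mft \<mu> q j)" for j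
      unfolding mft_def less_Suc_eq of_bool_def by (cases "j = ?j") (simp_all, blast+)
    then show ?thesis unfolding ft_step_def exs_simps if_not_P[OF nb] using I q M(4) by (simp add: agreeD[OF ag])
  qed
qed (use M f s in \<open>simp_all add: ft_step_def fresh_def mft_def\<close>)

text \<open>The hypergraph as a set of incidences q with vertex \<open>inc q\<close> and hyperedge
  \<open>eo q\<close>, where \<open>off\<close> supplies one incidence of each nonempty hyperedge.
  The last condition makes W too heavy to be cut.\<close>

definition hmem :: "hypergraph \<Rightarrow> mem \<Rightarrow> bool" where
  "hmem H \<mu> \<longleftrightarrow> wf_hypergraph H \<and> imem \<mu> ''hn'' 0 = hn H \<and> imem \<mu> ''hm'' 0 = hm H \<and> imem \<mu> ''hp'' 0 = hsize H \<and>
     (\<forall>q<hsize H. imem \<mu> ''inc'' q < hn H \<and> imem \<mu> ''eo'' q < hm H) \<and>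
     inj_on (\<lambda>q. (imem \<mu> ''eo'' q, imem \<mu> ''inc'' q)) {..<hsize H} \<and>
     (\<forall>j<hm H. hedge H j = {imem \<mu> ''inc'' q | q. q < hsize H \<and> imem \<mu> ''eo'' q = j}) \<and>
     (\<forall>q<hsize H. imem \<mu> ''off'' (imem \<mu> ''eo'' q) < hsize H \<and> imem \<mu> ''eo'' (imem \<mu> ''off'' (imem \<mu> ''eo'' q)) = imem \<mu> ''eo'' q) \<and>
     (\<forall>j<hm H. rmem \<mu> ''hw'' j = hweight H j) \<and> (\<Sum>j<hm H. hweight H j) < rmem \<mu> ''W'' 0"

lemma hmem_cong:
  "agree W \<mu> \<nu> \<Longrightarrow> W \<inter> {''hn'', ''hm'', ''hp'', ''inc'', ''eo'', ''off'', ''hw'', ''W''} = {} \<Longrightarrow> hmem H \<nu> \<longleftrightarrow> hmem H \<mu>"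
  using agreeD[of W \<mu> \<nu>] by (simp add: hmem_def)

definition lab_set :: "hypergraph \<Rightarrow> (nat \<Rightarrow> nat) \<Rightarrow> nat \<Rightarrow> nat set" where
  "lab_set H lab i = {v. v < hn H \<and> lab v = i}"

text \<open>The array \<open>r\<close> is read modulo contraction: sources always and sinks never belong to the cut.\<close>

definition good :: "hypergraph \<Rightarrow> (nat \<Rightarrow> nat) \<Rightarrow> (nat \<Rightarrow> nat) \<Rightarrow> (nat \<Rightarrow> nat) \<Rightarrow> nat \<Rightarrow> (nat \<Rightarrow> nat) \<Rightarrow> bool" where
  "good H lab src snk i r \<longleftrightarrow> (\<forall>Z. {v \<in> lab_set H lab i. src v \<noteq> 0} \<subseteq> Z \<longrightarrow> Z \<subseteq> {v \<in> lab_set H lab i. snk v = 0} \<longrightarrow>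
     hcut_weight H {v \<in> lab_set H lab i. (r v \<noteq> 0 \<or> src v \<noteq> 0) \<and> snk v = 0} \<le> hcut_weight H Z)"

lemma good_cong: "(\<And>v. v \<in> lab_set H lab i \<Longrightarrow> r v = r' v) \<Longrightarrow> good H lab src snk i r \<longleftrightarrow> good H lab src snk i r'"
proof -
  assume "\<And>v. v \<in> lab_set H lab i \<Longrightarrow> r v = r' v"
  then have "{v \<in> lab_set H lab i. (r v \<noteq> 0 \<or> src v \<noteq> 0) \<and> snk v = 0} = {v \<in> lab_set H lab i. (r' v \<noteq> 0 \<or> src v \<noteq> 0) \<and> snk v = 0}"
    by auto
  then show ?thesis by (simp add: good_def)
qed

text \<open>Carries along failures of the past and budgets for the future, which the program at hand
  does not influence.\<close>

lemma ok_add_const: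
  assumes "ok c \<mu> t Q \<phi> a"
  shows "ok c \<mu> t Q (\<lambda>\<nu>. \<phi> \<nu> + k) (a + k)"
  unfolding ok_def
proof (intro allI conjI)
  fix \<tau>
  show "lossless_spmf (exec c (\<mu>, \<tau>))" "\<forall>z\<in>set_spmf (exec c (\<mu>, \<tau>)). snd z \<le> \<tau> + t \<and> Q (fst z)"
    using assms unfolding ok_def by blast+
  have a: "(\<integral>\<^sup>+ z. \<phi> (fst z) \<partial>measure_spmf (exec c (\<mu>, \<tau>))) \<le> a" using assms unfolding ok_def by blast
  have "(\<integral>\<^sup>+ z. \<phi> (fst z) + k \<partial>measure_spmf (exec c (\<mu>, \<tau>))) =
    (\<integral>\<^sup>+ z. \<phi> (fst z) \<partial>measure_spmf (exec c (\<mu>, \<tau>))) + (\<integral>\<^sup>+ z. k \<partial>measure_spmf (exec c (\<mu>, \<tau>)))"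
    by (rule nn_integral_add) simp_all
  also have "\<dots> \<le> a + k" by (intro add_mono a nn_integral_spmf_le_const) simp
  finally show "(\<integral>\<^sup>+ z. \<phi> (fst z) + k \<partial>measure_spmf (exec c (\<mu>, \<tau>))) \<le> a + k" .
qed

definition prepd :: "hypergraph \<Rightarrow> mem \<Rightarrow> bool" where
  "prepd H \<mu> \<longleftrightarrow> hmem H \<mu> \<and> bucketed (imem \<mu> ''lab'') (hn H) (imem \<mu> ''VL'') (imem \<mu> ''vc'') (imem \<mu> ''pos'') (hn H) \<and>
     bucketed (\<lambda>q. imem \<mu> ''lab'' (imem \<mu> ''inc'' q)) (hsize H) (imem \<mu> ''IL'') (imem \<mu> ''ic'') (imem \<mu> ''iq'') (hsize H) \<and>
     imem \<mu> ''ft'' = mft \<mu> (hsize H)"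

lemma prepd_cong:
  assumes "agree W \<mu> \<nu>" "W \<subseteq> {''res'', ''i''}"
  shows "prepd H \<nu> \<longleftrightarrow> prepd H \<mu>"
proof -
  have ag: "agree {''res'', ''i''} \<mu> \<nu>" using assms by (rule agree_mono)
  have "mft \<nu> (hsize H) = mft \<mu> (hsize H)" by (intro ext) (simp add: mft_def agreeD[OF ag])
  then show ?thesis using hmem_cong[OF ag, of H] by (simp add: prepd_def agreeD[OF ag])
qed

lemma run_prep:
  assumes H: "hmem H \<mu>" and M: "bnd M \<mu>" "hn H \<le> M" "hsize H \<le> M" "1 \<le> M"
    and f: "fresh {''VL'', ''vc'', ''pos'', ''IL'', ''ic'', ''iq'', ''ft''} \<mu>"
    and s: "(hn H + hsize H + 1) * wlen M \<le> s"
  shows "run prep \<mu> (cst prep * s) (\<lambda>\<nu>. prepd H \<nu> \<and> bnd M \<nu>)"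
  unfolding prep_def
proof (rule run_Seq_cst)
  have s': "(hn H + 1) * wlen M \<le> s" "(hsize H + 1) * wlen M \<le> s" using s by (simp_all add: add_mult_distrib)
  have hn: "imem \<mu> ''hn'' 0 = hn H" and hp: "imem \<mu> ''hp'' 0 = hsize H" using H by (simp_all add: hmem_def)
  let ?l1 = "For ''v'' (rd ''hn'') (bucket ''VL'' ''vc'' ''pos'' ''hn'' ''v'' vlab)"
  let ?l2 = "For ''q'' (rd ''hp'') (bucket ''IL'' ''ic'' ''iq'' ''hp'' ''q'' qlab)"
  let ?l3 = "For ''q'' (rd ''hp'') ft_step"
  show "run ?l1 \<mu> (cst ?l1 * s) (\<lambda>\<nu>. bucketed (imem \<mu> ''lab'') (hn H) (imem \<nu> ''VL'') (imem \<nu> ''vc'') (imem \<nu> ''pos'') (hn H) \<and> bnd M \<nu>)"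
  proof (rule run_bucket)
    show "ival \<nu> vlab = imem \<mu> ''lab'' i" if "agree {''VL'', ''vc'', ''pos'', ''v''} \<mu> \<nu>" "imem \<nu> ''v'' 0 = i" for i \<nu>
      using that(2) by (simp add: vlab_def agreeD[OF that(1)])
  qed (use hn M f s' in \<open>simp_all add: fresh_def\<close>)
  fix \<nu>1 assume \<nu>1: "bucketed (imem \<mu> ''lab'') (hn H) (imem \<nu>1 ''VL'') (imem \<nu>1 ''vc'') (imem \<nu>1 ''pos'') (hn H) \<and> bnd M \<nu>1"
    and "agree (wr ?l1) \<mu> \<nu>1"
  then have ag1: "agree {''VL'', ''vc'', ''pos'', ''v''} \<mu> \<nu>1" by (simp add: insert_commute)
  show "run (Seq ?l2 ?l3) \<nu>1 (cst (Seq ?l2 ?l3) * s) (\<lambda>\<nu>. prepd H \<nu> \<and> bnd M \<nu>)"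
  proof (rule run_Seq_cst)
    show "run ?l2 \<nu>1 (cst ?l2 * s) (\<lambda>\<nu>. bucketed (\<lambda>q. imem \<mu> ''lab'' (imem \<mu> ''inc'' q)) (hsize H) (imem \<nu> ''IL'') (imem \<nu> ''ic'') (imem \<nu> ''iq'') (hsize H) \<and> bnd M \<nu>)"
    proof (rule run_bucket)
      show "ival \<nu> qlab = imem \<mu> ''lab'' (imem \<mu> ''inc'' i)" if "agree {''IL'', ''ic'', ''iq'', ''q''} \<nu>1 \<nu>" "imem \<nu> ''q'' 0 = i" for i \<nu>
        using that(2) by (simp add: qlab_def agreeD[OF that(1)] agreeD[OF ag1])
    qed (use hp M f s' \<nu>1 in \<open>simp_all add: fresh_def agreeD[OF ag1]\<close>)
    fix \<nu>2 assume \<nu>2: "bucketed (\<lambda>q. imem \<mu> ''lab'' (imem \<mu> ''inc'' q)) (hsize H) (imem \<nu>2 ''IL'') (imem \<nu>2 ''ic'') (imem \<nu>2 ''iq'') (hsize H) \<and> bnd M \<nu>2"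
      and "agree (wr ?l2) \<nu>1 \<nu>2"
    then have ag2: "agree {''IL'', ''ic'', ''iq'', ''q''} \<nu>1 \<nu>2" by (simp add: insert_commute)
    have "run ?l3 \<nu>2 (cst ?l3 * s) (\<lambda>\<nu>. (\<forall>j. imem \<nu> ''ft'' j = mft \<nu>2 (hsize H) j) \<and> bnd M \<nu>)"
      by (rule run_ft) (use hp M f s' \<nu>2 in \<open>simp_all add: fresh_def agreeD[OF ag1] agreeD[OF ag2]\<close>)
    then show "run ?l3 \<nu>2 (cst ?l3 * s) (\<lambda>\<nu>. prepd H \<nu> \<and> bnd M \<nu>)"
    proof (rule run_mono)
      fix \<nu> assume \<nu>: "(\<forall>j. imem \<nu> ''ft'' j = mft \<nu>2 (hsize H) j) \<and> bnd M \<nu>" and "agree (wr ?l3) \<nu>2 \<nu>"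
      then have ag3: "agree {''q'', ''ft''} \<nu>2 \<nu>" by (simp add: ft_step_def)
      note eqs = agreeD[OF ag3] agreeD[OF ag2] agreeD[OF ag1]
      have "mft \<nu> (hsize H) = mft \<nu>2 (hsize H)" by (intro ext) (simp add: mft_def agreeD[OF ag3])
      then have "imem \<nu> ''ft'' = mft \<nu> (hsize H)" using \<nu> by (simp add: fun_eq_iff)
      moreover have "hmem H \<nu>" using H by (simp add: hmem_def eqs)
      ultimately show "prepd H \<nu> \<and> bnd M \<nu>" using \<nu> \<nu>1 \<nu>2 by (simp add: prepd_def eqs)
    qed simp
  qed
qed

lemma bucketedD:
  assumes "bucketed f n bl bc bp n"
  shows "bc i = cnt f i n" "u < n \<Longrightarrow> bp u = rk f u" "u < n \<Longrightarrow> bl (f u * n + rk f u) = u"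
    "l < cnt f i n \<Longrightarrow> bl (i * n + l) < n \<and> f (bl (i * n + l)) = i \<and> rk f (bl (i * n + l)) = l"
proof -
  show b: "bc i = cnt f i n" "u < n \<Longrightarrow> bp u = rk f u" "u < n \<Longrightarrow> bl (f u * n + rk f u) = u" for i u
    using assms by (simp_all add: bucketed_def)
  assume "l < cnt f i n"
  then obtain u where "u < n" "f u = i" "rk f u = l" by (rule rk_surj)
  then show "bl (i * n + l) < n \<and> f (bl (i * n + l)) = i \<and> rk f (bl (i * n + l)) = l"
    using b(3)[of u] by simp
qed

text \<open>Dictionary between the memory of instance i and the hypergraph: local vertex l is the
  vertex of rank l in class i, and the objective becomes the \<open>contracted_cut\<close> of this
  class with its sources and sinks. An optimum of the network, corrected on sources and sinks, is
  then optimal among all sets that respect them, which is \<open>good\<close>.\<close>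

lemma inst_facts:
  assumes pr: "prepd H \<nu>" and M: "bnd M \<nu>" "2 + 2 * hm H + hn H \<le> M" "5 * hsize H \<le> M" and i: "imem \<nu> ''i'' 0 = i"
    and disj: "\<And>v. imem \<nu> ''src'' v = 0 \<or> imem \<nu> ''snk'' v = 0"
  defines "\<sigma> \<equiv> overlay inst_scope \<nu> zero_mem"
  shows "ml \<sigma> = cnt (imem \<nu> ''lab'') i (hn H)" "mp \<sigma> = cnt (\<lambda>q. imem \<nu> ''lab'' (imem \<nu> ''inc'' q)) i (hsize H)"
    "fits M \<sigma>" "inj_on (mVL \<sigma>) {..<ml \<sigma>}" "mVL \<sigma> ` {..<ml \<sigma>} = lab_set H (imem \<nu> ''lab'') i"
    "(\<forall>Y. mobj \<sigma> {l. l < ml \<sigma> \<and> r (mVL \<sigma> l) \<noteq> 0} \<le> mobj \<sigma> Y) \<Longrightarrow> good H (imem \<nu> ''lab'') (imem \<nu> ''src'') (imem \<nu> ''snk'') i r"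
proof -
  define lab where "lab = imem \<nu> ''lab''"
  define inc where "inc = imem \<nu> ''inc''"
  define eo where "eo = imem \<nu> ''eo''"
  define src where "src = imem \<nu> ''src''"
  define snk where "snk = imem \<nu> ''snk''"
  define off where "off = imem \<nu> ''off''"
  let ?n = "hn H" and ?p = "hsize H" and ?m = "hm H"
  let ?f2 = "\<lambda>q. lab (inc q)"
  have h: "hmem H \<nu>" using pr by (simp add: prepd_def)
  have wf: "wf_hypergraph H" using h by (simp add: hmem_def)
  have sc: "imem \<nu> ''hn'' 0 = ?n" "imem \<nu> ''hm'' 0 = ?m" "imem \<nu> ''hp'' 0 = ?p" using h by (simp_all add: hmem_def)
  have q: "inc q < ?n" "eo q < ?m" if "q < ?p" for q using h that by (simp_all add: hmem_def inc_def eo_def)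
  have injq: "inj_on (\<lambda>q. (eo q, inc q)) {..<?p}" using h by (simp add: hmem_def inc_def eo_def)
  have edge: "hedge H j = {inc q | q. q < ?p \<and> eo q = j}" if "j < ?m" for j using h that by (simp add: hmem_def inc_def eo_def)
  have off: "off (eo q) < ?p" "eo (off (eo q)) = eo q" if "q < ?p" for q using h that by (simp_all add: hmem_def off_def eo_def)
  have hw: "rmem \<nu> ''hw'' j = hweight H j" if "j < ?m" for j using h that by (simp add: hmem_def)
  have b1: "bucketed lab ?n (imem \<nu> ''VL'') (imem \<nu> ''vc'') (imem \<nu> ''pos'') ?n"
    and b2: "bucketed ?f2 ?p (imem \<nu> ''IL'') (imem \<nu> ''ic'') (imem \<nu> ''iq'') ?p"
    and ft: "imem \<nu> ''ft'' = mft \<nu> ?p"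
    using pr by (simp_all add: prepd_def lab_def inc_def)
  have \<sigma>: "imem \<sigma> x = imem \<nu> x" "rmem \<sigma> x = rmem \<nu> x" if "x \<in> set inst_scope" for x
    using that by (simp_all add: \<sigma>_def)
  have ml: "ml \<sigma> = cnt lab i ?n" using bucketedD(1)[OF b1] by (simp add: ml_def \<sigma> inst_scope_def i)
  have mp: "mp \<sigma> = cnt ?f2 i ?p" using bucketedD(1)[OF b2] by (simp add: mp_def \<sigma> inst_scope_def i)
  show "ml \<sigma> = cnt (imem \<nu> ''lab'') i (hn H)" "mp \<sigma> = cnt (\<lambda>q. imem \<nu> ''lab'' (imem \<nu> ''inc'' q)) i (hsize H)"
    using ml mp by (simp_all add: lab_def inc_def)
  \<comment> \<open>The incidence with local number a among those whose vertex has label i.\<close>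
  define qa where "qa a = imem \<nu> ''IL'' (i * ?p + a)" for a
  have qa: "qa a < ?p" "lab (inc (qa a)) = i" "rk ?f2 (qa a) = a" if "a < mp \<sigma>" for a
    using bucketedD(4)[OF b2, of a i] that by (simp_all add: qa_def mp)
  have aq: "rk ?f2 x < mp \<sigma>" "qa (rk ?f2 x) = x" if "x < ?p" "lab (inc x) = i" for x
    using rk_less[OF that(1), of ?f2] bucketedD(3)[OF b2 that(1)] that by (simp_all add: qa_def mp)
  have mE: "mE \<sigma> a = eo (qa a)" and mI: "mI \<sigma> a = inc (qa a)" for a
    by (simp_all add: mE_def mI_def \<sigma> inst_scope_def i sc qa_def eo_def inc_def)
  have mV: "mV \<sigma> a = rk lab (inc (qa a))" if "a < mp \<sigma>" for a
    using bucketedD(2)[OF b1 q(1)[OF qa(1)[OF that]]] by (simp add: mV_def \<sigma> inst_scope_def i sc qa_def inc_def)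
  define vl where "vl l = imem \<nu> ''VL'' (i * ?n + l)" for l
  have mVL: "mVL \<sigma> = vl" by (simp add: fun_eq_iff mVL_def \<sigma> inst_scope_def i sc vl_def)
  have vl: "vl l < ?n" "lab (vl l) = i" "rk lab (vl l) = l" if "l < ml \<sigma>" for l
    using bucketedD(4)[OF b1, of l i] that by (simp_all add: vl_def ml)
  have lv: "rk lab v < ml \<sigma>" "vl (rk lab v) = v" if "v < ?n" "lab v = i" for v
    using rk_less[OF that(1), of lab] bucketedD(3)[OF b1 that(1)] that by (simp_all add: vl_def ml)
  show inj: "inj_on (mVL \<sigma>) {..<ml \<sigma>}" unfolding mVL by (rule inj_onI) (metis lessThan_iff vl(3))
  define U where "U = lab_set H lab i"
  have U: "v \<in> U \<longleftrightarrow> v < ?n \<and> lab v = i" for v by (simp add: U_def lab_set_def)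
  have vlU: "vl ` {..<ml \<sigma>} = U"
  proof
    show "vl ` {..<ml \<sigma>} \<subseteq> U" using vl by (auto simp: U)
    show "U \<subseteq> vl ` {..<ml \<sigma>}"
    proof
      fix v assume "v \<in> U"
      then show "v \<in> vl ` {..<ml \<sigma>}" using lv[of v] by (intro image_eqI[where x="rk lab v"]) (simp_all add: U)
    qed
  qed
  then show "mVL \<sigma> ` {..<ml \<sigma>} = lab_set H (imem \<nu> ''lab'') i" by (simp add: mVL U_def lab_def)
  have W: "0 \<le> rmem \<nu> ''W'' 0"
  proof -
    have "0 \<le> (\<Sum>j<?m. hweight H j)" using wf by (intro sum_nonneg) (simp add: wf_hypergraph_def)
    also have "\<dots> < rmem \<nu> ''W'' 0" using h by (simp add: hmem_def)
    finally show ?thesis by simp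
  qed
  have injE: "inj_on (\<lambda>a. (mE \<sigma> a, mV \<sigma> a)) {..<mp \<sigma>}"
  proof (rule inj_onI)
    fix a b assume a: "a \<in> {..<mp \<sigma>}" and b: "b \<in> {..<mp \<sigma>}" and eq: "(mE \<sigma> a, mV \<sigma> a) = (mE \<sigma> b, mV \<sigma> b)"
    have a': "a < mp \<sigma>" "b < mp \<sigma>" using a b by simp_all
    have e: "eo (qa a) = eo (qa b)" using eq by (simp only: mE prod.inject)
    have r: "rk lab (inc (qa a)) = rk lab (inc (qa b))"
      using eq unfolding prod.inject mV[OF a'(1)] mV[OF a'(2)] by (rule conjunct2)
    have "inc (qa a) = vl (rk lab (inc (qa a)))" by (rule lv(2)[symmetric, OF q(1)[OF qa(1)[OF a'(1)]] qa(2)[OF a'(1)]])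
    also have "\<dots> = vl (rk lab (inc (qa b)))" by (simp only: r)
    also have "\<dots> = inc (qa b)" by (rule lv(2)[OF q(1)[OF qa(1)[OF a'(2)]] qa(2)[OF a'(2)]])
    finally have i': "inc (qa a) = inc (qa b)" .
    have qq: "qa a = qa b"
    proof (rule inj_onD[OF injq])
      show "(eo (qa a), inc (qa a)) = (eo (qa b), inc (qa b))" by (simp only: e i')
    qed (use qa(1)[OF a'(1)] qa(1)[OF a'(2)] in simp_all)
    have "a = rk ?f2 (qa a)" by (rule qa(3)[OF a'(1), symmetric])
    also have "\<dots> = rk ?f2 (qa b)" by (simp only: qq)
    also have "\<dots> = b" by (rule qa(3)[OF a'(2)])
    finally show "a = b" .
  qed
  have I: "incidences (mE \<sigma>) (mV \<sigma>) ?m (ml \<sigma>) (mp \<sigma>) fs (imem \<nu> ''ft'') (rmem \<nu> ''hw'') (rmem \<nu> ''W'' 0)"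
    if "\<And>j. fs j \<le> 1" for fs
  proof
    show "mE \<sigma> a < ?m" if "a < mp \<sigma>" for a unfolding mE by (rule q(2)[OF qa(1)[OF that]])
    show "mV \<sigma> a < ml \<sigma>" if "a < mp \<sigma>" for a unfolding mV[OF that] by (rule lv(1)[OF q(1)[OF qa(1)[OF that]] qa(2)[OF that]])
    show "imem \<nu> ''ft'' j \<le> 1" for j by (simp add: ft mft_def)
    show "0 \<le> rmem \<nu> ''hw'' j" if "j < ?m" for j using hw[OF that] that wf by (simp add: wf_hypergraph_def)
    show "inj_on (\<lambda>a. (mE \<sigma> a, mV \<sigma> a)) {..<mp \<sigma>}" by (rule injE)
    show "0 \<le> rmem \<nu> ''W'' 0" by (rule W)
    show "fs j \<le> 1" for j by (rule that)
  qed
  have "ml \<sigma> \<le> ?n" "mp \<sigma> \<le> ?p" by (simp_all add: ml mp cnt_le)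
  moreover have "minc \<sigma>" unfolding minc_def
    using I[of "imem \<sigma> ''fs''"] by (simp add: \<sigma> inst_scope_def sc) (simp add: \<sigma>_def inst_scope_def)
  ultimately show "fits M \<sigma>" unfolding fits_def using M
    by (simp add: \<sigma>_def bnd_overlay) (simp add: inst_scope_def sc)
  \<comment> \<open>A local incidence of hyperedge j amounts to a vertex of j inside U. All
    conditions in \<open>obj\<close> are translated by this equivalence.\<close>
  have P1: "(\<exists>a<mp \<sigma>. mE \<sigma> a = j \<and> R (inc (qa a))) \<longleftrightarrow> (\<exists>x\<in>hedge H j \<inter> U. R x)" if j: "j < ?m" for j R
  proof
    assume "\<exists>a<mp \<sigma>. mE \<sigma> a = j \<and> R (inc (qa a))"
    then obtain a where a: "a < mp \<sigma>" "eo (qa a) = j" "R (inc (qa a))" by (auto simp: mE)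
    then have "inc (qa a) \<in> hedge H j \<inter> U" using qa[OF a(1)] q edge[OF j] by (auto simp: U)
    then show "\<exists>x\<in>hedge H j \<inter> U. R x" using a(3) by blast
  next
    assume "\<exists>x\<in>hedge H j \<inter> U. R x"
    then obtain x where x: "x < ?p" "eo x = j" "lab (inc x) = i" "R (inc x)" by (auto simp: edge[OF j] U)
    then show "\<exists>a<mp \<sigma>. mE \<sigma> a = j \<and> R (inc (qa a))"
      using aq[OF x(1,3)] by (intro exI[of _ "rk ?f2 x"]) (simp add: mE)
  qed
  have P2: "(\<exists>x<?p. eo x = j \<and> R (inc x)) \<longleftrightarrow> (\<exists>x\<in>hedge H j. R x)" if "j < ?m" for j R
    unfolding edge[OF that] by blast
  define A where "A = {v \<in> U. src v \<noteq> 0}"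
  define B where "B = {v \<in> U. snk v \<noteq> 0}"
  have src1: "msrc \<sigma> j = 1 \<longleftrightarrow> hedge H j \<inter> A \<noteq> {}" if "j < ?m" for j
  proof -
    have "msrc \<sigma> j = 1 \<longleftrightarrow> (\<exists>a<mp \<sigma>. mE \<sigma> a = j \<and> src (inc (qa a)) \<noteq> 0)"
      by (simp add: msrc_def mI \<sigma> inst_scope_def src_def)
    then have "msrc \<sigma> j = 1 \<longleftrightarrow> (\<exists>x\<in>hedge H j \<inter> U. src x \<noteq> 0)"
      by (rule trans[OF _ P1[OF that, of "\<lambda>x. src x \<noteq> 0"]])
    then show ?thesis unfolding A_def by blast
  qed
  have ft1: "imem \<nu> ''ft'' j = 1 \<longleftrightarrow> \<not> hedge H j \<subseteq> U \<or> hedge H j \<inter> B \<noteq> {}" if j: "j < ?m" "hedge H j \<inter> U \<noteq> {}" for j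
  proof -
    obtain x0 where x0: "x0 < ?p" "eo x0 = j" using j(2) unfolding edge[OF j(1)] by blast
    then have o: "off j < ?p" "eo (off j) = j" using off[OF x0(1)] by simp_all
    then have oe: "inc (off j) \<in> hedge H j" unfolding edge[OF j(1)] by blast
    have e: "hedge H j \<subseteq> {..<?n}" using wf j(1) by (auto simp: wf_hypergraph_def hverts_def)
    have "imem \<nu> ''ft'' j = 1 \<longleftrightarrow> (\<exists>x<?p. eo x = j \<and> (lab (inc x) \<noteq> lab (inc (off j)) \<or> snk (inc x) \<noteq> 0))"
      unfolding ft mft_def by (simp add: lab_def inc_def off_def eo_def snk_def)
    then have 1: "imem \<nu> ''ft'' j = 1 \<longleftrightarrow> (\<exists>x\<in>hedge H j. lab x \<noteq> lab (inc (off j)) \<or> snk x \<noteq> 0)"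
      by (rule trans[OF _ P2[OF j(1), of "\<lambda>x. lab x \<noteq> lab (inc (off j)) \<or> snk x \<noteq> 0"]])
    obtain y where y0: "y \<in> hedge H j" "y \<in> U" using j(2) by blast
    have y: "y \<in> hedge H j" "lab y = i" using y0 by (simp_all add: U)
    show ?thesis
    proof (cases "hedge H j \<subseteq> U")
      case True
      then have "\<forall>x\<in>hedge H j. lab x = i" by (auto simp: U)
      then show ?thesis using 1 oe True by (auto simp: B_def)
    next
      case False
      then obtain z where z0: "z \<in> hedge H j" "z \<notin> U" by blast
      then have z: "lab z \<noteq> i" using e U by blast
      \<comment> \<open>There are vertices y inside and z outside the class, so one of them has a
        label different from that of the first vertex.\<close>
      have "imem \<nu> ''ft'' j = 1"
      proof (cases "lab (inc (off j)) = i")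
        case True
        then have "lab z \<noteq> lab (inc (off j))" using z by simp
        then show ?thesis using 1 z0(1) by blast
      next
        case False
        then have "lab y \<noteq> lab (inc (off j))" using y(2) by simp
        then show ?thesis using 1 y(1) by blast
      qed
      then show ?thesis using False by blast
    qed
  qed
  have obj: "mobj \<sigma> Y = contracted_cut H U A B {v \<in> U. rk lab v \<in> Y}" for Y
  proof -
    have Ix: "incidences (mE \<sigma>) (mV \<sigma>) ?m (ml \<sigma>) (mp \<sigma>) (msrc \<sigma>) (imem \<nu> ''ft'') (rmem \<nu> ''hw'') (rmem \<nu> ''W'' 0)"
      by (rule I) (simp add: msrc_def)
    have V: "(\<exists>b<mp \<sigma>. mE \<sigma> b = j \<and> mV \<sigma> b \<in> Y) \<longleftrightarrow> (\<exists>x\<in>hedge H j \<inter> U. rk lab x \<in> Y)"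
      "(\<exists>b<mp \<sigma>. mE \<sigma> b = j \<and> mV \<sigma> b \<notin> Y) \<longleftrightarrow> (\<exists>x\<in>hedge H j \<inter> U. rk lab x \<notin> Y)" if "j < ?m" for j
      using P1[OF that, of "\<lambda>x. rk lab x \<in> Y"] P1[OF that, of "\<lambda>x. rk lab x \<notin> Y"] mV by auto
    have J: "j \<in> mE \<sigma> ` {..<mp \<sigma>} \<longleftrightarrow> j < ?m \<and> hedge H j \<inter> U \<noteq> {}" for j
    proof -
      have "j \<in> mE \<sigma> ` {..<mp \<sigma>} \<longleftrightarrow> (\<exists>b<mp \<sigma>. mE \<sigma> b = j)" by auto
      moreover have "(\<exists>b<mp \<sigma>. mE \<sigma> b = j) \<Longrightarrow> j < ?m" using incidences.E_less[OF Ix] by blast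
      moreover have "j < ?m \<Longrightarrow> (\<exists>b<mp \<sigma>. mE \<sigma> b = j) \<longleftrightarrow> hedge H j \<inter> U \<noteq> {}"
        using P1[of j "\<lambda>_. True"] by auto
      ultimately show ?thesis by blast
    qed
    have "mobj \<sigma> Y = incidences.obj (mE \<sigma>) (mV \<sigma>) (mp \<sigma>) (msrc \<sigma>) (imem \<nu> ''ft'') (rmem \<nu> ''hw'') Y"
      by (simp add: mobj_def \<sigma> inst_scope_def)
    also have "\<dots> = contracted_cut H U A B {v \<in> U. rk lab v \<in> Y}"
      unfolding incidences.obj_def[OF Ix] contracted_cut_def
    proof (rule sum.cong)
      show "{j. j \<in> mE \<sigma> ` {..<mp \<sigma>} \<and> (msrc \<sigma> j = 1 \<or> (\<exists>b<mp \<sigma>. mE \<sigma> b = j \<and> mV \<sigma> b \<in> Y)) \<and>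
         (imem \<nu> ''ft'' j = 1 \<or> (\<exists>b<mp \<sigma>. mE \<sigma> b = j \<and> mV \<sigma> b \<notin> Y))}
        = {j. j < ?m \<and> hedge H j \<inter> U \<noteq> {} \<and> (hedge H j \<inter> A \<noteq> {} \<or> hedge H j \<inter> U \<inter> {v \<in> U. rk lab v \<in> Y} \<noteq> {}) \<and>
         (\<not> hedge H j \<subseteq> U \<or> hedge H j \<inter> B \<noteq> {} \<or> hedge H j \<inter> U - {v \<in> U. rk lab v \<in> Y} \<noteq> {})}"
      proof (intro Collect_cong)
        fix j
        have x: "hedge H j \<inter> U \<inter> {v \<in> U. rk lab v \<in> Y} \<noteq> {} \<longleftrightarrow> (\<exists>x\<in>hedge H j \<inter> U. rk lab x \<in> Y)"
          "hedge H j \<inter> U - {v \<in> U. rk lab v \<in> Y} \<noteq> {} \<longleftrightarrow> (\<exists>x\<in>hedge H j \<inter> U. rk lab x \<notin> Y)" by blast+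
        show "(j \<in> mE \<sigma> ` {..<mp \<sigma>} \<and> (msrc \<sigma> j = 1 \<or> (\<exists>b<mp \<sigma>. mE \<sigma> b = j \<and> mV \<sigma> b \<in> Y)) \<and>
         (imem \<nu> ''ft'' j = 1 \<or> (\<exists>b<mp \<sigma>. mE \<sigma> b = j \<and> mV \<sigma> b \<notin> Y))) \<longleftrightarrow>
         (j < ?m \<and> hedge H j \<inter> U \<noteq> {} \<and> (hedge H j \<inter> A \<noteq> {} \<or> hedge H j \<inter> U \<inter> {v \<in> U. rk lab v \<in> Y} \<noteq> {}) \<and>
         (\<not> hedge H j \<subseteq> U \<or> hedge H j \<inter> B \<noteq> {} \<or> hedge H j \<inter> U - {v \<in> U. rk lab v \<in> Y} \<noteq> {}))"
        proof (cases "j < ?m \<and> hedge H j \<inter> U \<noteq> {}")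
          case True
          then show ?thesis unfolding J x using src1[of j] ft1[of j] V[of j] by blast
        next
          case False
          then show ?thesis unfolding J by blast
        qed
      qed
    qed (use hw J in auto)
    finally show ?thesis .
  qed
  assume min: "\<forall>Y. mobj \<sigma> {l. l < ml \<sigma> \<and> r (mVL \<sigma> l) \<noteq> 0} \<le> mobj \<sigma> Y"
  have UH: "U \<subseteq> hverts H" by (auto simp: U hverts_def)
  have "v \<notin> B" if "v \<in> A" for v using disj[of v] that by (auto simp: A_def B_def src_def snk_def)
  then have AB: "A \<subseteq> U" "B \<subseteq> U" "A \<inter> B = {}" by (auto simp: A_def B_def)
  let ?Y = "{v \<in> U. r v \<noteq> 0}"
  have res: "{v \<in> U. rk lab v \<in> {l. l < ml \<sigma> \<and> r (mVL \<sigma> l) \<noteq> 0}} = ?Y"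
  proof (intro Collect_cong)
    show "v \<in> U \<and> rk lab v \<in> {l. l < ml \<sigma> \<and> r (mVL \<sigma> l) \<noteq> 0} \<longleftrightarrow> v \<in> U \<and> r v \<noteq> 0" for v
    proof (cases "v < ?n \<and> lab v = i")
      case True
      then show ?thesis using lv[of v] by (simp add: mVL U)
    next
      case False
      then show ?thesis unfolding U by blast
    qed
  qed
  have "hcut_weight H ((?Y \<union> A) - B) \<le> hcut_weight H Z" if Z: "A \<subseteq> Z" "Z \<subseteq> U - B" for Z
  proof -
    \<comment> \<open>Ranks are injective on U, so Z competes in the network through the set of its
      ranks.\<close>
    have "{v \<in> U. rk lab v \<in> rk lab ` Z} = Z"
    proof
      show "Z \<subseteq> {v \<in> U. rk lab v \<in> rk lab ` Z}" using Z(2) by blast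
      show "{v \<in> U. rk lab v \<in> rk lab ` Z} \<subseteq> Z"
      proof
        fix v assume "v \<in> {v \<in> U. rk lab v \<in> rk lab ` Z}"
        then obtain z where z: "z \<in> Z" "rk lab v = rk lab z" "v \<in> U" by blast
        then have "z \<in> U" using Z(2) by blast
        have lU: "vl (rk lab x) = x" if "x \<in> U" for x using lv(2)[of x] that by (simp add: U)
        have "v = vl (rk lab v)" by (rule lU[OF z(3), symmetric])
        also have "\<dots> = vl (rk lab z)" by (simp only: z(2))
        also have "\<dots> = z" by (rule lU[OF \<open>z \<in> U\<close>])
        finally have "v = z" .
        with z(1) show "v \<in> Z" by simp
      qed
    qed
    then have "mobj \<sigma> (rk lab ` Z) = contracted_cut H U A B Z" by (simp add: obj)
    also have "\<dots> = hcut_weight H Z" by (rule contracted_cut_eq[OF wf UH Z AB(2)])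
    finally have "contracted_cut H U A B ?Y \<le> hcut_weight H Z"
      using min[rule_format, of "rk lab ` Z"] unfolding obj[of "{l. l < ml \<sigma> \<and> r (mVL \<sigma> l) \<noteq> 0}"] res by simp
    moreover have "hcut_weight H ((?Y \<union> A) - B) \<le> contracted_cut H U A B ?Y"
      by (rule hcut_weight_le_contracted_cut[OF wf UH AB]) blast
    ultimately show ?thesis by linarith
  qed
  moreover have "(?Y \<union> A) - B = {v \<in> U. (r v \<noteq> 0 \<or> src v \<noteq> 0) \<and> snk v = 0}" by (auto simp: A_def B_def)
  moreover have "U - B = {v \<in> U. snk v = 0}" by (auto simp: B_def)
  ultimately show "good H (imem \<nu> ''lab'') (imem \<nu> ''src'') (imem \<nu> ''snk'') i r"
    unfolding good_def A_def U_def lab_def src_def snk_def by simp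
qed

text \<open>Time of one instance up to the constant \<open>cst\<close>: the bracket is the scale of
  one repetition, with at most \<open>5 * p\<close> arcs and \<open>2 + 2 * m + l\<close> nodes, and
  the factor in front comes from the doubling loop of \<open>amplify\<close>.\<close>

definition inst_time :: "nat \<Rightarrow> (nat \<Rightarrow> nat \<Rightarrow> nat) \<Rightarrow> nat \<Rightarrow> nat \<Rightarrow> nat \<Rightarrow> nat" where
  "inst_time M tp m l p = 2 * (wlen M + 1) * ((2 + 2 * m + l + 5 * p + p + 1) * wlen M + 2 * tp (5 * p) (2 + 2 * m + l)
       + normK * wlen M * (2 + 2 * m + l + 1))"

text \<open>Separates loop control X from the bodies Y, so that the times of the bodies may differ
  and are summed rather than multiplied by their maximum.\<close>

lemma For_time:
  fixes t :: "nat \<Rightarrow> nat"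
  assumes "(n + 1) * wlen M \<le> X" "(\<Sum>i<n. t i) \<le> cst c * Y"
  shows "(\<Sum>i<n. t i) + upcst x e * (n + 1) * wlen M + 3 * wlen M \<le> cst (For x e c) * (X + Y)"
proof -
  have c: "cst (For x e c) = upcst x e + 2 + cst c" "1 \<le> cst c" using cst_For[of x e c] cst_pos[of c] by simp_all
  have "wlen M \<le> X" using assms(1) by simp
  then have 1: "3 * wlen M \<le> 2 * X + cst c * X" using mult_le_mono1[OF c(2), of X] by linarith
  have 2: "upcst x e * ((n + 1) * wlen M) \<le> upcst x e * X" using assms(1) by (rule mult_left_mono) simp
  have "cst (For x e c) * (X + Y) = upcst x e * X + (2 * X + cst c * X) + cst c * Y + (upcst x e * Y + 2 * Y)"
    unfolding c(1) by (simp add: algebra_simps)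
  with 1 2 assms(2) show ?thesis by (simp only: mult.assoc)
qed

text \<open>Union bound as a potential: the indicator of a failure so far plus \<open>1 / NN\<close>
  for every instance still to come. An instance changes \<open>''res''\<close> only inside its own
  class, so by \<open>good_cong\<close> earlier successes persist.\<close>

lemma ok_part:
  assumes P: "solver P tp" and tp: "\<And>m' n' m n. m' \<le> m \<Longrightarrow> n' \<le> n \<Longrightarrow> tp m' n' \<le> tp m n"
    and H: "hmem H \<mu>" and M: "bnd M \<mu>" "2 + 2 * hm H + hn H \<le> M" "5 * hsize H \<le> M" "2 * imem \<mu> ''NN'' 0 \<le> M"
    and NN: "1 \<le> imem \<mu> ''NN'' 0" and K: "imem \<mu> ''K'' 0 = k" "k \<le> M"
    and disj: "\<And>v. imem \<mu> ''src'' v = 0 \<or> imem \<mu> ''snk'' v = 0" and res: "\<And>v. imem \<mu> ''res'' v \<le> 1"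
    and f: "fresh {''VL'', ''vc'', ''pos'', ''IL'', ''ic'', ''iq'', ''ft''} \<mu>"
    and s: "(hn H + hsize H + k + 1) * wlen M +
      (\<Sum>i<k. inst_time M tp (hm H) (cnt (imem \<mu> ''lab'') i (hn H)) (cnt (\<lambda>q. imem \<mu> ''lab'' (imem \<mu> ''inc'' q)) i (hsize H))) \<le> s"
  shows "ok (part P) \<mu> (cst (part P) * s) (\<lambda>\<nu>. \<forall>v. imem \<nu> ''res'' v \<le> 1)
    (\<lambda>\<nu>. of_bool (\<not> (\<forall>i<k. good H (imem \<mu> ''lab'') (imem \<mu> ''src'') (imem \<mu> ''snk'') i (imem \<nu> ''res''))))
    (ennreal (real k / real (imem \<mu> ''NN'' 0)))"
  unfolding part_def
proof (rule run_Seq_cst)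
  let ?N = "imem \<mu> ''NN'' 0"
  let ?lab = "imem \<mu> ''lab''" and ?src = "imem \<mu> ''src''" and ?snk = "imem \<mu> ''snk''"
  let ?f2 = "\<lambda>q. imem \<mu> ''lab'' (imem \<mu> ''inc'' q)"
  let ?it = "\<lambda>i. inst_time M tp (hm H) (cnt ?lab i (hn H)) (cnt ?f2 i (hsize H))"
  let ?good = "\<lambda>i r. good H ?lab ?src ?snk i r"
  let ?C = "Call inst_scope (inst P)"
  show "run prep \<mu> (cst prep * s) (\<lambda>\<nu>. prepd H \<nu> \<and> bnd M \<nu>)"
    by (rule run_prep[OF H M(1)]) (use M f s in \<open>simp_all add: add_mult_distrib\<close>)
  fix \<nu>1 assume \<nu>1: "prepd H \<nu>1 \<and> bnd M \<nu>1" and "agree (wr prep) \<mu> \<nu>1"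
  then have ag1: "agree {''VL'', ''vc'', ''pos'', ''v'', ''IL'', ''ic'', ''iq'', ''q'', ''ft''} \<mu> \<nu>1"
    by (elim agree_mono) (auto simp: prep_def ft_step_def)
  let ?I = "\<lambda>(i::nat) \<nu>. prepd H \<nu> \<and> agree {''res'', ''i''} \<nu>1 \<nu> \<and> (\<forall>v. imem \<nu> ''res'' v \<le> 1)"
  let ?\<Phi> = "\<lambda>i \<nu>. of_bool (\<not> (\<forall>i'<i. ?good i' (imem \<nu> ''res''))) + ennreal (real (k - i) / real ?N) :: ennreal"
  have "ok (For ''i'' (rd ''K'') ?C) \<nu>1 (cst (For ''i'' (rd ''K'') ?C) * s) (\<lambda>\<nu>. ?I k \<nu> \<and> bnd M \<nu> \<and> imem \<nu> ''i'' 0 = k) (?\<Phi> k) (ennreal (real k / real ?N))"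
  proof (rule ok_For[where I="?I" and \<Phi>="?\<Phi>" and t="\<lambda>i. cst ?C * ?it i", OF K(2)])
    show "bnd M \<nu>1" using \<nu>1 by simp
    have "agree {''i''} \<nu>1 (istore ''i'' 0 0 \<nu>1)" by (simp add: agree_def)
    from prepd_cong[OF this, of H] show "?I 0 (istore ''i'' 0 0 \<nu>1)"
      using \<nu>1 res by (simp add: agree_def agreeD[OF ag1])
    show "?\<Phi> 0 (istore ''i'' 0 0 \<nu>1) \<le> ennreal (real k / real ?N)" by simp
    show "ival \<nu> (rd ''K'') = k" if "?I i \<nu>" for i \<nu>
    proof -
      have "agree {''res'', ''i''} \<nu>1 \<nu>" using that by blast
      from agreeD[OF this] show ?thesis using K by (simp add: agreeD[OF ag1])
    qed
    have "(\<Sum>i<k. cst ?C * ?it i) + upcst ''i'' (rd ''K'') * (k + 1) * wlen M + 3 * wlen M \<le> cst (For ''i'' (rd ''K'') ?C) * ((k + 1) * wlen M + (\<Sum>i<k. ?it i))"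
      by (rule For_time) (simp_all add: sum_distrib_left)
    also have "\<dots> \<le> cst (For ''i'' (rd ''K'') ?C) * s"
      by (rule mult_left_mono) (use s in \<open>simp_all add: add_mult_distrib\<close>)
    finally show "(\<Sum>i<k. cst ?C * ?it i) + upcst ''i'' (rd ''K'') * (k + 1) * wlen M + 3 * wlen M \<le> cst (For ''i'' (rd ''K'') ?C) * s" .
    fix i \<nu> assume i: "i < k" and I: "?I i \<nu>" and bnd: "bnd M \<nu>" and iv: "imem \<nu> ''i'' 0 = i"
    have ag2: "agree {''res'', ''i''} \<nu>1 \<nu>" using I by blast
    note eqs = agreeD[OF ag2] agreeD[OF ag1]
    have same: "imem \<nu> ''lab'' = ?lab" "imem \<nu> ''src'' = ?src" "imem \<nu> ''snk'' = ?snk" "imem \<nu> ''inc'' = imem \<mu> ''inc''" "imem \<nu> ''NN'' 0 = ?N"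
      by (simp_all add: eqs)
    have disj': "imem \<nu> ''src'' v = 0 \<or> imem \<nu> ''snk'' v = 0" for v using disj same by simp
    define \<sigma> where "\<sigma> = overlay inst_scope \<nu> zero_mem"
    note fa = inst_facts[of H \<nu> M i, OF _ bnd M(2,3) iv disj', folded \<sigma>_def, unfolded same]
    have pr: "prepd H \<nu>" using I by blast
    have h: "hmem H \<nu>" using pr by (simp add: prepd_def)
    have s_hm: "imem \<sigma> ''hm'' 0 = hm H" "imem \<sigma> ''NN'' 0 = ?N"
      using h by (simp_all add: \<sigma>_def inst_scope_def hmem_def same)
    have it: "2 * (wlen M + 1) * ((2 + 2 * imem \<sigma> ''hm'' 0 + ml \<sigma> + 5 * mp \<sigma> + mp \<sigma> + 1) * wlen M + 2 * tp (5 * mp \<sigma>) (2 + 2 * imem \<sigma> ''hm'' 0 + ml \<sigma>)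
       + normK * wlen M * (2 + 2 * imem \<sigma> ''hm'' 0 + ml \<sigma> + 1)) = ?it i"
      unfolding inst_time_def fa(1)[OF pr] fa(2)[OF pr] s_hm ..
    have "ok (inst P) \<sigma> (cst (inst P) * ?it i)
      (\<lambda>\<nu>. (\<forall>l<ml \<sigma>. imem \<nu> ''res'' (mVL \<sigma> l) \<le> 1) \<and> (\<forall>v. v \<notin> mVL \<sigma> ` {..<ml \<sigma>} \<longrightarrow> imem \<nu> ''res'' v = imem \<sigma> ''res'' v))
      (\<lambda>\<nu>. of_bool (\<not> (\<forall>Y. mobj \<sigma> {l. l < ml \<sigma> \<and> imem \<nu> ''res'' (mVL \<sigma> l) \<noteq> 0} \<le> mobj \<sigma> Y))) (ennreal (1 / real ?N))"
      unfolding it[symmetric] s_hm(2)[symmetric]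
    proof (rule ok_inst[OF P fa(3)[OF pr] _ _ _ _ fa(4)[OF pr] tp])
      show "2 * imem \<sigma> ''NN'' 0 \<le> M" "1 \<le> imem \<sigma> ''NN'' 0" using s_hm M NN by simp_all
      show "fresh {''fs'', ''bc''} \<sigma>" by (simp add: fresh_def \<sigma>_def inst_scope_def fun_eq_iff)
      have "rmem \<sigma> ''hw'' j = hweight H j" if "j < hm H" for j using h that by (simp add: hmem_def \<sigma>_def inst_scope_def)
      then show "(\<Sum>j<imem \<sigma> ''hm'' 0. rmem \<sigma> ''hw'' j) < rmem \<sigma> ''W'' 0"
        using h by (simp add: s_hm(1) hmem_def) (simp add: \<sigma>_def inst_scope_def)
    qed simp_all
    then have "ok ?C \<nu> (cst ?C * ?it i)
      (\<lambda>\<nu>'. (\<forall>l<ml \<sigma>. imem \<nu>' ''res'' (mVL \<sigma> l) \<le> 1) \<and> (\<forall>v. v \<notin> mVL \<sigma> ` {..<ml \<sigma>} \<longrightarrow> imem \<nu>' ''res'' v = imem \<nu> ''res'' v))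
      (\<lambda>\<nu>'. of_bool (\<not> (\<forall>Y. mobj \<sigma> {l. l < ml \<sigma> \<and> imem \<nu>' ''res'' (mVL \<sigma> l) \<noteq> 0} \<le> mobj \<sigma> Y))) (ennreal (1 / real ?N))"
      unfolding \<sigma>_def
    proof (intro ok_Call_cst)
      have "1 \<le> wlen M" by (simp add: wlen_pos(2)[simplified])
      then have "1 * 1 \<le> 2 * (wlen M + 1) * ((2 + 2 * hm H + cnt ?lab i (hn H) + 5 * cnt ?f2 i (hsize H) + cnt ?f2 i (hsize H) + 1) * wlen M + 2 * tp (5 * cnt ?f2 i (hsize H)) (2 + 2 * hm H + cnt ?lab i (hn H))
         + normK * wlen M * (2 + 2 * hm H + cnt ?lab i (hn H) + 1))"
        by (intro mult_mono) simp_all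
      then show "1 \<le> ?it i" unfolding inst_time_def by simp
    qed (simp add: inst_scope_def)
    from ok_add_const[OF this, of "of_bool (\<not> (\<forall>i'<i. ?good i' (imem \<nu> ''res''))) + ennreal (real (k - Suc i) / real ?N)"]
    show "ok ?C \<nu> (cst ?C * ?it i) (\<lambda>\<nu>'. ?I (Suc i) (istore ''i'' 0 (Suc i) \<nu>') \<and> bnd M \<nu>' \<and> imem \<nu>' ''i'' 0 = i)
       (\<lambda>\<nu>'. ?\<Phi> (Suc i) (istore ''i'' 0 (Suc i) \<nu>')) (?\<Phi> i \<nu>)"
    proof (rule ok_mono)
      have "real (k - i) / real ?N = 1 / real ?N + real (k - Suc i) / real ?N"
        using i by (simp add: add_divide_distrib[symmetric] of_nat_diff)
      then have "ennreal (real (k - i) / real ?N) = ennreal (1 / real ?N) + ennreal (real (k - Suc i) / real ?N)"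
        by (simp only: ennreal_plus[symmetric] divide_nonneg_nonneg of_nat_0_le_iff zero_le_one)
      then show "ennreal (1 / real ?N) + (of_bool (\<not> (\<forall>i'<i. ?good i' (imem \<nu> ''res''))) + ennreal (real (k - Suc i) / real ?N)) \<le> ?\<Phi> i \<nu>"
        by (simp add: add.left_commute)
      fix \<nu>' assume Q: "(\<forall>l<ml \<sigma>. imem \<nu>' ''res'' (mVL \<sigma> l) \<le> 1) \<and> (\<forall>v. v \<notin> mVL \<sigma> ` {..<ml \<sigma>} \<longrightarrow> imem \<nu>' ''res'' v = imem \<nu> ''res'' v)"
        and "agree (wr ?C) \<nu> \<nu>'"
      then have ag3: "agree {''res''} \<nu> \<nu>'"
        by (elim agree_mono) (auto simp: inst_def inst_scope_def amplify_def fs_step_def extract_step_def rep_def compare_def sample_def wr_build accum_def copy_step_def norm_step_def inst_names_def net_names_def)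
      have res1: "imem \<nu>' ''res'' v \<le> 1" for v
      proof (cases "v \<in> mVL \<sigma> ` {..<ml \<sigma>}")
        case True
        then show ?thesis using Q by auto
      next
        case False
        then show ?thesis using Q I by simp
      qed
      have "bnd M \<nu>'" unfolding bnd_def
      proof (intro allI)
        fix x j
        have "imem \<nu>' ''res'' j \<le> M" using res1[of j] M(2) by simp
        then show "imem \<nu>' x j \<le> M" using bnd agreeD(1)[OF ag3, of x] by (cases "x = ''res''") (auto simp: bnd_def)
      qed
      moreover have "agree {''res'', ''i''} \<nu> (istore ''i'' 0 (Suc i) \<nu>')" using ag3 by (simp add: agree_def)
      then have "prepd H (istore ''i'' 0 (Suc i) \<nu>')" using prepd_cong[of "{''res'', ''i''}"] pr by blast
      moreover have "agree {''res'', ''i''} \<nu>1 (istore ''i'' 0 (Suc i) \<nu>')" using ag2 ag3 by (simp add: agree_def)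
      moreover have "imem \<nu>' ''i'' 0 = i" using iv by (simp add: agreeD[OF ag3])
      moreover have "?\<Phi> (Suc i) (istore ''i'' 0 (Suc i) \<nu>') \<le> of_bool (\<not> (\<forall>Y. mobj \<sigma> {l. l < ml \<sigma> \<and> imem \<nu>' ''res'' (mVL \<sigma> l) \<noteq> 0} \<le> mobj \<sigma> Y)) +
         (of_bool (\<not> (\<forall>i'<i. ?good i' (imem \<nu> ''res''))) + ennreal (real (k - Suc i) / real ?N))"
      proof -
        have "?good i' (imem \<nu>' ''res'') \<longleftrightarrow> ?good i' (imem \<nu> ''res'')" if "i' < i" for i'
        proof (rule good_cong)
          fix v assume "v \<in> lab_set H ?lab i'"
          then have "v \<notin> mVL \<sigma> ` {..<ml \<sigma>}" unfolding fa(5)[OF pr] using that by (simp add: lab_set_def)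
          then show "imem \<nu>' ''res'' v = imem \<nu> ''res'' v" using Q by blast
        qed
        moreover have "(\<forall>Y. mobj \<sigma> {l. l < ml \<sigma> \<and> imem \<nu>' ''res'' (mVL \<sigma> l) \<noteq> 0} \<le> mobj \<sigma> Y) \<Longrightarrow> ?good i (imem \<nu>' ''res'')"
          by (rule fa(6)[OF pr])
        ultimately have "of_bool (\<not> (\<forall>i'<Suc i. ?good i' (imem \<nu>' ''res''))) \<le>
            (of_bool (\<not> (\<forall>Y. mobj \<sigma> {l. l < ml \<sigma> \<and> imem \<nu>' ''res'' (mVL \<sigma> l) \<noteq> 0} \<le> mobj \<sigma> Y)) + of_bool (\<not> (\<forall>i'<i. ?good i' (imem \<nu> ''res''))) :: ennreal)"
          unfolding less_Suc_eq of_bool_def by auto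
        from add_right_mono[OF this, of "ennreal (real (k - Suc i) / real ?N)"] show ?thesis by (simp add: add.assoc)
      qed
      ultimately show "(?I (Suc i) (istore ''i'' 0 (Suc i) \<nu>') \<and> bnd M \<nu>' \<and> imem \<nu>' ''i'' 0 = i) \<and>
         ?\<Phi> (Suc i) (istore ''i'' 0 (Suc i) \<nu>') \<le> of_bool (\<not> (\<forall>Y. mobj \<sigma> {l. l < ml \<sigma> \<and> imem \<nu>' ''res'' (mVL \<sigma> l) \<noteq> 0} \<le> mobj \<sigma> Y)) +
         (of_bool (\<not> (\<forall>i'<i. ?good i' (imem \<nu> ''res''))) + ennreal (real (k - Suc i) / real ?N))"
        using res1 by simp
    qed simp
  qed
  then show "ok (For ''i'' (rd ''K'') ?C) \<nu>1 (cst (For ''i'' (rd ''K'') ?C) * s) (\<lambda>\<nu>. \<forall>v. imem \<nu> ''res'' v \<le> 1)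
    (\<lambda>\<nu>. of_bool (\<not> (\<forall>i<k. ?good i (imem \<nu> ''res'')))) (ennreal (real k / real ?N))"
    by (rule ok_mono) auto
qed

section \<open>Labelling by minimum cuts\<close>

definition offs :: "nat list list \<Rightarrow> nat \<Rightarrow> nat" where
  "offs es j = (\<Sum>i<j. length (es ! i))"

lemma offs_0 [simp]: "offs es 0 = 0"
  by (simp add: offs_def)

lemma offs_Suc: "offs es (Suc j) = offs es j + length (es ! j)"
  by (simp add: offs_def)

lemma offs_Cons: "offs (x # es) (Suc j) = length x + offs es j"
  unfolding offs_def by (simp add: sum.lessThan_Suc_shift del: sum.lessThan_Suc)

lemma offs_mono: "i \<le> j \<Longrightarrow> offs es i \<le> offs es j"
  by (induction j rule: dec_induct) (auto simp: offs_Suc)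

lemma offs_length: "offs es (length es) = length (concat es)"
  by (induction es) (simp_all add: offs_Cons)

lemma concat_offs:
  "j < length es \<Longrightarrow> a < length (es ! j) \<Longrightarrow> offs es j + a < length (concat es) \<and> concat es ! (offs es j + a) = es ! j ! a"
proof (induction es arbitrary: j)
  case (Cons x es)
  show ?case
  proof (cases j)
    case 0
    then show ?thesis using Cons.prems by (simp add: nth_append)
  next
    case (Suc i)
    then show ?thesis using Cons.IH[of i] Cons.prems by (simp add: offs_Cons nth_append add.assoc)
  qed
qed simp

lemma offs_cover: "q < length (concat es) \<Longrightarrow> \<exists>j<length es. \<exists>a<length (es ! j). q = offs es j + a"
proof (induction es arbitrary: q)
  case (Cons x es)
  show ?case
  proof (cases "q < length x")
    case True
    then show ?thesis by (intro exI[of _ 0]) simp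
  next
    case False
    then have "q - length x < length (concat es)" using Cons.prems by simp
    from Cons.IH[OF this] obtain j a where "j < length es" "a < length (es ! j)" "q - length x = offs es j + a" by blast
    with False show ?thesis by (intro exI[of _ "Suc j"] conjI exI[of _ a]) (simp_all add: offs_Cons)
  qed
qed simp

text \<open>The hyperedge to which position q of the concatenated lists belongs. An empty hyperedge
  has an empty segment, and the least index never selects it for a valid q.\<close>

definition owner :: "nat list list \<Rightarrow> nat \<Rightarrow> nat" where
  "owner es q = (LEAST j. q < offs es (Suc j))"

lemma owner_eq: "offs es j \<le> q \<Longrightarrow> q < offs es (Suc j) \<Longrightarrow> owner es q = j"
  unfolding owner_def
proof (rule Least_equality)
  fix i assume "offs es j \<le> q" "q < offs es (Suc i)"
  then show "j \<le> i" using offs_mono[of "Suc i" j es] by (meson not_less_eq_eq order_trans not_le)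
qed

lemma owner_offs: "a < length (es ! j) \<Longrightarrow> owner es (offs es j + a) = j"
  by (rule owner_eq) (simp_all add: offs_Suc)

text \<open>The exponent belongs to the program and not to the input, so the power is a single
  expression of constant size.\<close>

primrec ipow :: "nat \<Rightarrow> iexp \<Rightarrow> iexp" where
  "ipow 0 e = IConst 1"
| "ipow (Suc d) e = IMul e (ipow d e)"

lemma ival_ipow [simp]: "ival \<mu> (ipow d e) = ival \<mu> e ^ d"
  by (induction d) auto

definition init1 :: "nat \<Rightarrow> com" where
  "init1 d = Seq (wt ''hn'' (rd ''n'')) (Seq (wt ''hm'' (rd ''m'')) (Seq (wt ''hp'' (IRead ''off'' (rd ''hm'')))
     (Seq (wt ''NN'' (ipow d (IAdd (IAdd (IAdd (rd ''hp'') (rd ''hm'')) (rd ''hn'')) (IConst 1)))) (RAssign ''W'' (IConst 0) (ROf (IConst 1))))))"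

definition weight_step :: com where
  "weight_step = Seq (RAssign ''hw'' (rd ''j'') (RRead ''w'' (rd ''j'')))
     (RAssign ''W'' (IConst 0) (RAdd (RRead ''W'' (IConst 0)) (RRead ''w'' (rd ''j''))))"

definition owner_step :: com where
  "owner_step = IAssign ''eo'' (rd ''q'') (rd ''j'')"

text \<open>Continues from the current q, so that all runs together pass over the incidences
  once.\<close>

definition owner_loop :: com where
  "owner_loop = Up ''q'' (IRead ''off'' (IAdd (rd ''j'') (IConst 1))) owner_step"

definition init :: "nat \<Rightarrow> com" where
  "init d = Seq (init1 d) (Seq (For ''j'' (rd ''hm'') weight_step) (For ''j'' (rd ''hm'') owner_loop))"

definition input_lists :: "hypergraph \<Rightarrow> nat set \<Rightarrow> nat list list \<Rightarrow> nat list \<Rightarrow> mem \<Rightarrow> bool" where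
  "input_lists H R es rs \<mu> \<longleftrightarrow> wf_hypergraph H \<and> R \<subseteq> hverts H \<and> length es = hm H \<and> (\<forall>j<hm H. distinct (es ! j) \<and> set (es ! j) = hedge H j) \<and>
        distinct rs \<and> set rs = R \<and>
        \<mu> = \<lparr>imem = (\<lambda>_ _. 0)
                (''n'' := scalar (hn H), ''m'' := scalar (hm H), ''k'' := scalar (card R),
                 ''off'' := array (hm H + 1) (\<lambda>j. \<Sum>i<j. length (es ! i)),
                 ''inc'' := array (hsize H) (\<lambda>i. concat es ! i),
                 ''term'' := array (card R) (\<lambda>i. rs ! i)),
              rmem = (\<lambda>_ _. 0)(''w'' := array (hm H) (hweight H))\<rparr>"

lemma isocut_input_lists: "isocut_input (H, R) \<mu> \<Longrightarrow> \<exists>es rs. input_lists H R es rs \<mu>"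
  unfolding isocut_input_def input_lists_def by blast

definition main_mem :: "hypergraph \<Rightarrow> nat list list \<Rightarrow> nat list \<Rightarrow> nat \<Rightarrow> mem \<Rightarrow> bool" where
  "main_mem H es rs B \<mu> \<longleftrightarrow> hmem H \<mu> \<and> imem \<mu> ''NN'' 0 = B \<and> imem \<mu> ''k'' 0 = length rs \<and> (\<forall>l<length rs. imem \<mu> ''term'' l = rs ! l) \<and>
     (\<forall>q<hsize H. imem \<mu> ''inc'' q = concat es ! q)"

lemma main_mem_cong:
  "agree W \<mu> \<nu> \<Longrightarrow> W \<inter> {''hn'', ''hm'', ''hp'', ''inc'', ''eo'', ''off'', ''hw'', ''W'', ''NN'', ''k'', ''term''} = {} \<Longrightarrow>
   main_mem H es rs B \<nu> \<longleftrightarrow> main_mem H es rs B \<mu>"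
  using agreeD[of W \<mu> \<nu>] hmem_cong[of W \<mu> \<nu> H] by (simp add: main_mem_def)

lemma hsize_lists:
  assumes "length es = hm H" "\<forall>j<hm H. distinct (es ! j) \<and> set (es ! j) = hedge H j"
  shows "hsize H = length (concat es)" "hsize H = offs es (hm H)"
proof -
  show "hsize H = offs es (hm H)"
    unfolding hsize_def offs_def using assms(2) by (intro sum.cong) (auto simp: distinct_card[symmetric])
  then show "hsize H = length (concat es)" using offs_length[of es] assms(1) by simp
qed

text \<open>Each position is a hyperedge together with an index into its list, in one direction by
  \<open>dec\<close> and in the other by \<open>comp\<close>; the clauses of \<open>hmem\<close>
  follow from these two.\<close>

lemma hmem_lists:
  assumes wf: "wf_hypergraph H" and es: "length es = hm H" "\<forall>j<hm H. distinct (es ! j) \<and> set (es ! j) = hedge H j"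
    and m: "imem \<nu> ''hn'' 0 = hn H" "imem \<nu> ''hm'' 0 = hm H" "imem \<nu> ''hp'' 0 = hsize H"
      "\<And>q. q < hsize H \<Longrightarrow> imem \<nu> ''inc'' q = concat es ! q" "\<And>q. q < hsize H \<Longrightarrow> imem \<nu> ''eo'' q = owner es q"
      "\<And>j. j \<le> hm H \<Longrightarrow> imem \<nu> ''off'' j = offs es j" "\<And>j. j < hm H \<Longrightarrow> rmem \<nu> ''hw'' j = hweight H j"
      "rmem \<nu> ''W'' 0 = 1 + (\<Sum>j<hm H. hweight H j)"
  shows "hmem H \<nu>"
proof -
  note sz = hsize_lists[OF es]
  have dec: "\<exists>j<hm H. \<exists>a<length (es ! j). q = offs es j + a \<and> imem \<nu> ''eo'' q = j \<and> imem \<nu> ''inc'' q = es ! j ! a" if q: "q < hsize H" for q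
  proof -
    have "\<exists>j<hm H. \<exists>a<length (es ! j). q = offs es j + a" using offs_cover[of q es] q es(1) sz(1) by simp
    then obtain j a where ja: "j < hm H" "a < length (es ! j)" "q = offs es j + a" by blast
    have "imem \<nu> ''eo'' q = j" "imem \<nu> ''inc'' q = es ! j ! a"
      using m(4,5)[OF q] concat_offs[of j es a] owner_offs[of a es j] ja es(1) by simp_all
    with ja show ?thesis by blast
  qed
  have comp: "offs es j + a < hsize H \<and> imem \<nu> ''eo'' (offs es j + a) = j \<and> imem \<nu> ''inc'' (offs es j + a) = es ! j ! a"
    if "j < hm H" "a < length (es ! j)" for j a
    using concat_offs[of j es a] owner_offs[of a es j] m(4,5)[of "offs es j + a"] that es(1) sz(1) by simp
  have 1: "imem \<nu> ''inc'' q < hn H \<and> imem \<nu> ''eo'' q < hm H" if q: "q < hsize H" for q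
  proof -
    from dec[OF q] obtain j a where ja: "j < hm H" "a < length (es ! j)" "imem \<nu> ''eo'' q = j" "imem \<nu> ''inc'' q = es ! j ! a" by blast
    then have "es ! j ! a \<in> hedge H j" using es(2) nth_mem by blast
    then show ?thesis using ja wf by (auto simp: wf_hypergraph_def hverts_def)
  qed
  have 2: "inj_on (\<lambda>q. (imem \<nu> ''eo'' q, imem \<nu> ''inc'' q)) {..<hsize H}"
  proof (rule inj_onI)
    fix x y assume x: "x \<in> {..<hsize H}" and y: "y \<in> {..<hsize H}" and eq: "(imem \<nu> ''eo'' x, imem \<nu> ''inc'' x) = (imem \<nu> ''eo'' y, imem \<nu> ''inc'' y)"
    from x dec[of x] obtain j a where ja: "j < hm H" "a < length (es ! j)" "x = offs es j + a" "imem \<nu> ''eo'' x = j" "imem \<nu> ''inc'' x = es ! j ! a" by auto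
    from y dec[of y] obtain j' a' where ja': "a' < length (es ! j')" "y = offs es j' + a'" "imem \<nu> ''eo'' y = j'" "imem \<nu> ''inc'' y = es ! j' ! a'" by auto
    have "j' = j" using eq ja ja' by simp
    moreover have "a = a'" using eq ja ja' es(2) calculation nth_eq_iff_index_eq[of "es ! j" a a'] by simp
    ultimately show "x = y" using ja ja' by simp
  qed
  have 3: "hedge H j = {imem \<nu> ''inc'' q | q. q < hsize H \<and> imem \<nu> ''eo'' q = j}" if j: "j < hm H" for j
  proof
    show "hedge H j \<subseteq> {imem \<nu> ''inc'' q | q. q < hsize H \<and> imem \<nu> ''eo'' q = j}"
    proof
      fix v assume "v \<in> hedge H j"
      then have "v \<in> set (es ! j)" using es(2) j by simp
      then obtain a where a: "a < length (es ! j)" "es ! j ! a = v" unfolding in_set_conv_nth by blast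
      then show "v \<in> {imem \<nu> ''inc'' q | q. q < hsize H \<and> imem \<nu> ''eo'' q = j}" using comp[OF j a(1)] a(2)
        by (intro CollectI exI[of _ "offs es j + a"]) simp
    qed
    show "{imem \<nu> ''inc'' q | q. q < hsize H \<and> imem \<nu> ''eo'' q = j} \<subseteq> hedge H j"
    proof
      fix v assume "v \<in> {imem \<nu> ''inc'' q | q. q < hsize H \<and> imem \<nu> ''eo'' q = j}"
      then obtain q where q: "q < hsize H" "imem \<nu> ''eo'' q = j" "v = imem \<nu> ''inc'' q" by blast
      from dec[OF q(1)] obtain i a where ia: "a < length (es ! i)" "imem \<nu> ''eo'' q = i" "imem \<nu> ''inc'' q = es ! i ! a" by blast
      then have "v \<in> set (es ! j)" using q(2,3) nth_mem[OF ia(1)] by simp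
      then show "v \<in> hedge H j" using es(2) j by simp
    qed
  qed
  have 4: "imem \<nu> ''off'' (imem \<nu> ''eo'' q) < hsize H \<and> imem \<nu> ''eo'' (imem \<nu> ''off'' (imem \<nu> ''eo'' q)) = imem \<nu> ''eo'' q" if q: "q < hsize H" for q
  proof -
    from dec[OF q] obtain j a where ja: "j < hm H" "a < length (es ! j)" "imem \<nu> ''eo'' q = j" by blast
    have "0 < length (es ! j)" using ja(2) by linarith
    from comp[OF ja(1) this] show ?thesis using m(6)[of j] ja by simp
  qed
  have 5: "(\<Sum>j<hm H. hweight H j) < rmem \<nu> ''W'' 0" unfolding m(8) by simp
  show ?thesis unfolding hmem_def
    by (intro conjI allI impI)
      ((rule wf m(1,2,3,7) 2 3 5; assumption?) | (rule 1[THEN conjunct1] 1[THEN conjunct2] 4[THEN conjunct1] 4[THEN conjunct2]; assumption))+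
qed

lemma run_init:
  assumes inp: "input_lists H R es rs \<mu>" and B: "B = (hsize H + hm H + hn H + 1) ^ d"
    and M: "B \<le> M" "hsize H + hm H + hn H + 1 \<le> M" and s: "(2 * hsize H + 3 * hm H + 1) * wlen M \<le> s"
  shows "run (init d) \<mu> (cst (init d) * s) (\<lambda>\<nu>. main_mem H es rs B \<nu> \<and> bnd M \<nu>)"
proof -
  let ?p = "hsize H" and ?m = "hm H" and ?n = "hn H"
  have wf: "wf_hypergraph H" and R: "R \<subseteq> hverts H" and es: "length es = ?m" "\<forall>j<?m. distinct (es ! j) \<and> set (es ! j) = hedge H j"
    and rs: "distinct rs" "set rs = R"
    and \<mu>: "\<mu> = \<lparr>imem = (\<lambda>_ _. 0)
                (''n'' := scalar (hn H), ''m'' := scalar (hm H), ''k'' := scalar (card R),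
                 ''off'' := array (hm H + 1) (\<lambda>j. \<Sum>i<j. length (es ! i)),
                 ''inc'' := array (hsize H) (\<lambda>i. concat es ! i),
                 ''term'' := array (card R) (\<lambda>i. rs ! i)),
              rmem = (\<lambda>_ _. 0)(''w'' := array (hm H) (hweight H))\<rparr>"
    using inp by (simp_all add: input_lists_def)
  note sz = hsize_lists[OF es]
  have k: "card R = length rs" using rs distinct_card[of rs] by simp
  have im: "imem \<mu> ''n'' 0 = ?n" "imem \<mu> ''m'' 0 = ?m" "imem \<mu> ''k'' 0 = length rs"
    "\<And>j. j \<le> ?m \<Longrightarrow> imem \<mu> ''off'' j = offs es j" "\<And>q. q < ?p \<Longrightarrow> imem \<mu> ''inc'' q = concat es ! q"
    "\<And>l. l < length rs \<Longrightarrow> imem \<mu> ''term'' l = rs ! l" "\<And>j. j < ?m \<Longrightarrow> rmem \<mu> ''w'' j = hweight H j" "imem \<mu> ''q'' 0 = 0"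
    by (simp_all add: \<mu> k array_def offs_def)
  have kn: "length rs \<le> ?n" using R k card_mono[of "{..<?n}" R] by (simp add: hverts_def)
  have v: "concat es ! q < ?n" if q: "q < ?p" for q
  proof -
    have "\<exists>j<?m. \<exists>a<length (es ! j). q = offs es j + a" using offs_cover[of q es] q es(1) sz(1) by simp
    then obtain j a where ja: "j < ?m" "a < length (es ! j)" "q = offs es j + a" by blast
    then have "concat es ! q = es ! j ! a" using concat_offs[of j es a] es(1) by simp
    then have "concat es ! q \<in> set (es ! j)" using nth_mem[OF ja(2)] by simp
    then have "concat es ! q \<in> hedge H j" using es(2) ja(1) by simp
    then show ?thesis using ja(1) wf by (auto simp: wf_hypergraph_def hverts_def)
  qed
  have t: "rs ! l < ?n" if "l < length rs" for l using nth_mem[OF that] rs R by (auto simp: hverts_def)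
  have o: "offs es j \<le> ?p" if "j \<le> ?m" for j using offs_mono[OF that, of es] sz by simp
  have ar: "array l f i \<le> M" if "\<And>i. i < l \<Longrightarrow> f i \<le> M" for l f i
    using that by (simp add: array_def)
  have bnd: "bnd M \<mu>" unfolding bnd_def
  proof (intro allI)
    fix x i
    have "imem \<mu> x = scalar ?n \<or> imem \<mu> x = scalar ?m \<or> imem \<mu> x = scalar (length rs) \<or> imem \<mu> x = array (?m + 1) (offs es) \<or>
      imem \<mu> x = array ?p (\<lambda>i. concat es ! i) \<or> imem \<mu> x = array (length rs) (\<lambda>i. rs ! i) \<or> imem \<mu> x = (\<lambda>_. 0)"
    proof -
      have "offs es = (\<lambda>j. \<Sum>i<j. length (es ! i))" by (simp add: fun_eq_iff offs_def)
      then show ?thesis unfolding \<mu> by (simp add: k fun_upd_def)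
    qed
    moreover have "scalar a i \<le> M" if "a \<le> M" for a using that by (simp add: scalar_def array_def)
    moreover have "array (?m + 1) (offs es) i \<le> M"
    proof (rule ar)
      fix i assume "i < ?m + 1"
      then show "offs es i \<le> M" using o[of i] M(2) by simp
    qed
    moreover have "array ?p (\<lambda>i. concat es ! i) i \<le> M"
    proof (rule ar)
      fix i assume "i < ?p"
      then show "concat es ! i \<le> M" using v[of i] M(2) by simp
    qed
    moreover have "array (length rs) (\<lambda>i. rs ! i) i \<le> M"
    proof (rule ar)
      fix i assume "i < length rs"
      then show "rs ! i \<le> M" using t[of i] M(2) by simp
    qed
    moreover have "?n \<le> M" "?m \<le> M" "length rs \<le> M" using M(2) kn by simp_all
    ultimately show "imem \<mu> x i \<le> M" by (elim disjE) simp_all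
  qed
  have s': "wlen M \<le> s" "(?m + 1) * wlen M \<le> s" using s by (simp_all add: add_mult_distrib)
  have pw: "?p + ?m + ?n + 1 > 0" by simp
  show ?thesis unfolding init_def
  proof (rule run_Seq_cst)
    let ?P = "\<lambda>\<nu>. imem \<nu> ''hn'' 0 = ?n \<and> imem \<nu> ''hm'' 0 = ?m \<and> imem \<nu> ''hp'' 0 = ?p \<and> imem \<nu> ''NN'' 0 = B \<and> rmem \<nu> ''W'' 0 = 1"
    show "run (init1 d) \<mu> (cst (init1 d) * s) (\<lambda>\<nu>. ?P \<nu> \<and> bnd M \<nu>)"
      by (rule run_simple_cst[OF _ bnd s'(1)]) (use im sz B M in \<open>simp_all add: init1_def exs_simps\<close>)
    fix \<nu>1 assume \<nu>1: "?P \<nu>1 \<and> bnd M \<nu>1" and "agree (wr (init1 d)) \<mu> \<nu>1"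
    then have ag1: "agree {''hn'', ''hm'', ''hp'', ''NN'', ''W''} \<mu> \<nu>1" by (simp add: init1_def insert_commute)
    let ?l2 = "For ''j'' (rd ''hm'') weight_step" and ?l3 = "For ''j'' (rd ''hm'') owner_loop"
    show "run (Seq ?l2 ?l3) \<nu>1 (cst (Seq ?l2 ?l3) * s) (\<lambda>\<nu>. main_mem H es rs B \<nu> \<and> bnd M \<nu>)"
    proof (rule run_Seq_cst)
      show "run ?l2 \<nu>1 (cst ?l2 * s) (\<lambda>\<nu>. ((\<forall>j<?m. rmem \<nu> ''hw'' j = hweight H j) \<and> rmem \<nu> ''W'' 0 = 1 + (\<Sum>j<?m. hweight H j)) \<and> bnd M \<nu>)"
      proof (rule run_For_simple_cst[where I="\<lambda>i \<nu>. (\<forall>j<i. rmem \<nu> ''hw'' j = hweight H j) \<and> rmem \<nu> ''W'' 0 = 1 + (\<Sum>j<i. hweight H j)"])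
        fix i \<nu> assume "agree (insert ''j'' (wr weight_step)) \<nu>1 \<nu>"
        then have ag: "agree {''j'', ''hw'', ''W''} \<nu>1 \<nu>" by (simp add: weight_step_def insert_commute)
        show "ival \<nu> (rd ''hm'') = ?m" using \<nu>1 by (simp add: agreeD[OF ag])
        assume i: "i < ?m" "imem \<nu> ''j'' 0 = i" and I: "(\<forall>j<i. rmem \<nu> ''hw'' j = hweight H j) \<and> rmem \<nu> ''W'' 0 = 1 + (\<Sum>j<i. hweight H j)"
        have "rmem \<nu> ''w'' i = hweight H i" using im(7)[OF i(1)] by (simp add: agreeD[OF ag] agreeD[OF ag1])
        then show "exs M weight_step \<nu> (\<lambda>\<nu>'. (\<forall>j<Suc i. rmem (istore ''j'' 0 (Suc i) \<nu>') ''hw'' j = hweight H j) \<and>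
            rmem (istore ''j'' 0 (Suc i) \<nu>') ''W'' 0 = 1 + (\<Sum>j<Suc i. hweight H j))"
          unfolding weight_step_def exs_simps using I i by (simp add: less_Suc_eq)
      qed (use \<nu>1 M s' in \<open>simp_all add: weight_step_def\<close>)
      fix \<nu>2 assume \<nu>2: "((\<forall>j<?m. rmem \<nu>2 ''hw'' j = hweight H j) \<and> rmem \<nu>2 ''W'' 0 = 1 + (\<Sum>j<?m. hweight H j)) \<and> bnd M \<nu>2"
        and "agree (wr ?l2) \<nu>1 \<nu>2"
      then have ag2: "agree {''j'', ''hw'', ''W''} \<nu>1 \<nu>2" by (simp add: weight_step_def insert_commute)
      note eqs2 = agreeD[OF ag2] agreeD[OF ag1]
      let ?J = "\<lambda>j \<nu>. agree {''j'', ''q'', ''eo''} \<nu>2 \<nu> \<and> imem \<nu> ''q'' 0 = offs es j \<and> (\<forall>x<offs es j. imem \<nu> ''eo'' x = owner es x)"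
      \<comment> \<open>One unit per incidence of hyperedge j and one for the failing test. The sum
        over all hyperedges is of order p + m, although the loops are nested.\<close>
      let ?t = "\<lambda>j. (cst owner_loop + 1) * ((length (es ! j) + 1) * wlen M)"
      have "ok ?l3 \<nu>2 (cst ?l3 * s) (\<lambda>\<nu>. ?J ?m \<nu> \<and> bnd M \<nu> \<and> imem \<nu> ''j'' 0 = ?m) (\<lambda>_. 0) 0"
      proof (rule ok_For[where I="?J" and t="?t" and \<Phi>="\<lambda>_ _. 0"])
        show "?m \<le> M" using M by simp
        show "bnd M \<nu>2" using \<nu>2 by simp
        show "?J 0 (istore ''j'' 0 0 \<nu>2)" using im(8) by (simp add: agree_def eqs2)
        show "ival \<nu> (rd ''hm'') = ?m" if "?J j \<nu>" for j \<nu>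
        proof -
          have "agree {''j'', ''q'', ''eo''} \<nu>2 \<nu>" using that by blast
          from agreeD[OF this] show ?thesis using \<nu>1 by (simp add: eqs2)
        qed
        have "(\<Sum>j<?m. ?t j) = (cst owner_loop + 1) * ((?p + ?m) * wlen M)"
          unfolding sum_distrib_left[symmetric] sum_distrib_right[symmetric] sum.distrib sz(2) offs_def by simp
        also have "\<dots> \<le> cst owner_loop * (2 * ((?p + ?m) * wlen M))"
        proof -
          have "cst owner_loop + 1 \<le> cst owner_loop * 2" using cst_pos[of owner_loop] by simp
          from mult_le_mono1[OF this] show ?thesis by (simp only: mult.assoc)
        qed
        finally have "(\<Sum>j<?m. ?t j) + upcst ''j'' (rd ''hm'') * (?m + 1) * wlen M + 3 * wlen M \<le> cst ?l3 * ((?m + 1) * wlen M + 2 * ((?p + ?m) * wlen M))"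
          by (intro For_time) simp_all
        also have "\<dots> \<le> cst ?l3 * s"
          using s by (intro mult_left_mono) (simp_all add: add_mult_distrib algebra_simps)
        finally show "(\<Sum>j<?m. ?t j) + upcst ''j'' (rd ''hm'') * (?m + 1) * wlen M + 3 * wlen M \<le> cst ?l3 * s" .
        fix j \<nu> assume j: "j < ?m" and J: "?J j \<nu>" and bnd: "bnd M \<nu>" and jv: "imem \<nu> ''j'' 0 = j"
        have ag3: "agree {''j'', ''q'', ''eo''} \<nu>2 \<nu>" using J by blast
        have oj: "imem \<nu> ''off'' (Suc j) = offs es (Suc j)" using im(4)[of "Suc j"] j by (simp add: agreeD[OF ag3] eqs2)
        let ?I = "\<lambda>x \<kappa>. agree {''q'', ''eo''} \<nu> \<kappa> \<and> (\<forall>x'<x. imem \<kappa> ''eo'' x' = owner es x')"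
        have "ok owner_loop \<nu> (?t j) (\<lambda>\<kappa>. ?I (offs es (Suc j)) \<kappa> \<and> bnd M \<kappa> \<and> imem \<kappa> ''q'' 0 = offs es (Suc j)) (\<lambda>_. 0) 0"
          unfolding owner_loop_def
        proof (rule ok_Up[where I="?I" and t="\<lambda>_. cst owner_step * wlen M" and \<Phi>="\<lambda>_ _. 0" and lo="offs es j"])
          show "offs es j \<le> offs es (Suc j)" by (rule offs_mono) simp
          show "offs es (Suc j) \<le> M" using o[of "Suc j"] j M by simp
          show "?I (offs es j) \<nu>" "imem \<nu> ''q'' 0 = offs es j" "bnd M \<nu>" using J bnd by simp_all
          show "ival \<kappa> (IRead ''off'' (IAdd (rd ''j'') (IConst 1))) = offs es (Suc j)" if "?I x \<kappa>" for x \<kappa>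
          proof -
            have "agree {''q'', ''eo''} \<nu> \<kappa>" using that by blast
            from agreeD[OF this] show ?thesis using jv oj by simp
          qed
          have c: "cst (Up ''q'' (IRead ''off'' (IAdd (rd ''j'') (IConst 1))) owner_step) + 1 = upcst ''q'' (IRead ''off'' (IAdd (rd ''j'') (IConst 1))) + cst owner_step"
            by (rule cst_Up)
          show "(\<Sum>i\<in>{offs es j..<offs es (Suc j)}. cst owner_step * wlen M) + upcst ''q'' (IRead ''off'' (IAdd (rd ''j'') (IConst 1))) * (offs es (Suc j) - offs es j + 1) * wlen M
            \<le> (cst (Up ''q'' (IRead ''off'' (IAdd (rd ''j'') (IConst 1))) owner_step) + 1) * ((length (es ! j) + 1) * wlen M)"
            unfolding c by (simp add: offs_Suc algebra_simps)
          fix x \<kappa> assume x: "offs es j \<le> x" "x < offs es (Suc j)" and I: "?I x \<kappa>" and bk: "bnd M \<kappa>" and q: "imem \<kappa> ''q'' 0 = x"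
          have ag4: "agree {''q'', ''eo''} \<nu> \<kappa>" using I by blast
          have jk: "imem \<kappa> ''j'' 0 = j" using jv by (simp add: agreeD[OF ag4])
          have "run owner_step \<kappa> (cst owner_step * wlen M) (\<lambda>\<nu>. \<nu> = sem owner_step \<kappa> \<and> bnd M \<nu>)"
            by (rule run_simple) (use bk j M jk in \<open>simp_all add: owner_step_def\<close>)
          then show "ok owner_step \<kappa> (cst owner_step * wlen M) (\<lambda>\<nu>'. ?I (Suc x) (istore ''q'' 0 (Suc x) \<nu>') \<and> bnd M \<nu>' \<and> imem \<nu>' ''q'' 0 = x) (\<lambda>_. 0) 0"
          proof (rule run_mono)
            fix \<nu>' assume \<nu>': "\<nu>' = sem owner_step \<kappa> \<and> bnd M \<nu>'"
            then have e: "\<nu>' = istore ''eo'' x j \<kappa>" by (simp add: owner_step_def q jk)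
            have "owner es x = j" by (rule owner_eq[OF x])
            then show "?I (Suc x) (istore ''q'' 0 (Suc x) \<nu>') \<and> bnd M \<nu>' \<and> imem \<nu>' ''q'' 0 = x"
              using conjunct2[OF \<nu>'] I q unfolding e by (simp add: agree_def less_Suc_eq)
          qed simp
        qed
        then show "ok owner_loop \<nu> (?t j) (\<lambda>\<nu>'. ?J (Suc j) (istore ''j'' 0 (Suc j) \<nu>') \<and> bnd M \<nu>' \<and> imem \<nu>' ''j'' 0 = j) (\<lambda>_. 0) 0"
        proof (rule ok_mono)
          fix \<kappa> assume k: "?I (offs es (Suc j)) \<kappa> \<and> bnd M \<kappa> \<and> imem \<kappa> ''q'' 0 = offs es (Suc j)"
          then have ag4: "agree {''q'', ''eo''} \<nu> \<kappa>" by blast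
          have "agree {''j'', ''q'', ''eo''} \<nu>2 (istore ''j'' 0 (Suc j) \<kappa>)" using ag3 ag4 by (simp add: agree_def)
          then show "(?J (Suc j) (istore ''j'' 0 (Suc j) \<kappa>) \<and> bnd M \<kappa> \<and> imem \<kappa> ''j'' 0 = j) \<and> (0::ennreal) \<le> 0"
            using k jv by (simp add: agreeD[OF ag4])
        qed simp_all
      qed simp
      then show "run ?l3 \<nu>2 (cst ?l3 * s) (\<lambda>\<nu>. main_mem H es rs B \<nu> \<and> bnd M \<nu>)"
      proof (rule run_mono)
        fix \<nu> assume J: "?J ?m \<nu> \<and> bnd M \<nu> \<and> imem \<nu> ''j'' 0 = ?m"
        then have ag3: "agree {''j'', ''q'', ''eo''} \<nu>2 \<nu>" by blast
        note eqs = agreeD[OF ag3] eqs2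
        have "hmem H \<nu>"
          by (rule hmem_lists[OF wf es]) (use J \<nu>1 \<nu>2 im sz in \<open>simp_all add: eqs\<close>)
        then show "main_mem H es rs B \<nu> \<and> bnd M \<nu>"
          using J \<nu>1 im by (simp add: main_mem_def eqs)
      qed simp
    qed
  qed
qed

section \<open>Binary digits and the rounds of the labelling\<close>

definition bt :: "nat \<Rightarrow> nat \<Rightarrow> nat" where
  "bt b x = (x div 2 ^ b) mod 2"

lemma bt_le: "bt b x \<le> 1"
  unfolding bt_def by (simp add: less_Suc_eq_le[symmetric])

lemma bt_add: "b < j \<Longrightarrow> bt b (x + 2 ^ j) = bt b x"
proof -
  assume "b < j"
  then obtain d where d: "j = Suc (b + d)" using less_imp_Suc_add by blast
  have e: "(2::nat) ^ j = (2 * 2 ^ d) * 2 ^ b" unfolding d by (simp add: power_add)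
  have "(x + (2 * 2 ^ d) * 2 ^ b) div 2 ^ b = 2 * 2 ^ d + x div 2 ^ b" by (rule div_mult_self1) simp
  then show ?thesis unfolding bt_def e by simp
qed

lemma bt_top: "x < 2 ^ j \<Longrightarrow> bt j x = 0" "x < 2 ^ j \<Longrightarrow> bt j (x + 2 ^ j) = 1"
  by (simp_all add: bt_def)

lemma mod_bt: "x mod 2 ^ Suc j = x mod 2 ^ j + (if bt j x = 1 then 2 ^ j else 0)"
proof -
  have "x mod (2 ^ j * 2) = 2 ^ j * (x div 2 ^ j mod 2) + x mod 2 ^ j" by (rule mod_mult2_eq)
  then have *: "x mod 2 ^ Suc j = 2 ^ j * bt j x + x mod 2 ^ j" by (simp only: power_Suc2 bt_def)
  have "bt j x = 0 \<or> bt j x = 1" using bt_le[of j x] by linarith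
  then show ?thesis unfolding * by (elim disjE) simp_all
qed

text \<open>By \<open>mod_bt\<close>, the lowest i digits determine the remainder modulo
  \<open>2 ^ i\<close>.\<close>

lemma bt_inject: "x < 2 ^ j \<Longrightarrow> y < 2 ^ j \<Longrightarrow> (\<And>b. b < j \<Longrightarrow> bt b x = bt b y) \<Longrightarrow> x = y"
proof -
  assume x: "x < 2 ^ j" "y < 2 ^ j" and b: "\<And>b. b < j \<Longrightarrow> bt b x = bt b y"
  have "x mod 2 ^ i = y mod 2 ^ i" if "i \<le> j" for i
    using that by (induction i) (simp_all add: mod_bt b del: power_Suc)
  from this[of j] x show ?thesis by simp
qed

text \<open>The language has no remainder, so a digit is computed as
  \<open>l div pw - 2 * (l div (2 * pw))\<close>.\<close>

definition bit_exp :: iexp where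
  "bit_exp = ISub (IDiv (rd ''l'') (rd ''pw'')) (IMul (IConst 2) (IDiv (rd ''l'') (IMul (IConst 2) (rd ''pw''))))"

lemma ival_bit_exp: "imem \<mu> ''pw'' 0 = 2 ^ j \<Longrightarrow> ival \<mu> bit_exp = bt j (imem \<mu> ''l'' 0)"
proof -
  assume "imem \<mu> ''pw'' 0 = 2 ^ j"
  then have "ival \<mu> bit_exp = imem \<mu> ''l'' 0 div 2 ^ j - 2 * (imem \<mu> ''l'' 0 div (2 ^ j * 2))"
    by (simp add: bit_exp_def mult.commute)
  also have "\<dots> = imem \<mu> ''l'' 0 div 2 ^ j - 2 * (imem \<mu> ''l'' 0 div 2 ^ j div 2)" by (simp only: div_mult2_eq)
  also have "\<dots> = bt j (imem \<mu> ''l'' 0)" by (simp only: minus_mult_div_eq_mod bt_def)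
  finally show ?thesis .
qed

definition mark_step :: com where
  "mark_step = Seq (IAssign ''src'' (IRead ''term'' (rd ''l'')) bit_exp) (IAssign ''snk'' (IRead ''term'' (rd ''l'')) (ISub (IConst 1) bit_exp))"

definition upd_step :: com where
  "upd_step = Cond (BAnd (ILess (IRead ''snk'' (rd ''v'')) (IConst 1)) (ILess (IConst 0) (IAdd (IRead ''src'' (rd ''v'')) (IRead ''res'' (rd ''v'')))))
     (IAssign ''lab'' (rd ''v'') (IAdd (IRead ''lab'' (rd ''v'')) (rd ''pw''))) Skip"

text \<open>\<open>''lab''\<close> is not shared: the callee sees only zero labels and, with
  \<open>''K''\<close> set to 1, treats the whole hypergraph as one class.\<close>

definition scope1 :: "string list" where
  "scope1 = [''hn'', ''NN'', ''src'', ''snk'', ''res'', ''hm'', ''hp'', ''inc'', ''eo'', ''hw'', ''W'', ''off'']"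

text \<open>
  In the round with \<open>pw = 2 ^ j\<close>, the terminals are split by bit \<open>j\<close> of their numbers, and the side of
  a vertex in a minimum cut for this split becomes bit \<open>j\<close> of its label.
\<close>

definition round :: "com \<Rightarrow> com" where
  "round P = Seq (For ''l'' (rd ''k'') mark_step) (Seq (Call scope1 (Seq (wt ''K'' (IConst 1)) (part P))) (For ''v'' (rd ''hn'') upd_step))"

definition phase1 :: "com \<Rightarrow> com" where
  "phase1 P = Seq (wt ''pw'' (IConst 1)) (Dbl ''pw'' (rd ''k'') (round P))"

lemma run_mark:
  assumes m: "main_mem H es rs B \<mu>" and rs: "distinct rs" and M: "bnd M \<mu>" "length rs \<le> M" "1 \<le> M" and pw: "imem \<mu> ''pw'' 0 = 2 ^ j"
    and z: "\<And>v. v \<notin> set rs \<Longrightarrow> imem \<mu> ''src'' v = 0 \<and> imem \<mu> ''snk'' v = 0" and s: "(length rs + 1) * wlen M \<le> s"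
  shows "run (For ''l'' (rd ''k'') mark_step) \<mu> (cst (For ''l'' (rd ''k'') mark_step) * s)
    (\<lambda>\<nu>. ((\<forall>l<length rs. imem \<nu> ''src'' (rs ! l) = bt j l \<and> imem \<nu> ''snk'' (rs ! l) = 1 - bt j l) \<and>
      (\<forall>v. v \<notin> set rs \<longrightarrow> imem \<nu> ''src'' v = 0 \<and> imem \<nu> ''snk'' v = 0)) \<and> bnd M \<nu>)"
proof (rule run_For_simple_cst[where I="\<lambda>i \<nu>. (\<forall>l<i. imem \<nu> ''src'' (rs ! l) = bt j l \<and> imem \<nu> ''snk'' (rs ! l) = 1 - bt j l) \<and>
      (\<forall>v. v \<notin> set rs \<longrightarrow> imem \<nu> ''src'' v = 0 \<and> imem \<nu> ''snk'' v = 0)"])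
  fix i \<nu> assume "agree (insert ''l'' (wr mark_step)) \<mu> \<nu>"
  then have ag: "agree {''l'', ''src'', ''snk''} \<mu> \<nu>" by (simp add: mark_step_def insert_commute)
  show "ival \<nu> (rd ''k'') = length rs" using m by (simp add: agreeD[OF ag] main_mem_def)
  assume i: "i < length rs" "imem \<nu> ''l'' 0 = i" and I: "(\<forall>l<i. imem \<nu> ''src'' (rs ! l) = bt j l \<and> imem \<nu> ''snk'' (rs ! l) = 1 - bt j l) \<and>
      (\<forall>v. v \<notin> set rs \<longrightarrow> imem \<nu> ''src'' v = 0 \<and> imem \<nu> ''snk'' v = 0)"
  let ?\<nu>1 = "istore ''src'' (rs ! i) (bt j i) \<nu>"
  have t: "ival \<nu> (IRead ''term'' (rd ''l'')) = rs ! i" "ival ?\<nu>1 (IRead ''term'' (rd ''l'')) = rs ! i"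
    using m i by (simp_all add: agreeD[OF ag] main_mem_def)
  have b: "ival \<nu> bit_exp = bt j i" "ival ?\<nu>1 (ISub (IConst 1) bit_exp) = 1 - bt j i"
    using ival_bit_exp[of \<nu> j] ival_bit_exp[of ?\<nu>1 j] pw i by (simp_all add: agreeD[OF ag])
  have ne: "rs ! l \<noteq> rs ! i" if "l < i" for l using nth_eq_iff_index_eq[OF rs, of l i] that i(1) by simp
  have le: "bt j i \<le> M" "1 - bt j i \<le> M" using bt_le[of j i] M(3) by simp_all
  have r: "rs ! i \<in> set rs" using i(1) by simp
  show "exs M mark_step \<nu> (\<lambda>\<nu>'. (\<forall>l<Suc i. imem (istore ''l'' 0 (Suc i) \<nu>') ''src'' (rs ! l) = bt j l \<and> imem (istore ''l'' 0 (Suc i) \<nu>') ''snk'' (rs ! l) = 1 - bt j l) \<and>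
      (\<forall>v. v \<notin> set rs \<longrightarrow> imem (istore ''l'' 0 (Suc i) \<nu>') ''src'' v = 0 \<and> imem (istore ''l'' 0 (Suc i) \<nu>') ''snk'' v = 0))"
    unfolding mark_step_def exs_simps t b using I ne le r by (auto simp: less_Suc_eq)
qed (use M z s in \<open>simp_all add: mark_step_def\<close>)

lemma run_upd:
  assumes n: "imem \<mu> ''hn'' 0 = n" "n \<le> M" "bnd M \<mu>" and pw: "imem \<mu> ''pw'' 0 = 2 ^ j" "\<And>v. imem \<mu> ''lab'' v < 2 ^ j" "2 * 2 ^ j \<le> M"
    and s: "(n + 1) * wlen M \<le> s"
  shows "run (For ''v'' (rd ''hn'') upd_step) \<mu> (cst (For ''v'' (rd ''hn'') upd_step) * s)
    (\<lambda>\<nu>. (\<forall>u. imem \<nu> ''lab'' u = imem \<mu> ''lab'' u + (if u < n \<and> imem \<mu> ''snk'' u = 0 \<and> (imem \<mu> ''res'' u \<noteq> 0 \<or> imem \<mu> ''src'' u \<noteq> 0) then 2 ^ j else 0)) \<and> bnd M \<nu>)"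
proof (rule run_For_simple_cst[where I="\<lambda>i \<nu>. \<forall>u. imem \<nu> ''lab'' u = imem \<mu> ''lab'' u + (if u < i \<and> imem \<mu> ''snk'' u = 0 \<and> (imem \<mu> ''res'' u \<noteq> 0 \<or> imem \<mu> ''src'' u \<noteq> 0) then 2 ^ j else 0)"])
  fix i \<nu> assume "agree (insert ''v'' (wr upd_step)) \<mu> \<nu>"
  then have ag: "agree {''v'', ''lab''} \<mu> \<nu>" by (simp add: upd_step_def insert_commute)
  show "ival \<nu> (rd ''hn'') = n" using n by (simp add: agreeD[OF ag])
  assume i: "i < n" "imem \<nu> ''v'' 0 = i" and I: "\<forall>u. imem \<nu> ''lab'' u = imem \<mu> ''lab'' u + (if u < i \<and> imem \<mu> ''snk'' u = 0 \<and> (imem \<mu> ''res'' u \<noteq> 0 \<or> imem \<mu> ''src'' u \<noteq> 0) then 2 ^ j else 0)"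
  let ?c = "imem \<mu> ''snk'' i = 0 \<and> (imem \<mu> ''res'' i \<noteq> 0 \<or> imem \<mu> ''src'' i \<noteq> 0)"
  have b: "bval \<nu> (BAnd (ILess (IRead ''snk'' (rd ''v'')) (IConst 1)) (ILess (IConst 0) (IAdd (IRead ''src'' (rd ''v'')) (IRead ''res'' (rd ''v''))))) \<longleftrightarrow> ?c"
    using i(2) by (auto simp: agreeD[OF ag])
  have "imem \<mu> ''lab'' i + 2 ^ j \<le> M" using pw(2)[of i] pw(3) by linarith
  then show "exs M upd_step \<nu> (\<lambda>\<nu>'. \<forall>u. imem (istore ''v'' 0 (Suc i) \<nu>') ''lab'' u = imem \<mu> ''lab'' u + (if u < Suc i \<and> imem \<mu> ''snk'' u = 0 \<and> (imem \<mu> ''res'' u \<noteq> 0 \<or> imem \<mu> ''src'' u \<noteq> 0) then 2 ^ j else 0))"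
    unfolding upd_step_def exs_simps(5) b exs_simps(1,2) using I i pw(1) by (auto simp: less_Suc_eq agreeD[OF ag])
qed (use n s in \<open>simp_all add: upd_step_def\<close>)

definition bits_separating :: "hypergraph \<Rightarrow> nat set \<Rightarrow> nat \<Rightarrow> (nat \<Rightarrow> nat) \<Rightarrow> bool" where
  "bits_separating H R j lab \<longleftrightarrow> (\<forall>b<j. min_separating H R {v. v < hn H \<and> bt b (lab v) = 1})"

text \<open>The labels of terminals are right even if a computed cut is wrong, because in
  \<open>upd_step\<close> the marks of terminals override the computed side. Only the minimality of
  the sides is subject to failure.\<close>

definition round_inv :: "hypergraph \<Rightarrow> nat list list \<Rightarrow> nat list \<Rightarrow> nat \<Rightarrow> nat \<Rightarrow> mem \<Rightarrow> bool" where
  "round_inv H es rs B j \<mu> \<longleftrightarrow> main_mem H es rs B \<mu> \<and> (\<forall>v. v \<notin> set rs \<longrightarrow> imem \<mu> ''src'' v = 0 \<and> imem \<mu> ''snk'' v = 0) \<and>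
     (\<forall>v. imem \<mu> ''res'' v \<le> 1) \<and> (\<forall>v. imem \<mu> ''lab'' v < 2 ^ j) \<and> (\<forall>l<length rs. imem \<mu> ''lab'' (rs ! l) = l mod 2 ^ j)"

lemma round_inv_pw: "round_inv H es rs B j (istore ''pw'' i v \<mu>) \<longleftrightarrow> round_inv H es rs B j \<mu>"
proof -
  have "agree {''pw''} \<mu> (istore ''pw'' i v \<mu>)" by (simp add: agree_def)
  from main_mem_cong[OF this, of H es rs B] show ?thesis by (simp add: round_inv_def)
qed

lemma cnt_const: "cnt (\<lambda>_. 0) 0 n = n"
  by (induction n) (simp_all add: cnt_Suc)

text \<open>Adding \<open>2 ^ j\<close> leaves the lower digits intact, so earlier sides remain
  minimum and a new failure requires that the single instance is not \<open>good\<close>. A set with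
  the same trace on the terminals as the new side contains all sources and no sink, so it is among
  the competitors in \<open>good\<close>.\<close>

lemma ok_round:
  assumes P: "solver P tp" and tp: "\<And>m' n' m n. m' \<le> m \<Longrightarrow> n' \<le> n \<Longrightarrow> tp m' n' \<le> tp m n"
    and I: "round_inv H es rs B j \<mu>" and bnd: "bnd M \<mu>" and pw: "imem \<mu> ''pw'' 0 = 2 ^ j" and j: "2 ^ j < length rs"
    and rs: "distinct rs" "set rs \<subseteq> hverts H"
    and M: "2 + 2 * hm H + hn H \<le> M" "5 * hsize H \<le> M" "2 * B \<le> M" "2 * length rs \<le> M" and B: "1 \<le> B"
    and s: "(length rs + hn H + hsize H + 2) * wlen M + inst_time M tp (hm H) (hn H) (hsize H) \<le> s"
  shows "ok (round P) \<mu> (cst (round P) * s) (\<lambda>\<nu>. round_inv H es rs B (Suc j) \<nu> \<and> bnd M \<nu> \<and> imem \<nu> ''pw'' 0 = 2 ^ j)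
    (\<lambda>\<nu>. of_bool (\<not> bits_separating H (set rs) (Suc j) (imem \<nu> ''lab'')))
    (of_bool (\<not> bits_separating H (set rs) j (imem \<mu> ''lab'')) + ennreal (1 / real B))"
  unfolding round_def
proof (rule run_Seq_cst)
  let ?n = "hn H" and ?R = "set rs" and ?lab = "imem \<mu> ''lab''"
  let ?sep = "\<lambda>j lab. bits_separating H ?R j lab"
  have mm: "main_mem H es rs B \<mu>" using I by (simp add: round_inv_def)
  have h: "hmem H \<mu>" using mm by (simp add: main_mem_def)
  have wf: "wf_hypergraph H" and hn: "imem \<mu> ''hn'' 0 = ?n" using h by (simp_all add: hmem_def)
  have s': "(length rs + 1) * wlen M \<le> s" "(?n + 1) * wlen M \<le> s" "wlen M \<le> s" "(?n + hsize H + 1 + 1) * wlen M + inst_time M tp (hm H) ?n (hsize H) \<le> s"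
    using s by (simp_all add: add_mult_distrib)
  have M1: "1 \<le> M" "length rs \<le> M" "?n \<le> M" "2 * 2 ^ j \<le> M" using M j by simp_all
  let ?mark = "For ''l'' (rd ''k'') mark_step"
  let ?S = "\<lambda>\<nu>. (\<forall>l<length rs. imem \<nu> ''src'' (rs ! l) = bt j l \<and> imem \<nu> ''snk'' (rs ! l) = 1 - bt j l) \<and>
      (\<forall>v. v \<notin> ?R \<longrightarrow> imem \<nu> ''src'' v = 0 \<and> imem \<nu> ''snk'' v = 0)"
  show "run ?mark \<mu> (cst ?mark * s) (\<lambda>\<nu>. ?S \<nu> \<and> bnd M \<nu>)"
    by (rule run_mark[OF mm rs(1) bnd M1(2,1) pw]) (use I s' in \<open>auto simp: round_inv_def\<close>)
  fix \<nu>1 assume \<nu>1: "?S \<nu>1 \<and> bnd M \<nu>1" and "agree (wr ?mark) \<mu> \<nu>1"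
  then have ag1: "agree {''l'', ''src'', ''snk''} \<mu> \<nu>1" by (simp add: mark_step_def insert_commute)
  let ?src = "imem \<nu>1 ''src''" and ?snk = "imem \<nu>1 ''snk''"
  let ?call = "Call scope1 (Seq (wt ''K'' (IConst 1)) (part P))"
  let ?upd = "For ''v'' (rd ''hn'') upd_step"
  have disj: "?src v = 0 \<or> ?snk v = 0" for v
  proof (cases "v \<in> ?R")
    case True
    then obtain l where "l < length rs" "v = rs ! l" by (auto simp: in_set_conv_nth)
    moreover have "bt j l = 0 \<or> bt j l = 1" using bt_le[of j l] by linarith
    ultimately show ?thesis using \<nu>1 by auto
  qed (use \<nu>1 in auto)
  let ?good = "\<lambda>r. good H (\<lambda>_. 0) ?src ?snk 0 r"
  show "ok (Seq ?call ?upd) \<nu>1 (cst (Seq ?call ?upd) * s) (\<lambda>\<nu>. round_inv H es rs B (Suc j) \<nu> \<and> bnd M \<nu> \<and> imem \<nu> ''pw'' 0 = 2 ^ j)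
    (\<lambda>\<nu>. of_bool (\<not> ?sep (Suc j) (imem \<nu> ''lab''))) (of_bool (\<not> ?sep j ?lab) + ennreal (1 / real B))"
  proof (rule ok_Seq_cst)
    let ?o = "overlay scope1 \<nu>1 zero_mem"
    have "ok (Seq (wt ''K'' (IConst 1)) (part P)) ?o (cst (Seq (wt ''K'' (IConst 1)) (part P)) * s)
       (\<lambda>\<nu>. \<forall>v. imem \<nu> ''res'' v \<le> 1) (\<lambda>\<nu>. of_bool (\<not> ?good (imem \<nu> ''res''))) (ennreal (1 / real B))"
    proof (rule run_Seq_cst)
      show "run (wt ''K'' (IConst 1)) ?o (cst (wt ''K'' (IConst 1)) * s) (\<lambda>\<nu>. \<nu> = istore ''K'' 0 1 ?o \<and> bnd M \<nu>)"
        by (rule run_simple_cst) (use \<nu>1 M1 s' in \<open>simp_all add: exs_simps bnd_overlay\<close>)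
      fix \<kappa> assume \<kappa>: "\<kappa> = istore ''K'' 0 1 ?o \<and> bnd M \<kappa>"
      have k: "imem \<kappa> x = imem \<nu>1 x" "rmem \<kappa> x = rmem \<nu>1 x" if "x \<in> set scope1" for x
        using that \<kappa> by (auto simp: scope1_def)
      have lab0: "imem \<kappa> ''lab'' = (\<lambda>_. 0)" using \<kappa> by (simp add: scope1_def fun_eq_iff)
      have src: "imem \<kappa> ''src'' = ?src" "imem \<kappa> ''snk'' = ?snk" "imem \<kappa> ''NN'' 0 = B" "imem \<kappa> ''res'' = imem \<mu> ''res''"
        using mm by (simp_all add: k scope1_def agreeD[OF ag1] main_mem_def)
      have hk: "hmem H \<kappa>" using h by (simp add: hmem_def k scope1_def agreeD[OF ag1])
      have "ok (part P) \<kappa> (cst (part P) * s) (\<lambda>\<nu>. \<forall>v. imem \<nu> ''res'' v \<le> 1)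
        (\<lambda>\<nu>. of_bool (\<not> (\<forall>i<1. good H (imem \<kappa> ''lab'') (imem \<kappa> ''src'') (imem \<kappa> ''snk'') i (imem \<nu> ''res''))))
        (ennreal (real 1 / real (imem \<kappa> ''NN'' 0)))"
      proof (rule ok_part[OF P tp hk])
        show "fresh {''VL'', ''vc'', ''pos'', ''IL'', ''ic'', ''iq'', ''ft''} \<kappa>" using \<kappa> by (simp add: fresh_def scope1_def fun_eq_iff)
        show "(?n + hsize H + 1 + 1) * wlen M + (\<Sum>i<1. inst_time M tp (hm H) (cnt (imem \<kappa> ''lab'') i ?n)
           (cnt (\<lambda>q. imem \<kappa> ''lab'' (imem \<kappa> ''inc'' q)) i (hsize H))) \<le> s"
          using s'(4) by (simp add: lab0 cnt_const)
        show "bnd M \<kappa>" using \<kappa> by blast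
        show "imem \<kappa> ''K'' 0 = 1" using conjunct1[OF \<kappa>] by simp
        show "2 * imem \<kappa> ''NN'' 0 \<le> M" "1 \<le> imem \<kappa> ''NN'' 0" unfolding src by (rule M B)+
        show "imem \<kappa> ''src'' v = 0 \<or> imem \<kappa> ''snk'' v = 0" for v unfolding src by (rule disj)
        show "imem \<kappa> ''res'' v \<le> 1" for v unfolding src using I by (simp add: round_inv_def)
      qed (rule M M1 | assumption)+
      then show "ok (part P) \<kappa> (cst (part P) * s) (\<lambda>\<nu>. \<forall>v. imem \<nu> ''res'' v \<le> 1) (\<lambda>\<nu>. of_bool (\<not> ?good (imem \<nu> ''res''))) (ennreal (1 / real B))"
        by (simp add: lab0 src)
    qed
    then have "ok ?call \<nu>1 (cst ?call * s) (\<lambda>\<nu>. \<forall>v. imem \<nu> ''res'' v \<le> 1) (\<lambda>\<nu>. of_bool (\<not> ?good (imem \<nu> ''res''))) (ennreal (1 / real B))"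
      using s'(3) wlen_pos(2)[of M] by (intro ok_Call_cst) (simp_all add: scope1_def)
    from ok_add_const[OF this, of "of_bool (\<not> ?sep j ?lab)"]
    show "ok ?call \<nu>1 (cst ?call * s) (\<lambda>\<nu>. \<forall>v. imem \<nu> ''res'' v \<le> 1) (\<lambda>\<nu>. of_bool (\<not> ?good (imem \<nu> ''res'')) + of_bool (\<not> ?sep j ?lab))
      (of_bool (\<not> ?sep j ?lab) + ennreal (1 / real B))"
      by (simp only: add.commute)
    fix \<nu>2 assume \<nu>2: "\<forall>v. imem \<nu>2 ''res'' v \<le> 1" and "agree (wr ?call) \<nu>1 \<nu>2"
    then have ag2: "agree {''res''} \<nu>1 \<nu>2"
      by (elim agree_mono) (auto simp: part_def prep_def ft_step_def inst_def inst_scope_def amplify_def fs_step_def extract_step_def rep_def compare_def sample_def wr_build accum_def copy_step_def norm_step_def inst_names_def net_names_def scope1_def)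
    note eqs2 = agreeD[OF ag2] agreeD[OF ag1]
    have b2: "bnd M \<nu>2" unfolding bnd_def
    proof (intro allI)
      fix x i
      have "imem \<nu>2 ''res'' i \<le> M" using \<nu>2 M1(1) order_trans by blast
      then show "imem \<nu>2 x i \<le> M" using \<nu>1 agreeD(1)[OF ag2, of x] by (cases "x = ''res''") (auto simp: bnd_def)
    qed
    have lab2: "imem \<nu>2 ''lab'' = ?lab" "imem \<nu>2 ''src'' = ?src" "imem \<nu>2 ''snk'' = ?snk" by (simp_all add: eqs2)
    let ?c = "\<lambda>u. u < ?n \<and> ?snk u = 0 \<and> (imem \<nu>2 ''res'' u \<noteq> 0 \<or> ?src u \<noteq> 0)"
    have "run ?upd \<nu>2 (cst ?upd * s) (\<lambda>\<nu>. (\<forall>u. imem \<nu> ''lab'' u = ?lab u + (if ?c u then 2 ^ j else 0)) \<and> bnd M \<nu>)"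
      by (rule run_upd[of \<nu>2 ?n M j s, unfolded lab2]) (use hn pw M1 b2 I s' in \<open>simp_all add: eqs2 round_inv_def\<close>)
    then have "run ?upd \<nu>2 (cst ?upd * s) (\<lambda>\<nu>. (round_inv H es rs B (Suc j) \<nu> \<and> bnd M \<nu> \<and> imem \<nu> ''pw'' 0 = 2 ^ j) \<and>
      of_bool (\<not> ?sep (Suc j) (imem \<nu> ''lab'')) \<le> (of_bool (\<not> ?good (imem \<nu>2 ''res'')) + of_bool (\<not> ?sep j ?lab) :: ennreal))"
    proof (rule run_mono)
      fix \<nu> assume l: "(\<forall>u. imem \<nu> ''lab'' u = ?lab u + (if ?c u then 2 ^ j else 0)) \<and> bnd M \<nu>" and "agree (wr ?upd) \<nu>2 \<nu>"
      then have ag3: "agree {''v'', ''lab''} \<nu>2 \<nu>" by (simp add: upd_step_def insert_commute)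
      note eqs = agreeD[OF ag3] eqs2
      let ?lab' = "imem \<nu> ''lab''"
      have lj: "?lab v < 2 ^ j" for v using I by (simp add: round_inv_def)
      have lab': "?lab' u = ?lab u + (if ?c u then 2 ^ j else 0)" for u using l by blast
      have src: "?src (rs ! i) = bt j i" "?snk (rs ! i) = 1 - bt j i" if "i < length rs" for i using \<nu>1 that by simp_all
      have zero: "?src v = 0" "?snk v = 0" if "v \<notin> ?R" for v using \<nu>1 that by simp_all
      have Rn: "v < ?n" if "v \<in> ?R" for v using rs(2) that by (auto simp: hverts_def)
      \<comment> \<open>On terminals the selection is decided by the marks alone, whatever
        \<open>''res''\<close> contains.\<close>
      have cr: "?c (rs ! i) \<longleftrightarrow> bt j i = 1" if "i < length rs" for i
      proof -
        have "bt j i = 0 \<or> bt j i = 1" using bt_le[of j i] by linarith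
        moreover have "rs ! i < ?n" using Rn that by simp
        ultimately show ?thesis using src[OF that] by auto
      qed
      have mm': "main_mem H es rs B \<nu>"
      proof -
        have "agree {''v'', ''lab'', ''res'', ''l'', ''src'', ''snk''} \<mu> \<nu>" using ag1 ag2 ag3 by (simp add: agree_def)
        from main_mem_cong[OF this, of H es rs B] mm show ?thesis by simp
      qed
      have "?lab' v < 2 ^ Suc j" for v using lj[of v] by (simp add: lab')
      moreover have "?lab' (rs ! i) = i mod 2 ^ Suc j" if "i < length rs" for i
        unfolding mod_bt lab' using cr[OF that] I that by (simp add: round_inv_def)
      ultimately have "round_inv H es rs B (Suc j) \<nu>"
        unfolding round_inv_def using mm' zero \<nu>2 by (simp add: agreeD[OF ag3] agreeD[OF ag2])
      moreover have "imem \<nu> ''pw'' 0 = 2 ^ j" using pw by (simp add: eqs)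
      moreover have "?sep (Suc j) ?lab'" if g: "?good (imem \<nu>2 ''res'')" and sj: "?sep j ?lab"
        unfolding bits_separating_def
      proof (intro allI impI)
        fix b assume "b < Suc j"
        show "min_separating H ?R {v. v < ?n \<and> bt b (?lab' v) = 1}"
        proof (cases "b = j")
          case False
          then have "b < j" using \<open>b < Suc j\<close> by simp
          then have "bt b (?lab' v) = bt b (?lab v)" for v by (simp add: lab' bt_add)
          then show ?thesis using sj \<open>b < j\<close> by (simp add: bits_separating_def)
        next
          case True
          let ?C = "{v. v < ?n \<and> bt j (?lab' v) = 1}"
          have C: "?C = {v. ?c v}"
          proof (intro Collect_cong)
            fix v
            show "v < ?n \<and> bt j (?lab' v) = 1 \<longleftrightarrow> ?c v"
            proof (cases "?c v")
              case True
              then have "?lab' v = ?lab v + 2 ^ j" unfolding lab' by (rule if_P[THEN arg_cong[where f="\<lambda>x. ?lab v + x"]])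
              with True show ?thesis using bt_top(2)[OF lj[of v]] by (simp only: simp_thms)
            next
              case False
              then have "?lab' v = ?lab v" unfolding lab' by (simp only: if_False add_0_right)
              with False show ?thesis using bt_top(1)[OF lj[of v]] by (simp only: zero_neq_one simp_thms)
            qed
          qed
          have lsz: "lab_set H (\<lambda>_. 0) 0 = {v. v < ?n}" by (simp add: lab_set_def)
          have C2: "{v \<in> {v. v < ?n}. (imem \<nu>2 ''res'' v \<noteq> 0 \<or> ?src v \<noteq> 0) \<and> ?snk v = 0} = ?C"
            unfolding C mem_Collect_eq by (intro Collect_cong) (rule iffI; elim conjE; intro conjI; assumption)
          have "hcut_weight H ?C \<le> hcut_weight H C'" if C': "C' \<subseteq> hverts H" "C' \<inter> ?R = ?C \<inter> ?R" for C'
          proof -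
            have 1: "{v \<in> {v. v < ?n}. ?src v \<noteq> 0} \<subseteq> C'"
            proof
              fix v assume v: "v \<in> {v \<in> {v. v < ?n}. ?src v \<noteq> 0}"
              then have v': "v < ?n" "?src v \<noteq> 0" by simp_all
              then have "v \<in> ?R" using zero(1)[of v] by argo
              moreover have "v \<in> ?C" unfolding C mem_Collect_eq using v' disj[of v] by simp
              ultimately show "v \<in> C'" using C'(2) by blast
            qed
            \<comment> \<open>Only terminals are marked as sinks, and on terminals C' agrees with
              the computed side, which avoids them.\<close>
            have 2: "C' \<subseteq> {v \<in> {v. v < ?n}. ?snk v = 0}"
            proof
              fix v assume v: "v \<in> C'"
              have "?snk v = 0"
              proof (cases "v \<in> ?R")
                case True
                then have "v \<in> ?C" using v C'(2) by blast
                then show ?thesis unfolding C mem_Collect_eq by (elim conjE)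
              qed (rule zero)
              then show "v \<in> {v \<in> {v. v < ?n}. ?snk v = 0}" using v C'(1) by (auto simp: hverts_def)
            qed
            show ?thesis using g 1 2 unfolding good_def lsz C2 by blast
          qed
          moreover have "?C \<subseteq> hverts H" by (auto simp: hverts_def)
          ultimately show ?thesis unfolding True min_separating_def by blast
        qed
      qed
      then have "of_bool (\<not> ?sep (Suc j) ?lab') \<le> (of_bool (\<not> ?good (imem \<nu>2 ''res'')) + of_bool (\<not> ?sep j ?lab) :: ennreal)"
        by (auto simp: of_bool_def)
      ultimately show "(round_inv H es rs B (Suc j) \<nu> \<and> bnd M \<nu> \<and> imem \<nu> ''pw'' 0 = 2 ^ j) \<and>
        of_bool (\<not> ?sep (Suc j) ?lab') \<le> (of_bool (\<not> ?good (imem \<nu>2 ''res'')) + of_bool (\<not> ?sep j ?lab) :: ennreal)"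
        using l by blast
    qed simp
    then show "ok ?upd \<nu>2 (cst ?upd * s) (\<lambda>\<nu>. round_inv H es rs B (Suc j) \<nu> \<and> bnd M \<nu> \<and> imem \<nu> ''pw'' 0 = 2 ^ j)
      (\<lambda>\<nu>. of_bool (\<not> ?sep (Suc j) (imem \<nu> ''lab''))) (of_bool (\<not> ?good (imem \<nu>2 ''res'')) + of_bool (\<not> ?sep j ?lab))"
      by (rule ok_run)
  qed
qed

text \<open>Hides the number of rounds; what matters later is that the digits with minimum sides
  determine the label.\<close>

definition separated :: "hypergraph \<Rightarrow> nat set \<Rightarrow> (nat \<Rightarrow> nat) \<Rightarrow> bool" where
  "separated H R lab \<longleftrightarrow> (\<exists>j. (\<forall>v. lab v < 2 ^ j) \<and> bits_separating H R j lab)"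

lemma ok_phase1:
  assumes P: "solver P tp" and tp: "\<And>m' n' m n. m' \<le> m \<Longrightarrow> n' \<le> n \<Longrightarrow> tp m' n' \<le> tp m n"
    and m: "main_mem H es rs B \<mu>" "bnd M \<mu>" and f: "fresh {''src'', ''snk'', ''res'', ''lab''} \<mu>"
    and rs: "distinct rs" "set rs \<subseteq> hverts H"
    and M: "2 + 2 * hm H + hn H \<le> M" "5 * hsize H \<le> M" "2 * B \<le> M" "2 * length rs \<le> M" and B: "1 \<le> B"
    and s: "(length rs + hn H + hsize H + 2) * wlen M + inst_time M tp (hm H) (hn H) (hsize H) \<le> s"
  shows "ok (phase1 P) \<mu> (cst (phase1 P) * (2 * (wlen M + 1) * s)) (\<lambda>\<nu>. main_mem H es rs B \<nu> \<and> bnd M \<nu> \<and>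
      (\<forall>v. v \<notin> set rs \<longrightarrow> imem \<nu> ''src'' v = 0) \<and> (\<forall>v. imem \<nu> ''res'' v \<le> 1) \<and> (\<forall>l<length rs. imem \<nu> ''lab'' (rs ! l) = l))
    (\<lambda>\<nu>. of_bool (\<not> separated H (set rs) (imem \<nu> ''lab''))) (ennreal (real (length rs) / real B))"
  unfolding phase1_def
proof (rule run_Seq_cst)
  let ?s = "2 * (wlen M + 1) * s" and ?k = "length rs"
  have s1: "wlen M \<le> s" using s by (simp add: add_mult_distrib)
  have s2: "wlen M \<le> ?s" by (rule order_trans[OF s1]) simp
  show "run (wt ''pw'' (IConst 1)) \<mu> (cst (wt ''pw'' (IConst 1)) * ?s) (\<lambda>\<nu>. \<nu> = istore ''pw'' 0 1 \<mu> \<and> bnd M \<nu>)"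
    by (rule run_simple_cst[OF _ m(2) s2]) (use M in \<open>simp_all add: exs_simps\<close>)
  fix \<nu>1 assume \<nu>1: "\<nu>1 = istore ''pw'' 0 1 \<mu> \<and> bnd M \<nu>1"
  have I0: "round_inv H es rs B 0 \<nu>1"
    using \<nu>1 m(1) f by (simp add: round_inv_pw) (simp add: round_inv_def fresh_def)
  let ?\<Phi> = "\<lambda>j \<nu>. of_bool (\<not> bits_separating H (set rs) j (imem \<nu> ''lab'')) + ennreal (real (?k - j) / real B) :: ennreal"
  let ?Q = "\<lambda>\<nu>. main_mem H es rs B \<nu> \<and> bnd M \<nu> \<and> (\<forall>v. v \<notin> set rs \<longrightarrow> imem \<nu> ''src'' v = 0) \<and> (\<forall>v. imem \<nu> ''res'' v \<le> 1) \<and> (\<forall>l<?k. imem \<nu> ''lab'' (rs ! l) = l)"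
  have "ok (Dbl ''pw'' (rd ''k'') (round P)) \<nu>1 (cst (Dbl ''pw'' (rd ''k'') (round P)) * ?s) ?Q
    (\<lambda>\<nu>. of_bool (\<not> separated H (set rs) (imem \<nu> ''lab''))) (?\<Phi> 0 \<nu>1)"
  proof (rule ok_Dbl[where I="round_inv H es rs B" and \<Phi>="?\<Phi>", OF M(4)])
    show "bnd M \<nu>1" using \<nu>1 by blast
    show "round_inv H es rs B 0 \<nu>1" by (rule I0)
    show "imem \<nu>1 ''pw'' 0 = 1" by (simp add: conjunct1[OF \<nu>1])
    show "1 \<le> M" using M by simp
    show "ival \<nu> (rd ''k'') = ?k" if "round_inv H es rs B j \<nu>" for j \<nu> using that by (simp add: round_inv_def main_mem_def)
    show "cst (round P) * s \<le> cst (round P) * s" "wlen M \<le> s" using s1 by simp_all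
    fix j \<nu> assume j: "2 ^ j < ?k" and I: "round_inv H es rs B j \<nu>" and bnd: "bnd M \<nu>" and pw: "imem \<nu> ''pw'' 0 = 2 ^ j"
    from ok_add_const[OF ok_round[OF P tp I bnd pw j rs M B s], of "ennreal (real (?k - Suc j) / real B)"]
    show "ok (round P) \<nu> (cst (round P) * s)
      (\<lambda>\<nu>'. round_inv H es rs B (Suc j) (istore ''pw'' 0 (2 ^ Suc j) \<nu>') \<and> bnd M \<nu>' \<and> imem \<nu>' ''pw'' 0 = 2 ^ j)
      (\<lambda>\<nu>'. ?\<Phi> (Suc j) (istore ''pw'' 0 (2 ^ Suc j) \<nu>')) (?\<Phi> j \<nu>)"
    proof (rule ok_mono)
      \<comment> \<open>There are no more rounds than terminals, so a budget of one
        \<open>1 / B\<close> per terminal suffices.\<close>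
      have "j < 2 ^ j" by simp
      then have "j < ?k" using j by linarith
      then have "real (?k - j) / real B = 1 / real B + real (?k - Suc j) / real B"
        by (simp add: add_divide_distrib[symmetric] of_nat_diff)
      then have "ennreal (real (?k - j) / real B) = ennreal (1 / real B) + ennreal (real (?k - Suc j) / real B)"
        by (simp only: ennreal_plus[symmetric] divide_nonneg_nonneg of_nat_0_le_iff zero_le_one)
      then show "of_bool (\<not> bits_separating H (set rs) j (imem \<nu> ''lab'')) + ennreal (1 / real B) + ennreal (real (?k - Suc j) / real B) \<le> ?\<Phi> j \<nu>"
        by (simp add: add.assoc)
    qed (simp_all add: round_inv_pw)
  next
    fix j \<nu> assume j: "?k \<le> 2 ^ j" and I: "round_inv H es rs B j \<nu>" and bnd: "bnd M \<nu>"
    have "imem \<nu> ''lab'' (rs ! l) = l" if "l < ?k" for l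
      using I that j by (simp add: round_inv_def)
    moreover have "bits_separating H (set rs) j (imem \<nu> ''lab'') \<Longrightarrow> separated H (set rs) (imem \<nu> ''lab'')"
      unfolding separated_def using I by (auto simp: round_inv_def)
    ultimately show "?Q \<nu> \<and> of_bool (\<not> separated H (set rs) (imem \<nu> ''lab'')) \<le> ?\<Phi> j \<nu>"
      using I bnd by (auto simp: round_inv_def of_bool_def)
  qed
  then show "ok (Dbl ''pw'' (rd ''k'') (round P)) \<nu>1 (cst (Dbl ''pw'' (rd ''k'') (round P)) * ?s) ?Q
    (\<lambda>\<nu>. of_bool (\<not> separated H (set rs) (imem \<nu> ''lab''))) (ennreal (real ?k / real B))"
    by (rule ok_mono) (simp_all add: bits_separating_def)
qed

text \<open>By \<open>min_isolating_cut_in_sides\<close>, some minimum isolating cut agrees with its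
  terminal in all digits, that is, it lies inside the label class. The terminal is the only source
  in its class, so this cut is a competitor in \<open>good\<close>, and the computed set is no
  heavier.\<close>

lemma good_min_isolating:
  assumes wf: "wf_hypergraph H" and rs: "set rs \<subseteq> hverts H" and l: "l < length rs"
    and lab: "\<And>i. i < length rs \<Longrightarrow> lab (rs ! i) = i" and sep: "separated H (set rs) lab"
    and src: "\<And>v. src v \<noteq> 0 \<longleftrightarrow> v \<in> set rs" and g: "good H lab src (\<lambda>_. 0) l r"
  shows "min_isolating_cut H (set rs) (rs ! l) {v. v < hn H \<and> lab v = l \<and> (r v \<noteq> 0 \<or> src v \<noteq> 0)}"
proof -
  let ?R = "set rs" and ?r = "rs ! l" and ?U = "lab_set H lab l" and ?Y = "{v. v < hn H \<and> lab v = l \<and> (r v \<noteq> 0 \<or> src v \<noteq> 0)}"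
  obtain j where j: "\<forall>v. lab v < 2 ^ j" "bits_separating H ?R j lab" using sep by (auto simp: separated_def)
  have rR: "?r \<in> ?R" using l by simp
  have Un: "v \<in> ?U \<longleftrightarrow> v < hn H \<and> lab v = l" for v by (simp add: lab_set_def)
  have n: "v < hn H" if "v \<in> ?R" for v using rs that by (auto simp: hverts_def)
  have UR: "v = ?r" if v: "v \<in> ?R" "lab v = l" for v
  proof -
    obtain i where "i < length rs" "v = rs ! i" using v(1) unfolding in_set_conv_nth by blast
    then show ?thesis using lab[of i] v(2) by simp
  qed
  have rU: "?r \<in> ?U" using lab[OF l] n[OF rR] by (simp add: Un)
  have A: "v \<in> ?U \<and> src v \<noteq> 0 \<longleftrightarrow> v = ?r" for v
    using UR[of v] rU rR unfolding src Un by blast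
  obtain Y0 where Y0: "min_isolating_cut H ?R ?r Y0" "\<forall>v\<in>Y0. \<forall>b<j. v \<in> {v. v < hn H \<and> bt b (lab v) = 1} \<longleftrightarrow> ?r \<in> {v. v < hn H \<and> bt b (lab v) = 1}"
    using min_isolating_cut_in_sides[OF wf rs rR, of j "\<lambda>b. {v. v < hn H \<and> bt b (lab v) = 1}"] j(2) unfolding bits_separating_def by blast
  have iso: "Y0 \<subseteq> hverts H" "Y0 \<inter> ?R = {?r}" using Y0(1) by (simp_all add: min_isolating_cut_def isolating_set_def)
  have Y0U: "Y0 \<subseteq> ?U"
  proof
    fix v assume v: "v \<in> Y0"
    then have vn: "v < hn H" using iso(1) by (auto simp: hverts_def)
    have "lab v = l"
    proof (rule bt_inject)
      show "lab v < 2 ^ j" using j(1) by blast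
      show "l < 2 ^ j" using spec[OF j(1), of ?r] lab[OF l] by simp
      fix b assume "b < j"
      then have "bt b (lab v) = 1 \<longleftrightarrow> bt b l = 1" using bspec[OF Y0(2) v] vn n[OF rR] lab[OF l] by simp
      moreover have "bt b (lab v) = 0 \<or> bt b (lab v) = 1" "bt b l = 0 \<or> bt b l = 1"
        using bt_le[of b "lab v"] bt_le[of b l] by linarith+
      ultimately show "bt b (lab v) = bt b l" by (elim disjE) simp_all
    qed
    with vn show "v \<in> ?U" by (simp add: Un)
  qed
  have "?r \<in> Y0" using iso(2) by blast
  then have "hcut_weight H ?Y \<le> hcut_weight H Y0"
  proof -
    have "{v \<in> ?U. src v \<noteq> 0} \<subseteq> Y0"
    proof
      fix v assume "v \<in> {v \<in> ?U. src v \<noteq> 0}"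
      then have "v = ?r" using A[of v] by simp
      then show "v \<in> Y0" using \<open>?r \<in> Y0\<close> by simp
    qed
    moreover have "Y0 \<subseteq> {v \<in> ?U. (0::nat) = 0}" using Y0U by simp
    ultimately have "hcut_weight H {v \<in> ?U. (r v \<noteq> 0 \<or> src v \<noteq> 0) \<and> (0::nat) = 0} \<le> hcut_weight H Y0"
      using g unfolding good_def by blast
    moreover have "{v \<in> ?U. (r v \<noteq> 0 \<or> src v \<noteq> 0) \<and> (0::nat) = 0} = ?Y"
      unfolding Un by (intro Collect_cong) simp
    ultimately show ?thesis by simp
  qed
  moreover have "isolating_set H ?R ?r ?Y"
    unfolding isolating_set_def
  proof
    show "?Y \<subseteq> hverts H" by (auto simp: hverts_def)
    have mem: "v \<in> ?Y \<inter> ?R \<longleftrightarrow> v = ?r" for v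
    proof
      assume "v \<in> ?Y \<inter> ?R"
      then show "v = ?r" using UR[of v] by simp
    next
      assume "v = ?r"
      then show "v \<in> ?Y \<inter> ?R" using rU rR src[of ?r] Un[of ?r] by simp
    qed
    show "?Y \<inter> ?R = {?r}" by (intro set_eqI) (simp only: mem singleton_iff)
  qed
  moreover have "hcut_weight H Y0 \<le> hcut_weight H Y'" if "isolating_set H ?R ?r Y'" for Y'
    using Y0(1) that by (simp add: min_isolating_cut_def)
  ultimately show ?thesis unfolding min_isolating_cut_def using order_trans by blast
qed

section \<open>Extracting the isolating cuts\<close>

text \<open>Now every terminal is a source; the labels place exactly one of them in each class below
  k. The output segment of terminal l starts at \<open>l * hn\<close>, with gaps as in the
  buckets.\<close>

definition term_step :: com where
  "term_step = Seq (IAssign ''src'' (IRead ''term'' (rd ''l'')) (IConst 1))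
     (Seq (IAssign ''start'' (IRead ''term'' (rd ''l'')) (IMul (rd ''l'') (rd ''hn'')))
       (IAssign ''stop'' (IRead ''term'' (rd ''l'')) (IMul (rd ''l'') (rd ''hn''))))"

definition stop_at :: iexp where
  "stop_at = IRead ''stop'' (IRead ''term'' (IRead ''lab'' (rd ''v'')))"

text \<open>Labels from k on belong to no terminal, and their vertices occur in no output
  set.\<close>

definition out_step :: com where
  "out_step = Cond (BAnd (ILess (IRead ''lab'' (rd ''v'')) (rd ''k'')) (ILess (IConst 0) (IAdd (IRead ''src'' (rd ''v'')) (IRead ''res'' (rd ''v'')))))
     (Seq (IAssign ''verts'' stop_at (rd ''v'')) (IAssign ''stop'' (IRead ''term'' (IRead ''lab'' (rd ''v''))) (IAdd stop_at (IConst 1)))) Skip"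

text \<open>\<open>''snk''\<close> is not shared and hence zero in the callee: the sink consists
  only of what lies outside the class.\<close>

definition scope2 :: "string list" where
  "scope2 = [''hn'', ''NN'', ''src'', ''res'', ''hm'', ''hp'', ''inc'', ''eo'', ''hw'', ''W'', ''off'', ''lab'', ''k'']"

definition phase2 :: "com \<Rightarrow> com" where
  "phase2 P = Seq (For ''l'' (rd ''k'') term_step) (Seq (Call scope2 (Seq (wt ''K'' (rd ''k'')) (part P))) (For ''v'' (rd ''hn'') out_step))"

definition iso_cuts :: "nat \<Rightarrow> com \<Rightarrow> com" where
  "iso_cuts d P = Seq (init d) (Seq (phase1 P) (phase2 P))"

lemma run_term:
  assumes m: "main_mem H es rs B \<mu>" and rs: "distinct rs" and M: "bnd M \<mu>" "length rs \<le> M" "1 \<le> M" "length rs * hn H \<le> M"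
    and z: "\<And>v. v \<notin> set rs \<Longrightarrow> imem \<mu> ''src'' v = 0" and s: "(length rs + 1) * wlen M \<le> s"
  shows "run (For ''l'' (rd ''k'') term_step) \<mu> (cst (For ''l'' (rd ''k'') term_step) * s)
    (\<lambda>\<nu>. ((\<forall>l<length rs. imem \<nu> ''src'' (rs ! l) = 1 \<and> imem \<nu> ''start'' (rs ! l) = l * hn H \<and> imem \<nu> ''stop'' (rs ! l) = l * hn H) \<and>
      (\<forall>v. v \<notin> set rs \<longrightarrow> imem \<nu> ''src'' v = 0)) \<and> bnd M \<nu>)"
proof (rule run_For_simple_cst[where I="\<lambda>i \<nu>. (\<forall>l<i. imem \<nu> ''src'' (rs ! l) = 1 \<and> imem \<nu> ''start'' (rs ! l) = l * hn H \<and> imem \<nu> ''stop'' (rs ! l) = l * hn H) \<and>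
      (\<forall>v. v \<notin> set rs \<longrightarrow> imem \<nu> ''src'' v = 0)"])
  fix i \<nu> assume "agree (insert ''l'' (wr term_step)) \<mu> \<nu>"
  then have ag: "agree {''l'', ''src'', ''start'', ''stop''} \<mu> \<nu>" by (simp add: term_step_def insert_commute)
  show "ival \<nu> (rd ''k'') = length rs" using m by (simp add: agreeD[OF ag] main_mem_def)
  assume i: "i < length rs" "imem \<nu> ''l'' 0 = i" and I: "(\<forall>l<i. imem \<nu> ''src'' (rs ! l) = 1 \<and> imem \<nu> ''start'' (rs ! l) = l * hn H \<and> imem \<nu> ''stop'' (rs ! l) = l * hn H) \<and>
      (\<forall>v. v \<notin> set rs \<longrightarrow> imem \<nu> ''src'' v = 0)"
  have t: "imem \<nu> ''term'' i = rs ! i" "imem \<nu> ''hn'' 0 = hn H" using m i by (simp_all add: agreeD[OF ag] main_mem_def hmem_def)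
  have ne: "rs ! l \<noteq> rs ! i" if "l < i" for l using nth_eq_iff_index_eq[OF rs, of l i] that i(1) by simp
  have "i * hn H \<le> length rs * hn H" using i(1) by (intro mult_right_mono) simp_all
  then have le: "i * hn H \<le> M" using M(4) by linarith
  have r: "v \<noteq> rs ! i" if "v \<notin> set rs" for v using i(1) that by auto
  show "exs M term_step \<nu> (\<lambda>\<nu>'. (\<forall>l<Suc i. imem (istore ''l'' 0 (Suc i) \<nu>') ''src'' (rs ! l) = 1 \<and> imem (istore ''l'' 0 (Suc i) \<nu>') ''start'' (rs ! l) = l * hn H \<and> imem (istore ''l'' 0 (Suc i) \<nu>') ''stop'' (rs ! l) = l * hn H) \<and>
      (\<forall>v. v \<notin> set rs \<longrightarrow> imem (istore ''l'' 0 (Suc i) \<nu>') ''src'' v = 0))"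
    unfolding term_step_def exs_simps using I ne le r i t M(3) by (simp add: less_Suc_eq)
qed (use M z s in \<open>simp_all add: term_step_def\<close>)

lemma run_out:
  assumes m: "main_mem H es rs B \<mu>" and rs: "distinct rs" and M: "bnd M \<mu>" "hn H \<le> M" "length rs * hn H + hn H + 1 \<le> M"
    and st: "\<And>l. l < length rs \<Longrightarrow> imem \<mu> ''start'' (rs ! l) = l * hn H \<and> imem \<mu> ''stop'' (rs ! l) = l * hn H"
    and s: "(hn H + 1) * wlen M \<le> s"
  shows "run (For ''v'' (rd ''hn'') out_step) \<mu> (cst (For ''v'' (rd ''hn'') out_step) * s)
    (\<lambda>\<nu>. (\<forall>l<length rs. imem \<nu> ''verts'' ` {imem \<nu> ''start'' (rs ! l)..<imem \<nu> ''stop'' (rs ! l)} =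
       {u. u < hn H \<and> imem \<mu> ''lab'' u = l \<and> (imem \<mu> ''res'' u \<noteq> 0 \<or> imem \<mu> ''src'' u \<noteq> 0)}) \<and> bnd M \<nu>)"
proof -
  let ?n = "hn H" and ?k = "length rs"
  let ?sel = "\<lambda>u. imem \<mu> ''res'' u \<noteq> 0 \<or> imem \<mu> ''src'' u \<noteq> 0"
  let ?J = "\<lambda>i \<nu>. \<forall>l<?k. l * ?n \<le> imem \<nu> ''stop'' (rs ! l) \<and> imem \<nu> ''stop'' (rs ! l) \<le> l * ?n + i \<and>
    imem \<nu> ''verts'' ` {l * ?n..<imem \<nu> ''stop'' (rs ! l)} = {u. u < i \<and> imem \<mu> ''lab'' u = l \<and> ?sel u}"
  have "run (For ''v'' (rd ''hn'') out_step) \<mu> (cst (For ''v'' (rd ''hn'') out_step) * s) (\<lambda>\<nu>. ?J ?n \<nu> \<and> bnd M \<nu>)"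
  proof (rule run_For_simple_cst[where I="?J"])
    fix i \<nu> assume "agree (insert ''v'' (wr out_step)) \<mu> \<nu>"
    then have ag: "agree {''v'', ''verts'', ''stop''} \<mu> \<nu>" by (simp add: out_step_def insert_commute)
    show "ival \<nu> (rd ''hn'') = ?n" using m by (simp add: agreeD[OF ag] main_mem_def hmem_def)
    assume i: "i < ?n" "imem \<nu> ''v'' 0 = i" and J: "?J i \<nu>"
    let ?l = "imem \<mu> ''lab'' i"
    have k: "imem \<nu> ''k'' 0 = ?k" using m by (simp add: agreeD[OF ag] main_mem_def)
    have b: "bval \<nu> (BAnd (ILess (IRead ''lab'' (rd ''v'')) (rd ''k'')) (ILess (IConst 0) (IAdd (IRead ''src'' (rd ''v'')) (IRead ''res'' (rd ''v''))))) \<longleftrightarrow> ?l < ?k \<and> ?sel i"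
      using i(2) k by (auto simp: agreeD[OF ag])
    show "exs M out_step \<nu> (\<lambda>\<nu>'. ?J (Suc i) (istore ''v'' 0 (Suc i) \<nu>'))"
    proof (cases "?l < ?k \<and> ?sel i")
      case False
      have nb: "\<not> bval \<nu> (BAnd (ILess (IRead ''lab'' (rd ''v'')) (rd ''k'')) (ILess (IConst 0) (IAdd (IRead ''src'' (rd ''v'')) (IRead ''res'' (rd ''v'')))))"
        unfolding b by (rule False)
      have "?J (Suc i) \<nu>"
      proof (intro allI impI)
        fix l assume l: "l < ?k"
        have "{u. u < Suc i \<and> imem \<mu> ''lab'' u = l \<and> ?sel u} = {u. u < i \<and> imem \<mu> ''lab'' u = l \<and> ?sel u}"
        proof (intro Collect_cong)
          show "u < Suc i \<and> imem \<mu> ''lab'' u = l \<and> ?sel u \<longleftrightarrow> u < i \<and> imem \<mu> ''lab'' u = l \<and> ?sel u" for u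
            using False l by (cases "u = i") (simp_all add: less_Suc_eq)
        qed
        with J l show "l * ?n \<le> imem \<nu> ''stop'' (rs ! l) \<and> imem \<nu> ''stop'' (rs ! l) \<le> l * ?n + Suc i \<and>
            imem \<nu> ''verts'' ` {l * ?n..<imem \<nu> ''stop'' (rs ! l)} = {u. u < Suc i \<and> imem \<mu> ''lab'' u = l \<and> ?sel u}" by (simp add: le_SucI)
      qed
      then show ?thesis unfolding out_step_def exs_simps if_not_P[OF nb] by simp
    next
      case True
      have nb: "bval \<nu> (BAnd (ILess (IRead ''lab'' (rd ''v'')) (rd ''k'')) (ILess (IConst 0) (IAdd (IRead ''src'' (rd ''v'')) (IRead ''res'' (rd ''v'')))))"
        unfolding b by (rule True)
      have lk: "?l < ?k" using True by simp
      let ?s = "imem \<nu> ''stop'' (rs ! ?l)"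
      let ?\<nu>1 = "istore ''verts'' ?s i \<nu>"
      let ?\<nu>2 = "istore ''stop'' (rs ! ?l) (Suc ?s) ?\<nu>1"
      have t: "imem \<nu> ''term'' ?l = rs ! ?l" "imem \<nu> ''lab'' i = ?l" using m lk by (simp_all add: agreeD[OF ag] main_mem_def)
      have e: "ival \<nu> stop_at = ?s" "ival ?\<nu>1 stop_at = ?s" "ival ?\<nu>1 (IRead ''term'' (IRead ''lab'' (rd ''v''))) = rs ! ?l" "ival \<nu> (rd ''v'') = i"
        using i(2) t by (simp_all add: stop_at_def)
      have sl: "?l * ?n \<le> ?s" "?s \<le> ?l * ?n + i" using J lk by simp_all
      have "?l * ?n \<le> ?k * ?n" using lk by (intro mult_right_mono) simp_all
      then have sM: "Suc ?s \<le> M" using sl i(1) M(3) by linarith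
      have iM: "i \<le> M" using i(1) M(2) by simp
      have "?J (Suc i) ?\<nu>2"
      proof (intro allI impI)
        fix l assume l: "l < ?k"
        show "l * ?n \<le> imem ?\<nu>2 ''stop'' (rs ! l) \<and> imem ?\<nu>2 ''stop'' (rs ! l) \<le> l * ?n + Suc i \<and>
            imem ?\<nu>2 ''verts'' ` {l * ?n..<imem ?\<nu>2 ''stop'' (rs ! l)} = {u. u < Suc i \<and> imem \<mu> ''lab'' u = l \<and> ?sel u}"
        proof (cases "l = ?l")
          case True
          have "{?l * ?n..<Suc ?s} = insert ?s {?l * ?n..<?s}" using sl(1) by auto
          moreover have "imem ?\<nu>2 ''verts'' ` {?l * ?n..<?s} = imem \<nu> ''verts'' ` {?l * ?n..<?s}" by (intro image_cong) simp_all
          moreover have "imem \<nu> ''verts'' ` {?l * ?n..<?s} = {u. u < i \<and> imem \<mu> ''lab'' u = ?l \<and> ?sel u}" using J lk by simp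
          moreover have "{u. u < Suc i \<and> imem \<mu> ''lab'' u = ?l \<and> ?sel u} = insert i {u. u < i \<and> imem \<mu> ''lab'' u = ?l \<and> ?sel u}"
            using \<open>?l < ?k \<and> ?sel i\<close> unfolding less_Suc_eq by blast
          moreover have "imem ?\<nu>2 ''verts'' ?s = i" "imem ?\<nu>2 ''stop'' (rs ! ?l) = Suc ?s" by simp_all
          ultimately show ?thesis unfolding True using sl by (simp del: imem_istore)
        next
          case False
          have ne: "rs ! l \<noteq> rs ! ?l" using nth_eq_iff_index_eq[OF rs l lk] False by simp
          \<comment> \<open>Output segments never overlap: before round i each holds at most i
            entries, fewer than the stride n, so the new entry lies in its own stride.\<close>
          have dis: "imem ?\<nu>2 ''verts'' x = imem \<nu> ''verts'' x" if x: "x \<in> {l * ?n..<imem \<nu> ''stop'' (rs ! l)}" for x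
          proof -
            have "imem \<nu> ''stop'' (rs ! l) \<le> l * ?n + i" using J l by blast
            then have "x - l * ?n < ?n" "l * ?n + (x - l * ?n) = x" using x i(1) by auto
            moreover have "?s - ?l * ?n < ?n" "?l * ?n + (?s - ?l * ?n) = ?s" using sl i(1) by auto
            ultimately have "x \<noteq> ?s" using mult_add_inj[of "x - l * ?n" ?n "?s - ?l * ?n" l ?l] False by metis
            then show ?thesis by simp
          qed
          have stop: "imem ?\<nu>2 ''stop'' (rs ! l) = imem \<nu> ''stop'' (rs ! l)" using ne by simp
          have "imem ?\<nu>2 ''verts'' ` {l * ?n..<imem \<nu> ''stop'' (rs ! l)} = imem \<nu> ''verts'' ` {l * ?n..<imem \<nu> ''stop'' (rs ! l)}"
            by (rule image_cong[OF refl dis])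
          moreover have "{u. u < Suc i \<and> imem \<mu> ''lab'' u = l \<and> ?sel u} = {u. u < i \<and> imem \<mu> ''lab'' u = l \<and> ?sel u}"
            using False unfolding less_Suc_eq by blast
          ultimately show ?thesis unfolding stop using J l by (simp del: imem_istore add: le_SucI)
        qed
      qed
      then show ?thesis unfolding out_step_def exs_simps if_P[OF nb] e using sM iM e by simp
    qed
  next
    show "?J 0 (istore ''v'' 0 0 \<mu>)" using st by simp
  qed (use M s in \<open>simp_all add: out_step_def\<close>)
  then show ?thesis
  proof (rule run_mono)
    fix \<nu> assume J: "?J ?n \<nu> \<and> bnd M \<nu>" and "agree (wr (For ''v'' (rd ''hn'') out_step)) \<mu> \<nu>"
    then have "agree {''v'', ''verts'', ''stop''} \<mu> \<nu>" by (simp add: out_step_def insert_commute)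
    then have "imem \<nu> ''start'' (rs ! l) = l * ?n" if "l < ?k" for l using st[OF that] by (simp add: agreeD)
    then show "(\<forall>l<length rs. imem \<nu> ''verts'' ` {imem \<nu> ''start'' (rs ! l)..<imem \<nu> ''stop'' (rs ! l)} =
       {u. u < hn H \<and> imem \<mu> ''lab'' u = l \<and> (imem \<mu> ''res'' u \<noteq> 0 \<or> imem \<mu> ''src'' u \<noteq> 0)}) \<and> bnd M \<nu>"
      using J by simp
  qed simp
qed

text \<open>The output can be wrong only if the labels were not \<open>separated\<close>, which is
  known before the phase starts, or if some instance is not \<open>good\<close>; the two
  contributions are added.\<close>

lemma ok_phase2:
  assumes P: "solver P tp" and tp: "\<And>m' n' m n. m' \<le> m \<Longrightarrow> n' \<le> n \<Longrightarrow> tp m' n' \<le> tp m n"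
    and m: "main_mem H es rs B \<mu>" "bnd M \<mu>" and z: "\<And>v. v \<notin> set rs \<Longrightarrow> imem \<mu> ''src'' v = 0" and r: "\<And>v. imem \<mu> ''res'' v \<le> 1"
    and lab: "\<And>l. l < length rs \<Longrightarrow> imem \<mu> ''lab'' (rs ! l) = l"
    and rs: "distinct rs" "set rs \<subseteq> hverts H"
    and M: "2 + 2 * hm H + hn H \<le> M" "5 * hsize H \<le> M" "2 * B \<le> M" "length rs \<le> M" "length rs * hn H + hn H + 1 \<le> M" and B: "1 \<le> B"
    and s: "(hn H + hsize H + length rs + 1) * wlen M + (\<Sum>i<length rs. inst_time M tp (hm H) (cnt (imem \<mu> ''lab'') i (hn H))
      (cnt (\<lambda>q. imem \<mu> ''lab'' (concat es ! q)) i (hsize H))) \<le> s"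
  shows "ok (phase2 P) \<mu> (cst (phase2 P) * s) (\<lambda>_. True) (\<lambda>\<nu>. of_bool (\<not> isocut_output (H, set rs) \<nu>))
    (of_bool (\<not> separated H (set rs) (imem \<mu> ''lab'')) + ennreal (real (length rs) / real B))"
  unfolding phase2_def
proof (rule run_Seq_cst)
  let ?n = "hn H" and ?k = "length rs" and ?lab = "imem \<mu> ''lab''"
  let ?t = "For ''l'' (rd ''k'') term_step" and ?out = "For ''v'' (rd ''hn'') out_step"
  have h: "hmem H \<mu>" using m by (simp add: main_mem_def)
  have wf: "wf_hypergraph H" using h by (simp add: hmem_def)
  have s': "(?k + 1) * wlen M \<le> s" "(?n + 1) * wlen M \<le> s" "wlen M \<le> s" using s by (simp_all add: add_mult_distrib)
  have M1: "1 \<le> M" "?n \<le> M" "?k * ?n \<le> M" using M by simp_all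
  let ?S = "\<lambda>\<nu>. (\<forall>l<?k. imem \<nu> ''src'' (rs ! l) = 1 \<and> imem \<nu> ''start'' (rs ! l) = l * ?n \<and> imem \<nu> ''stop'' (rs ! l) = l * ?n) \<and>
      (\<forall>v. v \<notin> set rs \<longrightarrow> imem \<nu> ''src'' v = 0)"
  show "run ?t \<mu> (cst ?t * s) (\<lambda>\<nu>. ?S \<nu> \<and> bnd M \<nu>)"
    by (rule run_term[OF m(1) rs(1) m(2) M(4) M1(1,3) z s'(1)])
  fix \<nu>1 assume \<nu>1: "?S \<nu>1 \<and> bnd M \<nu>1" and "agree (wr ?t) \<mu> \<nu>1"
  then have ag1: "agree {''l'', ''src'', ''start'', ''stop''} \<mu> \<nu>1" by (simp add: term_step_def insert_commute)
  let ?src = "imem \<nu>1 ''src''"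
  have src: "?src v \<noteq> 0 \<longleftrightarrow> v \<in> set rs" for v
  proof (cases "v \<in> set rs")
    case True
    then obtain l where "l < ?k" "v = rs ! l" unfolding in_set_conv_nth by blast
    with True \<nu>1 show ?thesis by simp
  next
    case False
    with \<nu>1 show ?thesis by simp
  qed
  have mm1: "main_mem H es rs B \<nu>1" using main_mem_cong[OF ag1, of H es rs B] m(1) by simp
  let ?call = "Call scope2 (Seq (wt ''K'' (rd ''k'')) (part P))"
  let ?good = "\<lambda>r. \<forall>i<?k. good H ?lab ?src (\<lambda>_. 0) i r"
  let ?sep = "separated H (set rs) ?lab"
  show "ok (Seq ?call ?out) \<nu>1 (cst (Seq ?call ?out) * s) (\<lambda>_. True) (\<lambda>\<nu>. of_bool (\<not> isocut_output (H, set rs) \<nu>))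
    (of_bool (\<not> ?sep) + ennreal (real ?k / real B))"
  proof (rule ok_Seq_cst)
    let ?o = "overlay scope2 \<nu>1 zero_mem"
    have "ok (Seq (wt ''K'' (rd ''k'')) (part P)) ?o (cst (Seq (wt ''K'' (rd ''k'')) (part P)) * s)
       (\<lambda>\<nu>. \<forall>v. imem \<nu> ''res'' v \<le> 1) (\<lambda>\<nu>. of_bool (\<not> ?good (imem \<nu> ''res''))) (ennreal (real ?k / real B))"
    proof (rule run_Seq_cst)
      have k0: "imem ?o ''k'' 0 = ?k" using mm1 by (simp add: scope2_def main_mem_def)
      show "run (wt ''K'' (rd ''k'')) ?o (cst (wt ''K'' (rd ''k'')) * s) (\<lambda>\<nu>. \<nu> = istore ''K'' 0 ?k ?o \<and> bnd M \<nu>)"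
        by (rule run_simple_cst) (use \<nu>1 M s' k0 in \<open>simp_all add: exs_simps bnd_overlay\<close>)
      fix \<kappa> assume \<kappa>: "\<kappa> = istore ''K'' 0 ?k ?o \<and> bnd M \<kappa>"
      have k: "imem \<kappa> x = imem \<nu>1 x" "rmem \<kappa> x = rmem \<nu>1 x" if "x \<in> set scope2" for x
        using that conjunct1[OF \<kappa>] by (auto simp: scope2_def)
      have snk0: "imem \<kappa> ''snk'' = (\<lambda>_. 0)" using conjunct1[OF \<kappa>] by (simp add: scope2_def fun_eq_iff)
      have src': "imem \<kappa> ''src'' = ?src" "imem \<kappa> ''lab'' = ?lab" "imem \<kappa> ''NN'' 0 = B" "imem \<kappa> ''res'' = imem \<mu> ''res''" "imem \<kappa> ''inc'' = imem \<mu> ''inc''"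
        using m(1) by (simp_all add: k scope2_def agreeD[OF ag1] main_mem_def)
      have hk: "hmem H \<kappa>" using h by (simp add: hmem_def k scope2_def agreeD[OF ag1])
      have inc: "imem \<mu> ''inc'' q = concat es ! q" if "q < hsize H" for q using m(1) that by (simp add: main_mem_def)
      have ceq: "cnt (\<lambda>q. ?lab (imem \<mu> ''inc'' q)) i (hsize H) = cnt (\<lambda>q. ?lab (concat es ! q)) i (hsize H)" for i
        unfolding cnt_def using inc by (intro arg_cong[where f=card] Collect_cong) auto
      have "ok (part P) \<kappa> (cst (part P) * s) (\<lambda>\<nu>. \<forall>v. imem \<nu> ''res'' v \<le> 1)
        (\<lambda>\<nu>. of_bool (\<not> (\<forall>i<?k. good H (imem \<kappa> ''lab'') (imem \<kappa> ''src'') (imem \<kappa> ''snk'') i (imem \<nu> ''res''))))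
        (ennreal (real ?k / real (imem \<kappa> ''NN'' 0)))"
      proof (rule ok_part[OF P tp hk])
        show "fresh {''VL'', ''vc'', ''pos'', ''IL'', ''ic'', ''iq'', ''ft''} \<kappa>" using conjunct1[OF \<kappa>] by (simp add: fresh_def scope2_def fun_eq_iff)
        show "(?n + hsize H + ?k + 1) * wlen M + (\<Sum>i<?k. inst_time M tp (hm H) (cnt (imem \<kappa> ''lab'') i ?n)
           (cnt (\<lambda>q. imem \<kappa> ''lab'' (imem \<kappa> ''inc'' q)) i (hsize H))) \<le> s"
          using s by (simp only: src' ceq)
        show "bnd M \<kappa>" using \<kappa> by blast
        show "imem \<kappa> ''K'' 0 = ?k" using conjunct1[OF \<kappa>] by simp
        show "2 * imem \<kappa> ''NN'' 0 \<le> M" "1 \<le> imem \<kappa> ''NN'' 0" unfolding src' by (rule M B)+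
        show "imem \<kappa> ''src'' v = 0 \<or> imem \<kappa> ''snk'' v = 0" for v unfolding snk0 by simp
        show "imem \<kappa> ''res'' v \<le> 1" for v unfolding src' by (rule r)
      qed (rule M M1 | assumption)+
      then show "ok (part P) \<kappa> (cst (part P) * s) (\<lambda>\<nu>. \<forall>v. imem \<nu> ''res'' v \<le> 1) (\<lambda>\<nu>. of_bool (\<not> ?good (imem \<nu> ''res''))) (ennreal (real ?k / real B))"
        by (simp only: snk0 src')
    qed
    then have "ok ?call \<nu>1 (cst ?call * s) (\<lambda>\<nu>. \<forall>v. imem \<nu> ''res'' v \<le> 1) (\<lambda>\<nu>. of_bool (\<not> ?good (imem \<nu> ''res''))) (ennreal (real ?k / real B))"
    proof (intro ok_Call_cst)
      assume "ok (Seq (wt ''K'' (rd ''k'')) (part P)) ?o (cst (Seq (wt ''K'' (rd ''k'')) (part P)) * s)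
       (\<lambda>\<nu>. \<forall>v. imem \<nu> ''res'' v \<le> 1) (\<lambda>\<nu>. of_bool (\<not> ?good (imem \<nu> ''res''))) (ennreal (real ?k / real B))"
      then show "ok (Seq (wt ''K'' (rd ''k'')) (part P)) ?o (cst (Seq (wt ''K'' (rd ''k'')) (part P)) * s)
       (\<lambda>\<nu>. \<forall>v. imem (overlay scope2 \<nu> \<nu>1) ''res'' v \<le> 1) (\<lambda>\<nu>. of_bool (\<not> ?good (imem (overlay scope2 \<nu> \<nu>1) ''res''))) (ennreal (real ?k / real B))"
        by (rule ok_mono) (simp_all add: scope2_def)
    qed (use s'(3) wlen_pos(2)[of M] in simp)
    from ok_add_const[OF this, of "of_bool (\<not> ?sep)"]
    show "ok ?call \<nu>1 (cst ?call * s) (\<lambda>\<nu>. \<forall>v. imem \<nu> ''res'' v \<le> 1) (\<lambda>\<nu>. of_bool (\<not> ?good (imem \<nu> ''res'')) + of_bool (\<not> ?sep))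
      (of_bool (\<not> ?sep) + ennreal (real ?k / real B))"
      by (simp only: add.commute)
    fix \<nu>2 assume \<nu>2: "\<forall>v. imem \<nu>2 ''res'' v \<le> 1" and "agree (wr ?call) \<nu>1 \<nu>2"
    then have ag2: "agree {''res''} \<nu>1 \<nu>2"
      by (elim agree_mono) (auto simp: part_def prep_def ft_step_def inst_def inst_scope_def amplify_def fs_step_def extract_step_def rep_def compare_def sample_def wr_build accum_def copy_step_def norm_step_def inst_names_def net_names_def scope2_def)
    have b2: "bnd M \<nu>2" unfolding bnd_def
    proof (intro allI)
      fix x i
      have r2: "imem \<nu>2 ''res'' i \<le> M" using spec[OF \<nu>2] M1(1) order_trans by blast
      show "imem \<nu>2 x i \<le> M"
      proof (cases "x = ''res''")
        case True
        then show ?thesis using r2 by simp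
      next
        case False
        then have "imem \<nu>2 x = imem \<nu>1 x" using agreeD(1)[OF ag2, of x] by simp
        then show ?thesis using \<nu>1 by (simp add: bnd_def)
      qed
    qed
    have eq2: "imem \<nu>2 ''lab'' = ?lab" "imem \<nu>2 ''src'' = ?src" "imem \<nu>2 ''start'' = imem \<nu>1 ''start''" "imem \<nu>2 ''stop'' = imem \<nu>1 ''stop''"
      by (simp_all add: agreeD[OF ag2] agreeD[OF ag1])
    have mm2: "main_mem H es rs B \<nu>2" using main_mem_cong[OF ag2, of H es rs B] mm1 by simp
    have st: "imem \<nu>2 ''start'' (rs ! l) = l * ?n \<and> imem \<nu>2 ''stop'' (rs ! l) = l * ?n" if "l < ?k" for l
      unfolding eq2 using \<nu>1 that by simp
    let ?r = "imem \<nu>2 ''res''"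
    let ?bad = "of_bool (\<not> ?good ?r) + of_bool (\<not> ?sep) :: ennreal"
    have "run ?out \<nu>2 (cst ?out * s) (\<lambda>\<nu>. (\<forall>l<?k. imem \<nu> ''verts'' ` {imem \<nu> ''start'' (rs ! l)..<imem \<nu> ''stop'' (rs ! l)} =
       {u. u < ?n \<and> imem \<nu>2 ''lab'' u = l \<and> (imem \<nu>2 ''res'' u \<noteq> 0 \<or> imem \<nu>2 ''src'' u \<noteq> 0)}) \<and> bnd M \<nu>)"
      by (rule run_out[OF mm2 rs(1) b2 M1(2) M(5) st s'(2)])
    then have "run ?out \<nu>2 (cst ?out * s) (\<lambda>\<nu>. True \<and> of_bool (\<not> isocut_output (H, set rs) \<nu>) \<le> ?bad)"
    proof (rule run_mono)
      fix \<nu> assume "(\<forall>l<?k. imem \<nu> ''verts'' ` {imem \<nu> ''start'' (rs ! l)..<imem \<nu> ''stop'' (rs ! l)} =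
       {u. u < ?n \<and> imem \<nu>2 ''lab'' u = l \<and> (imem \<nu>2 ''res'' u \<noteq> 0 \<or> imem \<nu>2 ''src'' u \<noteq> 0)}) \<and> bnd M \<nu>"
      then have out: "imem \<nu> ''verts'' ` {imem \<nu> ''start'' (rs ! l)..<imem \<nu> ''stop'' (rs ! l)} =
        {u. u < ?n \<and> ?lab u = l \<and> (?r u \<noteq> 0 \<or> ?src u \<noteq> 0)}" if "l < ?k" for l
        unfolding eq2 using that by blast
      have iso: "isocut_output (H, set rs) \<nu>" if g: "?good ?r" and sep: "?sep"
        unfolding isocut_output_def prod.case
      proof
        fix r assume "r \<in> set rs"
        then obtain l where l: "l < ?k" "r = rs ! l" unfolding in_set_conv_nth by blast
        have gl: "good H ?lab ?src (\<lambda>_. 0) l ?r" using g l(1) by blast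
        show "min_isolating_cut H (set rs) r (imem \<nu> ''verts'' ` {imem \<nu> ''start'' r..<imem \<nu> ''stop'' r})"
          unfolding l(2) out[OF l(1)] by (rule good_min_isolating[OF wf rs(2) l(1) lab sep src gl])
      qed
      show "True \<and> of_bool (\<not> isocut_output (H, set rs) \<nu>) \<le> ?bad"
      proof (cases "?good ?r \<and> ?sep")
        case True
        then have "isocut_output (H, set rs) \<nu>" by (intro iso) simp_all
        then show ?thesis by simp
      next
        case False
        have "1 \<le> ?bad"
        proof (cases "?sep")
          case True
          then have "\<not> ?good ?r" using False by blast
          then show ?thesis unfolding of_bool_eq(1) by (simp only: of_bool_eq not_False_eq_True le_iff_add) (rule exI, rule refl)
        qed simp
        moreover have "of_bool (\<not> isocut_output (H, set rs) \<nu>) \<le> (1::ennreal)" by simp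
        ultimately show ?thesis using order_trans by blast
      qed
    qed simp
    then show "ok ?out \<nu>2 (cst ?out * s) (\<lambda>_. True) (\<lambda>\<nu>. of_bool (\<not> isocut_output (H, set rs) \<nu>)) ?bad"
      by (rule ok_run)
  qed
qed

section \<open>The running time\<close>

text \<open>The labels are random, so the scale s has to suffice for every possible labelling; hence
  the quantification over f and g. Each phase contributes \<open>k / B\<close> to the failure
  probability, and the factor \<open>2 * (wlen M + 1)\<close> is the doubling loop over the
  digits.\<close>

lemma ok_iso_cuts:
  assumes P: "solver P tp" and tp: "\<And>m' n' m n. m' \<le> m \<Longrightarrow> n' \<le> n \<Longrightarrow> tp m' n' \<le> tp m n"
    and inp: "input_lists H R es rs \<mu>" and B: "B = (hsize H + hm H + hn H + 1) ^ d"
    and M: "hsize H + hm H + hn H + 1 \<le> M" "2 + 2 * hm H + hn H \<le> M" "5 * hsize H \<le> M" "2 * B \<le> M" "2 * length rs \<le> M"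
      "length rs * hn H + hn H + 1 \<le> M"
    and s1: "(2 * hsize H + 3 * hm H + hn H + length rs + 2) * wlen M + inst_time M tp (hm H) (hn H) (hsize H) \<le> s"
    and s2: "\<And>f g. (2 * hsize H + 3 * hm H + hn H + length rs + 2) * wlen M +
      (\<Sum>i<length rs. inst_time M tp (hm H) (cnt f i (hn H)) (cnt g i (hsize H))) \<le> s"
  shows "ok (iso_cuts d P) \<mu> (cst (iso_cuts d P) * (2 * (wlen M + 1) * s)) (\<lambda>_. True) (\<lambda>\<nu>. of_bool (\<not> isocut_output (H, R) \<nu>))
    (ennreal (2 * real (length rs) / real B))"
proof -
  let ?k = "length rs" and ?s = "2 * (wlen M + 1) * s"
  have rs: "distinct rs" "set rs = R" "R \<subseteq> hverts H" using inp by (simp_all add: input_lists_def)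
  have rs': "set rs \<subseteq> hverts H" using rs by simp
  have B1: "1 \<le> B" unfolding B by simp
  have ss: "s \<le> ?s" by simp
  have a: "(2 * hsize H + 3 * hm H + hn H + ?k + 2) * wlen M \<le> s" using s1 by linarith
  have le: "x * wlen M \<le> (2 * hsize H + 3 * hm H + hn H + ?k + 2) * wlen M" if "x \<le> 2 * hsize H + 3 * hm H + hn H + ?k + 2" for x
    using that by (rule mult_le_mono1)
  have si: "(2 * hsize H + 3 * hm H + 1) * wlen M \<le> ?s" using le[of "2 * hsize H + 3 * hm H + 1"] a ss by linarith
  have sp: "(?k + hn H + hsize H + 2) * wlen M + inst_time M tp (hm H) (hn H) (hsize H) \<le> s"
    using le[of "?k + hn H + hsize H + 2"] s1 by linarith
  have sq: "(hn H + hsize H + ?k + 1) * wlen M + (\<Sum>i<?k. inst_time M tp (hm H) (cnt f i (hn H)) (cnt g i (hsize H))) \<le> ?s" for f g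
    using le[of "hn H + hsize H + ?k + 1"] s2[of f g] ss by linarith
  have BM: "B \<le> M" "?k \<le> M" using M by simp_all
  have e: "ennreal (real ?k / real B) + ennreal (real ?k / real B) = ennreal (2 * real ?k / real B)"
    by (subst ennreal_plus[symmetric]) simp_all
  show ?thesis unfolding iso_cuts_def
  proof (rule run_Seq_cst)
    show "run (init d) \<mu> (cst (init d) * ?s) (\<lambda>\<nu>. main_mem H es rs B \<nu> \<and> bnd M \<nu>)"
      by (rule run_init[OF inp B BM(1) M(1) si])
    fix \<nu> assume \<nu>: "main_mem H es rs B \<nu> \<and> bnd M \<nu>" and ag: "agree (wr (init d)) \<mu> \<nu>"
    have "fresh {''src'', ''snk'', ''res'', ''lab''} \<mu>"
      using inp by (auto simp: input_lists_def fresh_def)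
    then have f: "fresh {''src'', ''snk'', ''res'', ''lab''} \<nu>"
      using agreeD[OF ag] by (simp add: fresh_def init_def init1_def weight_step_def owner_loop_def owner_step_def)
    let ?sep = "\<lambda>\<nu>. separated H (set rs) (imem \<nu> ''lab'')"
    show "ok (Seq (phase1 P) (phase2 P)) \<nu> (cst (Seq (phase1 P) (phase2 P)) * ?s) (\<lambda>_. True)
       (\<lambda>\<nu>. of_bool (\<not> isocut_output (H, R) \<nu>)) (ennreal (2 * real ?k / real B))"
      unfolding e[symmetric]
    proof (rule ok_Seq_cst)
      show "ok (phase1 P) \<nu> (cst (phase1 P) * ?s) (\<lambda>\<nu>. main_mem H es rs B \<nu> \<and> bnd M \<nu> \<and>
          (\<forall>v. v \<notin> set rs \<longrightarrow> imem \<nu> ''src'' v = 0) \<and> (\<forall>v. imem \<nu> ''res'' v \<le> 1) \<and> (\<forall>l<?k. imem \<nu> ''lab'' (rs ! l) = l))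
        (\<lambda>\<nu>. of_bool (\<not> ?sep \<nu>) + ennreal (real ?k / real B)) (ennreal (real ?k / real B) + ennreal (real ?k / real B))"
        by (rule ok_add_const, rule ok_phase1[OF P tp conjunct1[OF \<nu>] conjunct2[OF \<nu>] f rs(1) rs' M(2-5) B1 sp])
      fix \<kappa> assume \<kappa>: "main_mem H es rs B \<kappa> \<and> bnd M \<kappa> \<and>
          (\<forall>v. v \<notin> set rs \<longrightarrow> imem \<kappa> ''src'' v = 0) \<and> (\<forall>v. imem \<kappa> ''res'' v \<le> 1) \<and> (\<forall>l<?k. imem \<kappa> ''lab'' (rs ! l) = l)"
      show "ok (phase2 P) \<kappa> (cst (phase2 P) * ?s) (\<lambda>_. True) (\<lambda>\<nu>. of_bool (\<not> isocut_output (H, R) \<nu>))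
        (of_bool (\<not> ?sep \<kappa>) + ennreal (real ?k / real B))"
      proof -
        have k: "main_mem H es rs B \<kappa>" "bnd M \<kappa>" "\<And>v. v \<notin> set rs \<Longrightarrow> imem \<kappa> ''src'' v = 0" "\<And>v. imem \<kappa> ''res'' v \<le> 1"
          "\<And>l. l < ?k \<Longrightarrow> imem \<kappa> ''lab'' (rs ! l) = l" using \<kappa> by blast+
        show ?thesis unfolding rs(2)[symmetric]
          by (rule ok_phase2[OF P tp k rs(1) rs' M(2-4) BM(2) M(6) B1 sq])
      qed
    qed
  qed
qed

text \<open>Without divergence, the expected failure indicator is one minus the success probability.
  This links \<open>ok\<close> to \<open>soft_solvable_whp\<close>.\<close>

lemma nn_integral_fail:
  assumes "lossless_spmf p"
  shows "(\<integral>\<^sup>+ z. of_bool (\<not> Q (fst z)) \<partial>measure_spmf p) = ennreal (1 - measure (measure_spmf p) {(\<nu>, \<tau>). Q \<nu>})"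
proof -
  let ?A = "{(\<nu>, \<tau>). Q \<nu>}"
  have "(\<integral>\<^sup>+ z. of_bool (\<not> Q (fst z)) \<partial>measure_spmf p) = (\<integral>\<^sup>+ z. indicator (- ?A) z \<partial>measure_spmf p)"
    by (intro nn_integral_cong) (auto simp: indicator_def)
  also have "\<dots> = emeasure (measure_spmf p) (- ?A)" by simp
  also have "\<dots> = ennreal (measure (measure_spmf p) (- ?A))" by (rule measure_spmf.emeasure_eq_measure)
  also have "measure (measure_spmf p) (- ?A) = 1 - measure (measure_spmf p) ?A"
    using measure_spmf.finite_measure_compl[of ?A p] assms by (simp add: lossless_spmf_def Compl_eq_Diff_UNIV space_measure_spmf)
  finally show ?thesis .
qed

text \<open>Exponent 1 in the hypothesis gives failure probability at most
  \<open>1 / (m + n)\<close>, and distinct vertices s and t force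
  \<open>m + n \<ge> 2\<close>.\<close>

lemma ex_solver:
  assumes "stcut_time T"
  shows "\<exists>P K d. 0 \<le> K \<and> solver P (\<lambda>m n. nat \<lceil>K * ln (real (m + n) + 2) ^ d * real (T m n)\<rceil>)"
proof -
  from assms have "\<exists>P K d. \<forall>I \<mu>. stcut_input I \<mu> \<longrightarrow> lossless_spmf (exec P (\<mu>, 0)) \<and>
        (\<forall>(\<nu>, \<tau>) \<in> set_spmf (exec P (\<mu>, 0)).
           real \<tau> \<le> K * ln (real ((\<lambda>(G, s, t). dm G + dn G) I) + 2) ^ d * real ((\<lambda>(G, s, t). T (dm G) (dn G)) I)) \<and>
        measure (measure_spmf (exec P (\<mu>, 0))) {(\<nu>, \<tau>). stcut_output I \<nu>} \<ge> 1 - 1 / real ((\<lambda>(G, s, t). dm G + dn G) I) ^ 1"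
    unfolding stcut_time_def soft_solvable_whp_def by blast
  then obtain P K d where P: "\<And>G s t \<mu>. stcut_input (G, s, t) \<mu> \<Longrightarrow> lossless_spmf (exec P (\<mu>, 0)) \<and>
        (\<forall>(\<nu>, \<tau>) \<in> set_spmf (exec P (\<mu>, 0)). real \<tau> \<le> K * ln (real (dm G + dn G) + 2) ^ d * real (T (dm G) (dn G))) \<and>
        measure (measure_spmf (exec P (\<mu>, 0))) {(\<nu>, \<tau>). stcut_output (G, s, t) \<nu>} \<ge> 1 - 1 / real (dm G + dn G)"
    by fastforce
  \<comment> \<open>The constant K may be negative; \<open>max K 0\<close> makes the bound monotone
    in its other factors.\<close>
  have "solver P (\<lambda>m n. nat \<lceil>max K 0 * ln (real (m + n) + 2) ^ d * real (T m n)\<rceil>)"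
    unfolding solver_def
  proof (intro allI impI)
    fix G s t \<mu> assume i: "stcut_input (G, s, t) \<mu>"
    let ?Q = "stcut_output (G, s, t)" and ?p = "exec P (\<mu>, 0)"
    let ?t = "nat \<lceil>max K 0 * ln (real (dm G + dn G) + 2) ^ d * real (T (dm G) (dn G))\<rceil>"
    have Pi: "lossless_spmf ?p" "\<And>z. z \<in> set_spmf ?p \<Longrightarrow> real (snd z) \<le> K * ln (real (dm G + dn G) + 2) ^ d * real (T (dm G) (dn G))"
      "measure (measure_spmf ?p) {(\<nu>, \<tau>). ?Q \<nu>} \<ge> 1 - 1 / real (dm G + dn G)"
      using P[OF i] by auto
    have t: "snd z \<le> ?t" if "z \<in> set_spmf ?p" for z
    proof -
      have "real (snd z) \<le> K * (ln (real (dm G + dn G) + 2) ^ d * real (T (dm G) (dn G)))" using Pi(2)[OF that] by (simp only: mult.assoc)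
      also have "\<dots> \<le> max K 0 * (ln (real (dm G + dn G) + 2) ^ d * real (T (dm G) (dn G)))"
        by (intro mult_right_mono mult_nonneg_nonneg zero_le_power ln_ge_zero) simp_all
      also have "\<dots> \<le> real ?t" by (simp only: mult.assoc real_nat_ceiling_ge)
      finally show ?thesis by simp
    qed
    have "2 \<le> dm G + dn G" using i by (auto simp: stcut_input_def)
    then have "2 \<le> real (dm G + dn G)" by linarith
    then have "1 / real (dm G + dn G) \<le> 1 / 2" by (intro divide_left_mono) simp_all
    then have half: "1 - measure (measure_spmf ?p) {(\<nu>, \<tau>). ?Q \<nu>} \<le> 1 / 2" using Pi(3) by linarith
    show "ok P \<mu> ?t (\<lambda>_. True) (\<lambda>\<nu>. of_bool (\<not> ?Q \<nu>)) (ennreal (1 / 2))"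
      unfolding ok_def
    proof (intro allI conjI)
      fix \<tau>
      have eq: "exec P (\<mu>, \<tau>) = map_spmf (delay \<tau>) ?p" using exec_delay[of P \<tau> "(\<mu>, 0)"] by (simp add: delay_Pair)
      show "lossless_spmf (exec P (\<mu>, \<tau>))" unfolding eq using Pi(1) by simp
      show "\<forall>z\<in>set_spmf (exec P (\<mu>, \<tau>)). snd z \<le> \<tau> + ?t \<and> True" unfolding eq using t by (auto simp: delay_def)
      have "(\<integral>\<^sup>+ z. of_bool (\<not> ?Q (fst z)) \<partial>measure_spmf (exec P (\<mu>, \<tau>))) = (\<integral>\<^sup>+ z. of_bool (\<not> ?Q (fst z)) \<partial>measure_spmf ?p)"
        unfolding eq nn_integral_map_spmf o_def by (simp add: delay_def)
      also have "\<dots> \<le> ennreal (1 / 2)" unfolding nn_integral_fail[OF Pi(1)] using half by (rule ennreal_leI)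
      finally show "(\<integral>\<^sup>+ z. of_bool (\<not> ?Q (fst z)) \<partial>measure_spmf (exec P (\<mu>, \<tau>))) \<le> ennreal (1 / 2)" .
    qed
  qed
  then show ?thesis by (intro exI[of _ P] exI[of _ "max K 0"] exI[of _ d]) simp
qed

text \<open>The network sizes are at most 8 times p and \<open>m + l\<close>, which is three
  doublings. If \<open>m + l = 0\<close>, scaling cannot produce the two extra nodes, but then p is
  0 as well, and the constant \<open>T 0 2\<close> is absorbed because \<open>T 0 0\<close> is
  positive.\<close>

lemma regular_time_scale:
  assumes T: "regular_time T"
  shows "\<exists>D. \<forall>p m l. (m = 0 \<longrightarrow> p = 0) \<longrightarrow> T (5 * p) (2 + 2 * m + l) \<le> D * T p (m + l)"
proof -
  have mono: "T m n \<le> T m' n'" if "m \<le> m'" "n \<le> n'" for m m' n n' using T that by (simp add: regular_time_def)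
  have pos: "0 < T m n" for m n using T by (simp add: regular_time_def)
  obtain C where C: "\<And>m n. T (2 * m) (2 * n) \<le> C * T m n" using T unfolding regular_time_def by blast
  have 8: "T (8 * m) (8 * n) \<le> C ^ 3 * T m n" for m n
  proof -
    have "T (8 * m) (8 * n) \<le> C * T (4 * m) (4 * n)" using C[of "4 * m" "4 * n"] by simp
    also have "\<dots> \<le> C * (C * T (2 * m) (2 * n))" using C[of "2 * m" "2 * n"] by (intro mult_le_mono2) simp
    also have "\<dots> \<le> C * (C * (C * T m n))" by (rule mult_le_mono2, rule mult_le_mono2, rule C)
    finally show ?thesis by (simp add: power3_eq_cube mult.assoc)
  qed
  have "T (5 * p) (2 + 2 * m + l) \<le> (C ^ 3 + T 0 2) * T p (m + l)" if p: "m = 0 \<longrightarrow> p = 0" for p m l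
  proof (cases "m + l = 0")
    case True
    have "T 0 2 * 1 \<le> T 0 2 * T 0 0" using pos[of 0 0] by (intro mult_left_mono) simp_all
    moreover have "(C ^ 3 + T 0 2) * T 0 0 = C ^ 3 * T 0 0 + T 0 2 * T 0 0" by (rule add_mult_distrib)
    ultimately have "T 0 2 \<le> (C ^ 3 + T 0 2) * T 0 0" by linarith
    then show ?thesis using True p by (simp add: numeral_2_eq_2)
  next
    case False
    have "0 < m + l" using False by simp
    then have "2 + 2 * m + l \<le> 8 * (m + l)" by presburger
    then have "T (5 * p) (2 + 2 * m + l) \<le> T (8 * p) (8 * (m + l))" by (intro mono) simp_all
    also have "\<dots> \<le> C ^ 3 * T p (m + l)" by (rule 8)
    finally show ?thesis by (simp add: add_mult_distrib)
  qed
  then show ?thesis by (intro exI allI impI)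
qed

text \<open>Membership gives a bound by \<open>Max\<close> only for a finite set; finiteness holds
  because each \<open>ns i\<close> and \<open>ps i\<close> is at most the bound on its sum. The
  shift by one passes from indices below k to indices from 1 to k.\<close>

lemma sum_le_Max:
  fixes T :: "nat \<Rightarrow> nat \<Rightarrow> nat" and k :: nat
  assumes T: "regular_time T" and n: "(\<Sum>i<k. ns i) \<le> n" and p: "(\<Sum>i<k. ps i) \<le> q"
  shows "(\<Sum>i<k. T (ps i) (m + ns i)) \<le> Max {\<Sum>i=1..k. T (ps i) (m + ns i) | ns ps. (\<Sum>i=1..k. ns i) \<le> n \<and> (\<Sum>i=1..k. ps i) \<le> q}"
    (is "_ \<le> Max ?S")
proof (rule Max_ge)
  have "?S \<subseteq> {..k * T q (m + n)}"
  proof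
    fix x assume "x \<in> ?S"
    then obtain ns ps where x: "x = (\<Sum>i=1..k. T (ps i) (m + ns i))" and le: "(\<Sum>i=1..k. ns i) \<le> n" "(\<Sum>i=1..k. ps i) \<le> q" by blast
    have "T (ps i) (m + ns i) \<le> T q (m + n)" if "i \<in> {1..k}" for i
    proof -
      have "ns i \<le> (\<Sum>i=1..k. ns i)" "ps i \<le> (\<Sum>i=1..k. ps i)" using that by (auto intro!: member_le_sum)
      then show ?thesis using T le by (simp add: regular_time_def)
    qed
    then have "x \<le> (\<Sum>i=1..k. T q (m + n))" unfolding x by (rule sum_mono)
    then show "x \<in> {..k * T q (m + n)}" by simp
  qed
  then show "finite ?S" by (rule finite_subset) simp
  show "(\<Sum>i<k. T (ps i) (m + ns i)) \<in> ?S"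
    by (rule CollectI, rule exI[of _ "\<lambda>i. ns (i - 1)"], rule exI[of _ "\<lambda>i. ps (i - 1)"])
       (use n p in \<open>simp add: sum.atLeast1_atMost_eq\<close>)
qed

text \<open>The scale x is at least 1, so that higher powers absorb lower ones. The exponent is d
  from the subroutine, one for the length of numbers, and one for the doubling loop. Terms that are
  linear in the size are absorbed because T is at least linear.\<close>

lemma inst_time_le:
  fixes K w :: real and D d M N :: nat
  defines "x \<equiv> 2 * ln (real N + 2)"
  assumes T: "regular_time T" and K: "0 \<le> K" and D: "T (5 * p) (2 + 2 * m + l) \<le> D * T p (m + l)"
    and w: "0 \<le> w" "real (wlen M) \<le> w * x" and N: "p + m + l \<le> N" and x: "1 \<le> x"
  shows "real (inst_time M (\<lambda>m n. nat \<lceil>K * ln (real (m + n) + 2) ^ d * real (T m n)\<rceil>) m l p)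
    \<le> 2 * (w + 1) * (9 * w + 2 * (K * 2 ^ d * real D + 1) + 9 * real normK * w) * x ^ (d + 2) * real (T p (m + l))"
proof -
  let ?t = "real (T p (m + l))" and ?L = "real (wlen M)"
  let ?tp = "nat \<lceil>K * ln (real (5 * p + (2 + 2 * m + l)) + 2) ^ d * real (T (5 * p) (2 + 2 * m + l))\<rceil>"
  have t1: "1 \<le> ?t" "p + m + l \<le> T p (m + l)" using T by (auto simp: regular_time_def Suc_le_eq add.assoc)
  have t2: "real p + real m + real l \<le> ?t" using t1(2) by (simp flip: of_nat_add)
  have x0: "x \<le> x ^ (d + 1)" "x ^ d \<le> x ^ (d + 1)" "1 \<le> x ^ (d + 1)"
    using x self_le_power[of x "d + 1"] by (auto intro: power_increasing one_le_power simp del: power_Suc)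
  have xp: "0 \<le> x" using x by simp
  have ln: "ln (real (5 * p + (2 + 2 * m + l)) + 2) \<le> 2 * x"
  proof -
    have "real (5 * p + (2 + 2 * m + l)) + 2 \<le> 5 * real N + 4" using N by linarith
    \<comment> \<open>A polynomially larger argument changes the logarithm only by a constant
      factor.\<close>
    also have "\<dots> \<le> (real N + 2) ^ 4" by (simp add: power4_eq_xxxx algebra_simps)
    finally have "ln (real (5 * p + (2 + 2 * m + l)) + 2) \<le> ln ((real N + 2) ^ 4)" by (intro ln_mono) simp_all
    also have "\<dots> = 4 * ln (real N + 2)" by (simp add: ln_realpow)
    finally show ?thesis by (simp add: x_def)
  qed
  have ceil: "real (nat \<lceil>y\<rceil>) \<le> y + 1" if "0 \<le> y" for y :: real
    using that of_int_ceiling_le_add_one[of y] by simp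
  have "real ?tp \<le> K * ln (real (5 * p + (2 + 2 * m + l)) + 2) ^ d * real (T (5 * p) (2 + 2 * m + l)) + 1"
  proof (rule ceil)
    show "0 \<le> K * ln (real (5 * p + (2 + 2 * m + l)) + 2) ^ d * real (T (5 * p) (2 + 2 * m + l))"
      using K by (intro mult_nonneg_nonneg zero_le_power ln_ge_zero) simp_all
  qed
  also have "\<dots> \<le> K * (2 * x) ^ d * real (D * T p (m + l)) + 1"
    using K D xp by (intro add_right_mono mult_mono power_mono ln mult_nonneg_nonneg zero_le_power ln_ge_zero) (simp_all del: of_nat_mult)
  also have "\<dots> = K * 2 ^ d * real D * (x ^ d * ?t) + 1" by (simp add: power_mult_distrib)
  also have "\<dots> \<le> K * 2 ^ d * real D * (x ^ (d + 1) * ?t) + x ^ (d + 1) * ?t"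
    using K x0 t1(1) mult_mono[of 1 "x ^ (d + 1)" 1 ?t] by (intro add_mono mult_left_mono mult_right_mono) simp_all
  also have "\<dots> = (K * 2 ^ d * real D + 1) * (x ^ (d + 1) * ?t)" by (simp add: distrib_right)
  finally have tp: "real ?tp \<le> (K * 2 ^ d * real D + 1) * (x ^ (d + 1) * ?t)" .
  have L: "?L \<le> w * x ^ (d + 1)" using w(2) mult_left_mono[OF x0(1) w(1)] by linarith
  have c1: "real (2 + 2 * m + l + 5 * p + p + 1) * ?L \<le> (9 * ?t) * (w * x ^ (d + 1))"
    using t1(1) t2 L by (intro mult_mono) simp_all
  have c2: "real (2 + 2 * m + l + 1) * ?L \<le> (9 * ?t) * (w * x ^ (d + 1))"
    using t1(1) t2 L by (intro mult_mono) simp_all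
  have c3: "real normK * ?L * real (2 + 2 * m + l + 1) \<le> real normK * ((9 * ?t) * (w * x ^ (d + 1)))"
    using mult_left_mono[OF c2, of "real normK"] by (simp add: mult.assoc mult.commute[of ?L])
  have in_le: "real (2 + 2 * m + l + 5 * p + p + 1) * ?L + 2 * real ?tp + real normK * ?L * real (2 + 2 * m + l + 1)
     \<le> (9 * w + 2 * (K * 2 ^ d * real D + 1) + 9 * real normK * w) * (x ^ (d + 1) * ?t)"
    (is "_ \<le> ?c * (x ^ (d + 1) * ?t)")
    using c1 tp c3 by (simp add: algebra_simps)
  have L1: "?L + 1 \<le> (w + 1) * x" using w(2) x by (simp add: algebra_simps)
  have "real (inst_time M (\<lambda>m n. nat \<lceil>K * ln (real (m + n) + 2) ^ d * real (T m n)\<rceil>) m l p) =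
     2 * (?L + 1) * (real (2 + 2 * m + l + 5 * p + p + 1) * ?L + 2 * real ?tp + real normK * ?L * real (2 + 2 * m + l + 1))"
    unfolding inst_time_def by (simp only: of_nat_mult of_nat_add of_nat_numeral of_nat_1)
  also have "\<dots> \<le> 2 * ((w + 1) * x) * (?c * (x ^ (d + 1) * ?t))"
    using L1 xp w(1) by (intro mult_mono in_le add_nonneg_nonneg mult_nonneg_nonneg) simp_all
  also have "\<dots> = 2 * (w + 1) * ?c * x ^ (d + 2) * ?t" by (simp add: power_add power2_eq_square)
  finally show ?thesis .
qed

text \<open>\<open>N + 4 \<le> (N + 2) ^ 2\<close> compares the logarithms, and
  \<open>1 / 2 \<le> ln 2\<close> passes from base 2 to the natural logarithm.\<close>

lemma wlen_power_le: "real (wlen ((N + 4) ^ e)) \<le> (2 * real e + 2) * (2 * ln (real N + 2))"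
proof -
  let ?x = "2 * ln (real N + 2)"
  have l2: "1 / 2 \<le> ln (2::real)" using ln2_ge_two_thirds by simp
  have x: "1 \<le> ?x" using l2 ln_mono[of 2 "real N + 2"] by linarith
  have "real (wlen ((N + 4) ^ e)) = real_of_int \<lfloor>log 2 (real ((N + 4) ^ e))\<rfloor> + 2"
    by (simp add: wlen_def floorlog_def)
  also have "\<dots> \<le> log 2 (real ((N + 4) ^ e)) + 2" by simp
  also have "log 2 (real ((N + 4) ^ e)) = real e * (ln (real N + 4) / ln 2)"
    by (simp add: log_nat_power log_def ln_realpow)
  also have "ln (real N + 4) / ln 2 \<le> 2 * ?x"
  proof -
    have "ln (real N + 4) \<le> ln ((real N + 2) ^ 2)" by (intro ln_mono) (simp_all add: power2_eq_square algebra_simps)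
    then have "ln (real N + 4) \<le> ?x" by (simp add: ln_realpow)
    also have "\<dots> \<le> 2 * ?x * ln 2" using mult_left_mono[OF l2, of "2 * ?x"] x by simp
    finally show ?thesis by (simp add: divide_le_eq)
  qed
  then have "real e * (ln (real N + 4) / ln 2) + 2 \<le> real e * (2 * ?x) + 2 * ?x"
    using x by (intro add_mono mult_left_mono) simp_all
  finally show ?thesis by (simp add: algebra_simps)
qed

theorem theorem5p1:
  fixes T :: "nat \<Rightarrow> nat \<Rightarrow> nat"
  assumes "stcut_time T"
  shows "soft_solvable_whp isocut_input isocut_output
    (\<lambda>(H, R). hsize H + hm H + hn H)
    (\<lambda>(H, R). let p = hsize H; m = hm H; n = hn H; k = card R in
       T p (m + n) +
       Max {\<Sum>i=1..k. T (ps i) (m + ns i) | (ns :: nat \<Rightarrow> nat) (ps :: nat \<Rightarrow> nat).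
              (\<Sum>i=1..k. ns i) \<le> n \<and> (\<Sum>i=1..k. ps i) \<le> 2 * p})"
  unfolding soft_solvable_whp_def
proof
  fix c :: nat
  have T: "regular_time T" using assms by (simp add: stcut_time_def)
  have mono: "T m n \<le> T m' n'" if "m \<le> m'" "n \<le> n'" for m m' n n' using T that by (simp add: regular_time_def)
  obtain P K d where K: "0 \<le> K" and P: "solver P (\<lambda>m n. nat \<lceil>K * ln (real (m + n) + 2) ^ d * real (T m n)\<rceil>)"
    using ex_solver[OF assms] by blast
  define tp where "tp = (\<lambda>m n. nat \<lceil>K * ln (real (m + n) + 2) ^ d * real (T m n)\<rceil>)"
  have tp: "tp m' n' \<le> tp m n" if "m' \<le> m" "n' \<le> n" for m n m' n'
  proof -
    let ?l = "\<lambda>m n. ln (real (m + n) + 2)"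
    have "real (m' + n') + 2 \<le> real (m + n) + 2" using that by simp
    then have "?l m' n' \<le> ?l m n" by (rule ln_mono) simp
    then have l: "?l m' n' ^ d \<le> ?l m n ^ d" by (rule power_mono) (rule ln_ge_zero, simp)
    have p: "0 \<le> ?l m n ^ d" "0 \<le> ?l m' n' ^ d" for m n by (rule zero_le_power, rule ln_ge_zero, simp)+
    have "?l m' n' ^ d * real (T m' n') \<le> ?l m n ^ d * real (T m n)"
      using mono[OF that] by (intro mult_mono l p) simp_all
    then have "K * (?l m' n' ^ d * real (T m' n')) \<le> K * (?l m n ^ d * real (T m n))" using K by (rule mult_left_mono)
    then show ?thesis unfolding tp_def mult.assoc by (intro nat_mono ceiling_mono)
  qed
  obtain D where D: "\<And>p m l. (m = 0 \<longrightarrow> p = 0) \<Longrightarrow> T (5 * p) (2 + 2 * m + l) \<le> D * T p (m + l)"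
    using regular_time_scale[OF T] by blast
  let ?C = "iso_cuts (c + 2) P"
  \<comment> \<open>The constant of \<open>wlen_power_le\<close> for the exponent c + 4 of
    M.\<close>
  define w where "w = 2 * real (c + 4) + 2"
  define c1 where "c1 = 2 * (w + 1) * (9 * w + 2 * (K * 2 ^ d * real D + 1) + 9 * real normK * w)"
  have w0: "0 \<le> w" by (simp add: w_def)
  have c10: "0 \<le> c1" using K w0 by (simp add: c1_def)
  \<comment> \<open>The factor \<open>2 ^ (d + 3)\<close> removes the 2 from the scale x. Beyond
    \<open>x ^ (d + 2)\<close> for an instance, the doubling loop over the digits adds one more
    factor x.\<close>
  define K' where "K' = real (cst ?C) * (2 * (w + 1) * (5 * w + c1)) * 2 ^ (d + 3)"
  let ?f = "\<lambda>(H, R). let p = hsize H; m = hm H; n = hn H; k = card R in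
       T p (m + n) + Max {\<Sum>i=1..k. T (ps i) (m + ns i) | (ns :: nat \<Rightarrow> nat) (ps :: nat \<Rightarrow> nat).
              (\<Sum>i=1..k. ns i) \<le> n \<and> (\<Sum>i=1..k. ps i) \<le> 2 * p}"
  have main: "lossless_spmf (exec ?C (\<mu>, 0)) \<and>
        (\<forall>(\<nu>, \<tau>) \<in> set_spmf (exec ?C (\<mu>, 0)). real \<tau> \<le> K' * ln (real (hsize H + hm H + hn H) + 2) ^ (d + 3) * real (?f (H, R))) \<and>
        measure (measure_spmf (exec ?C (\<mu>, 0))) {(\<nu>, \<tau>). isocut_output (H, R) \<nu>} \<ge> 1 - 1 / real (hsize H + hm H + hn H) ^ c"
    if inp: "isocut_input (H, R) \<mu>" for H R \<mu>
  proof -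
    obtain es rs where il: "input_lists H R es rs \<mu>" using isocut_input_lists[OF inp] by blast
    have wf: "wf_hypergraph H" and R: "R \<subseteq> hverts H" "distinct rs" "set rs = R" using il by (simp_all add: input_lists_def)
    have k: "card R = length rs" using distinct_card[OF R(2)] R(3) by simp
    let ?p = "hsize H" and ?m = "hm H" and ?n = "hn H" and ?k = "length rs"
    define N where "N = ?p + ?m + ?n"
    \<comment> \<open>Two more powers than in B leave room for \<open>2 * B\<close> and for the
      stored output addresses of size about \<open>k * n\<close>.\<close>
    define M where "M = (N + 4) ^ (c + 4)"
    define B where "B = (?p + ?m + ?n + 1) ^ (c + 2)"
    define x where "x = 2 * ln (real N + 2)"
    define F where "F = Max {\<Sum>i=1..?k. T (ps i) (?m + ns i) | (ns :: nat \<Rightarrow> nat) (ps :: nat \<Rightarrow> nat).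
              (\<Sum>i=1..?k. ns i) \<le> ?n \<and> (\<Sum>i=1..?k. ps i) \<le> 2 * ?p}"
    let ?t = "T ?p (?m + ?n)"
    have kn: "?k \<le> ?n" using card_mono[of "{..<?n}" R] R(1) k by (simp add: hverts_def)
    have x: "1 \<le> x" using ln2_ge_two_thirds ln_mono[of 2 "real N + 2"] unfolding x_def by linarith
    have x0: "0 \<le> x" using x by simp
    have wl: "real (wlen M) \<le> w * x" using wlen_power_le[of N "c + 4"] by (simp add: M_def w_def x_def)
    have M2: "(N + 4) ^ 2 \<le> M" unfolding M_def by (intro power_increasing) simp_all
    have M3: "N * N + 8 * N + 16 \<le> M" using M2 by (simp add: power2_eq_square algebra_simps)
    have BM: "2 * B \<le> M"
    proof -
      have four: "2 \<le> (N + 4) ^ 2" using power_mono[of 2 "N + 4" 2] by simp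
      have "2 * B \<le> (N + 4) ^ 2 * (N + 4) ^ (c + 2)"
        unfolding B_def N_def[symmetric] by (intro mult_mono power_mono four) simp_all
      also have "\<dots> = M" unfolding M_def power_add[symmetric] by (rule arg_cong[where f="power (N + 4)"]) simp
      finally show ?thesis .
    qed
    have kk: "?k * ?n \<le> N * N" using kn by (intro mult_mono) (simp_all add: N_def)
    have Ms: "?p + ?m + ?n + 1 \<le> M" "2 + 2 * ?m + ?n \<le> M" "5 * ?p \<le> M" "2 * ?k \<le> M" "?k * ?n + ?n + 1 \<le> M"
      using M3 kn kk by (simp_all add: N_def)
    have it: "real (inst_time M tp ?m l p) \<le> c1 * x ^ (d + 2) * real (T p (?m + l))" if "p \<le> ?p" "l \<le> ?n" for p l
      unfolding tp_def c1_def x_def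
    proof (rule inst_time_le[OF T K _ w0 wl[unfolded x_def] _ x[unfolded x_def]])
      show "T (5 * p) (2 + 2 * ?m + l) \<le> D * T p (?m + l)"
      proof (rule D, rule impI)
        assume "?m = 0"
        then have "?p = 0" by (simp add: hsize_def)
        then show "p = 0" using that(1) by simp
      qed
      show "p + ?m + l \<le> N" using that by (simp add: N_def)
    qed
    let ?a = "(2 * ?p + 3 * ?m + ?n + ?k + 2) * wlen M"
    have a: "real ?a \<le> 5 * w * x ^ (d + 2) * real ?t"
    proof -
      have t: "0 < ?t" "?p + (?m + ?n) \<le> ?t" using T by (simp_all add: regular_time_def)
      then have "2 * ?p + 3 * ?m + ?n + ?k + 2 \<le> 5 * ?t" using kn by linarith
      then have "real (2 * ?p + 3 * ?m + ?n + ?k + 2) \<le> 5 * real ?t" by linarith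
      then have "real ?a \<le> (5 * real ?t) * (w * x)"
        unfolding of_nat_mult by (intro mult_mono wl) simp_all
      also have "\<dots> \<le> (5 * real ?t) * (w * x ^ (d + 2))"
        using x w0 self_le_power[of x "d + 2"] by (intro mult_left_mono) simp_all
      finally show ?thesis by (simp add: mult_ac)
    qed
    \<comment> \<open>Rounding down is harmless, because the quantities that s has to dominate are
      natural numbers.\<close>
    define s where "s = nat \<lfloor>(5 * w + c1) * x ^ (d + 2) * real (?t + F)\<rfloor>"
    have xd: "0 \<le> x ^ (d + 2)" using x0 by simp
    have s1: "?a + inst_time M tp ?m ?n ?p \<le> s"
      unfolding s_def
    proof (rule le_nat_floor)
      have "real (?a + inst_time M tp ?m ?n ?p) \<le> (5 * w + c1) * x ^ (d + 2) * real ?t"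
        using a it[of ?p ?n] by (simp add: distrib_right)
      also have "\<dots> \<le> (5 * w + c1) * x ^ (d + 2) * real (?t + F)"
        using w0 c10 xd by (intro mult_left_mono mult_nonneg_nonneg) simp_all
      finally show "real (?a + inst_time M tp ?m ?n ?p) \<le> (5 * w + c1) * x ^ (d + 2) * real (?t + F)" .
    qed
    have s2: "?a + (\<Sum>i<?k. inst_time M tp ?m (cnt f i ?n) (cnt g i ?p)) \<le> s" for f g
      unfolding s_def
    proof (rule le_nat_floor)
      have cl: "cnt f i n \<le> n" for f i n
        unfolding cnt_def using card_mono[of "{..<n}" "{u. u < n \<and> f u = i}"] by fastforce
      have "(\<Sum>i<?k. cnt g i ?p) \<le> 2 * ?p" using sum_cnt[of g ?p ?k] by simp
      then have F: "(\<Sum>i<?k. T (cnt g i ?p) (?m + cnt f i ?n)) \<le> F"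
        unfolding F_def by (rule sum_le_Max[OF T sum_cnt])
      have "real (\<Sum>i<?k. inst_time M tp ?m (cnt f i ?n) (cnt g i ?p)) \<le> (\<Sum>i<?k. c1 * x ^ (d + 2) * real (T (cnt g i ?p) (?m + cnt f i ?n)))"
        unfolding of_nat_sum by (intro sum_mono it cl)
      also have "\<dots> = c1 * x ^ (d + 2) * real (\<Sum>i<?k. T (cnt g i ?p) (?m + cnt f i ?n))"
        by (simp only: sum_distrib_left of_nat_sum)
      also have "\<dots> \<le> c1 * x ^ (d + 2) * real F"
        using F c10 xd by (intro mult_left_mono mult_nonneg_nonneg) (simp_all del: of_nat_sum)
      finally have "real (?a + (\<Sum>i<?k. inst_time M tp ?m (cnt f i ?n) (cnt g i ?p))) \<le> 5 * w * x ^ (d + 2) * real ?t + c1 * x ^ (d + 2) * real F"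
        using a by (simp only: of_nat_add)
      also have "\<dots> \<le> (5 * w + c1) * x ^ (d + 2) * real ?t + (5 * w + c1) * x ^ (d + 2) * real F"
        using w0 c10 xd by (intro add_mono mult_right_mono) simp_all
      finally show "real (?a + (\<Sum>i<?k. inst_time M tp ?m (cnt f i ?n) (cnt g i ?p))) \<le> (5 * w + c1) * x ^ (d + 2) * real (?t + F)"
        by (simp only: of_nat_add distrib_left)
    qed
    have ok: "ok ?C \<mu> (cst ?C * (2 * (wlen M + 1) * s)) (\<lambda>_. True) (\<lambda>\<nu>. of_bool (\<not> isocut_output (H, R) \<nu>)) (ennreal (2 * real ?k / real B))"
      by (rule ok_iso_cuts[OF P[folded tp_def] tp il B_def Ms(1-3) BM Ms(4,5) s1 s2])
    let ?e = "exec ?C (\<mu>, 0)"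
    have ll: "lossless_spmf ?e" and tm: "\<forall>z\<in>set_spmf ?e. snd z \<le> cst ?C * (2 * (wlen M + 1) * s)"
      and fl: "(\<integral>\<^sup>+ z. of_bool (\<not> isocut_output (H, R) (fst z)) \<partial>measure_spmf ?e) \<le> ennreal (2 * real ?k / real B)"
      using spec[OF ok[unfolded ok_def], of 0] by simp_all
    have f: "?f (H, R) = ?t + F" by (simp only: prod.case Let_def k F_def)
    have s: "real s \<le> (5 * w + c1) * x ^ (d + 2) * real (?t + F)"
      unfolding s_def using w0 c10 xd by (intro of_nat_floor mult_nonneg_nonneg) simp_all
    have "real (cst ?C * (2 * (wlen M + 1) * s)) \<le> K' * ln (real (?p + ?m + ?n) + 2) ^ (d + 3) * real (?t + F)"
    proof -
      have "real (wlen M) + 1 \<le> (w + 1) * x" using wl x by (simp add: algebra_simps)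
      then have "real (cst ?C * (2 * (wlen M + 1) * s)) \<le> real (cst ?C) * (2 * ((w + 1) * x) * ((5 * w + c1) * x ^ (d + 2) * real (?t + F)))"
        unfolding of_nat_mult using w0 x0 s by (intro mult_left_mono mult_mono mult_nonneg_nonneg) simp_all
      also have "\<dots> = real (cst ?C) * (2 * (w + 1) * (5 * w + c1)) * x ^ (d + 3) * real (?t + F)"
        by (simp only: power_add power_one_right power2_eq_square power3_eq_cube mult_ac)
      also have "x ^ (d + 3) = 2 ^ (d + 3) * ln (real (?p + ?m + ?n) + 2) ^ (d + 3)"
        by (simp only: x_def N_def power_mult_distrib)
      finally show ?thesis by (simp only: K'_def mult.assoc)
    qed
    then have time: "\<forall>(\<nu>, \<tau>)\<in>set_spmf ?e. real \<tau> \<le> K' * ln (real (?p + ?m + ?n) + 2) ^ (d + 3) * real (?f (H, R))"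
      unfolding f using tm by (fastforce simp del: of_nat_mult of_nat_add)
    \<comment> \<open>From \<open>2 * k \<le> (N + 1) ^ 2\<close> follows
      \<open>2 * k * N ^ c \<le> B\<close>. For N = 0 there are no terminals and the left side is 0,
      which matters since \<open>1 / 0 ^ c\<close> is 0 for positive c.\<close>
    have kB: "2 * real ?k / real B \<le> 1 / real N ^ c"
    proof (cases "N = 0")
      case True
      then have "?k = 0" using kn by (simp add: N_def)
      then show ?thesis by simp
    next
      case False
      have "(N + 1) ^ 2 = N * N + 2 * N + 1" by (simp add: power2_eq_square)
      then have "2 * ?k \<le> (N + 1) ^ 2" using kn by (simp add: N_def)
      then have "2 * ?k * N ^ c \<le> (N + 1) ^ 2 * (N + 1) ^ c" by (rule mult_le_mono) (rule power_mono, simp_all)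
      also have "\<dots> = B" unfolding B_def N_def[symmetric] power_add[symmetric] by (rule arg_cong[where f="power (N + 1)"]) simp
      finally have "real (2 * ?k * N ^ c) \<le> real B" by (simp only: of_nat_le_iff)
      then have le: "2 * real ?k * real N ^ c \<le> real B" by (simp only: of_nat_mult of_nat_power of_nat_numeral)
      have "0 < B" unfolding B_def by (rule zero_less_power) simp
      then have pos: "0 < real B" "0 < real N ^ c" using False by simp_all
      show ?thesis unfolding pos_divide_le_eq[OF pos(1)] using le pos_le_divide_eq[OF pos(2), of "2 * real ?k" "real B"] by simp
    qed
    have "ennreal (1 - measure (measure_spmf ?e) {(\<nu>, \<tau>). isocut_output (H, R) \<nu>}) \<le> ennreal (2 * real ?k / real B)"
      using fl unfolding nn_integral_fail[OF ll] .
    then have "1 - measure (measure_spmf ?e) {(\<nu>, \<tau>). isocut_output (H, R) \<nu>} \<le> 2 * real ?k / real B"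
      by (subst (asm) ennreal_le_iff) simp_all
    then have "1 - 1 / real (?p + ?m + ?n) ^ c \<le> measure (measure_spmf ?e) {(\<nu>, \<tau>). isocut_output (H, R) \<nu>}"
      using kB unfolding N_def by linarith
    with ll time show ?thesis by blast
  qed
  show "\<exists>P K d. \<forall>I \<mu>. isocut_input I \<mu> \<longrightarrow> lossless_spmf (exec P (\<mu>, 0)) \<and>
        (\<forall>(\<nu>, \<tau>) \<in> set_spmf (exec P (\<mu>, 0)). real \<tau> \<le> K * ln (real ((\<lambda>(H, R). hsize H + hm H + hn H) I) + 2) ^ d * real (?f I)) \<and>
        measure (measure_spmf (exec P (\<mu>, 0))) {(\<nu>, \<tau>). isocut_output I \<nu>} \<ge> 1 - 1 / real ((\<lambda>(H, R). hsize H + hm H + hn H) I) ^ c"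
  proof (rule exI[of _ ?C], rule exI[of _ K'], rule exI[of _ "d + 3"], intro allI impI)
    fix I \<mu> assume I: "isocut_input I \<mu>"
    obtain H R where HR: "I = (H, R)" by (cases I)
    show "lossless_spmf (exec ?C (\<mu>, 0)) \<and>
        (\<forall>(\<nu>, \<tau>) \<in> set_spmf (exec ?C (\<mu>, 0)). real \<tau> \<le> K' * ln (real ((\<lambda>(H, R). hsize H + hm H + hn H) I) + 2) ^ (d + 3) * real (?f I)) \<and>
        measure (measure_spmf (exec ?C (\<mu>, 0))) {(\<nu>, \<tau>). isocut_output I \<nu>} \<ge> 1 - 1 / real ((\<lambda>(H, R). hsize H + hm H + hn H) I) ^ c"
      using main[OF I[unfolded HR]] unfolding HR prod.case .
  qed
qed

end
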